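(* Let $\mathcal J$ be a generalized almost complex structure on $T\oplus T^*$, with $+i$-eigenbundle $L$ and associated grading $\wedge^\bullet T^*\otimes\mathbb C=U^{-n}\oplus\cdots\oplus U^n$, and define $$\partial=\pi_{k+1}\circ d_H:C^\infty(U^k)\to C^\infty(U^{k+1}),\qquad \overline\partial=\pi_{k-1}\circ d_H:C^\infty(U^k)\to C^\infty(U^{k-1}),$$ where $\pi_k$ is the projection onto $U^k$. Then $$d_H=\partial+\overline\partial+T_L+\overline{T_L},$$ where $T_L\in\wedge^3L^*=\wedge^3\overline L$ is defined by $$T_L(e_1,e_2,e_3)=\langle[e_1,e_2],e_3\rangle,$$ and acts via the Clifford action in the formula for $d_H$. Therefore $\mathcal J$ is integrable if and only if $d_H=\partial+\overline\partial$, or equivalently, if and only if $$d_H(C^\infty(U^n))\subset C^\infty(U^{n-1}).$$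
   Context: Let $M$ be a manifold of real dimension $2n$, $T=TM$, and $H$ a real closed 3-form on $M$. The bundle $T\oplus T^*$ carries the inner product $\langle X+\xi,Y+\eta\rangle=\tfrac12(\xi(Y)+\eta(X))$ and the $H$-twisted Courant bracket $[X+\xi,Y+\eta]=[X,Y]+\mathcal L_X\eta-i_Yd\xi+i_Xi_YH$, both extended complex (bi)linearly to $(T\oplus T^* )\otimes\mathbb C$. The twisted differential is $d_H\varphi=d\varphi+H\wedge\varphi$. A generalized almost complex structure on $T\oplus T^*$ is an endomorphism $\mathcal J$ with $\mathcal J^2=-1$ that is orthogonal for $\langle\cdot,\cdot\rangle$. It is integrable if its $+i$-eigenbundle $L\subset(T\oplus T^* )\otimes\mathbb C$ is involutive, i.e. $C^\infty(L)$ is closed under the $H$-twisted Courant bracket. One has $(T\oplus T^* )\otimes\mathbb C=L\oplus\overline L$ with $L$ maximal isotropic, and the inner product is used to identify $L^*$ with $\overline L$, hence $\wedge^3L^*$ with $\wedge^3\overline L$. In the definition of $T_L$, the $e_i$ are sections of $L$; $\overline{T_L}$ is the complex conjugate of $T_L$. The Clifford algebra of $T\oplus T^*$, with relation $v^2=\langle v,v\rangle$, acts on $\wedge^\bullet T^*\otimes\mathbb C$ by $(X+\xi)\cdot\varphi=i_X\varphi+\xi\wedge\varphi$. Since $L$ and $\overline L$ are isotropic, $\wedge^\bullet L$ and $\wedge^\bullet\overline L$ are subalgebras of the complexified Clifford algebra and so act on forms. Let $U^n=K\subset\wedge^\bullet T^*\otimes\mathbb C$ be the complex line subbundle of forms annihilated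 by $L$ (the canonical line bundle), and let $U^{n-k}=\wedge^k\overline L\cdot U^n$ for $0\le k\le 2n$, with $U^k=0$ for $|k|>n$. This gives the grading $\wedge^\bullet T^*\otimes\mathbb C=U^{-n}\oplus\cdots\oplus U^n$.
   Formalization: The identification of ∧³L* with ∧³L̄ is taken as −4 times the determinant induced by the inner product; with the plain induced identification, T_L and its conjugate would need the factor −1/4 in the formula for d_H. *)

theory Defs
  imports "HOL-Analysis.Analysis"
begin

section \<open>Smooth manifolds\<close>

primrec Ck_on :: "nat \<Rightarrow> 'a::real_normed_vector set \<Rightarrow> ('a \<Rightarrow> 'b::real_normed_vector) \<Rightarrow> bool" where
  "Ck_on 0 S f \<longleftrightarrow> continuous_on S f"
| "Ck_on (Suc k) S f \<longleftrightarrow> (\<forall>x\<in>S. f differentiable (at x)) \<and>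
     (\<forall>v. Ck_on k S (\<lambda>x. frechet_derivative f (at x) v))"

definition Cinf_on :: "'a::real_normed_vector set \<Rightarrow> ('a \<Rightarrow> 'b::real_normed_vector) \<Rightarrow> bool" where
  "Cinf_on S f \<longleftrightarrow> (\<forall>k. Ck_on k S f)"

text \<open>A chart is an open domain together with its coordinate map.  The manifold is the whole
  type \<open>'m\<close>; the Hausdorff and second countability axioms are imposed on \<open>'m\<close> as type classes.\<close>

type_synonym ('m, 'e) chart = "'m set \<times> ('m \<Rightarrow> 'e)"

definition cinv :: "('m, 'e) chart \<Rightarrow> 'e \<Rightarrow> 'm" where
  "cinv c = inv_into (fst c) (snd c)"

definition cimage :: "('m, 'e) chart \<Rightarrow> 'e set" where
  "cimage c = snd c ` fst c"

definition is_chart :: "('m::topological_space, 'e::euclidean_space) chart \<Rightarrow> bool" where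
  "is_chart c \<longleftrightarrow> open (fst c) \<and> open (cimage c) \<and>
     homeomorphism (fst c) (cimage c) (snd c) (cinv c)"

definition smooth_atlas :: "('m::topological_space, 'e::euclidean_space) chart set \<Rightarrow> bool" where
  "smooth_atlas A \<longleftrightarrow> (\<forall>c\<in>A. is_chart c) \<and> (\<Union>c\<in>A. fst c) = UNIV \<and>
     (\<forall>c\<in>A. \<forall>c'\<in>A. Cinf_on (snd c ` (fst c \<inter> fst c')) (snd c' \<circ> cinv c))"

text \<open>The tangent space at \<open>p\<close> is represented by the model space \<open>'e\<close>: a vector of \<open>'e\<close> stands
  for the tangent vector at \<open>p\<close> whose components in the chosen chart \<open>pchart A p\<close> around \<open>p\<close> are
  that vector.  The function \<open>tr c c' p\<close> is the change of components of tangent vectors at \<open>p\<close>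
  from the chart \<open>c\<close> to the chart \<open>c'\<close>.\<close>

definition pchart :: "('m, 'e) chart set \<Rightarrow> 'm \<Rightarrow> ('m, 'e) chart" where
  "pchart A p = (SOME c. c \<in> A \<and> p \<in> fst c)"

definition tr :: "('m, 'e::euclidean_space) chart \<Rightarrow> ('m, 'e) chart \<Rightarrow> 'm \<Rightarrow> 'e \<Rightarrow> 'e" where
  "tr c c' p = frechet_derivative (snd c' \<circ> cinv c) (at (snd c p))"

definition smooth_fun :: "('m, 'e::euclidean_space) chart set \<Rightarrow> ('m \<Rightarrow> 'b::real_normed_vector) \<Rightarrow> bool" where
  "smooth_fun A f \<longleftrightarrow> (\<forall>c\<in>A. Cinf_on (cimage c) (\<lambda>x. f (cinv c x)))"

section \<open>Vector fields and differential forms\<close>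

text \<open>The component functions of a vector field, a 1-form and a form in a chart \<open>c\<close>, as functions
  of the coordinates \<open>x\<close>.  An element of \<open>\<Lambda>\<^sup>\<bullet>T\<^sub>p\<^sup>*\<otimes>\<complex>\<close>, in general of mixed degree, is a function on
  lists of tangent vectors, whose restriction to lists of length \<open>k\<close> is its component of degree \<open>k\<close>.\<close>

type_synonym 'e covec = "'e \<Rightarrow>\<^sub>L real"
type_synonym 'e form = "'e list \<Rightarrow> complex"

definition vloc :: "('m, 'e::euclidean_space) chart set \<Rightarrow> ('m, 'e) chart \<Rightarrow> ('m \<Rightarrow> 'e) \<Rightarrow> 'e \<Rightarrow> 'e" where
  "vloc A c X x = (let p = cinv c x in tr (pchart A p) c p (X p))"

definition cloc :: "('m, 'e::euclidean_space) chart set \<Rightarrow> ('m, 'e) chart \<Rightarrow> ('m \<Rightarrow> 'e covec) \<Rightarrow> 'e \<Rightarrow> 'e covec" where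
  "cloc A c \<xi> x = (let p = cinv c x in Blinfun (\<lambda>v. blinfun_apply (\<xi> p) (tr c (pchart A p) p v)))"

definition floc :: "('m, 'e::euclidean_space) chart set \<Rightarrow> ('m, 'e) chart \<Rightarrow> ('m \<Rightarrow> 'e form) \<Rightarrow> 'e \<Rightarrow> 'e form" where
  "floc A c \<phi> x = (let p = cinv c x in (\<lambda>vs. \<phi> p (map (tr c (pchart A p) p) vs)))"

definition alt_form :: "'e::euclidean_space form \<Rightarrow> bool" where
  "alt_form \<phi> \<longleftrightarrow> (\<forall>us vs. linear (\<lambda>x. \<phi> (us @ x # vs))) \<and>
     (\<forall>us x vs ws. \<phi> (us @ x # vs @ x # ws) = 0)"

definition smooth_form :: "('m, 'e::euclidean_space) chart set \<Rightarrow> ('m \<Rightarrow> 'e form) \<Rightarrow> bool" where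
  "smooth_form A \<phi> \<longleftrightarrow> (\<forall>p. alt_form (\<phi> p)) \<and>
     (\<forall>c\<in>A. \<forall>vs. Cinf_on (cimage c) (\<lambda>x. floc A c \<phi> x vs))"

definition real_form_of_degree :: "nat \<Rightarrow> ('m \<Rightarrow> 'e form) \<Rightarrow> bool" where
  "real_form_of_degree k \<phi> \<longleftrightarrow> (\<forall>p vs. \<phi> p vs \<in> \<real> \<and> (length vs \<noteq> k \<longrightarrow> \<phi> p vs = 0))"

text \<open>The shuffle formula; the exponent is the number of inversions of the shuffle that lists
  first the positions in \<open>I\<close> and then the remaining ones.\<close>

definition wedge :: "'e form \<Rightarrow> 'e form \<Rightarrow> 'e form" where
  "wedge \<alpha> \<beta> vs = (\<Sum>I\<in>Pow {..<length vs}.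
     (-1) ^ card {(i, j). i \<in> I \<and> j \<in> {..<length vs} - I \<and> j < i} * \<alpha> (nths vs I) * \<beta> (nths vs (- I)))"

definition iprod :: "'e \<Rightarrow> 'e form \<Rightarrow> 'e form" where
  "iprod X \<phi> vs = \<phi> (X # vs)"

definition covec_form :: "'e::euclidean_space covec \<Rightarrow> 'e form" where
  "covec_form \<xi> vs = (case vs of [v] \<Rightarrow> of_real (blinfun_apply \<xi> v) | _ \<Rightarrow> 0)"

text \<open>Derivatives at \<open>p\<close> are taken in the chart \<open>pchart A p\<close>, in which the components at \<open>p\<close> are
  the given values.\<close>

definition ext_d :: "('m, 'e::euclidean_space) chart set \<Rightarrow> ('m \<Rightarrow> 'e form) \<Rightarrow> 'm \<Rightarrow> 'e form" where
  "ext_d A \<phi> p vs = (let c = pchart A p in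
     \<Sum>i<length vs. (-1) ^ i *
       frechet_derivative (\<lambda>x. floc A c \<phi> x (take i vs @ drop (Suc i) vs)) (at (snd c p)) (vs ! i))"

definition twisted_d :: "('m, 'e::euclidean_space) chart set \<Rightarrow> ('m \<Rightarrow> 'e form) \<Rightarrow> ('m \<Rightarrow> 'e form) \<Rightarrow> 'm \<Rightarrow> 'e form" where
  "twisted_d A H \<phi> p vs = ext_d A \<phi> p vs + wedge (H p) (\<phi> p) vs"

definition lie_bracket :: "('m, 'e::euclidean_space) chart set \<Rightarrow> ('m \<Rightarrow> 'e) \<Rightarrow> ('m \<Rightarrow> 'e) \<Rightarrow> 'm \<Rightarrow> 'e" where
  "lie_bracket A X Y p = (let c = pchart A p in
     frechet_derivative (vloc A c Y) (at (snd c p)) (X p) - frechet_derivative (vloc A c X) (at (snd c p)) (Y p))"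

text \<open>In components, \<open>(L\<^sub>X\<eta>)\<^sub>j = X\<^sup>i \<partial>\<^sub>i\<eta>\<^sub>j + \<eta>\<^sub>i \<partial>\<^sub>jX\<^sup>i\<close>.\<close>

definition lie_deriv :: "('m, 'e::euclidean_space) chart set \<Rightarrow> ('m \<Rightarrow> 'e) \<Rightarrow> ('m \<Rightarrow> 'e covec) \<Rightarrow> 'm \<Rightarrow> 'e covec" where
  "lie_deriv A X \<eta> p = (let c = pchart A p in Blinfun (\<lambda>v.
     blinfun_apply (frechet_derivative (cloc A c \<eta>) (at (snd c p)) (X p)) v
     + blinfun_apply (\<eta> p) (frechet_derivative (vloc A c X) (at (snd c p)) v)))"

definition form_covec :: "'e::euclidean_space form \<Rightarrow> 'e covec" where
  "form_covec \<omega> = Blinfun (\<lambda>v. Re (\<omega> [v]))"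

section \<open>The bundle \<open>T \<oplus> T\<^sup>*\<close> and its complexification\<close>

type_synonym 'e gtan = "'e \<times> 'e covec"

definition smooth_gsection :: "('m, 'e::euclidean_space) chart set \<Rightarrow> ('m \<Rightarrow> 'e gtan) \<Rightarrow> bool" where
  "smooth_gsection A s \<longleftrightarrow> (\<forall>c\<in>A. Cinf_on (cimage c) (vloc A c (\<lambda>p. fst (s p)))
     \<and> Cinf_on (cimage c) (cloc A c (\<lambda>p. snd (s p))))"

definition gtr :: "('m, 'e::euclidean_space) chart \<Rightarrow> ('m, 'e) chart \<Rightarrow> 'm \<Rightarrow> 'e gtan \<Rightarrow> 'e gtan" where
  "gtr c c' p w = (tr c c' p (fst w), Blinfun (\<lambda>v. blinfun_apply (snd w) (tr c' c p v)))"

definition ginner :: "'e::euclidean_space gtan \<Rightarrow> 'e gtan \<Rightarrow> real" where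
  "ginner w z = (blinfun_apply (snd w) (fst z) + blinfun_apply (snd z) (fst w)) / 2"

definition courant :: "('m, 'e::euclidean_space) chart set \<Rightarrow> ('m \<Rightarrow> 'e form) \<Rightarrow>
    ('m \<Rightarrow> 'e gtan) \<Rightarrow> ('m \<Rightarrow> 'e gtan) \<Rightarrow> 'm \<Rightarrow> 'e gtan" where
  "courant A H s t p =
     (let X = (\<lambda>q. fst (s q)); \<xi> = (\<lambda>q. snd (s q)); Y = (\<lambda>q. fst (t q)); \<eta> = (\<lambda>q. snd (t q))
      in (lie_bracket A X Y p,
          lie_deriv A X \<eta> p
          - form_covec (iprod (Y p) (ext_d A (\<lambda>q. covec_form (\<xi> q)) p))
          + form_covec (iprod (X p) (iprod (Y p) (H p)))))"

text \<open>The complexification of a real vector space \<open>V\<close> is \<open>V \<times> V\<close>, with \<open>(u, v)\<close> standing for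
  \<open>u + \<i>v\<close>.\<close>

type_synonym 'e cgtan = "'e gtan \<times> 'e gtan"

definition cscale :: "complex \<Rightarrow> 'v::real_vector \<times> 'v \<Rightarrow> 'v \<times> 'v" where
  "cscale a z = (Re a *\<^sub>R fst z - Im a *\<^sub>R snd z, Re a *\<^sub>R snd z + Im a *\<^sub>R fst z)"

definition cconj :: "'v::real_vector \<times> 'v \<Rightarrow> 'v \<times> 'v" where
  "cconj z = (fst z, - snd z)"

definition cinner :: "'e::euclidean_space cgtan \<Rightarrow> 'e cgtan \<Rightarrow> complex" where
  "cinner z w = Complex (ginner (fst z) (fst w) - ginner (snd z) (snd w))
                        (ginner (fst z) (snd w) + ginner (snd z) (fst w))"

definition smooth_csection :: "('m, 'e::euclidean_space) chart set \<Rightarrow> ('m \<Rightarrow> 'e cgtan) \<Rightarrow> bool" where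
  "smooth_csection A e \<longleftrightarrow> smooth_gsection A (\<lambda>p. fst (e p)) \<and> smooth_gsection A (\<lambda>p. snd (e p))"

definition ccourant :: "('m, 'e::euclidean_space) chart set \<Rightarrow> ('m \<Rightarrow> 'e form) \<Rightarrow>
    ('m \<Rightarrow> 'e cgtan) \<Rightarrow> ('m \<Rightarrow> 'e cgtan) \<Rightarrow> 'm \<Rightarrow> 'e cgtan" where
  "ccourant A H e f p =
     (let e1 = (\<lambda>q. fst (e q)); e2 = (\<lambda>q. snd (e q)); f1 = (\<lambda>q. fst (f q)); f2 = (\<lambda>q. snd (f q))
      in (courant A H e1 f1 p - courant A H e2 f2 p, courant A H e1 f2 p + courant A H e2 f1 p))"

definition cliff_real :: "'e::euclidean_space gtan \<Rightarrow> 'e form \<Rightarrow> 'e form" where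
  "cliff_real w \<phi> vs = iprod (fst w) \<phi> vs + wedge (covec_form (snd w)) \<phi> vs"

definition cliff :: "'e::euclidean_space cgtan \<Rightarrow> 'e form \<Rightarrow> 'e form" where
  "cliff z \<phi> vs = cliff_real (fst z) \<phi> vs + \<i> * cliff_real (snd z) \<phi> vs"

section \<open>Generalized almost complex structures\<close>

definition gen_almost_complex ::
    "('m, 'e::euclidean_space) chart set \<Rightarrow> ('m \<Rightarrow> 'e gtan \<Rightarrow> 'e gtan) \<Rightarrow> bool" where
  "gen_almost_complex A J \<longleftrightarrow>
     (\<forall>p. linear (J p) \<and> (\<forall>w. J p (J p w) = - w) \<and> (\<forall>w z. ginner (J p w) (J p z) = ginner w z)) \<and>
     (\<forall>c\<in>A. \<forall>w. Cinf_on (cimage c)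
        (\<lambda>x. let p = cinv c x in gtr (pchart A p) c p (J p (gtr c (pchart A p) p w))))"

definition Lbun :: "('m \<Rightarrow> 'e::euclidean_space gtan \<Rightarrow> 'e gtan) \<Rightarrow> 'm \<Rightarrow> 'e cgtan set" where
  "Lbun J p = {z. (J p (fst z), J p (snd z)) = cscale \<i> z}"

definition sections_L :: "('m, 'e::euclidean_space) chart set \<Rightarrow> ('m \<Rightarrow> 'e gtan \<Rightarrow> 'e gtan) \<Rightarrow> ('m \<Rightarrow> 'e cgtan) set" where
  "sections_L A J = {e. smooth_csection A e \<and> (\<forall>p. e p \<in> Lbun J p)}"

definition integrable_gcs :: "('m, 'e::euclidean_space) chart set \<Rightarrow> ('m \<Rightarrow> 'e form) \<Rightarrow>
    ('m \<Rightarrow> 'e gtan \<Rightarrow> 'e gtan) \<Rightarrow> bool" where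
  "integrable_gcs A H J \<longleftrightarrow> (\<forall>e\<in>sections_L A J. \<forall>f\<in>sections_L A J. ccourant A H e f \<in> sections_L A J)"

section \<open>The grading\<close>

definition Kbun :: "('m \<Rightarrow> 'e::euclidean_space gtan \<Rightarrow> 'e gtan) \<Rightarrow> 'm \<Rightarrow> 'e form set" where
  "Kbun J p = {\<phi>. alt_form \<phi> \<and> (\<forall>z\<in>Lbun J p. cliff z \<phi> = (\<lambda>vs. 0))}"

text \<open>The space \<open>\<Lambda>\<^sup>kL\<^sup>c \<cdot> K\<close>, where \<open>L\<^sup>c\<close> denotes the conjugate of \<open>L\<close>: finite sums of elements
  \<open>a\<^sub>1 \<cdot> \<dots> \<cdot> a\<^sub>k \<cdot> \<phi>\<close>.\<close>

definition wedge_conjL_K :: "('m \<Rightarrow> 'e::euclidean_space gtan \<Rightarrow> 'e gtan) \<Rightarrow> 'm \<Rightarrow> nat \<Rightarrow> 'e form set" where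
  "wedge_conjL_K J p k = {\<psi>. \<exists>(N::nat) f. (\<forall>i<N. \<exists>as. length as = k \<and> set as \<subseteq> cconj ` Lbun J p \<and>
       (\<exists>\<phi>\<in>Kbun J p. f i = foldr cliff as \<phi>)) \<and> \<psi> = (\<lambda>vs. \<Sum>i<N. f i vs)}"

definition Ubun :: "nat \<Rightarrow> ('m \<Rightarrow> 'e::euclidean_space gtan \<Rightarrow> 'e gtan) \<Rightarrow> int \<Rightarrow> 'm \<Rightarrow> 'e form set" where
  "Ubun n J k p = (if \<bar>k\<bar> \<le> int n then wedge_conjL_K J p (nat (int n - k)) else {\<lambda>vs. 0})"

definition sections_U :: "('m, 'e::euclidean_space) chart set \<Rightarrow> nat \<Rightarrow> ('m \<Rightarrow> 'e gtan \<Rightarrow> 'e gtan) \<Rightarrow> int \<Rightarrow> ('m \<Rightarrow> 'e form) set" where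
  "sections_U A n J k = {\<phi>. smooth_form A \<phi> \<and> (\<forall>p. \<phi> p \<in> Ubun n J k p)}"

definition proj_U :: "nat \<Rightarrow> ('m \<Rightarrow> 'e::euclidean_space gtan \<Rightarrow> 'e gtan) \<Rightarrow> int \<Rightarrow> 'm \<Rightarrow> 'e form \<Rightarrow> 'e form" where
  "proj_U n J k p \<phi> = (THE \<psi>. \<exists>f. (\<forall>j. f j \<in> Ubun n J j p) \<and>
     \<phi> = (\<lambda>vs. \<Sum>j\<in>{- int n..int n}. f j vs) \<and> \<psi> = f k)"

definition del :: "('m, 'e::euclidean_space) chart set \<Rightarrow> ('m \<Rightarrow> 'e form) \<Rightarrow> nat \<Rightarrow>
    ('m \<Rightarrow> 'e gtan \<Rightarrow> 'e gtan) \<Rightarrow> int \<Rightarrow> ('m \<Rightarrow> 'e form) \<Rightarrow> 'm \<Rightarrow> 'e form" where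
  "del A H n J k \<phi> p = proj_U n J (k + 1) p (twisted_d A H \<phi> p)"

definition delbar :: "('m, 'e::euclidean_space) chart set \<Rightarrow> ('m \<Rightarrow> 'e form) \<Rightarrow> nat \<Rightarrow>
    ('m \<Rightarrow> 'e gtan \<Rightarrow> 'e gtan) \<Rightarrow> int \<Rightarrow> ('m \<Rightarrow> 'e form) \<Rightarrow> 'm \<Rightarrow> 'e form" where
  "delbar A H n J k \<phi> p = proj_U n J (k - 1) p (twisted_d A H \<phi> p)"

section \<open>The tensor \<open>T\<^sub>L\<close> and its Clifford action\<close>

type_synonym 'e trilinear = "'e cgtan \<Rightarrow> 'e cgtan \<Rightarrow> 'e cgtan \<Rightarrow> complex"

text \<open>The set \<open>\<Lambda>\<^sup>3W\<^sup>*\<close>, for a complex subspace \<open>W\<close>.  By the alternating property, linearity in the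
  first argument gives linearity in all of them.\<close>

definition alt3_on :: "'e::euclidean_space cgtan set \<Rightarrow> 'e trilinear \<Rightarrow> bool" where
  "alt3_on W T \<longleftrightarrow>
     (\<forall>u\<in>W. \<forall>u'\<in>W. \<forall>v\<in>W. \<forall>w\<in>W. T (u + u') v w = T u v w + T u' v w) \<and>
     (\<forall>a. \<forall>u\<in>W. \<forall>v\<in>W. \<forall>w\<in>W. T (cscale a u) v w = a * T u v w) \<and>
     (\<forall>u\<in>W. \<forall>v\<in>W. \<forall>w\<in>W. T v u w = - T u v w \<and> T u w v = - T u v w)"

definition sections_wedge3_dualL :: "('m, 'e::euclidean_space) chart set \<Rightarrow>
    ('m \<Rightarrow> 'e gtan \<Rightarrow> 'e gtan) \<Rightarrow> ('m \<Rightarrow> 'e trilinear) set" where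
  "sections_wedge3_dualL A J = {T. (\<forall>p. alt3_on (Lbun J p) (T p)) \<and>
     (\<forall>e1\<in>sections_L A J. \<forall>e2\<in>sections_L A J. \<forall>e3\<in>sections_L A J.
        smooth_fun A (\<lambda>p. T p (e1 p) (e2 p) (e3 p)))}"

text \<open>The value of \<open>T\<^sub>L\<close> on vectors of \<open>L\<^sub>p\<close>, through sections of \<open>L\<close> that extend them.\<close>

definition TL :: "('m, 'e::euclidean_space) chart set \<Rightarrow> ('m \<Rightarrow> 'e form) \<Rightarrow>
    ('m \<Rightarrow> 'e gtan \<Rightarrow> 'e gtan) \<Rightarrow> 'm \<Rightarrow> 'e trilinear" where
  "TL A H J p u v w = (THE r. \<forall>e1\<in>sections_L A J. \<forall>e2\<in>sections_L A J. \<forall>e3\<in>sections_L A J.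
     e1 p = u \<and> e2 p = v \<and> e3 p = w \<longrightarrow> cinner (ccourant A H e1 e2 p) (e3 p) = r)"

definition conj_tri :: "'e::euclidean_space trilinear \<Rightarrow> 'e trilinear" where
  "conj_tri T u v w = cnj (T (cconj u) (cconj v) (cconj w))"

text \<open>The identification of \<open>\<Lambda>\<^sup>3W\<^sup>c\<close> with \<open>\<Lambda>\<^sup>3W\<^sup>*\<close> (\<open>W\<close> being \<open>L\<close> or its conjugate, and \<open>W\<^sup>c\<close> the
  conjugate of \<open>W\<close>).  A vector \<open>a\<close> of \<open>W\<^sup>c\<close> is identified with the functional \<open>\<langle>a, \<cdot>\<rangle>\<close> on \<open>W\<close>, and
  a trivector \<open>\<tau>\<close>, viewed in the Clifford algebra, with the 3-form \<open>T\<close> determined by the iterated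
  Clifford (graded) commutators \<open>[[\<tau>, e\<^sub>1], e\<^sub>2] = T(e\<^sub>1, e\<^sub>2, \<cdot>)\<close>.  As \<open>ae + ea = 2\<langle>a, e\<rangle>\<close>, this
  gives, for \<open>\<tau> = a \<and> b \<and> c\<close>, the determinant of the inner products multiplied by \<open>-4\<close>.  This is
  the normalization under which \<open>d\<^sub>H = \<partial> + \<partial>\<^sup>c + T\<^sub>L + T\<^sub>L\<^sup>c\<close> holds for the relation
  \<open>v\<^sup>2 = \<langle>v, v\<rangle>\<close>: with the bare determinant, the torsion terms would carry the factor \<open>-1/4\<close>.\<close>

definition trivector_form :: "'e::euclidean_space cgtan \<times> 'e cgtan \<times> 'e cgtan \<Rightarrow> 'e trilinear" where
  "trivector_form t e1 e2 e3 = (case t of (a, b, c) \<Rightarrow> -4 *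
     (cinner a e1 * (cinner b e2 * cinner c e3 - cinner b e3 * cinner c e2)
      - cinner b e1 * (cinner a e2 * cinner c e3 - cinner a e3 * cinner c e2)
      + cinner c e1 * (cinner a e2 * cinner b e3 - cinner a e3 * cinner b e2)))"

text \<open>The Clifford action of \<open>T \<in> \<Lambda>\<^sup>3W\<^sup>*\<close>.  A trivector is given by a list of triples \<open>(a, b, c)\<close>,
  which stands for the sum of the corresponding \<open>a \<and> b \<and> c\<close>.\<close>

definition cliff3 :: "'e::euclidean_space cgtan set \<Rightarrow> 'e trilinear \<Rightarrow> 'e form \<Rightarrow> 'e form" where
  "cliff3 W T \<phi> = (THE \<psi>. \<exists>ts. set ts \<subseteq> cconj ` W \<times> cconj ` W \<times> cconj ` W \<and>
     (\<forall>e1\<in>W. \<forall>e2\<in>W. \<forall>e3\<in>W. T e1 e2 e3 = (\<Sum>t\<leftarrow>ts. trivector_form t e1 e2 e3)) \<and>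
     \<psi> = (\<lambda>vs. \<Sum>(a, b, c)\<leftarrow>ts. cliff a (cliff b (cliff c \<phi>)) vs))"

definition TL_act :: "('m, 'e::euclidean_space) chart set \<Rightarrow> ('m \<Rightarrow> 'e form) \<Rightarrow>
    ('m \<Rightarrow> 'e gtan \<Rightarrow> 'e gtan) \<Rightarrow> ('m \<Rightarrow> 'e form) \<Rightarrow> 'm \<Rightarrow> 'e form" where
  "TL_act A H J \<phi> p = cliff3 (Lbun J p) (TL A H J p) (\<phi> p)"

definition TLbar_act :: "('m, 'e::euclidean_space) chart set \<Rightarrow> ('m \<Rightarrow> 'e form) \<Rightarrow>
    ('m \<Rightarrow> 'e gtan \<Rightarrow> 'e gtan) \<Rightarrow> ('m \<Rightarrow> 'e form) \<Rightarrow> 'm \<Rightarrow> 'e form" where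
  "TLbar_act A H J \<phi> p = cliff3 (cconj ` Lbun J p) (conj_tri (TL A H J p)) (\<phi> p)"

end

theory Submission
  imports Defs "HOL-Library.Function_Algebras" "HOL-Computational_Algebra.Polynomial"
begin

text \<open>
The spin action \<open>S\<close> of \<open>\<J>\<close> on forms is multiplication by \<open>k\<close> on \<open>U\<^sup>k\<close>; hence the projections
\<open>\<pi>\<^sub>k\<close> are polynomials in \<open>S\<close>, and in particular smooth. For a section \<open>\<phi>\<close> of \<open>U\<^sup>k\<close> the derivative of
\<open>S \<phi> = k \<phi>\<close> in the direction \<open>b\<close> reads \<open>(k - S) \<partial>\<^sub>b \<phi> = (\<partial>\<^sub>b S) \<phi>\<close>, where \<open>\<partial>\<^sub>b S\<close> is the spin action of
\<open>\<partial>\<^sub>b \<J>\<close>. As \<open>\<partial>\<^sub>b \<J>\<close> anticommutes with \<open>\<J>\<close>, it exchanges \<open>L\<close> and its conjugate, and \<open>(\<partial>\<^sub>b S) \<phi>\<close> lies in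
\<open>U\<^bsup>k-2\<^esup> \<oplus> U\<^bsup>k+2\<^esup>\<close>. Wedging with \<open>dx\<^sup>b\<close>, summing and adding \<open>H \<and> \<phi>\<close> shows that \<open>d\<^sub>H \<phi>\<close> has components in degrees
\<open>k \<plusminus> 1\<close> and \<open>k \<plusminus> 3\<close> only, and that those in degrees \<open>k \<mp> 3\<close> are the Clifford actions on \<open>\<phi>\<close> of a
trivector, algebraic in \<open>\<partial>\<J>\<close> and \<open>H\<close>, and of its conjugate. Differentiating \<open>\<J> e = \<i> e\<close> in
\<open>\<langle>[e\<^sub>1, e\<^sub>2], e\<^sub>3\<rangle>\<close> yields the same trivector, so it is \<open>T\<^sub>L\<close>. The action of \<open>\<wedge>\<^sup>3 L\<^sup>*\<close> on a nonzero element of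
\<open>U\<^sup>n\<close> is faithful, hence \<open>T\<^sub>L\<close> vanishes as soon as it annihilates \<open>U\<^sup>n\<close>; and \<open>T\<^sub>L = 0\<close> is involutivity of \<open>L\<close>
since \<open>L\<close> is maximal isotropic.
\<close>

text \<open>The tangent space at \<open>p\<close> is identified with the model space through the
  chart \<open>pchart A p\<close>, which may jump as \<open>p\<close> varies. So nothing can be
  differentiated on the manifold directly: forms, sections and \<open>J\<close> are moved to one
  fixed chart (\<open>floc\<close>, \<open>sloc\<close>, \<open>Jloc\<close>), and naturality under
  coordinate changes shows that \<open>d_H\<close> does not depend on the chart. At the point
  \<open>p\<close> itself, components in \<open>pchart A p\<close> are the given values, so there
  the torsion is a problem of linear algebra in values and first derivatives, with the derivative of
  \<open>J\<close> kept as an abstract family \<open>M\<close>.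

  \<open>T_L\<close> and its Clifford action are given by definite descriptions, over all extending
  sections and over all representing trivectors. Both are settled by formulas free of choices,
  \<open>Tor\<close> and \<open>tact\<close>.

  The Courant bracket is also defined pointwise in the chosen charts. That it preserves smoothness
  follows by writing its Clifford action as a double commutator with \<open>d_H\<close>, whose
  smoothness is established before.\<close>

lemma sum_fun_apply: "(\<Sum>i\<in>I. f i) x = (\<Sum>i\<in>I. f i x)" for f :: "'i \<Rightarrow> 'a \<Rightarrow> 'b::comm_monoid_add"
  by (induction I rule: infinite_finite_induct) auto

lemma sum_list_fun_apply: "(\<Sum>i\<leftarrow>xs. f i) x = (\<Sum>i\<leftarrow>xs. f i x)" for f :: "'i \<Rightarrow> 'a \<Rightarrow> 'b::comm_monoid_add"
  by (induction xs) auto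

lemma additive_sum:
  fixes F :: "'a::comm_monoid_add \<Rightarrow> 'b::comm_monoid_add"
  assumes "F 0 = 0" "\<And>x y. F (x + y) = F x + F y"
  shows "F (sum f I) = (\<Sum>i\<in>I. F (f i))"
  using sum_comp_morphism[of F f I] assms by (simp add: o_def)

lemma sum_closed:
  fixes f :: "'i \<Rightarrow> 'a::comm_monoid_add"
  assumes "P 0" "\<And>x y. P x \<Longrightarrow> P y \<Longrightarrow> P (x + y)" "\<And>i. i \<in> I \<Longrightarrow> P (f i)"
  shows "P (sum f I)"
  using assms by (induction I rule: infinite_finite_induct) auto

definition fsc :: "complex \<Rightarrow> 'e form \<Rightarrow> 'e form" where
  "fsc a \<phi> = (\<lambda>vs. a * \<phi> vs)"

lemma fsc_apply [simp]: "fsc a \<phi> vs = a * \<phi> vs"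
  by (simp add: fsc_def)

lemma fsc_simps:
  "fsc a (\<phi> + \<psi>) = fsc a \<phi> + fsc a \<psi>" "fsc a (\<phi> - \<psi>) = fsc a \<phi> - fsc a \<psi>" "fsc a (- \<phi>) = - fsc a \<phi>"
  "fsc (a + b) \<phi> = fsc a \<phi> + fsc b \<phi>" "fsc a (fsc b \<phi>) = fsc (a * b) \<phi>" "fsc a 0 = 0" "fsc 0 \<phi> = 0" "fsc 1 \<phi> = \<phi>"
  "fsc a (sum f I) = (\<Sum>i\<in>I. fsc a (f i))" "fsc (- a) \<phi> = - fsc a \<phi>" "fsc (a - b) \<phi> = fsc a \<phi> - fsc b \<phi>"
  by (auto simp: fun_eq_iff algebra_simps sum_distrib_left sum_fun_apply)

section \<open>Exterior algebra\<close>

text \<open>The grading involution. It carries the sign that a contraction or a 1-form picks up in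
  passing a form of mixed degree.\<close>

definition par :: "'e form \<Rightarrow> 'e form" where
  "par \<alpha> vs = (-1) ^ length vs * \<alpha> vs"

lemma par_par [simp]: "par (par \<alpha>) = \<alpha>"
  by (auto simp: par_def fun_eq_iff simp flip: power_mult_distrib mult.assoc)

lemma iprod_par: "iprod v (par \<alpha>) = - par (iprod v \<alpha>)"
  by (auto simp: par_def iprod_def fun_eq_iff)

lemma iprod_simps:
  "iprod v (\<phi> + \<psi>) = iprod v \<phi> + iprod v \<psi>" "iprod v (\<phi> - \<psi>) = iprod v \<phi> - iprod v \<psi>"
  "iprod v (- \<phi>) = - iprod v \<phi>" "iprod v (fsc a \<phi>) = fsc a (iprod v \<phi>)" "iprod v 0 = 0"
  "iprod v (sum f I) = (\<Sum>i\<in>I. iprod v (f i))"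
  by (auto simp: iprod_def fun_eq_iff sum_fun_apply)

lemma form_eqI: "\<phi> [] = \<psi> [] \<Longrightarrow> (\<And>v. iprod v \<phi> = iprod v \<psi>) \<Longrightarrow> \<phi> = \<psi>"
  unfolding fun_eq_iff iprod_def by (metis neq_Nil_conv)

lemma wedge_Nil [simp]: "wedge \<alpha> \<beta> [] = \<alpha> [] * \<beta> []"
  by (simp add: wedge_def)

text \<open>Whether \<open>0\<close> belongs to the set decides which factor of a wedge product
  receives the first vector.\<close>

lemma Pow_lessThan_Suc_decomp:
  "Pow {..<Suc n} = (\<lambda>I. insert 0 (Suc ` I)) ` Pow {..<n} \<union> (\<lambda>I. Suc ` I) ` Pow {..<n}"
proof (intro equalityI subsetI)
  fix I assume I: "I \<in> Pow {..<Suc n}"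
  let ?I = "{j. Suc j \<in> I}"
  have *: "?I \<in> Pow {..<n}" using I by auto
  show "I \<in> (\<lambda>I. insert 0 (Suc ` I)) ` Pow {..<n} \<union> (\<lambda>I. Suc ` I) ` Pow {..<n}"
  proof (cases "0 \<in> I")
    case True
    then have "I = insert 0 (Suc ` ?I)" using I by (auto simp: image_iff) (metis not0_implies_Suc)
    then show ?thesis using * by blast
  next
    case False
    then have "I = Suc ` ?I" using I by (auto simp: image_iff) (metis not0_implies_Suc)
    then show ?thesis using * by blast
  qed
qed auto

text \<open>The antiderivation rule for contraction. Together with the value on the empty list it is
  a recursion for \<open>wedge\<close> along the argument list, on which the later inductions
  run.\<close>

lemma wedge_Cons: "wedge \<alpha> \<beta> (v # vs) = wedge (iprod v \<alpha>) \<beta> vs + wedge (par \<alpha>) (iprod v \<beta>) vs"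
proof -
  define n where "n = length vs"
  define inv where "inv N I = card {(i, j). i \<in> I \<and> j \<in> {..<N} - I \<and> j < i}" for N :: nat and I
  define g where "g I = (-1) ^ inv (Suc n) I * \<alpha> (nths (v # vs) I) * \<beta> (nths (v # vs) (- I))" for I
  have disj: "(\<lambda>I. insert 0 (Suc ` I)) ` Pow {..<n} \<inter> (\<lambda>I. Suc ` I) ` Pow {..<n} = {}"
    by auto
  have inj1: "inj_on (\<lambda>I. insert 0 (Suc ` I)) (Pow {..<n})"
    by (rule inj_onI) (metis Diff_insert_absorb image_iff inj_Suc inj_image_eq_iff nat.distinct(1))
  have inj2: "inj_on (\<lambda>I. Suc ` I) (Pow {..<n})"
    by (rule inj_onI) (metis inj_Suc inj_image_eq_iff)
  have "wedge \<alpha> \<beta> (v # vs) = (\<Sum>I\<in>Pow {..<Suc n}. g I)"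
    by (simp add: wedge_def g_def inv_def n_def)
  also have "\<dots> = (\<Sum>I\<in>Pow {..<n}. g (insert 0 (Suc ` I))) + (\<Sum>I\<in>Pow {..<n}. g (Suc ` I))"
    unfolding Pow_lessThan_Suc_decomp
    by (subst sum.union_disjoint)
      (auto simp: disj sum.reindex[OF inj1, unfolded o_def] sum.reindex[OF inj2, unfolded o_def] simp del: Pow_iff)
  also have "(\<Sum>I\<in>Pow {..<n}. g (insert 0 (Suc ` I))) = wedge (iprod v \<alpha>) \<beta> vs"
    unfolding wedge_def
  proof (rule sum.cong)
    fix I assume I: "I \<in> Pow {..<length vs}"
    have "{(i, j). i \<in> insert 0 (Suc ` I) \<and> j \<in> {..<Suc n} - insert 0 (Suc ` I) \<and> j < i}
        = map_prod Suc Suc ` {(i, j). i \<in> I \<and> j \<in> {..<n} - I \<and> j < i}" (is "?A = ?B")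
    proof
      show "?A \<subseteq> ?B"
      proof
        fix x assume "x \<in> ?A"
        then obtain i j where "x = (i,j)" "i \<in> insert 0 (Suc ` I)" "j < Suc n" "j \<noteq> 0" "j \<notin> Suc ` I" "j < i" by auto
        then show "x \<in> ?B" by (cases j; cases i) (auto simp: image_iff)
      qed
    qed auto
    then have "inv (Suc n) (insert 0 (Suc ` I)) = inv n I"
      unfolding inv_def by (simp add: card_image inj_on_def)
    moreover have "{j. Suc j \<in> insert 0 (Suc ` I)} = I" "{j. Suc j \<in> - insert 0 (Suc ` I)} = - I" by auto
    ultimately show "g (insert 0 (Suc ` I)) = (- 1) ^ card {(i, j). i \<in> I \<and> j \<in> {..<length vs} - I \<and> j < i} *
         iprod v \<alpha> (nths vs I) * \<beta> (nths vs (- I))"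
      by (simp add: g_def nths_Cons iprod_def inv_def n_def)
  qed (simp add: n_def)
  also have "(\<Sum>I\<in>Pow {..<n}. g (Suc ` I)) = wedge (par \<alpha>) (iprod v \<beta>) vs"
    unfolding wedge_def
  proof (rule sum.cong)
    fix I assume I: "I \<in> Pow {..<length vs}"
    then have fin: "finite I" by (auto intro: finite_subset)
    \<comment> \<open>The first vector goes to the right factor and so stands behind the whole left
      block, which adds one inversion for each element of \<open>I\<close>; \<open>par\<close>
      absorbs this sign.\<close>
    have "{(i, j). i \<in> Suc ` I \<and> j \<in> {..<Suc n} - Suc ` I \<and> j < i}
        = (\<lambda>i. (Suc i, 0)) ` I \<union> map_prod Suc Suc ` {(i, j). i \<in> I \<and> j \<in> {..<n} - I \<and> j < i}" (is "?A = ?B")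
    proof
      show "?A \<subseteq> ?B"
      proof
        fix x assume "x \<in> ?A"
        then obtain i j where "x = (i,j)" "i \<in> Suc ` I" "j < Suc n" "j \<notin> Suc ` I" "j < i" by auto
        then show "x \<in> ?B" by (cases j; cases i) (auto simp: image_iff)
      qed
    qed auto
    moreover have "card (\<dots>) = card I + inv n I"
    proof (subst card_Un_disjoint)
      have "{(i, j). i \<in> I \<and> j \<in> {..<n} - I \<and> j < i} \<subseteq> I \<times> {..<n}" by auto
      then show "finite (map_prod Suc Suc ` {(i, j). i \<in> I \<and> j \<in> {..<n} - I \<and> j < i})"
        using fin by (meson finite_SigmaI finite_imageI finite_lessThan finite_subset)
    qed (auto simp: fin card_image inj_on_def inv_def)
    ultimately have "inv (Suc n) (Suc ` I) = card I + inv n I"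
      unfolding inv_def by simp
    moreover have "{j. Suc j \<in> Suc ` I} = I" "{j. Suc j \<in> - Suc ` I} = - I" by auto
    moreover have "length (nths vs I) = card I"
      unfolding length_nths using I by (intro arg_cong[where f=card]) auto
    ultimately show "g (Suc ` I) = (- 1) ^ card {(i, j). i \<in> I \<and> j \<in> {..<length vs} - I \<and> j < i} *
         par \<alpha> (nths vs I) * iprod v \<beta> (nths vs (- I))"
      by (simp add: g_def nths_Cons iprod_def inv_def n_def par_def power_add)
  qed (simp add: n_def)
  finally show ?thesis .
qed

lemma iprod_wedge: "iprod v (wedge \<alpha> \<beta>) = wedge (iprod v \<alpha>) \<beta> + wedge (par \<alpha>) (iprod v \<beta>)"
  by (auto simp: fun_eq_iff wedge_Cons iprod_def[of v "wedge \<alpha> \<beta>"])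

lemma wedge_linear:
  "wedge \<alpha> (\<phi> + \<psi>) = wedge \<alpha> \<phi> + wedge \<alpha> \<psi>" "wedge \<alpha> (fsc a \<phi>) = fsc a (wedge \<alpha> \<phi>)" "wedge \<alpha> 0 = 0"
  "wedge (\<alpha> + \<beta>) \<phi> = wedge \<alpha> \<phi> + wedge \<beta> \<phi>" "wedge (fsc a \<alpha>) \<phi> = fsc a (wedge \<alpha> \<phi>)" "wedge 0 \<phi> = 0"
  "wedge (- \<alpha>) \<phi> = - wedge \<alpha> \<phi>" "wedge \<alpha> (- \<phi>) = - wedge \<alpha> \<phi>"
  by (auto simp: fun_eq_iff wedge_def algebra_simps sum_distrib_left sum_negf simp flip: sum.distrib intro!: sum.cong)

section \<open>Exterior multiplication by a covector\<close>

definition eps :: "'e::euclidean_space covec \<Rightarrow> 'e form \<Rightarrow> 'e form" where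
  "eps \<xi> = wedge (covec_form \<xi>)"

lemma par_covec_form: "par (covec_form \<xi>) = - covec_form \<xi>"
  by (auto simp: fun_eq_iff par_def covec_form_def split: list.splits)

lemma iprod_covec_form: "iprod v (covec_form \<xi>) = (\<lambda>vs. if vs = [] then of_real (\<xi> v) else 0)"
  by (auto simp: fun_eq_iff iprod_def covec_form_def split: list.splits)

lemma wedge_scalar: "wedge (\<lambda>vs. if vs = [] then a else 0) \<phi> = fsc a \<phi>"
proof -
  have "wedge (\<lambda>vs. if vs = [] then a else 0) \<phi> vs = a * \<phi> vs" for vs
  proof (induction vs arbitrary: \<phi>)
    case (Cons v vs)
    have "iprod v (\<lambda>vs. if vs = [] then a else 0) = 0" "par (\<lambda>vs::'a list. if vs = [] then a else 0) = (\<lambda>vs. if vs = [] then a else 0)"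
      by (auto simp: fun_eq_iff iprod_def par_def)
    with Cons show ?case by (simp add: wedge_Cons wedge_linear iprod_def[of _ \<phi>])
  qed simp
  then show ?thesis by auto
qed

lemma eps_Nil [simp]: "eps \<xi> \<phi> [] = 0"
  by (simp add: eps_def covec_form_def)

text \<open>The canonical anticommutation relation, from which the mixed terms of the Clifford
  relation come. Evaluated on a list, as in \<open>eps_Cons\<close>, it is the recursion for
  \<open>eps\<close>.\<close>

lemma iprod_eps: "iprod v (eps \<xi> \<phi>) = fsc (of_real (\<xi> v)) \<phi> - eps \<xi> (iprod v \<phi>)"
  by (simp add: eps_def iprod_wedge par_covec_form iprod_covec_form wedge_scalar wedge_linear)

lemma eps_Cons: "eps \<xi> \<phi> (v # vs) = of_real (\<xi> v) * \<phi> vs - eps \<xi> (iprod v \<phi>) vs"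
  using fun_cong[OF iprod_eps[of v \<xi> \<phi>], of vs] by (simp add: iprod_def)

lemma eps_linear:
  "eps \<xi> (\<phi> + \<psi>) = eps \<xi> \<phi> + eps \<xi> \<psi>" "eps \<xi> (fsc a \<phi>) = fsc a (eps \<xi> \<phi>)" "eps \<xi> 0 = 0" "eps \<xi> (- \<phi>) = - eps \<xi> \<phi>"
  "eps \<xi> (\<phi> - \<psi>) = eps \<xi> \<phi> - eps \<xi> \<psi>"
  "eps (\<xi> + \<eta>) \<phi> = eps \<xi> \<phi> + eps \<eta> \<phi>" "eps (r *\<^sub>R \<xi>) \<phi> = fsc (of_real r) (eps \<xi> \<phi>)" "eps 0 \<phi> = 0"
proof -
  have 1: "covec_form (\<xi> + \<eta>) = covec_form \<xi> + covec_form \<eta>" "covec_form (r *\<^sub>R \<xi>) = fsc (of_real r) (covec_form \<xi>)" "covec_form (0::'a covec) = 0"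
    by (auto simp: fun_eq_iff covec_form_def plus_blinfun.rep_eq scaleR_blinfun.rep_eq split: list.splits)
  show "eps \<xi> (\<phi> + \<psi>) = eps \<xi> \<phi> + eps \<xi> \<psi>" "eps \<xi> (fsc a \<phi>) = fsc a (eps \<xi> \<phi>)" "eps \<xi> 0 = 0" "eps \<xi> (- \<phi>) = - eps \<xi> \<phi>"
  "eps (\<xi> + \<eta>) \<phi> = eps \<xi> \<phi> + eps \<eta> \<phi>" "eps (r *\<^sub>R \<xi>) \<phi> = fsc (of_real r) (eps \<xi> \<phi>)" "eps 0 \<phi> = 0"
    by (simp_all add: eps_def wedge_linear 1)
  show "eps \<xi> (\<phi> - \<psi>) = eps \<xi> \<phi> - eps \<xi> \<psi>"
    using wedge_linear(1)[of "covec_form \<xi>" \<phi> "- \<psi>"] by (simp add: eps_def wedge_linear)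
qed

lemma eps_sum: "eps \<xi> (sum f I) = (\<Sum>i\<in>I. eps \<xi> (f i))"
  by (rule additive_sum[of "eps \<xi>"]) (simp_all add: eps_linear)

lemma eps_sum_left: "eps (sum f I) \<phi> = (\<Sum>i\<in>I. eps (f i) \<phi>)"
  by (rule additive_sum[of "\<lambda>\<xi>. eps \<xi> \<phi>"]) (simp_all add: eps_linear)

lemma eps_anticommute: "eps \<xi> (eps \<eta> \<phi>) = - eps \<eta> (eps \<xi> \<phi>)"
proof -
  have "eps \<xi> (eps \<eta> \<phi>) vs = - eps \<eta> (eps \<xi> \<phi>) vs" for vs
  proof (induction vs arbitrary: \<phi>)
    case (Cons v vs)
    then show ?case by (simp add: eps_Cons iprod_eps eps_linear)
  qed simp
  then show ?thesis by auto
qed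

text \<open>Associativity and graded commutativity against a 1-form in a single identity; in this
  shape it can be proved by recursion on the arguments with both forms generalized.\<close>

lemma eps_wedge: "eps \<xi> (wedge \<alpha> \<phi>) = wedge (par \<alpha>) (eps \<xi> \<phi>)"
proof -
  have "eps \<xi> (wedge \<alpha> \<phi>) vs = wedge (par \<alpha>) (eps \<xi> \<phi>) vs" for vs
  proof (induction vs arbitrary: \<phi> \<alpha>)
    case (Cons v vs)
    have "wedge \<alpha> (\<phi> - \<psi>) = wedge \<alpha> \<phi> - wedge \<alpha> \<psi>" for \<alpha> \<phi> and \<psi> :: "'a form"
      using wedge_linear(1)[of \<alpha> \<phi> "-\<psi>"] by (simp add: wedge_linear)
    with Cons show ?case by (simp add: eps_Cons wedge_Cons iprod_wedge iprod_eps eps_linear iprod_par wedge_linear)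
  qed simp
  then show ?thesis by auto
qed

section \<open>Alternating forms\<close>

lemma alt_form_linear: "alt_form \<phi> \<Longrightarrow> linear (\<lambda>x. \<phi> (us @ x # vs))"
  by (simp add: alt_form_def)

lemma alt_form_linear0: "alt_form \<phi> \<Longrightarrow> linear (\<lambda>x. \<phi> (x # vs))"
  using alt_form_linear[of \<phi> "[]"] by simp

lemma alt_form_zero: "alt_form \<phi> \<Longrightarrow> \<phi> (us @ x # vs @ x # ws) = 0"
  by (simp add: alt_form_def)

lemma alt_form_iprod: "alt_form \<phi> \<Longrightarrow> alt_form (iprod v \<phi>)"
  using alt_form_linear[of \<phi> "v # us" vs for us vs] alt_form_zero[of \<phi> "v # us" for us]
  by (simp add: alt_form_def iprod_def)

lemma alt_form_simps:
  "alt_form 0" "alt_form \<phi> \<Longrightarrow> alt_form \<psi> \<Longrightarrow> alt_form (\<phi> + \<psi>)" "alt_form \<phi> \<Longrightarrow> alt_form \<psi> \<Longrightarrow> alt_form (\<phi> - \<psi>)"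
  "alt_form \<phi> \<Longrightarrow> alt_form (- \<phi>)" "alt_form \<phi> \<Longrightarrow> alt_form (fsc a \<phi>)"
  unfolding alt_form_def
  by (auto simp: linear_iff algebra_simps scaleR_conv_of_real)

lemma alt_form_sum: "(\<And>i. i \<in> I \<Longrightarrow> alt_form (f i)) \<Longrightarrow> alt_form (sum f I)"
  by (rule sum_closed[of alt_form]) (simp_all add: alt_form_simps)

lemma iprod_add: "alt_form \<phi> \<Longrightarrow> iprod (v + w) \<phi> = iprod v \<phi> + iprod w \<phi>"
  by (simp add: fun_eq_iff iprod_def linear_add[OF alt_form_linear0])

lemma iprod_scaleR: "alt_form \<phi> \<Longrightarrow> iprod (r *\<^sub>R v) \<phi> = fsc (of_real r) (iprod v \<phi>)"
  by (simp add: fun_eq_iff iprod_def linear_cmul[OF alt_form_linear0] scaleR_conv_of_real)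

lemma iprod_zero: "alt_form \<phi> \<Longrightarrow> iprod 0 \<phi> = 0"
  using iprod_scaleR[of \<phi> 0] by (simp add: fsc_simps)

lemma iprod_iprod_self: "alt_form \<phi> \<Longrightarrow> iprod v (iprod v \<phi>) = 0"
  using alt_form_zero[of \<phi> "[]" v "[]"] by (auto simp: fun_eq_iff iprod_def)

lemma iprod_anticommute: "alt_form \<phi> \<Longrightarrow> iprod v (iprod w \<phi>) = - iprod w (iprod v \<phi>)"
  using iprod_iprod_self[of \<phi> "v + w"]
  by (simp add: iprod_add alt_form_iprod iprod_simps iprod_iprod_self eq_neg_iff_add_eq_0 add.commute)

lemma iprod_sum: "alt_form \<phi> \<Longrightarrow> iprod (sum f I) \<phi> = (\<Sum>i\<in>I. iprod (f i) \<phi>)"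
  by (rule additive_sum[of "\<lambda>v. iprod v \<phi>"]) (simp_all add: iprod_add iprod_zero)

lemma alt_form_eps:
  assumes "alt_form \<phi>"
  shows "alt_form (eps \<xi> \<phi>)"
proof -
  have lin: "linear (\<lambda>x. eps \<xi> \<phi> (us @ x # vs))" if "alt_form \<phi>" for us vs \<phi>
    using that
  proof (induction us arbitrary: \<phi>)
    case Nil
    then show ?case
      by (auto simp: eps_Cons iprod_add iprod_scaleR eps_linear linear_iff blinfun.add_right blinfun.scaleR_right algebra_simps scaleR_conv_of_real)
  next
    case (Cons u us)
    have "linear (\<lambda>x. of_real (\<xi> u) * \<phi> (us @ x # vs))"
      using linear_compose[OF alt_form_linear[OF Cons.prems] bounded_linear.linear[OF bounded_linear_mult_right]] by (simp add: o_def)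
    then show ?case using Cons.IH[OF alt_form_iprod[OF Cons.prems, of u]]
      by (auto simp: eps_Cons intro: linear_compose_sub)
  qed
  \<comment> \<open>Exchanging the first two arguments suffices: it brings a vector standing between
    two equal ones to the front, where the recursion strips it off.\<close>
  have swap: "eps \<xi> \<phi> (x # y # zs) = - eps \<xi> \<phi> (y # x # zs)" if "alt_form \<phi>" for x y zs \<phi>
    using iprod_anticommute[OF that, of x y] by (simp add: eps_Cons eps_linear iprod_def)
  have zero1: "eps \<xi> \<phi> (x # vs @ x # ws) = 0" if "alt_form \<phi>" for x vs ws \<phi>
    using that
  proof (induction vs arbitrary: \<phi>)
    case Nil
    then show ?case using swap[OF Nil, of x x ws] by simp
  next
    case (Cons y vs)
    have "eps \<xi> \<phi> (x # y # vs @ x # ws) = - eps \<xi> \<phi> (y # x # vs @ x # ws)"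
      by (rule swap[OF Cons.prems])
    also have "\<dots> = 0"
      using Cons.IH[OF alt_form_iprod[OF Cons.prems, of y]] alt_form_zero[OF Cons.prems, of "[]" x vs ws]
      by (subst eps_Cons) simp
    finally show ?case by simp
  qed
  have zero: "eps \<xi> \<phi> (us @ x # vs @ x # ws) = 0" if "alt_form \<phi>" for us x vs ws \<phi>
    using that
  proof (induction us arbitrary: \<phi>)
    case Nil
    then show ?case using zero1 by simp
  next
    case (Cons u us)
    then show ?case by (simp add: eps_Cons alt_form_iprod alt_form_zero)
  qed
  show ?thesis unfolding alt_form_def using lin zero assms by blast
qed

abbreviation dx :: "'e::euclidean_space \<Rightarrow> 'e covec" where
  "dx \<equiv> blinfun_inner_left"

lemma covec_expand: "\<xi> = (\<Sum>b\<in>Basis. blinfun_apply \<xi> b *\<^sub>R dx b)" for \<xi> :: "'e::euclidean_space covec"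
proof (rule blinfun_eqI)
  fix v
  have "\<xi> v = \<xi> (\<Sum>b\<in>Basis. (v \<bullet> b) *\<^sub>R b)" by (simp add: euclidean_representation)
  then show "\<xi> v = (\<Sum>b\<in>Basis. blinfun_apply \<xi> b *\<^sub>R dx b) v"
    by (simp add: blinfun.sum_left blinfun.sum_right blinfun.scaleR_left blinfun.scaleR_right mult.commute)
qed

section \<open>Homogeneous forms and multiplication by a 3-form\<close>

definition homog :: "nat \<Rightarrow> 'e form \<Rightarrow> bool" where
  "homog k \<alpha> \<longleftrightarrow> (\<forall>vs. length vs \<noteq> k \<longrightarrow> \<alpha> vs = 0)"

lemma homog_par: "homog k \<alpha> \<Longrightarrow> par \<alpha> = fsc ((-1) ^ k) \<alpha>"
  by (auto simp: fun_eq_iff par_def homog_def)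

lemma homog_iprod: "homog (Suc k) \<alpha> \<Longrightarrow> homog k (iprod v \<alpha>)"
  by (auto simp: homog_def iprod_def)

lemma homog_0_iprod: "homog 0 \<alpha> \<Longrightarrow> iprod v \<alpha> = 0"
  by (auto simp: homog_def iprod_def)

lemma homog_0_wedge: "homog 0 \<alpha> \<Longrightarrow> wedge \<alpha> \<phi> = fsc (\<alpha> []) \<phi>"
  using wedge_scalar[of "\<alpha> []" \<phi>] by (rule back_subst[of "\<lambda>x. wedge x \<phi> = _"]) (auto simp: homog_def fun_eq_iff)

text \<open>Euler's identity: contracting with the basis vectors and wedging the dual covectors back
  counts the degree.\<close>

lemma wedge_homog_eps:
  assumes "alt_form \<alpha>" "homog k \<alpha>"
  shows "(\<Sum>b\<in>Basis. eps (dx b) (wedge (iprod b \<alpha>) \<phi>)) = fsc (of_nat k) (wedge \<alpha> \<phi>)"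
proof -
  have "(\<Sum>b\<in>Basis. eps (dx b) (wedge (iprod b \<alpha>) \<phi>)) vs = of_nat k * wedge \<alpha> \<phi> vs" for vs
    using assms
  proof (induction vs arbitrary: \<phi> \<alpha> k)
    case Nil
    then show ?case by (cases k) (auto simp: homog_def sum_fun_apply)
  next
    case (Cons v vs)
    have alt: "alt_form \<alpha>" by fact
    have A: "(\<Sum>b\<in>Basis. of_real (v \<bullet> b) * wedge (iprod b \<alpha>) \<phi> vs) = wedge (iprod v \<alpha>) \<phi> vs"
    proof -
      have eq: "iprod v \<alpha> = (\<Sum>b\<in>Basis. fsc (of_real (v \<bullet> b)) (iprod b \<alpha>))"
        using iprod_sum[OF alt, of "\<lambda>b. (v \<bullet> b) *\<^sub>R b" Basis] by (simp add: euclidean_representation iprod_scaleR alt)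
      have "wedge (sum f I) \<phi> = (\<Sum>i\<in>I. wedge (f i) \<phi>)" for f and I :: "'a set"
        by (rule additive_sum[of "\<lambda>\<alpha>. wedge \<alpha> \<phi>"]) (simp_all add: wedge_linear)
      then show ?thesis by (subst eq) (simp add: wedge_linear sum_fun_apply)
    qed
    show ?case
    proof (cases k)
      case 0
      then have "iprod w \<alpha> = 0" for w using Cons.prems by (intro homog_0_iprod) simp
      then have "eps (dx b) (wedge (iprod b \<alpha>) \<phi>) = 0" for b by (simp only: wedge_linear eps_linear)
      with 0 show ?thesis by (simp add: sum_fun_apply)
    next
      case (Suc l)
      have hi: "homog l (iprod w \<alpha>)" for w using Cons.prems(2) Suc homog_iprod[of l \<alpha> w] by simp
      have p: "par \<alpha> = fsc ((-1)^k) \<alpha>" using homog_par[OF Cons.prems(2)] .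
      \<comment> \<open>Contraction with \<open>v\<close> lowers the degree of
        \<open>\<alpha>\<close> to \<open>l\<close>. The missing unit in \<open>k = l + 1\<close> is
        supplied by the term \<open>A\<close>, where \<open>v\<close> meets the new
        covector.\<close>
      have IH1: "(\<Sum>b\<in>Basis. eps (dx b) (wedge (iprod b (iprod v \<alpha>)) \<phi>) vs) = of_nat l * wedge (iprod v \<alpha>) \<phi> vs"
        using Cons.IH[OF alt_form_iprod[OF alt] hi, of v \<phi>] by (simp add: sum_fun_apply)
      have IH2: "(\<Sum>b\<in>Basis. eps (dx b) (wedge (iprod b \<alpha>) (iprod v \<phi>)) vs) = of_nat k * wedge \<alpha> (iprod v \<phi>) vs"
        using Cons.IH[OF alt Cons.prems(2), of "iprod v \<phi>"] by (simp add: sum_fun_apply)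
      have ev: "eps (dx b) (iprod v (wedge (iprod b \<alpha>) \<phi>)) vs
         = - eps (dx b) (wedge (iprod b (iprod v \<alpha>)) \<phi>) vs + (-1)^l * eps (dx b) (wedge (iprod b \<alpha>) (iprod v \<phi>)) vs" for b
        by (simp add: iprod_wedge eps_linear homog_par[OF hi] wedge_linear iprod_anticommute[OF alt, of v b])
      have "(\<Sum>b\<in>Basis. eps (dx b) (wedge (iprod b \<alpha>) \<phi>)) (v # vs)
         = wedge (iprod v \<alpha>) \<phi> vs + of_nat l * wedge (iprod v \<alpha>) \<phi> vs - (-1)^l * (of_nat k * wedge \<alpha> (iprod v \<phi>) vs)"
        by (simp add: eps_Cons sum_fun_apply sum_subtractf sum.distrib A ev sum_negf IH1 IH2 flip: sum_distrib_left)
      also have "\<dots> = of_nat k * wedge \<alpha> \<phi> (v # vs)"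
        by (simp add: wedge_Cons Suc p wedge_linear algebra_simps)
      finally show ?thesis .
    qed
  qed
  then show ?thesis by auto
qed

text \<open>Euler's identity in degrees 3, 2 and 1 gives the factor \<open>1/6\<close>. The point is
  to write multiplication by \<open>H\<close> as a sum of Clifford products of covectors, which can
  then be split along \<open>L\<close> and its conjugate.\<close>

lemma wedge_3_eps:
  assumes "alt_form h" "homog 3 h"
  shows "wedge h \<phi> = fsc (1/6) (\<Sum>a\<in>Basis. \<Sum>b\<in>Basis. \<Sum>c\<in>Basis. fsc (h [a, b, c]) (eps (dx a) (eps (dx b) (eps (dx c) \<phi>))))"
proof -
  have h: "homog 2 (iprod a h)" "homog 1 (iprod b (iprod a h))" "homog 0 (iprod c (iprod b (iprod a h)))" for a b c
    using assms(2) by (auto simp: homog_def iprod_def)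
  have 1: "wedge (iprod b (iprod a h)) \<phi> = (\<Sum>c\<in>Basis. fsc (h [a, b, c]) (eps (dx c) \<phi>))" for a b
    using wedge_homog_eps[OF _ h(2), of b a \<phi>] assms
    by (simp add: alt_form_iprod homog_0_wedge[OF h(3)] eps_linear fsc_simps iprod_def)
  have 2: "wedge (iprod a h) \<phi> = fsc (1/2) (\<Sum>b\<in>Basis. eps (dx b) (wedge (iprod b (iprod a h)) \<phi>))" for a
    using arg_cong[OF wedge_homog_eps[OF alt_form_iprod[OF assms(1)] h(1), of a \<phi>], of "fsc (1/2)"]
    by (simp add: fsc_simps)
  have 3: "wedge h \<phi> = fsc (1/3) (\<Sum>a\<in>Basis. eps (dx a) (wedge (iprod a h) \<phi>))"
    using arg_cong[OF wedge_homog_eps[OF assms, of \<phi>], of "fsc (1/3)"] by (simp add: fsc_simps)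
  show ?thesis
    unfolding 3 2 1 by (simp add: eps_linear eps_sum fsc_simps)
qed

section \<open>The Clifford action\<close>

lemma cliff_real_eq: "cliff_real w \<phi> = iprod (fst w) \<phi> + eps (snd w) \<phi>"
  by (auto simp: fun_eq_iff cliff_real_def eps_def)

lemma cliff_eq: "cliff z \<phi> = cliff_real (fst z) \<phi> + fsc \<i> (cliff_real (snd z) \<phi>)"
  by (auto simp: fun_eq_iff cliff_def)

lemma cliff_real_linear:
  "cliff_real w (\<phi> + \<psi>) = cliff_real w \<phi> + cliff_real w \<psi>" "cliff_real w (fsc a \<phi>) = fsc a (cliff_real w \<phi>)"
  "cliff_real w 0 = 0" "cliff_real w (- \<phi>) = - cliff_real w \<phi>" "cliff_real w (\<phi> - \<psi>) = cliff_real w \<phi> - cliff_real w \<psi>"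
  by (simp_all add: cliff_real_eq iprod_simps eps_linear fsc_simps)

lemma cliff_real_sum: "cliff_real w (sum f I) = (\<Sum>i\<in>I. cliff_real w (f i))"
  by (rule additive_sum[of "cliff_real w"]) (simp_all add: cliff_real_linear)

lemma alt_form_cliff_real: "alt_form \<phi> \<Longrightarrow> alt_form (cliff_real w \<phi>)"
  by (simp add: cliff_real_eq alt_form_simps alt_form_iprod alt_form_eps)

lemma cliff_real_add: "alt_form \<phi> \<Longrightarrow> cliff_real (w + z) \<phi> = cliff_real w \<phi> + cliff_real z \<phi>"
  by (simp add: cliff_real_eq iprod_add eps_linear)

lemma cliff_real_scaleR: "alt_form \<phi> \<Longrightarrow> cliff_real (r *\<^sub>R w) \<phi> = fsc (of_real r) (cliff_real w \<phi>)"
  by (simp add: cliff_real_eq iprod_scaleR eps_linear fsc_simps)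

lemma cliff_real_uminus: "alt_form \<phi> \<Longrightarrow> cliff_real (- w) \<phi> = - cliff_real w \<phi>"
  using cliff_real_scaleR[of \<phi> "-1" w] by (simp add: fsc_simps)

lemma cliff_real_diff: "alt_form \<phi> \<Longrightarrow> cliff_real (w - z) \<phi> = cliff_real w \<phi> - cliff_real z \<phi>"
  using cliff_real_add[of \<phi> w "- z"] by (simp add: cliff_real_uminus)

text \<open>The type of forms contains all functions on lists, and two contractions anticommute only
  on alternating ones. This is why \<open>alt_form\<close> accompanies every use of the Clifford
  relation.\<close>

lemma cliff_real_anticommute:
  "alt_form \<phi> \<Longrightarrow> cliff_real w (cliff_real z \<phi>) + cliff_real z (cliff_real w \<phi>) = fsc (of_real (2 * ginner w z)) \<phi>"
  by (simp add: cliff_real_eq iprod_simps eps_linear iprod_eps iprod_anticommute[of \<phi> "fst z" "fst w"]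
      eps_anticommute[of "snd z" "snd w"] ginner_def fun_eq_iff algebra_simps)

abbreviation csc :: "complex \<Rightarrow> 'e::euclidean_space cgtan \<Rightarrow> 'e cgtan" where
  "csc \<equiv> cscale"

lemma cliff_linear:
  "cliff w (\<phi> + \<psi>) = cliff w \<phi> + cliff w \<psi>" "cliff w (fsc a \<phi>) = fsc a (cliff w \<phi>)"
  "cliff w 0 = 0" "cliff w (- \<phi>) = - cliff w \<phi>" "cliff w (\<phi> - \<psi>) = cliff w \<phi> - cliff w \<psi>"
  by (simp_all add: cliff_eq cliff_real_linear fsc_simps mult.commute)

lemma cliff_sum: "cliff w (sum f I) = (\<Sum>i\<in>I. cliff w (f i))"
  by (rule additive_sum[of "cliff w"]) (simp_all add: cliff_linear)

lemma alt_form_cliff: "alt_form \<phi> \<Longrightarrow> alt_form (cliff w \<phi>)"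
  by (simp add: cliff_eq alt_form_simps alt_form_cliff_real)

lemma cliff_add: "alt_form \<phi> \<Longrightarrow> cliff (w + z) \<phi> = cliff w \<phi> + cliff z \<phi>"
  by (simp add: cliff_eq cliff_real_add fsc_simps)

lemma cliff_csc: "alt_form \<phi> \<Longrightarrow> cliff (csc a w) \<phi> = fsc a (cliff w \<phi>)"
  by (simp add: cliff_eq cscale_def cliff_real_add cliff_real_diff cliff_real_scaleR fun_eq_iff)
     (simp add: complex_eq_iff algebra_simps)

lemma cliff_zero: "alt_form \<phi> \<Longrightarrow> cliff 0 \<phi> = 0"
  using cliff_csc[of \<phi> 0 0] by (simp add: fsc_simps cscale_def flip: zero_prod_def)

lemma cliff_uminus: "alt_form \<phi> \<Longrightarrow> cliff (- w) \<phi> = - cliff w \<phi>"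
  using cliff_add[of \<phi> w "-w"] by (simp add: cliff_zero eq_neg_iff_add_eq_0 add.commute)

lemma cliff_sum_left: "alt_form \<phi> \<Longrightarrow> cliff (sum f I) \<phi> = (\<Sum>i\<in>I. cliff (f i) \<phi>)"
  by (rule additive_sum[of "\<lambda>v. cliff v \<phi>"]) (simp_all add: cliff_add cliff_zero)

lemma cliff_anticommute:
  assumes "alt_form \<phi>"
  shows "cliff w (cliff z \<phi>) + cliff z (cliff w \<phi>) = fsc (2 * cinner w z) \<phi>"
proof -
  obtain w1 w2 where w: "w = (w1, w2)" by (cases w)
  obtain z1 z2 where z: "z = (z1, z2)" by (cases z)
  note wz = w z
  have "cliff w (cliff z \<phi>) + cliff z (cliff w \<phi>) =
    (cliff_real w1 (cliff_real z1 \<phi>) + cliff_real z1 (cliff_real w1 \<phi>))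
    + fsc \<i> (cliff_real w1 (cliff_real z2 \<phi>) + cliff_real z2 (cliff_real w1 \<phi>))
    + fsc \<i> (cliff_real w2 (cliff_real z1 \<phi>) + cliff_real z1 (cliff_real w2 \<phi>))
    - (cliff_real w2 (cliff_real z2 \<phi>) + cliff_real z2 (cliff_real w2 \<phi>))"
    by (simp add: wz cliff_eq cliff_real_linear fsc_simps algebra_simps)
  also have "\<dots> = fsc (2 * cinner w z) \<phi>"
    by (simp add: cliff_real_anticommute[OF assms] fun_eq_iff wz cinner_def) (simp add: complex_eq_iff algebra_simps)
  finally show ?thesis .
qed

lemma cliff_swap: "alt_form \<phi> \<Longrightarrow> cliff w (cliff z \<phi>) = fsc (2 * cinner w z) \<phi> - cliff z (cliff w \<phi>)"
  using cliff_anticommute[of \<phi> w z] by (simp add: algebra_simps)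

section \<open>Complexified generalized tangent vectors\<close>

lemma csc_simps:
  "csc a (z + w) = csc a z + csc a w" "csc (a + b) z = csc a z + csc b z" "csc a (csc b z) = csc (a * b) z"
  "csc 1 z = z" "csc 0 z = 0" "csc a 0 = 0" "csc a (- z) = - csc a z" "csc (- a) z = - csc a z"
  "csc a (z - w) = csc a z - csc a w"
  by (auto simp: cscale_def prod_eq_iff algebra_simps)

interpretation cgt: vector_space "cscale :: complex \<Rightarrow> 'e::euclidean_space cgtan \<Rightarrow> _"
  by unfold_locales (simp_all add: csc_simps)

lemma csc_sum: "csc a (sum f I) = (\<Sum>i\<in>I. csc a (f i))"
  by (rule additive_sum[of "csc a"]) (simp_all add: csc_simps)

lemma ginner_simps:
  "ginner (z + w) y = ginner z y + ginner w y" "ginner y (z + w) = ginner y z + ginner y w"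
  "ginner (r *\<^sub>R z) y = r * ginner z y" "ginner y (r *\<^sub>R z) = r * ginner y z" "ginner 0 y = 0" "ginner y 0 = 0"
  "ginner (- z) y = - ginner z y" "ginner y (- z) = - ginner y z"
  "ginner (z - w) y = ginner z y - ginner w y" "ginner y (z - w) = ginner y z - ginner y w"
  by (auto simp: ginner_def blinfun.bilinear_simps field_simps)

lemma ginner_commute: "ginner z w = ginner w z"
  by (simp add: ginner_def)

lemma cinner_commute: "cinner z w = cinner w z"
  by (simp add: cinner_def ginner_commute complex_eq_iff)

lemma cinner_simps:
  "cinner (z + w) y = cinner z y + cinner w y" "cinner y (z + w) = cinner y z + cinner y w"
  "cinner (csc a z) y = a * cinner z y" "cinner y (csc a z) = a * cinner y z" "cinner 0 y = 0" "cinner y 0 = 0"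
  "cinner (- z) y = - cinner z y" "cinner y (- z) = - cinner y z"
  "cinner (z - w) y = cinner z y - cinner w y" "cinner y (z - w) = cinner y z - cinner y w"
  by (auto simp: cinner_def cscale_def ginner_simps complex_eq_iff algebra_simps)

lemma cinner_sum: "cinner (sum f I) y = (\<Sum>i\<in>I. cinner (f i) y)" "cinner y (sum f I) = (\<Sum>i\<in>I. cinner y (f i))"
  by (rule additive_sum[of "\<lambda>x. cinner x y"] additive_sum[of "\<lambda>x. cinner y x"]; simp add: cinner_simps)+

text \<open>The standard real frame, consisting of the basis vectors and the dual covectors. Its
  partner \<open>gd\<close> exchanges the two kinds, so that \<open>gw i\<close> and
  \<open>gd i\<close> pair to \<open>1/2\<close>; hence the factors 2 in all expansions.\<close>

definition gw :: "'e::euclidean_space \<times> bool \<Rightarrow> 'e cgtan" where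
  "gw i = ((if snd i then (fst i, 0) else (0, dx (fst i))), 0)"

definition gd :: "'e::euclidean_space \<times> bool \<Rightarrow> 'e cgtan" where
  "gd i = gw (fst i, \<not> snd i)"

definition GI :: "('e::euclidean_space \<times> bool) set" where
  "GI = Basis \<times> UNIV"

lemma finite_GI [simp]: "finite GI"
  by (simp add: GI_def)

lemma sum_GI_flip: "(\<Sum>i\<in>GI. f (gw i) (gd i)) = (\<Sum>i\<in>GI. f (gd i) (gw i))"
  by (rule sum.reindex_bij_witness[of _ "\<lambda>i. (fst i, \<not> snd i)" "\<lambda>i. (fst i, \<not> snd i)"])
     (auto simp: GI_def gd_def)

lemma sum_GI: "(\<Sum>i\<in>GI. f i) = (\<Sum>b\<in>Basis. f (b, True) + f (b, False))"
  using sum.cartesian_product[of "\<lambda>b t. f (b, t)" UNIV Basis] by (simp add: GI_def UNIV_bool add.commute)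

lemma gtan_expand:
  "w = (\<Sum>b\<in>Basis. (2 * ginner w (0, dx b)) *\<^sub>R (b, 0) + (2 * ginner w (b, 0)) *\<^sub>R (0, dx b))"
proof -
  have "fst w = (\<Sum>b\<in>Basis. (fst w \<bullet> b) *\<^sub>R b)" by (simp add: euclidean_representation)
  then show ?thesis
    using covec_expand[of "snd w"]
    by (simp add: prod_eq_iff fst_sum snd_sum ginner_def)
qed

lemma cgtan_expand: "z = (\<Sum>i\<in>GI. csc (2 * cinner z (gd i)) (gw i))"
proof -
  have "fst z = fst (\<Sum>i\<in>GI. csc (2 * cinner z (gd i)) (gw i))"
    by (subst gtan_expand[of "fst z"])
      (simp add: sum_GI fst_sum gw_def gd_def cscale_def cinner_def ginner_simps flip: zero_prod_def)
  moreover have "snd z = snd (\<Sum>i\<in>GI. csc (2 * cinner z (gd i)) (gw i))"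
    by (subst gtan_expand[of "snd z"])
      (simp add: sum_GI snd_sum gw_def gd_def cscale_def cinner_def ginner_simps flip: zero_prod_def)
  ultimately show ?thesis by (simp add: prod_eq_iff)
qed

lemma cgtan_expand': "z = (\<Sum>i\<in>GI. csc (2 * cinner z (gw i)) (gd i))"
  using cgtan_expand[of z] sum_GI_flip[of "\<lambda>x y. csc (2 * cinner z y) x"] by simp

text \<open>Half the trace of the identity: the frame has \<open>2 * DIM('e)\<close> elements, each
  pairing to \<open>1/2\<close>.\<close>

lemma sum_cinner_gw_gd: "(\<Sum>i\<in>GI. cinner (gw i) (gd i :: 'e::euclidean_space cgtan)) = of_nat DIM('e)"
  by (simp add: sum_GI gw_def gd_def cinner_def ginner_def complex_eq_iff)

section \<open>Complex linear functionals and contractions over the frame\<close>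

definition clin :: "('e::euclidean_space cgtan \<Rightarrow> complex) \<Rightarrow> bool" where
  "clin f \<longleftrightarrow> (\<forall>z w. f (z + w) = f z + f w) \<and> (\<forall>a z. f (csc a z) = a * f z)"

lemma clin_add: "clin f \<Longrightarrow> f (z + w) = f z + f w"
  and clin_csc: "clin f \<Longrightarrow> f (csc a z) = a * f z"
  by (auto simp: clin_def simp del: split_paired_All)

lemma clinI: "(\<And>z w. f (z + w) = f z + f w) \<Longrightarrow> (\<And>a z. f (csc a z) = a * f z) \<Longrightarrow> clin f"
  unfolding clin_def by blast

lemma clin_sum:
  assumes "clin f"
  shows "f (sum g I) = (\<Sum>i\<in>I. f (g i))"
  by (rule additive_sum[of f]) (use clin_csc[OF assms, of 0 0] in \<open>simp_all add: csc_simps clin_add[OF assms]\<close>)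

lemma clin_expand:
  assumes "clin f"
  shows "f z = (\<Sum>i\<in>GI. 2 * cinner z (gd i) * f (gw i))" "f z = (\<Sum>i\<in>GI. 2 * cinner z (gw i) * f (gd i))"
  by (subst cgtan_expand, simp add: clin_sum[OF assms] clin_csc[OF assms])
     (subst cgtan_expand', simp add: clin_sum[OF assms] clin_csc[OF assms])

text \<open>The sum over the frame and its dual is an invariant contraction, so an operator on one
  slot can be replaced by its adjoint on the other. It is applied to the projections onto
  \<open>L\<close> and to changes of coordinates.\<close>

lemma sum_GI_adjoint:
  assumes F: "\<And>y. clin (\<lambda>x. F x y)" "\<And>x. clin (F x)" and adj: "\<And>x y. cinner (G x) y = cinner x (G' y)"
  shows "(\<Sum>i\<in>GI. F (G (gw i)) (gd i)) = (\<Sum>i\<in>GI. F (gw i) (G' (gd i)))"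
proof -
  have "(\<Sum>i\<in>GI. F (G (gw i)) (gd i)) = (\<Sum>i\<in>GI. \<Sum>j\<in>GI. 2 * cinner (G (gw i)) (gd j) * F (gw j) (gd i))"
    by (rule sum.cong[OF refl]) (rule clin_expand(1)[OF F(1)])
  also have "\<dots> = (\<Sum>j\<in>GI. \<Sum>i\<in>GI. 2 * cinner (G' (gd j)) (gw i) * F (gw j) (gd i))"
    by (subst sum.swap) (simp add: adj cinner_commute[of "gw _" "G' _"])
  also have "\<dots> = (\<Sum>j\<in>GI. F (gw j) (G' (gd j)))"
    by (rule sum.cong[OF refl]) (rule clin_expand(2)[OF F(2), symmetric])
  finally show ?thesis .
qed

lemma clin_cliff: "alt_form \<phi> \<Longrightarrow> clin (\<lambda>z. cliff z \<phi> vs)" "alt_form \<phi> \<Longrightarrow> clin (\<lambda>z. cliff y (cliff z \<phi>) vs)"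
  by (rule clinI; simp add: cliff_add cliff_csc cliff_linear)+

lemma clin_cinner: "clin (cinner z)" "clin (\<lambda>w. cinner w z)"
  by (rule clinI; simp add: cinner_simps)+

definition Jc :: "('e::euclidean_space gtan \<Rightarrow> 'e gtan) \<Rightarrow> 'e cgtan \<Rightarrow> 'e cgtan" where
  "Jc J z = (J (fst z), J (snd z))"

definition LL :: "('e::euclidean_space gtan \<Rightarrow> 'e gtan) \<Rightarrow> 'e cgtan set" where
  "LL J = {z. Jc J z = csc \<i> z}"

definition KK :: "('e::euclidean_space gtan \<Rightarrow> 'e gtan) \<Rightarrow> 'e form set" where
  "KK J = {\<phi>. alt_form \<phi> \<and> (\<forall>z\<in>LL J. cliff z \<phi> = 0)}"

definition projL :: "('e::euclidean_space gtan \<Rightarrow> 'e gtan) \<Rightarrow> 'e cgtan \<Rightarrow> 'e cgtan" where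
  "projL J z = csc (1/2) (z - csc \<i> (Jc J z))"

text \<open>The spin action of \<open>J\<close>; it multiplies \<open>U\<^sup>k\<close> by \<open>k\<close>.\<close>

definition Sop :: "('e::euclidean_space gtan \<Rightarrow> 'e gtan) \<Rightarrow> 'e form \<Rightarrow> 'e form" where
  "Sop J \<phi> = fsc (- \<i> / 2) (\<Sum>i\<in>GI. cliff (Jc J (gw i)) (cliff (gd i) \<phi>))"

text \<open>The fibres of the grading described as eigenspaces, which are closed under far more
  operations than the spans that define them; \<open>Ubun_eq\<close> identifies the two
  descriptions.\<close>

definition EE :: "('e::euclidean_space gtan \<Rightarrow> 'e gtan) \<Rightarrow> int \<Rightarrow> 'e form set" where
  "EE J k = {\<phi>. alt_form \<phi> \<and> Sop J \<phi> = fsc (of_int k) \<phi>}"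

lemma Sop_linear:
  "Sop J (\<phi> + \<psi>) = Sop J \<phi> + Sop J \<psi>" "Sop J (fsc a \<phi>) = fsc a (Sop J \<phi>)" "Sop J 0 = 0" "Sop J (- \<phi>) = - Sop J \<phi>"
  "Sop J (\<phi> - \<psi>) = Sop J \<phi> - Sop J \<psi>"
  by (simp_all add: Sop_def cliff_linear sum.distrib sum_subtractf sum_negf fsc_simps mult.commute)

lemma alt_form_Sop: "alt_form \<phi> \<Longrightarrow> alt_form (Sop J \<phi>)"
  unfolding Sop_def by (intro alt_form_simps alt_form_sum alt_form_cliff)

lemma EE_simps:
  "0 \<in> EE J k" "\<phi> \<in> EE J k \<Longrightarrow> \<psi> \<in> EE J k \<Longrightarrow> \<phi> + \<psi> \<in> EE J k" "\<phi> \<in> EE J k \<Longrightarrow> fsc a \<phi> \<in> EE J k"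
  "\<phi> \<in> EE J k \<Longrightarrow> \<psi> \<in> EE J k \<Longrightarrow> \<phi> - \<psi> \<in> EE J k" "\<phi> \<in> EE J k \<Longrightarrow> - \<phi> \<in> EE J k"
  by (auto simp: EE_def alt_form_simps Sop_linear fsc_simps mult.commute)

lemma EE_sum: "(\<And>i. i \<in> I \<Longrightarrow> f i \<in> EE J k) \<Longrightarrow> sum f I \<in> EE J k"
  by (rule sum_closed[of "\<lambda>x. x \<in> EE J k"]) (auto simp: EE_simps)

lemma EE_alt: "\<phi> \<in> EE J k \<Longrightarrow> alt_form \<phi>"
  by (simp add: EE_def)

text \<open>The span that defines the grading, with \<open>M\<close> and \<open>K\<close> left free:
  in the induction that produces the decomposition, \<open>K\<close> is the space of forms
  annihilated by only a part of a basis of \<open>L\<close>.\<close>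

definition Wg :: "'e::euclidean_space cgtan set \<Rightarrow> 'e form set \<Rightarrow> nat \<Rightarrow> 'e form set" where
  "Wg M K k = {\<psi>. \<exists>gs. (\<forall>g\<in>set gs. \<exists>as. length as = k \<and> set as \<subseteq> M \<and> (\<exists>\<phi>\<in>K. g = foldr cliff as \<phi>))
      \<and> \<psi> = sum_list gs}"

lemma Wg_zero: "0 \<in> Wg M K k"
  by (auto simp: Wg_def intro: exI[of _ "[]"])

lemma Wg_add: "\<phi> \<in> Wg M K k \<Longrightarrow> \<psi> \<in> Wg M K k \<Longrightarrow> \<phi> + \<psi> \<in> Wg M K k"
proof -
  assume "\<phi> \<in> Wg M K k" "\<psi> \<in> Wg M K k"
  then obtain gs hs where "\<forall>g\<in>set gs \<union> set hs. \<exists>as. length as = k \<and> set as \<subseteq> M \<and> (\<exists>\<phi>\<in>K. g = foldr cliff as \<phi>)"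
    "\<phi> = sum_list gs" "\<psi> = sum_list hs"
    unfolding Wg_def by blast
  then show ?thesis unfolding Wg_def by (auto intro!: exI[of _ "gs @ hs"])
qed

lemma Wg_generator: "set as \<subseteq> M \<Longrightarrow> \<phi> \<in> K \<Longrightarrow> foldr cliff as \<phi> \<in> Wg M K (length as)"
  unfolding Wg_def by (rule CollectI, rule exI[of _ "[foldr cliff as \<phi>]"]) auto

lemma Wg_closed:
  assumes "\<phi> \<in> Wg M K k" and P: "P 0" "\<And>x y. P x \<Longrightarrow> P y \<Longrightarrow> P (x + y)"
    and gen: "\<And>as \<psi>. length as = k \<Longrightarrow> set as \<subseteq> M \<Longrightarrow> \<psi> \<in> K \<Longrightarrow> P (foldr cliff as \<psi>)"
  shows "P \<phi>"
proof -
  obtain gs where gs: "\<forall>g\<in>set gs. \<exists>as. length as = k \<and> set as \<subseteq> M \<and> (\<exists>\<phi>\<in>K. g = foldr cliff as \<phi>)" "\<phi> = sum_list gs"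
    using assms(1) unfolding Wg_def mem_Collect_eq by (elim exE conjE) (rule that)
  have "\<forall>g\<in>set gs. P g" using gs(1) gen by metis
  then have "P (sum_list gs)" by (induction gs) (simp_all add: P)
  then show ?thesis by (simp add: gs)
qed

lemma Lbun_eq: "Lbun J p = LL (J p)"
  by (simp add: Lbun_def LL_def Jc_def)

lemma Kbun_eq: "Kbun J p = KK (J p)"
  by (simp add: Kbun_def KK_def Lbun_eq zero_fun_def)

lemma wedge_conjL_K_eq: "wedge_conjL_K J p k = Wg (cconj ` LL (J p)) (KK (J p)) k"
proof -
  define G where "G = {g. \<exists>as. length as = k \<and> set as \<subseteq> cconj ` LL (J p) \<and> (\<exists>\<phi>\<in>KK (J p). g = foldr cliff as \<phi>)}"
  have "wedge_conjL_K J p k = {\<psi>. \<exists>(N::nat) f. (\<forall>i<N. f i \<in> G) \<and> \<psi> = (\<Sum>i<N. f i)}"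
    by (auto simp: wedge_conjL_K_def Lbun_eq Kbun_eq G_def fun_eq_iff sum_fun_apply)
  also have "\<dots> = {\<psi>. \<exists>gs. set gs \<subseteq> G \<and> \<psi> = sum_list gs}"
  proof (intro equalityI subsetI)
    fix \<psi> assume "\<psi> \<in> {\<psi>. \<exists>(N::nat) f. (\<forall>i<N. f i \<in> G) \<and> \<psi> = (\<Sum>i<N. f i)}"
    then obtain N f where "\<forall>i<N. f i \<in> G" "\<psi> = (\<Sum>i<(N::nat). f i)" by blast
    then show "\<psi> \<in> {\<psi>. \<exists>gs. set gs \<subseteq> G \<and> \<psi> = sum_list gs}"
      by (intro CollectI exI[of _ "map f [0..<N]"]) (auto simp: interv_sum_list_conv_sum_set_nat atLeast0LessThan)
  next
    fix \<psi> assume "\<psi> \<in> {\<psi>. \<exists>gs. set gs \<subseteq> G \<and> \<psi> = sum_list gs}"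
    then obtain gs where "set gs \<subseteq> G" "\<psi> = sum_list gs" by blast
    then show "\<psi> \<in> {\<psi>. \<exists>(N::nat) f. (\<forall>i<N. f i \<in> G) \<and> \<psi> = (\<Sum>i<N. f i)}"
      by (intro CollectI exI[of _ "length gs"] exI[of _ "nth gs"]) (auto simp: sum_list_sum_nth atLeast0LessThan)
  qed
  also have "\<dots> = Wg (cconj ` LL (J p)) (KK (J p)) k"
    by (auto simp: Wg_def G_def subset_iff)
  finally show ?thesis .
qed

section \<open>Projections as interpolation polynomials in the spin action\<close>

definition gstep :: "('e::euclidean_space gtan \<Rightarrow> 'e gtan) \<Rightarrow> int \<Rightarrow> int \<Rightarrow> 'e form \<Rightarrow> 'e form" where
  "gstep J k j \<psi> = fsc (1 / of_int (k - j)) (Sop J \<psi> - fsc (of_int j) \<psi>)"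

text \<open>The Lagrange polynomial in \<open>Sop J\<close> with value 1 at \<open>k\<close> and 0
  at the other integers between \<open>-n\<close> and \<open>n\<close>. The value 0 for
  \<open>k\<close> outside of this range agrees with the convention for the grading.\<close>

definition gproj :: "nat \<Rightarrow> ('e::euclidean_space gtan \<Rightarrow> 'e gtan) \<Rightarrow> int \<Rightarrow> 'e form \<Rightarrow> 'e form" where
  "gproj n J k \<phi> = (if \<bar>k\<bar> \<le> int n then foldr (gstep J k) (filter (\<lambda>j. j \<noteq> k) [- int n..int n]) \<phi> else 0)"

lemma foldr_additive:
  fixes g :: "'i \<Rightarrow> 'a::plus \<Rightarrow> 'a"
  assumes "\<And>j x y. g j (x + y) = g j x + g j y"
  shows "foldr g js (x + y) = foldr g js x + foldr g js y"
  by (induction js) (simp_all add: assms)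

lemma foldr_closed:
  assumes "\<And>j x. P x \<Longrightarrow> P (g j x)" "P x"
  shows "P (foldr g js x)"
  by (induction js) (simp_all add: assms)

lemma gproj_add: "gproj n J k (\<phi> + \<psi>) = gproj n J k \<phi> + gproj n J k \<psi>"
  using foldr_additive[of "gstep J k" _ \<phi> \<psi>]
  by (simp add: gproj_def gstep_def Sop_linear fsc_simps)

lemma gproj_zero: "gproj n J k 0 = 0"
  using gproj_add[of n J k 0 0] by simp

lemma gproj_sum: "gproj n J k (sum f I) = (\<Sum>i\<in>I. gproj n J k (f i))"
  by (rule additive_sum[of "gproj n J k"]) (simp_all add: gproj_zero gproj_add)

lemma gstep_EE:
  assumes "\<phi> \<in> EE J l"
  shows "gstep J k j (fsc a \<phi>) = fsc ((of_int l - of_int j) / (of_int k - of_int j) * a) \<phi>"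
proof -
  have "Sop J \<phi> = fsc (of_int l) \<phi>" using assms by (simp add: EE_def)
  then show ?thesis by (simp add: gstep_def Sop_linear fun_eq_iff diff_divide_distrib algebra_simps)
qed

lemma foldr_gstep_EE:
  assumes "\<phi> \<in> EE J l"
  shows "foldr (gstep J k) js \<phi> = fsc (\<Prod>j\<leftarrow>js. (of_int l - of_int j) / (of_int k - of_int j)) \<phi>"
proof -
  define P where "P js \<longleftrightarrow> foldr (gstep J k) js \<phi> = fsc (\<Prod>j\<leftarrow>js. (of_int l - of_int j) / (of_int k - of_int j)) \<phi>" for js
  have "P js"
  proof (induction js)
    case (Cons j js)
    then show ?case unfolding P_def by (simp add: gstep_EE[OF assms])
  qed (simp add: P_def fsc_simps)
  then show ?thesis by (simp add: P_def)
qed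

lemma gproj_EE:
  assumes "\<phi> \<in> EE J l" "\<bar>l\<bar> \<le> int n"
  shows "gproj n J k \<phi> = (if l = k then \<phi> else 0)"
proof (cases "\<bar>k\<bar> \<le> int n")
  case True
  show ?thesis
  proof (cases "l = k")
    case True
    have "(\<Prod>j\<leftarrow>filter (\<lambda>j. j \<noteq> k) js. (of_int k - of_int j) / (of_int k - of_int j)) = (1::complex)" for js
      by (induction js) auto
    then show ?thesis using True foldr_gstep_EE[OF assms(1)] assms(2) by (simp add: gproj_def fsc_simps)
  next
    case False
    then have "l \<in> set (filter (\<lambda>j. j \<noteq> k) [- int n..int n])" using assms by auto
    then have "(\<Prod>j\<leftarrow>filter (\<lambda>j. j \<noteq> k) [- int n..int n]. (of_int l - of_int j) / (of_int k - of_int j)) = (0::complex)"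
      by (auto simp: prod_list_zero_iff)
    then show ?thesis using False True foldr_gstep_EE[OF assms(1)] by (simp add: gproj_def fsc_simps)
  qed
qed (use assms in \<open>auto simp: gproj_def\<close>)

section \<open>The grading at a point\<close>

locale gcs_point =
  fixes J :: "'e::euclidean_space gtan \<Rightarrow> 'e gtan"
  assumes J_linear: "linear J" and J_J: "\<And>w. J (J w) = - w"
    and J_orth: "\<And>w z. ginner (J w) (J z) = ginner w z"
begin

lemma Jc_simps:
  "Jc J (z + w) = Jc J z + Jc J w" "Jc J (csc a z) = csc a (Jc J z)" "Jc J (Jc J z) = - z" "Jc J 0 = 0"
  "Jc J (- z) = - Jc J z" "Jc J (z - w) = Jc J z - Jc J w"
  by (auto simp: Jc_def cscale_def prod_eq_iff J_J linear_add[OF J_linear] linear_cmul[OF J_linear]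
      linear_diff[OF J_linear] linear_0[OF J_linear] linear_neg[OF J_linear])

lemma Jc_sum: "Jc J (sum f I) = (\<Sum>i\<in>I. Jc J (f i))"
  by (rule additive_sum[of "Jc J"]) (simp_all add: Jc_simps)

lemma ginner_J: "ginner (J w) z = - ginner w (J z)"
  using J_orth[of w "J z"] by (simp add: J_J ginner_simps)

lemma cinner_Jc: "cinner (Jc J z) w = - cinner z (Jc J w)"
  by (simp add: cinner_def Jc_def ginner_J complex_eq_iff)

lemma clin_Jc: "clin f \<Longrightarrow> clin (\<lambda>z. f (Jc J z))"
  by (rule clinI) (simp_all add: Jc_simps clin_add clin_csc)

text \<open>Passing to the opposite structure exchanges \<open>L\<close> with its conjugate and
  weight \<open>k\<close> with weight \<open>-k\<close>. Facts about the conjugate of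
  \<open>L\<close> are obtained below as facts about \<open>L\<close> for this structure.\<close>

lemma gcs_point_uminus: "gcs_point (\<lambda>w. - J w)"
proof (rule gcs_point.intro)
  show "linear (\<lambda>w. - J w)" by (rule linear_compose_neg[OF J_linear])
qed (simp_all add: J_J J_orth ginner_simps linear_neg[OF J_linear])

lemma LL_iff: "z \<in> LL J \<longleftrightarrow> Jc J z = csc \<i> z"
  by (simp add: LL_def)

lemma LL_uminus_iff: "z \<in> LL (\<lambda>w. - J w) \<longleftrightarrow> Jc J z = csc (- \<i>) z"
proof -
  have "Jc (\<lambda>w. - J w) z = - Jc J z" by (simp add: Jc_def)
  then show ?thesis by (simp add: LL_def csc_simps minus_equation_iff[of "Jc J z"] eq_commute[of "Jc J z"])
qed

lemma cconj_LL: "cconj ` LL J = LL (\<lambda>w. - J w)"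
proof -
  have "z \<in> LL J \<longleftrightarrow> cconj z \<in> LL (\<lambda>w. - J w)" for z
    by (auto simp: LL_def Jc_def cconj_def cscale_def prod_eq_iff linear_neg[OF J_linear])
  moreover have "cconj (cconj z) = z" for z :: "'e cgtan" by (simp add: cconj_def)
  ultimately show ?thesis by (metis (no_types, lifting) equalityI image_iff image_subsetI subsetI)
qed

lemma LL_simps:
  "z \<in> LL J \<Longrightarrow> w \<in> LL J \<Longrightarrow> z + w \<in> LL J" "z \<in> LL J \<Longrightarrow> csc a z \<in> LL J" "0 \<in> LL J"
  by (auto simp: LL_iff Jc_simps csc_simps mult.commute)

lemma LL_sum: "(\<And>i. i \<in> I \<Longrightarrow> f i \<in> LL J) \<Longrightarrow> sum f I \<in> LL J"
  by (rule sum_closed[of "\<lambda>x. x \<in> LL J"]) (auto simp: LL_simps)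

lemma LL_isotropic: "z \<in> LL J \<Longrightarrow> w \<in> LL J \<Longrightarrow> cinner z w = 0"
  using cinner_Jc[of z w] by (simp add: LL_iff cinner_simps)

abbreviation projM :: "'e cgtan \<Rightarrow> 'e cgtan" where
  "projM \<equiv> projL (\<lambda>w. - J w)"

lemma projM_eq: "projM z = csc (1/2) (z + csc \<i> (Jc J z))"
  by (auto simp: projL_def Jc_def cscale_def prod_eq_iff)

lemma projL_LL: "projL J z \<in> LL J"
  by (simp add: LL_iff projL_def Jc_simps csc_simps add.commute)

lemma projM_LL: "projM z \<in> LL (\<lambda>w. - J w)"
  using gcs_point.projL_LL[OF gcs_point_uminus] .

lemma projL_projM: "projL J z + projM z = z"
proof -
  have "projL J z + projM z = csc (1/2) (z + z)"
    by (simp add: projM_eq projL_def flip: csc_simps(1))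
  then show ?thesis by (simp add: cscale_def flip: scaleR_right_distrib)
qed

lemma projL_id: "z \<in> LL J \<Longrightarrow> projL J z = z"
proof -
  assume "z \<in> LL J"
  then have "projL J z = csc (1/2) (z + z)" by (simp add: projL_def LL_iff csc_simps(3,4,8))
  then show ?thesis by (simp add: cscale_def flip: scaleR_right_distrib)
qed

lemma cinner_projL: "cinner (projL J z) w = cinner z (projM w)"
  unfolding projM_eq projL_def[of J] by (simp add: cinner_simps cinner_Jc)

lemma Sop_uminus: "alt_form \<phi> \<Longrightarrow> Sop (\<lambda>w. - J w) \<phi> = - Sop J \<phi>"
proof -
  assume "alt_form \<phi>"
  have "Jc (\<lambda>w. - J w) z = - Jc J z" for z by (simp add: Jc_def)
  then show ?thesis using \<open>alt_form \<phi>\<close> by (simp add: Sop_def cliff_uminus alt_form_cliff sum_negf fsc_simps)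
qed

lemma EE_uminus: "EE (\<lambda>w. - J w) (- k) = EE J k"
  by (auto simp: EE_def Sop_uminus fsc_simps)

text \<open>\<open>Sop J\<close> lifts \<open>J\<close> to the spin representation: its commutator
  with Clifford multiplication by \<open>z\<close> is multiplication by \<open>- \<i>\<close> times
  \<open>J z\<close>. Moving \<open>z\<close> past each of the two factors yields \<open>J z\<close>
  once, and this doubling cancels the \<open>1/2\<close> in \<open>Sop\<close>. On \<open>L\<close>
  the commutator is the identity, so \<open>L\<close> raises the weight by 1.\<close>

lemma Sop_cliff:
  assumes "alt_form \<phi>"
  shows "Sop J (cliff z \<phi>) = cliff z (Sop J \<phi>) - fsc \<i> (cliff (Jc J z) \<phi>)"
proof -
  have *: "cliff (Jc J (gw i)) (cliff (gd i) (cliff z \<phi>))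
     = cliff z (cliff (Jc J (gw i)) (cliff (gd i) \<phi>))
     + (cliff (csc (2 * cinner (gd i) z) (Jc J (gw i))) \<phi> + cliff (csc (2 * cinner z (Jc J (gw i))) (- gd i)) \<phi>)" for i
    using assms
    by (simp add: cliff_swap[OF assms, of "gd i" z] cliff_linear cliff_csc cliff_uminus
        cliff_swap[OF alt_form_cliff[OF assms], of "Jc J (gw i)" z] cinner_commute fsc_simps)
  have 1: "(\<Sum>i\<in>GI. csc (2 * cinner (gd i) z) (Jc J (gw i))) = Jc J z"
    by (subst (2) cgtan_expand[of z]) (simp add: Jc_sum Jc_simps cinner_commute)
  have 2: "(\<Sum>i\<in>GI. csc (2 * cinner z (Jc J (gw i))) (- gd i)) = Jc J z"
    by (subst cgtan_expand'[of "Jc J z"]) (simp add: cinner_Jc csc_simps)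
  define s where "s = (\<Sum>i\<in>GI. cliff (Jc J (gw i)) (cliff (gd i) \<phi>))"
  have "(\<Sum>i\<in>GI. cliff (Jc J (gw i)) (cliff (gd i) (cliff z \<phi>))) = cliff z s + (cliff (Jc J z) \<phi> + cliff (Jc J z) \<phi>)"
    by (simp only: s_def * sum.distrib cliff_sum cliff_sum_left[OF assms, symmetric] 1 2)
  then show ?thesis
    unfolding Sop_def s_def[symmetric] by (simp add: cliff_linear) (simp add: fun_eq_iff algebra_simps)
qed

lemma cliff_LL_EE:
  assumes "z \<in> LL J" "\<phi> \<in> EE J k"
  shows "cliff z \<phi> \<in> EE J (k + 1)"
  using assms by (auto simp: EE_def Sop_cliff LL_iff cliff_csc cliff_linear alt_form_cliff fsc_simps)

lemma cliff_LM_EE: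
  assumes "z \<in> LL (\<lambda>w. - J w)" "\<phi> \<in> EE J k"
  shows "cliff z \<phi> \<in> EE J (k - 1)"
  using assms by (auto simp: EE_def Sop_cliff LL_uminus_iff cliff_csc cliff_uminus cliff_linear alt_form_cliff fsc_simps)

text \<open>A trace, which vanishes because \<open>J\<close> is antisymmetric for the inner
  product.\<close>

lemma sum_cinner_Jc: "(\<Sum>i\<in>GI. cinner (Jc J (gw i)) (gd i)) = 0"
proof -
  have "(\<Sum>i\<in>GI. cinner (Jc J (gw i)) (gd i)) = (\<Sum>i\<in>GI. - cinner (Jc J (gd i)) (gw i))"
    by (simp add: cinner_Jc cinner_commute[of "gw _"])
  also have "\<dots> = - (\<Sum>i\<in>GI. cinner (Jc J (gw i)) (gd i))"
    using sum_GI_flip[of "\<lambda>x y. cinner (Jc J x) y"] by (simp add: sum_negf)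
  finally show ?thesis by simp
qed

text \<open>This fixes the zero point of the grading. Only the part of \<open>gd i\<close> in the
  conjugate of \<open>L\<close> acts on \<open>\<phi>\<close>; once it is moved to the left, what
  remains is the trace of the projection composed with \<open>J\<close>.\<close>

lemma Sop_KK:
  assumes "\<phi> \<in> KK J"
  shows "Sop J \<phi> = fsc (of_nat DIM('e) / 2) \<phi>"
proof -
  have alt: "alt_form \<phi>" and L: "\<And>z. z \<in> LL J \<Longrightarrow> cliff z \<phi> = 0" using assms by (auto simp: KK_def)
  have gd: "cliff (gd i) \<phi> = cliff (projM (gd i)) \<phi>" for i
    by (subst projL_projM[of "gd i", symmetric]) (simp add: cliff_add alt L projL_LL)
  \<comment> \<open>Taking the adjoint moves the projection to the other slot, where it becomes the
    projection onto \<open>L\<close>; then \<open>J\<close> acts as \<open>\<i>\<close> and the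
    vector annihilates \<open>\<phi>\<close>.\<close>
  have "(\<Sum>i\<in>GI. cliff (projM (gd i)) (cliff (Jc J (gw i)) \<phi>)) vs = 0" for vs
  proof -
    define F where "F x y = cliff y (cliff (Jc J x) \<phi>) vs" for x y
    have "(\<Sum>i\<in>GI. cliff (projM (gd i)) (cliff (Jc J (gw i)) \<phi>) vs) = (\<Sum>i\<in>GI. F (gw i) (projM (gd i)))"
      by (simp add: F_def)
    also have "\<dots> = (\<Sum>i\<in>GI. F (projL J (gw i)) (gd i))"
    proof (rule sum_GI_adjoint[symmetric])
      show "clin (\<lambda>x. F x y)" for y using clin_Jc[OF clin_cliff(2)[OF alt, of y vs]] by (simp add: F_def)
      show "clin (F x)" for x using clin_cliff(1)[OF alt_form_cliff[OF alt]] by (simp add: F_def[abs_def])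
    qed (rule cinner_projL)
    also have "\<dots> = 0"
    proof -
      have "Jc J (projL J x) = csc \<i> (projL J x)" for x using projL_LL by (simp add: LL_iff)
      then show ?thesis by (simp add: F_def cliff_csc alt L projL_LL cliff_linear fsc_simps)
    qed
    finally show ?thesis by (simp add: sum_fun_apply)
  qed
  then have 0: "(\<Sum>i\<in>GI. cliff (projM (gd i)) (cliff (Jc J (gw i)) \<phi>)) = 0" by (simp add: fun_eq_iff)
  have tr: "(\<Sum>i\<in>GI. cinner (Jc J (gw i)) (projM (gd i))) = \<i> / 2 * of_nat DIM('e)"
  proof -
    have "cinner (Jc J (gw i)) (projM (gd i)) = 1/2 * cinner (Jc J (gw i)) (gd i) + \<i> / 2 * cinner (gw i) (gd i :: 'e cgtan)" for i
      by (simp add: projM_eq cinner_simps cinner_Jc[of _ "Jc J _"] Jc_simps algebra_simps)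
    then have "(\<Sum>i\<in>GI. cinner (Jc J (gw i)) (projM (gd i))) = 1/2 * (\<Sum>i\<in>GI. cinner (Jc J (gw i)) (gd i)) + \<i> / 2 * (\<Sum>i\<in>GI. cinner (gw i) (gd i :: 'e cgtan))"
      by (simp add: sum.distrib sum_distrib_left sum_divide_distrib)
    then show ?thesis by (simp add: sum_cinner_Jc sum_cinner_gw_gd)
  qed
  have "(\<Sum>i\<in>GI. cliff (Jc J (gw i)) (cliff (gd i) \<phi>)) =
      (\<Sum>i\<in>GI. fsc (2 * cinner (Jc J (gw i)) (projM (gd i))) \<phi>) - (\<Sum>i\<in>GI. cliff (projM (gd i)) (cliff (Jc J (gw i)) \<phi>))"
    by (simp only: gd cliff_swap[OF alt, of "Jc J _"] sum_subtractf)
  also have "\<dots> = fsc (2 * (\<Sum>i\<in>GI. cinner (Jc J (gw i)) (projM (gd i)))) \<phi>"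
    by (simp add: 0 fun_eq_iff sum_fun_apply sum_distrib_left sum_distrib_right)
  finally show ?thesis unfolding tr by (simp add: Sop_def fsc_simps)
qed

section \<open>Dual bases of \<open>L\<close> and its conjugate\<close>

lemma LL_span: "LL J \<subseteq> cgt.span (projL J ` gw ` GI)"
proof
  fix z assume "z \<in> LL J"
  then have "z = (\<Sum>i\<in>GI. csc (2 * cinner z (gd i)) (projL J (gw i)))"
    by (subst projL_id[symmetric], assumption, subst cgtan_expand)
       (simp add: projL_def Jc_sum Jc_simps csc_simps csc_sum sum_subtractf mult.commute)
  then show "z \<in> cgt.span (projL J ` gw ` GI)"
    by (metis (no_types, lifting) cgt.span_base cgt.span_scale cgt.span_sum image_eqI)
qed

text \<open>The pairing \<open>1/2\<close> is chosen so that \<open>b\<close> and \<open>a b\<close>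
  have anticommutator 1 in the Clifford algebra.\<close>

lemma dual_basis:
  "\<exists>B a. finite B \<and> B \<subseteq> LL J \<and> (\<forall>b\<in>B. a b \<in> LL (\<lambda>w. - J w)) \<and> card B = DIM('e) \<and>
    (\<forall>b\<in>B. \<forall>b'\<in>B. cinner b (a b') = (if b = b' then 1/2 else 0)) \<and>
    (\<forall>z\<in>LL J. z = (\<Sum>b\<in>B. csc (2 * cinner z (a b)) b))"
proof -
  obtain B where B: "B \<subseteq> projL J ` gw ` GI" "cgt.independent B" "projL J ` gw ` GI \<subseteq> cgt.span B"
    by (rule cgt.maximal_independent_subset)
  have fin: "finite B" using finite_subset[OF B(1)] by simp
  have BL: "B \<subseteq> LL J"
    by (rule subset_trans[OF B(1)]) (auto simp only: projL_LL image_iff)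
  have span: "z \<in> cgt.span B" if "z \<in> LL J" for z
    using subsetD[OF cgt.span_minimal[OF B(3) cgt.subspace_span] subsetD[OF LL_span that]] .
  define r where "r = cgt.representation B"
  \<comment> \<open>The vector in the conjugate of \<open>L\<close> that represents half of the
    coordinate functional of \<open>b\<close> on \<open>L\<close>.\<close>
  define a where "a b = (\<Sum>i\<in>GI. csc (r (projL J (gw i)) b) (projM (gd i)))" for b
  have a: "a b \<in> LL (\<lambda>w. - J w)" for b
    unfolding a_def by (intro gcs_point.LL_sum[OF gcs_point_uminus] gcs_point.LL_simps(2)[OF gcs_point_uminus] projM_LL)
  have sum_r: "(\<Sum>b\<in>B. csc (r z b) b) = z" if "z \<in> LL J" for z
    unfolding r_def using cgt.sum_representation_eq[OF B(2) span[OF that] fin] by simp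
  have ca: "2 * cinner z (a b) = r z b" if "z \<in> LL J" for z b
  proof -
    have "r z b = r (\<Sum>i\<in>GI. csc (2 * cinner z (gd i)) (projL J (gw i))) b"
      by (subst projL_id[OF that, symmetric], subst cgtan_expand)
       (simp add: projL_def Jc_sum Jc_simps csc_simps csc_sum sum_subtractf mult.commute)
    also have "\<dots> = (\<Sum>i\<in>GI. r (csc (2 * cinner z (gd i)) (projL J (gw i))) b)"
      unfolding r_def by (subst cgt.representation_sum[OF B(2)]) (auto intro!: span LL_simps projL_LL)
    also have "\<dots> = (\<Sum>i\<in>GI. 2 * cinner z (gd i) * r (projL J (gw i)) b)"
      unfolding r_def by (subst cgt.representation_scale[OF B(2)]) (auto intro!: span projL_LL)
    also have "\<dots> = 2 * cinner z (a b)"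
    proof -
      have "cinner z (projM y) = cinner z y" for y using cinner_projL[of z y] projL_id[OF that] by simp
      then show ?thesis by (simp add: a_def cinner_sum cinner_simps sum_distrib_left algebra_simps)
    qed
    finally show ?thesis by simp
  qed
  have dual: "cinner b (a b') = (if b = b' then 1/2 else 0)" if "b \<in> B" "b' \<in> B" for b b'
    using ca[OF subsetD[OF BL that(1)], of b'] cgt.representation_basis[OF B(2) that(1)] by (auto simp: r_def mult.commute)
  have expand: "z = (\<Sum>b\<in>B. csc (2 * cinner z (a b)) b)" if "z \<in> LL J" for z
    using sum_r[OF that] ca[OF that] by simp
  \<comment> \<open>The cardinality of the basis is the trace of the projection onto
    \<open>L\<close>. Written in the standard frame, this is half the trace of the identity minus a
    multiple of the trace of \<open>J\<close>.\<close>
  have "of_nat (card B) = (\<Sum>b\<in>B. 2 * cinner b (a b))"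
    using dual by simp
  also have "\<dots> = 2 * (\<Sum>i\<in>GI. \<Sum>b\<in>B. r (projL J (gw i)) b * cinner b (projM (gd i)))"
    by (subst sum.swap) (simp add: a_def cinner_sum cinner_simps sum_distrib_left)
  also have "\<dots> = 2 * (\<Sum>i\<in>GI. cinner (projL J (gw i)) (projM (gd i)))"
  proof -
    have "(\<Sum>b\<in>B. r (projL J (gw i)) b * cinner b (projM (gd i))) = cinner (projL J (gw i)) (projM (gd i))" for i
      by (subst (2) sum_r[OF projL_LL, symmetric]) (simp add: cinner_sum cinner_simps)
    then show ?thesis by simp
  qed
  also have "\<dots> = 2 * (\<Sum>i\<in>GI. cinner (projL J (gw i)) (gd i))"
    using cinner_projL[of "projL J _"] projL_id[OF projL_LL] by simp
  also have "\<dots> = (\<Sum>i\<in>GI. cinner (gw i) (gd i :: 'e cgtan)) - \<i> * (\<Sum>i\<in>GI. cinner (Jc J (gw i)) (gd i))"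
  proof -
    have "2 * cinner (projL J z) w = cinner z w - \<i> * cinner (Jc J z) w" for z w
      by (simp add: projL_def cinner_simps)
    then show ?thesis by (simp only: sum_distrib_left sum_subtractf)
  qed
  also have "\<dots> = of_nat DIM('e)" by (simp add: sum_cinner_Jc sum_cinner_gw_gd)
  finally have "card B = DIM('e)" using of_nat_eq_iff by blast
  then show ?thesis using fin BL a dual expand by (intro exI[of _ B] exI[of _ a]) simp
qed

lemma foldr_cliff_add: "foldr cliff as (\<phi> + \<psi>) = foldr cliff as \<phi> + foldr cliff as \<psi>"
  by (rule foldr_additive) (rule cliff_linear)

lemma cliff_cliff_zero:
  assumes "alt_form \<phi>" "cinner z w = 0" "cliff w \<phi> = 0"
  shows "cliff w (cliff z \<phi>) = 0"
  using cliff_swap[OF assms(1), of w z] assms by (simp add: cliff_linear fsc_simps cinner_commute)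

lemma cliff_cliff_self: "alt_form \<phi> \<Longrightarrow> cinner z z = 0 \<Longrightarrow> cliff z (cliff z \<phi>) = 0"
proof -
  assume "alt_form \<phi>" "cinner z z = 0"
  then have "cliff z (cliff z \<phi>) + cliff z (cliff z \<phi>) = 0" using cliff_anticommute[of \<phi> z z] by (simp add: fsc_simps)
  then have "2 * cliff z (cliff z \<phi>) vs = 0" for vs unfolding mult_2 by (metis plus_fun_apply zero_fun_apply)
  then show ?thesis by (simp add: fun_eq_iff)
qed

text \<open>The identity \<open>1 = b a + a b\<close> in the Clifford algebra, for a dual pair \<open>b\<close>, \<open>a\<close>, splits off
  one element of the basis \<open>B\<close> of \<open>L\<close> at a time.\<close>

lemma Wg_insert:
  assumes "\<psi> \<in> Wg M {\<phi>. alt_form \<phi> \<and> (\<forall>z\<in>F. cliff z \<phi> = 0)} j"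
    and "b \<in> LL J" "F \<subseteq> LL J" "a \<in> M" "cinner b a = 1/2" "\<And>z. z \<in> F \<Longrightarrow> cinner z a = 0"
  shows "\<exists>g h. \<psi> = g + h \<and> g \<in> Wg M {\<phi>. alt_form \<phi> \<and> (\<forall>z\<in>insert b F. cliff z \<phi> = 0)} j
     \<and> h \<in> Wg M {\<phi>. alt_form \<phi> \<and> (\<forall>z\<in>insert b F. cliff z \<phi> = 0)} (Suc j)"
proof -
  let ?K = "{\<phi>. alt_form \<phi> \<and> (\<forall>z\<in>insert b F. cliff z \<phi> = 0)}"
  define P where "P \<psi> \<longleftrightarrow> (\<exists>g h. \<psi> = g + h \<and> g \<in> Wg M ?K j \<and> h \<in> Wg M ?K (Suc j))" for \<psi>
  have P0: "P 0" unfolding P_def by (intro exI[of _ 0]) (simp add: Wg_zero)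
  have Padd: "P (x + y)" if xy: "P x" "P y" for x y
  proof -
    obtain g h where "x = g + h" "g \<in> Wg M ?K j" "h \<in> Wg M ?K (Suc j)"
      using xy(1) unfolding P_def by (elim exE conjE) (rule that)
    moreover obtain g' h' where "y = g' + h'" "g' \<in> Wg M ?K j" "h' \<in> Wg M ?K (Suc j)"
      using xy(2) unfolding P_def by (elim exE conjE) (rule that)
    ultimately    show ?thesis unfolding P_def
      by (intro exI[of _ "g + g'"] exI[of _ "h + h'"]) (simp only: Wg_add ac_simps simp_thms)
  qed
  have iso: "cinner z w = 0" if "z \<in> insert b F" "w \<in> insert b F" for z w
    using that assms LL_isotropic by blast
  have gen: "P (foldr cliff as \<phi>)" if as: "length as = j" "set as \<subseteq> M" and alt: "alt_form \<phi>" and F: "\<forall>z\<in>F. cliff z \<phi> = 0" for as \<phi>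
  proof -
    have "\<phi> = cliff b (cliff a \<phi>) + cliff a (cliff b \<phi>)"
      using cliff_anticommute[OF alt, of b a] assms by (simp add: fsc_simps)
    then have "foldr cliff as \<phi> = foldr cliff as (cliff b (cliff a \<phi>)) + foldr cliff (as @ [a]) (cliff b \<phi>)"
      using foldr_cliff_add[of as "cliff b (cliff a \<phi>)" "cliff a (cliff b \<phi>)"] by simp
    moreover have "cliff b (cliff a \<phi>) \<in> ?K"
    proof -
      have "cliff z (cliff b (cliff a \<phi>)) = 0" if z: "z \<in> insert b F" for z
      proof (cases "z = b")
        case True
        then show ?thesis using iso[OF z z] by (simp add: cliff_cliff_self alt_form_cliff alt)
      next
        case False
        then have "z \<in> F" using z by simp
        then have "cliff z (cliff a \<phi>) = 0"
          using F assms(6) by (intro cliff_cliff_zero[OF alt]) (simp_all add: cinner_commute[of a])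
        then show ?thesis using iso[OF _ z, of b] by (intro cliff_cliff_zero[OF alt_form_cliff[OF alt]]) simp_all
      qed
      then show ?thesis using alt alt_form_cliff by blast
    qed
    moreover have "cliff b \<phi> \<in> ?K"
    proof -
      have "cliff z (cliff b \<phi>) = 0" if z: "z \<in> insert b F" for z
      proof (cases "z = b")
        case True
        then show ?thesis using iso[OF z z] by (simp add: cliff_cliff_self alt)
      next
        case False
        then show ?thesis using F z iso[OF _ z, of b] by (intro cliff_cliff_zero[OF alt]) simp_all
      qed
      then show ?thesis using alt alt_form_cliff by blast
    qed
    ultimately show ?thesis unfolding P_def
      using Wg_generator[of as M _ ?K] Wg_generator[of "as @ [a]" M _ ?K] as assms(4)
      by (metis (no_types, lifting) Un_insert_right append_Nil2 insert_subset length_append_singleton list.set(1) list.simps(15) set_append)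
  qed
  have "P \<psi>" by (rule Wg_closed[OF assms(1) P0 Padd]) (use gen in auto)
  then show ?thesis by (simp add: P_def)
qed

lemma Wg_KK_EE:
  assumes "DIM('e) = 2 * n" "\<phi> \<in> Wg (LL (\<lambda>w. - J w)) (KK J) k"
  shows "\<phi> \<in> EE J (int n - int k)"
proof -
  have gen: "foldr cliff as \<psi> \<in> EE J (int n - int (length as))" if "\<psi> \<in> KK J" "set as \<subseteq> LL (\<lambda>w. - J w)" for as \<psi>
    using that
  proof (induction as)
    case Nil
    then show ?case using Sop_KK[OF Nil(1)] assms(1) by (simp add: EE_def KK_def)
  next
    case (Cons a as)
    then have "cliff a (foldr cliff as \<psi>) \<in> EE J (int n - int (length as) - 1)" by (intro cliff_LM_EE) auto
    then show ?case by (simp add: algebra_simps)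
  qed
  show ?thesis by (rule Wg_closed[OF assms(2), of "\<lambda>x. x \<in> EE J (int n - int k)"]) (use gen in \<open>auto simp: EE_simps\<close>)
qed

text \<open>Induction over the subsets \<open>F\<close> of a basis of \<open>L\<close>: a form is a
  sum of products of at most \<open>card F\<close> elements of the conjugate of \<open>L\<close>,
  acting on forms annihilated by \<open>F\<close>. Nothing is asked for \<open>F\<close> empty, and
  for the whole basis the forms lie in \<open>KK J\<close>.\<close>

lemma Wg_decomposition:
  assumes "DIM('e) = 2 * n" "alt_form \<phi>"
  shows "\<exists>f. (\<forall>j. f j \<in> Wg (LL (\<lambda>w. - J w)) (KK J) j) \<and> \<phi> = (\<Sum>j\<le>2*n. f j)"
proof -
  obtain B a where B: "finite B" "B \<subseteq> LL J" "\<forall>b\<in>B. a b \<in> LL (\<lambda>w. - J w)" "card B = DIM('e)"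
    "\<forall>b\<in>B. \<forall>b'\<in>B. cinner b (a b') = (if b = b' then 1/2 else 0)"
    "\<forall>z\<in>LL J. z = (\<Sum>b\<in>B. csc (2 * cinner z (a b)) b)"
    using dual_basis by (elim exE conjE) (rule that)
  let ?M = "LL (\<lambda>w. - J w)"
  let ?W = "\<lambda>F. Wg ?M {\<phi>. alt_form \<phi> \<and> (\<forall>z\<in>F. cliff z \<phi> = 0)}"
  define Q where "Q F \<longleftrightarrow> (\<exists>f. (\<forall>j. f j \<in> ?W F j) \<and> \<phi> = (\<Sum>j\<le>card F. f j))" for F
  have "Q F" if "F \<subseteq> B" for F
    using finite_subset[OF that B(1)] that
  proof (induction F)
    case empty
    have "foldr cliff [] \<phi> \<in> ?W {} (length ([]::'e cgtan list))" using assms by (intro Wg_generator) auto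
    then show ?case unfolding Q_def using Wg_zero
      by (intro exI[of _ "\<lambda>j. if j = 0 then \<phi> else 0"]) auto
  next
    case (insert b F)
    then obtain f where f: "\<forall>j. f j \<in> ?W F j" "\<phi> = (\<Sum>j\<le>card F. f j)" unfolding Q_def by auto
    have "\<forall>j. \<exists>g h. f j = g + h \<and> g \<in> ?W (insert b F) j \<and> h \<in> ?W (insert b F) (Suc j)"
    proof
      fix j
      show "\<exists>g h. f j = g + h \<and> g \<in> ?W (insert b F) j \<and> h \<in> ?W (insert b F) (Suc j)"
        by (rule Wg_insert[where a="a b"]) (use f(1) insert.prems insert.hyps B in auto)
    qed
    from choice[OF this] obtain g where
      "\<forall>j. \<exists>h. f j = g j + h \<and> g j \<in> ?W (insert b F) j \<and> h \<in> ?W (insert b F) (Suc j)"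
      by (elim exE) (rule that)
    from choice[OF this] obtain h where
      gh0: "\<forall>j. f j = g j + h j \<and> g j \<in> ?W (insert b F) j \<and> h j \<in> ?W (insert b F) (Suc j)"
      by (elim exE) (rule that)
    note gh = gh0[THEN spec, THEN conjunct1] gh0[THEN spec, THEN conjunct2, THEN conjunct1]
      gh0[THEN spec, THEN conjunct2, THEN conjunct2]
    \<comment> \<open>The new term of index \<open>j\<close> consists of the part of
      \<open>f j\<close> that keeps its factors and the part of \<open>f (j - 1)\<close> that gains
      the factor \<open>a b\<close>. The family \<open>g\<close> is cut off at
      \<open>card F\<close>, where the old sum ended.\<close>
    define f' where "f' j = (if j \<le> card F then g j else 0) + (case j of 0 \<Rightarrow> 0 | Suc i \<Rightarrow> h i)" for j
    have "f' j \<in> ?W (insert b F) j" for j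
      unfolding f'_def using gh by (intro Wg_add) (auto simp: Wg_zero split: nat.splits)
    moreover have "\<phi> = (\<Sum>j\<le>card (insert b F). f' j)"
    proof -
      have "(\<Sum>j\<le>Suc (card F). case j of 0 \<Rightarrow> 0 | Suc i \<Rightarrow> h i) = (\<Sum>j\<le>card F. h j)"
        by (subst sum.atMost_Suc_shift) simp
      moreover have "(\<Sum>j\<le>Suc (card F). if j \<le> card F then g j else 0) = (\<Sum>j\<le>card F. g j)"
        by (simp add: sum.atMost_Suc)
      moreover have "card (insert b F) = Suc (card F)" using insert.hyps by simp
      ultimately show ?thesis by (simp only: f'_def f(2) gh(1) sum.distrib)
    qed
    ultimately show ?case unfolding Q_def by blast
  qed
  then have "Q B" by blast
  moreover have "{\<phi>. alt_form \<phi> \<and> (\<forall>z\<in>B. cliff z \<phi> = 0)} = KK J"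
  proof -
    have "cliff z \<psi> = 0" if "alt_form \<psi>" "\<forall>z\<in>B. cliff z \<psi> = 0" "z \<in> LL J" for \<psi> z
      by (subst bspec[OF B(6) that(3)], use that in \<open>simp add: cliff_sum_left cliff_csc fsc_simps\<close>)
    then show ?thesis using B(2) by (auto simp: KK_def)
  qed
  ultimately show ?thesis unfolding Q_def B(4) assms(1) by simp
qed

end

section \<open>Weight decomposition of forms at a point\<close>

context gcs_point
begin

text \<open>The summand with \<open>j\<close> factors has eigenvalue \<open>n - j\<close>, so the
  interpolation polynomials return the summands. This removes the choice of a basis from the
  decomposition.\<close>

lemma decomposition:
  assumes "DIM('e) = 2 * n" "alt_form \<phi>"
  shows "(\<forall>k. \<bar>k\<bar> \<le> int n \<longrightarrow> gproj n J k \<phi> \<in> Wg (LL (\<lambda>w. - J w)) (KK J) (nat (int n - k)))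
    \<and> \<phi> = (\<Sum>k\<in>{- int n..int n}. gproj n J k \<phi>)"
proof -
  obtain f where f: "\<forall>j. f j \<in> Wg (LL (\<lambda>w. - J w)) (KK J) j" "\<phi> = (\<Sum>j\<le>2*n. f j)"
    using Wg_decomposition[OF assms] by (elim exE conjE) (rule that)
  have E: "f j \<in> EE J (int n - int j)" for j by (rule Wg_KK_EE[OF assms(1) f(1)[THEN spec]])
  have g: "gproj n J k \<phi> = f (nat (int n - k))" if "\<bar>k\<bar> \<le> int n" for k
  proof -
    have "gproj n J k \<phi> = (\<Sum>j\<le>2*n. gproj n J k (f j))" by (subst f(2)) (rule gproj_sum)
    also have "\<dots> = (\<Sum>j\<le>2*n. if j = nat (int n - k) then f j else 0)"
      by (rule sum.cong[OF refl], subst gproj_EE[OF E]) (use that in auto)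
    also have "\<dots> = f (nat (int n - k))" using that by (simp add: sum.delta)
    finally show ?thesis .
  qed
  have "(\<Sum>k\<in>{- int n..int n}. gproj n J k \<phi>) = (\<Sum>j\<le>2*n. f j)"
    by (rule sum.reindex_bij_witness[of _ "\<lambda>j. int n - int j" "\<lambda>k. nat (int n - k)"]) (auto simp: g)
  then show ?thesis using f g by simp
qed

text \<open>Applying \<open>Sop J - k\<close> to the decomposition multiplies the component of
  weight \<open>j\<close> by \<open>j - k\<close>, which is nonzero for all weights that occur;
  hence all components vanish.\<close>

lemma EE_trivial:
  assumes "DIM('e) = 2 * n" "\<phi> \<in> EE J k" "\<not> \<bar>k\<bar> \<le> int n"
  shows "\<phi> = 0"
proof -
  have alt: "alt_form \<phi>" using assms(2) by (rule EE_alt)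
  have *: "gproj n J l \<phi> = 0" if l: "\<bar>l\<bar> \<le> int n" for l
  proof -
    have E: "gproj n J j \<phi> \<in> EE J j" if "\<bar>j\<bar> \<le> int n" for j
      using decomposition[OF assms(1) alt] Wg_KK_EE[OF assms(1), of "gproj n J j \<phi>" "nat (int n - j)"] that
      by (auto simp: abs_le_iff split: if_splits)
    have S: "Sop J (sum f I) = (\<Sum>i\<in>I. Sop J (f i))" for f :: "int \<Rightarrow> 'e form" and I
      by (rule additive_sum[of "Sop J"]) (simp_all add: Sop_linear)
    have "0 = Sop J \<phi> - fsc (of_int k) \<phi>" using assms(2) by (simp add: EE_def)
    also have "\<dots> = (\<Sum>j\<in>{- int n..int n}. Sop J (gproj n J j \<phi>) - fsc (of_int k) (gproj n J j \<phi>))"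
      by (subst (1 2) conjunct2[OF decomposition[OF assms(1) alt]]) (simp add: S fsc_simps sum_subtractf)
    also have "\<dots> = (\<Sum>j\<in>{- int n..int n}. fsc (of_int (j - k)) (gproj n J j \<phi>))"
      by (rule sum.cong[OF refl]) (use E in \<open>auto simp: EE_def fsc_simps abs_le_iff\<close>)
    finally have "0 = gproj n J l (\<Sum>j\<in>{- int n..int n}. fsc (of_int (j - k)) (gproj n J j \<phi>))"
      by (simp add: gproj_zero)
    also have "\<dots> = (\<Sum>j\<in>{- int n..int n}. if j = l then fsc (of_int (j - k)) (gproj n J j \<phi>) else 0)"
      unfolding gproj_sum by (rule sum.cong[OF refl], subst gproj_EE[OF EE_simps(3)[OF E]]) auto
    also have "\<dots> = fsc (of_int (l - k)) (gproj n J l \<phi>)" using l by (auto simp: sum.delta abs_le_iff)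
    finally have "of_int (l - k) * gproj n J l \<phi> vs = 0" for vs by (metis fsc_apply zero_fun_apply)
    then show ?thesis using l assms(3) by (auto simp: fun_eq_iff)
  qed
  show ?thesis by (subst conjunct2[OF decomposition[OF assms(1) alt]]) (simp add: * abs_le_iff)
qed

text \<open>The polynomial need not vanish at an eigenvalue beyond \<open>n\<close>, but there the
  eigenspace is trivial.\<close>

lemma gproj_EE':
  assumes "DIM('e) = 2 * n" "\<phi> \<in> EE J l"
  shows "gproj n J k \<phi> = (if l = k then \<phi> else 0)"
  using EE_trivial[OF assms] gproj_EE[OF assms(2), of n k] by (cases "\<bar>l\<bar> \<le> int n") (auto simp: gproj_zero)

lemma EE_eq_Wg:
  assumes "DIM('e) = 2 * n" "\<bar>k\<bar> \<le> int n"
  shows "EE J k = Wg (LL (\<lambda>w. - J w)) (KK J) (nat (int n - k))"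
proof
  show "EE J k \<subseteq> Wg (LL (\<lambda>w. - J w)) (KK J) (nat (int n - k))"
  proof
    fix \<phi> assume "\<phi> \<in> EE J k"
    then show "\<phi> \<in> Wg (LL (\<lambda>w. - J w)) (KK J) (nat (int n - k))"
      using decomposition[OF assms(1) EE_alt] gproj_EE'[OF assms(1), of \<phi> k k] assms(2) by metis
  qed
  show "Wg (LL (\<lambda>w. - J w)) (KK J) (nat (int n - k)) \<subseteq> EE J k"
    using Wg_KK_EE[OF assms(1), of _ "nat (int n - k)"] assms(2) by (auto simp only: subset_iff nat_0_le) (simp add: abs_le_iff)
qed

lemma gproj_in_EE:
  assumes "DIM('e) = 2 * n" "alt_form \<phi>"
  shows "gproj n J k \<phi> \<in> EE J k"
proof (cases "\<bar>k\<bar> \<le> int n")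
  case True
  then show ?thesis using decomposition[OF assms] EE_eq_Wg[OF assms(1) True] by simp
qed (simp add: gproj_def EE_simps)

text \<open>\<open>L\<close> raises the weight, and there is no weight \<open>n + 1\<close>.\<close>

lemma KK_eq_EE: "DIM('e) = 2 * n \<Longrightarrow> KK J = EE J (int n)"
proof
  assume n: "DIM('e) = 2 * n"
  then show "KK J \<subseteq> EE J (int n)" using Sop_KK by (auto simp: EE_def KK_def)
  have "cliff z \<phi> = 0" if "z \<in> LL J" "\<phi> \<in> EE J (int n)" for z \<phi>
    by (rule EE_trivial[OF n cliff_LL_EE[OF that]]) simp
  then show "EE J (int n) \<subseteq> KK J" by (auto simp: KK_def EE_alt)
qed

text \<open>Existence of a pure spinor. All weight spaces are generated from \<open>KK J\<close>; if
  it were zero, the constant form 1 would have only zero components.\<close>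

lemma KK_nonzero:
  assumes "DIM('e) = 2 * n"
  shows "\<exists>\<phi>\<in>KK J. \<phi> \<noteq> 0"
proof (rule ccontr)
  assume *: "\<not> (\<exists>\<phi>\<in>KK J. \<phi> \<noteq> 0)"
  define one :: "'e form" where "one vs = (if vs = [] then 1 else 0)" for vs
  have "alt_form one"
    unfolding alt_form_def by (simp add: one_def linear_zero)
  have foldr0: "foldr cliff as 0 = (0::'e form)" for as :: "'e cgtan list"
    by (rule foldr_closed[of "\<lambda>x. x = 0"]) (simp_all add: cliff_linear)
  have "\<phi> = 0" if "\<phi> \<in> Wg M (KK J) k" for \<phi> M k
    by (rule Wg_closed[OF that, of "\<lambda>x. x = 0"]) (use * foldr0 in auto)
  then have "gproj n J k one = 0" if "\<bar>k\<bar> \<le> int n" for k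
    using decomposition[OF assms \<open>alt_form one\<close>] that by blast
  then have "one = 0" by (subst conjunct2[OF decomposition[OF assms \<open>alt_form one\<close>]]) (simp add: abs_le_iff)
  then have "one [] = 0" by (simp only: zero_fun_apply)
  then show False by (simp add: one_def)
qed

text \<open>The component of \<open>z\<close> in the conjugate of \<open>L\<close> pairs with any
  \<open>w\<close> as \<open>z\<close> does with the projection of \<open>w\<close> to
  \<open>L\<close>; so it pairs to zero with everything and vanishes.\<close>

lemma LL_maximal:
  assumes "\<And>w. w \<in> LL J \<Longrightarrow> cinner z w = 0"
  shows "z \<in> LL J"
proof -
  have "cinner (projM z) w = 0" for w
    using assms[OF projL_LL, of w] cinner_projL[of w z] by (simp add: cinner_commute)
  then have "projM z = 0" using cgtan_expand[of "projM z"] by (simp add: csc_simps)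
  then show ?thesis using projL_projM[of z] projL_LL[of z] by simp
qed

end

section \<open>Comparison with the given grading and its projections\<close>

lemma Ubun_eq:
  fixes J :: "'m \<Rightarrow> 'e::euclidean_space gtan \<Rightarrow> 'e gtan"
  assumes "gcs_point (J p)" "DIM('e) = 2 * n"
  shows "Ubun n J k p = EE (J p) k"
proof (cases "\<bar>k\<bar> \<le> int n")
  case True
  then show ?thesis
    using gcs_point.EE_eq_Wg[OF assms True] by (simp add: Ubun_def wedge_conjL_K_eq gcs_point.cconj_LL[OF assms(1)])
next
  case False
  then show ?thesis using gcs_point.EE_trivial[OF assms, of _ k] by (auto simp: Ubun_def EE_simps zero_fun_def[symmetric])
qed

text \<open>The polynomial projection extracts the \<open>k\<close>-th term from any decomposition
  along the grading, which proves the uniqueness that the definite description requires.\<close>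

lemma proj_U_eq:
  fixes J :: "'m \<Rightarrow> 'e::euclidean_space gtan \<Rightarrow> 'e gtan"
  assumes J: "gcs_point (J p)" and n: "DIM('e) = 2 * n" and alt: "alt_form \<phi>"
  shows "proj_U n J k p \<phi> = gproj n (J p) k \<phi>"
proof -
  interpret gcs_point "J p" by (rule J)
  have sum: "(\<lambda>vs. \<Sum>j\<in>{- int n..int n}. f j vs) = (\<Sum>j\<in>{- int n..int n}. f j)" for f :: "int \<Rightarrow> 'e form"
    by (auto simp: fun_eq_iff sum_fun_apply)
  show ?thesis
    unfolding proj_U_def sum Ubun_eq[where J=J and p=p, OF J n]
  proof (rule the_equality)
    show "\<exists>f. (\<forall>j. f j \<in> EE (J p) j) \<and> \<phi> = sum f {- int n..int n} \<and> gproj n (J p) k \<phi> = f k"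
      using decomposition[OF n alt] gproj_in_EE[OF n alt] by (intro exI[of _ "\<lambda>k. gproj n (J p) k \<phi>"]) simp
  next
    fix \<psi> assume "\<exists>f. (\<forall>j. f j \<in> EE (J p) j) \<and> \<phi> = sum f {- int n..int n} \<and> \<psi> = f k"
    then obtain f where f: "\<forall>j. f j \<in> EE (J p) j" "\<phi> = sum f {- int n..int n}" "\<psi> = f k"
      by (elim exE conjE) (rule that)
    have "gproj n (J p) k \<phi> = (\<Sum>j\<in>{- int n..int n}. if j = k then f j else 0)"
      unfolding f(2) gproj_sum using gproj_EE'[OF n f(1)[THEN spec]] by (intro sum.cong) auto
    also have "\<dots> = f k" using EE_trivial[OF n f(1)[THEN spec, of k]] by (auto simp: sum.delta)
    finally show "\<psi> = gproj n (J p) k \<phi>" using f(3) by simp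
  qed
qed

section \<open>Trivectors\<close>

text \<open>The relation from which \<open>cliff3\<close> selects its value. Sums of trivectors are
  built up with it before it is known to determine \<open>\<psi>\<close>.\<close>

definition act3 :: "'e::euclidean_space cgtan set \<Rightarrow> 'e trilinear \<Rightarrow> 'e form \<Rightarrow> 'e form \<Rightarrow> bool" where
  "act3 W T \<phi> \<psi> \<longleftrightarrow> (\<exists>ts. set ts \<subseteq> cconj ` W \<times> cconj ` W \<times> cconj ` W \<and>
     (\<forall>e1\<in>W. \<forall>e2\<in>W. \<forall>e3\<in>W. T e1 e2 e3 = (\<Sum>t\<leftarrow>ts. trivector_form t e1 e2 e3)) \<and>
     \<psi> = (\<Sum>(a, b, c)\<leftarrow>ts. cliff a (cliff b (cliff c \<phi>))))"

lemma cliff3_eq_The: "cliff3 W T \<phi> = (THE \<psi>. act3 W T \<phi> \<psi>)"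
proof -
  have "(\<lambda>vs. \<Sum>(a, b, c)\<leftarrow>ts. cliff a (cliff b (cliff c \<phi>)) vs) = (\<Sum>(a, b, c)\<leftarrow>ts. cliff a (cliff b (cliff c \<phi>)))"
    for ts :: "('a cgtan \<times> 'a cgtan \<times> 'a cgtan) list"
    by (rule ext) (simp add: sum_list_fun_apply case_prod_beta')
  then show ?thesis unfolding cliff3_def act3_def by simp
qed

lemma act3_zero: "(\<And>u v w. u \<in> W \<Longrightarrow> v \<in> W \<Longrightarrow> w \<in> W \<Longrightarrow> T u v w = 0) \<Longrightarrow> act3 W T \<phi> 0"
  unfolding act3_def by (rule exI[of _ "[]"]) simp

lemma act3_single:
  "a \<in> cconj ` W \<Longrightarrow> b \<in> cconj ` W \<Longrightarrow> c \<in> cconj ` W \<Longrightarrow> act3 W (trivector_form (a, b, c)) \<phi> (cliff a (cliff b (cliff c \<phi>)))"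
  unfolding act3_def by (rule exI[of _ "[(a, b, c)]"]) simp

lemma act3_add:
  assumes "act3 W T \<phi> \<psi>" "act3 W T' \<phi> \<psi>'"
  shows "act3 W (\<lambda>u v w. T u v w + T' u v w) \<phi> (\<psi> + \<psi>')"
proof -
  obtain ts where ts: "set ts \<subseteq> cconj ` W \<times> cconj ` W \<times> cconj ` W"
     "\<forall>e1\<in>W. \<forall>e2\<in>W. \<forall>e3\<in>W. T e1 e2 e3 = (\<Sum>t\<leftarrow>ts. trivector_form t e1 e2 e3)"
     "\<psi> = (\<Sum>(a, b, c)\<leftarrow>ts. cliff a (cliff b (cliff c \<phi>)))"
    using assms(1) unfolding act3_def by (elim exE conjE) (rule that)
  obtain ts' where ts': "set ts' \<subseteq> cconj ` W \<times> cconj ` W \<times> cconj ` W"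
     "\<forall>e1\<in>W. \<forall>e2\<in>W. \<forall>e3\<in>W. T' e1 e2 e3 = (\<Sum>t\<leftarrow>ts'. trivector_form t e1 e2 e3)"
     "\<psi>' = (\<Sum>(a, b, c)\<leftarrow>ts'. cliff a (cliff b (cliff c \<phi>)))"
    using assms(2) unfolding act3_def by (elim exE conjE) (rule that)
  show ?thesis unfolding act3_def
    by (rule exI[of _ "ts @ ts'"]) (use ts ts' in \<open>simp del: split_paired_All\<close>)
qed

lemma act3_sum:
  assumes "finite I" "\<And>i. i \<in> I \<Longrightarrow> act3 W (T i) \<phi> (\<psi> i)"
  shows "act3 W (\<lambda>u v w. \<Sum>i\<in>I. T i u v w) \<phi> (\<Sum>i\<in>I. \<psi> i)"
proof -
  define P where "P I \<longleftrightarrow> act3 W (\<lambda>u v w. \<Sum>i\<in>I. T i u v w) \<phi> (\<Sum>i\<in>I. \<psi> i)" for I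
  have "P I" using assms
  proof (induction I)
    case empty
    then show ?case by (simp add: P_def act3_zero)
  next
    case (insert i I)
    then have "P I" "act3 W (T i) \<phi> (\<psi> i)" by simp_all
    then show ?case unfolding P_def using act3_add[of W "T i" \<phi> "\<psi> i"] insert.hyps by simp
  qed
  then show ?thesis by (simp add: P_def)
qed

lemma act3_cong:
  assumes "act3 W T \<phi> \<psi>" "\<And>u v w. u \<in> W \<Longrightarrow> v \<in> W \<Longrightarrow> w \<in> W \<Longrightarrow> T' u v w = T u v w" "\<psi>' = \<psi>"
  shows "act3 W T' \<phi> \<psi>'"
  using assms unfolding act3_def by (simp del: split_paired_All split_paired_Ex)

section \<open>Uniqueness and faithfulness of the action of trivectors\<close>

context gcs_point
begin

lemma LM_isotropic: "z \<in> LL (\<lambda>w. - J w) \<Longrightarrow> w \<in> LL (\<lambda>w. - J w) \<Longrightarrow> cinner z w = 0"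
  by (rule gcs_point.LL_isotropic[OF gcs_point_uminus])

lemma projM_id: "z \<in> LL (\<lambda>w. - J w) \<Longrightarrow> projM z = z"
  by (rule gcs_point.projL_id[OF gcs_point_uminus])

lemma projM_sum: "projM (sum f I) = (\<Sum>i\<in>I. projM (f i))" and projM_csc: "projM (csc a z) = csc a (projM z)"
  by (rule additive_sum[of projM]) (simp_all only: projM_eq csc_simps Jc_simps add.right_neutral ac_simps)

lemma cinner_projM: "cinner (projM z) w = cinner z (projL J w)"
  using cinner_projL[of w z] by (simp add: cinner_commute)

lemma LM_expand: "z \<in> LL (\<lambda>w. - J w) \<Longrightarrow> z = (\<Sum>i\<in>GI. csc (2 * cinner z (projL J (gw i))) (projM (gd i)))"
proof -
  assume z: "z \<in> LL (\<lambda>w. - J w)"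
  have "z = projM (\<Sum>i\<in>GI. csc (2 * cinner z (gw i)) (gd i))"
    using projM_id[OF z] cgtan_expand'[of z] by simp
  also have "\<dots> = (\<Sum>i\<in>GI. csc (2 * cinner (projM z) (gw i)) (projM (gd i)))"
    by (simp add: projM_sum projM_csc projM_id[OF z])
  finally show ?thesis by (simp add: cinner_projM)
qed

lemma cliff3_expand:
  assumes "alt_form \<phi>" "x \<in> LL (\<lambda>w. - J w)" "y \<in> LL (\<lambda>w. - J w)" "z \<in> LL (\<lambda>w. - J w)"
  shows "(\<Sum>i\<in>GI. \<Sum>j\<in>GI. \<Sum>k\<in>GI. fsc (cinner x (projL J (gw i)) * cinner y (projL J (gw j)) * cinner z (projL J (gw k)))
     (cliff (projM (gd i)) (cliff (projM (gd j)) (cliff (projM (gd k)) \<phi>)))) = fsc (1/8) (cliff x (cliff y (cliff z \<phi>)))"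
proof -
  have 1: "cliff z \<psi> = (\<Sum>i\<in>GI. fsc (2 * cinner z (projL J (gw i))) (cliff (projM (gd i)) \<psi>))"
    if "alt_form \<psi>" "z \<in> LL (\<lambda>w. - J w)" for z \<psi>
    by (subst LM_expand[OF that(2)]) (simp add: cliff_sum_left that(1) cliff_csc)
  have "cliff x (cliff y (cliff z \<phi>)) =
    (\<Sum>i\<in>GI. \<Sum>j\<in>GI. \<Sum>k\<in>GI. fsc (8 * (cinner x (projL J (gw i)) * cinner y (projL J (gw j)) * cinner z (projL J (gw k))))
     (cliff (projM (gd i)) (cliff (projM (gd j)) (cliff (projM (gd k)) \<phi>))))"
    by (subst 1[OF alt_form_cliff[OF alt_form_cliff[OF assms(1)]] assms(2)], subst 1[OF alt_form_cliff[OF assms(1)] assms(3)],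
        subst 1[OF assms(1,4)]) (simp add: cliff_sum cliff_linear fsc_simps algebra_simps)
  then show ?thesis by (simp add: fsc_simps)
qed

text \<open>An expression for the action in the values of the 3-form alone, which shows that the
  representing trivector does not matter. For \<open>a \<and> b \<and> c\<close> the six terms of
  the determinant contribute equally, each with \<open>1/8\<close> from the expansion of three
  vectors and with the \<open>-4\<close> of \<open>trivector_form\<close>; \<open>- 1 / 3\<close>
  normalizes the product of these to 1.\<close>

definition tact :: "'e trilinear \<Rightarrow> 'e form \<Rightarrow> 'e form" where
  "tact T \<phi> = fsc (- 1 / 3) (\<Sum>i\<in>GI. \<Sum>j\<in>GI. \<Sum>k\<in>GI. fsc (T (projL J (gw i)) (projL J (gw j)) (projL J (gw k)))
     (cliff (projM (gd i)) (cliff (projM (gd j)) (cliff (projM (gd k)) \<phi>))))"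

lemma cliff_LM_swap: "alt_form \<phi> \<Longrightarrow> x \<in> LL (\<lambda>w. - J w) \<Longrightarrow> y \<in> LL (\<lambda>w. - J w) \<Longrightarrow> cliff x (cliff y \<phi>) = - cliff y (cliff x \<phi>)"
  by (simp add: cliff_swap[of \<phi> x y] LM_isotropic fsc_simps)

lemma tact_trivector:
  assumes alt: "alt_form \<phi>" and abc: "a \<in> LL (\<lambda>w. - J w)" "b \<in> LL (\<lambda>w. - J w)" "c \<in> LL (\<lambda>w. - J w)"
  shows "tact (trivector_form (a, b, c)) \<phi> = cliff a (cliff b (cliff c \<phi>))"
proof -
  let ?S = "\<lambda>x y z. (\<Sum>i\<in>GI. \<Sum>j\<in>GI. \<Sum>k\<in>GI. fsc (cinner x (projL J (gw i)) * cinner y (projL J (gw j)) * cinner z (projL J (gw k)))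
     (cliff (projM (gd i)) (cliff (projM (gd j)) (cliff (projM (gd k)) \<phi>))))"
  have "tact (trivector_form (a, b, c)) \<phi> = fsc (4/3) (?S a b c - ?S a c b - ?S b a c + ?S b c a + ?S c a b - ?S c b a)"
    unfolding tact_def trivector_form_def
    by (simp add: fun_eq_iff sum_fun_apply sum_subtractf[symmetric] sum.distrib[symmetric] sum_distrib_left algebra_simps)
  also have "\<dots> = cliff a (cliff b (cliff c \<phi>))"
    unfolding cliff3_expand[OF alt abc(1,2,3)] cliff3_expand[OF alt abc(1,3,2)] cliff3_expand[OF alt abc(2,1,3)]
      cliff3_expand[OF alt abc(2,3,1)] cliff3_expand[OF alt abc(3,1,2)] cliff3_expand[OF alt abc(3,2,1)]
      cliff_LM_swap[OF alt abc(3,2)] cliff_LM_swap[OF alt abc(3,1)] cliff_LM_swap[OF alt abc(2,1)] cliff_linear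
      cliff_LM_swap[OF alt_form_cliff[OF alt] abc(3,1)] cliff_LM_swap[OF alt_form_cliff[OF alt] abc(2,1)]
      cliff_LM_swap[OF alt_form_cliff[OF alt] abc(3,2)]
    by (simp add: cliff_linear cliff_LM_swap[OF alt abc(3,2)] fun_eq_iff)
  finally show ?thesis .
qed

lemma act3_tact:
  assumes alt: "alt_form \<phi>" and "act3 (LL J) T \<phi> \<psi>"
  shows "\<psi> = tact T \<phi>"
proof -
  obtain ts where ts: "set ts \<subseteq> LL (\<lambda>w. - J w) \<times> LL (\<lambda>w. - J w) \<times> LL (\<lambda>w. - J w)"
     "\<forall>e1\<in>LL J. \<forall>e2\<in>LL J. \<forall>e3\<in>LL J. T e1 e2 e3 = (\<Sum>t\<leftarrow>ts. trivector_form t e1 e2 e3)"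
     "\<psi> = (\<Sum>(a, b, c)\<leftarrow>ts. cliff a (cliff b (cliff c \<phi>)))"
    using assms(2) unfolding act3_def cconj_LL by (elim exE conjE) (rule that)
  have add: "tact (\<lambda>u v w. T u v w + T' u v w) \<phi> = tact T \<phi> + tact T' \<phi>" for T T'
    by (simp add: tact_def fun_eq_iff sum_fun_apply sum.distrib[symmetric] sum_distrib_left algebra_simps)
  have zero: "tact (\<lambda>u v w. 0) \<phi> = 0" by (simp add: tact_def fsc_simps)
  define P where "P ts \<longleftrightarrow> (\<Sum>(a, b, c)\<leftarrow>ts. cliff a (cliff b (cliff c \<phi>))) = tact (\<lambda>u v w. \<Sum>t\<leftarrow>ts. trivector_form t u v w) \<phi>" for ts
  have "P ts" using ts(1)
  proof (induction ts)
    case (Cons t ts)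
    obtain a b c where t: "t = (a, b, c)" by (cases t)
    have "tact (trivector_form (a, b, c)) \<phi> = cliff a (cliff b (cliff c \<phi>))"
      using Cons.prems t by (intro tact_trivector[OF alt]) auto
    then show ?case using Cons t add[of "trivector_form (a, b, c)"] by (simp add: P_def)
  qed (simp add: P_def zero)
  moreover have "tact T \<phi> = tact (\<lambda>u v w. \<Sum>t\<leftarrow>ts. trivector_form t u v w) \<phi>"
    using ts(2) projL_LL by (simp add: tact_def del: split_paired_All)
  ultimately show ?thesis using ts(3) by (simp add: P_def)
qed

lemma cliff3_eqI: "alt_form \<phi> \<Longrightarrow> act3 (LL J) T \<phi> \<psi> \<Longrightarrow> cliff3 (LL J) T \<phi> = \<psi>"
  unfolding cliff3_eq_The using act3_tact by (intro the_equality) metis+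

text \<open>The vectors of \<open>L\<close> annihilate \<open>\<phi>\<close>, so moving them to the
  right leaves only the scalars \<open>2 * cinner\<close>: in total 8 times the determinant, which
  is \<open>-2\<close> times the \<open>-4\<close> of \<open>trivector_form\<close>. The values of a
  3-form can thus be read off from its action on one nonzero pure spinor.\<close>

lemma cliff3_KK:
  assumes phi: "\<phi> \<in> KK J" and e: "e1 \<in> LL J" "e2 \<in> LL J" "e3 \<in> LL J"
  shows "cliff e3 (cliff e2 (cliff e1 (cliff a (cliff b (cliff c \<phi>))))) = fsc (- 2 * trivector_form (a, b, c) e1 e2 e3) \<phi>"
proof -
  have alt: "alt_form \<phi>" using phi by (simp add: KK_def)
  have e0: "cliff e1 \<phi> = 0" "cliff e2 \<phi> = 0" "cliff e3 \<phi> = 0" using phi e by (auto simp: KK_def)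
  have 1: "cliff e1 (cliff a (cliff b (cliff c \<phi>))) = fsc (2 * cinner e1 a) (cliff b (cliff c \<phi>))
     - fsc (2 * cinner e1 b) (cliff a (cliff c \<phi>)) + fsc (2 * cinner e1 c) (cliff a (cliff b \<phi>))"
    by (simp add: cliff_swap[of _ e1] alt alt_form_cliff cliff_linear e0)
  have 2: "cliff e2 (cliff x (cliff y \<phi>)) = fsc (2 * cinner e2 x) (cliff y \<phi>) - fsc (2 * cinner e2 y) (cliff x \<phi>)" for x y
    by (simp add: cliff_swap[of _ e2] alt alt_form_cliff cliff_linear e0)
  have 3: "cliff e3 (cliff x \<phi>) = fsc (2 * cinner e3 x) \<phi>" for x
    by (simp add: cliff_swap[of _ e3] alt e0 cliff_linear)
  show ?thesis
    unfolding 1 cliff_linear 2 3 by (simp add: fun_eq_iff trivector_form_def cinner_commute[of e1] cinner_commute[of e2] cinner_commute[of e3] algebra_simps)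
qed

lemma act3_faithful:
  assumes "\<phi> \<in> KK J" "\<phi> \<noteq> 0" "act3 (LL J) T \<phi> 0" and e: "e1 \<in> LL J" "e2 \<in> LL J" "e3 \<in> LL J"
  shows "T e1 e2 e3 = 0"
proof -
  obtain ts where ts: "T e1 e2 e3 = (\<Sum>t\<leftarrow>ts. trivector_form t e1 e2 e3)"
     "0 = (\<Sum>(a, b, c)\<leftarrow>ts. cliff a (cliff b (cliff c \<phi>)))"
    using assms(3) e unfolding act3_def by (elim exE conjE) (rule that, auto)
  define P where "P ts \<longleftrightarrow> cliff e3 (cliff e2 (cliff e1 (\<Sum>(a, b, c)\<leftarrow>ts. cliff a (cliff b (cliff c \<phi>)))))
    = fsc (- 2 * (\<Sum>t\<leftarrow>ts. trivector_form t e1 e2 e3)) \<phi>" for ts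
  have "P ts"
  proof (induction ts)
    case (Cons t ts)
    obtain a b c where t: "t = (a, b, c)" by (cases t)
    show ?case using Cons cliff3_KK[OF assms(1) e, of a b c] t by (simp add: P_def cliff_linear fsc_simps algebra_simps)
  qed (simp add: P_def cliff_linear fsc_simps)
  then have "fsc (- 2 * T e1 e2 e3) \<phi> = 0" by (simp only: P_def ts(1) ts(2)[symmetric] cliff_linear)
  then show ?thesis using assms(2) by (auto simp: fun_eq_iff)
qed

end

section \<open>The torsion at a point\<close>

definition ee :: "'e::euclidean_space \<Rightarrow> 'e cgtan" where
  "ee b = ((0, dx b), 0)"

text \<open>The closed formula for \<open>T_L\<close>, with \<open>M b\<close> in the place of the
  partial derivatives of \<open>J\<close> and \<open>h\<close> in that of \<open>H\<close>. The
  pairing of \<open>ee a\<close> with a vector is half of its \<open>a\<close>-th component; the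
  factor 4 therefore turns the second sum into half of \<open>h\<close> on the vector parts.\<close>

definition Tor :: "('e::euclidean_space \<Rightarrow> 'e gtan \<Rightarrow> 'e gtan) \<Rightarrow> 'e form \<Rightarrow> 'e trilinear" where
  "Tor M h u v w = - \<i> * (\<Sum>b\<in>Basis. cinner (ee b) u * cinner (Jc (M b) v) w
      + cinner (ee b) v * cinner (Jc (M b) w) u + cinner (ee b) w * cinner (Jc (M b) u) v)
    - 4 * (\<Sum>a\<in>Basis. \<Sum>b\<in>Basis. \<Sum>c\<in>Basis. h [a, b, c] * (cinner (ee a) u * cinner (ee b) v * cinner (ee c) w))"

lemma Jc_uminus_fun: "Jc (\<lambda>w. - M w) z = - Jc M z"
  by (simp add: Jc_def)

lemma eps_eq_cliff: "alt_form \<phi> \<Longrightarrow> eps (dx b) \<phi> = cliff (ee b) \<phi>"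
  by (simp add: ee_def cliff_eq cliff_real_eq iprod_zero eps_linear fsc_simps)

lemma cinner_cconj: "cinner (cconj z) (cconj w) = cnj (cinner z w)"
  by (simp add: cinner_def cconj_def ginner_simps complex_eq_iff)

lemma cconj_cconj [simp]: "cconj (cconj z) = z"
  by (simp add: cconj_def)

text \<open>Since \<open>M\<close> and \<open>h\<close> are real, conjugation only changes
  \<open>- \<i>\<close> to \<open>\<i>\<close>, which is the same as changing the sign of
  \<open>M\<close>: the conjugate torsion is that of the opposite structure.\<close>

lemma conj_tri_Tor:
  assumes "\<And>b. b \<in> Basis \<Longrightarrow> linear (M b)" "\<And>vs. h vs \<in> \<real>"
  shows "conj_tri (Tor M h) = Tor (\<lambda>b w. - M b w) h"
proof (intro ext)
  fix u v w
  have e: "cinner (ee b) (cconj u) = cnj (cinner (ee b) u)" for b u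
    using cinner_cconj[of "ee b" u] by (simp add: ee_def cconj_def flip: zero_prod_def)
  have M: "cinner (Jc (M b) (cconj v)) (cconj w) = cnj (cinner (Jc (M b) v) w)" if "b \<in> Basis" for b v w
    using cinner_cconj[of "Jc (M b) v" w] linear_neg[OF assms(1)[OF that]] by (simp add: Jc_def cconj_def)
  have h: "cnj (h vs) = h vs" for vs using assms(2) by (simp add: Reals_cnj_iff)
  show "conj_tri (Tor M h) u v w = Tor (\<lambda>b w. - M b w) h u v w"
    by (simp add: conj_tri_def Tor_def e M h Jc_uminus_fun cinner_simps sum_negf sum_subtractf sum.distrib algebra_simps cong: sum.cong)
qed

text \<open>The six terms of the determinant become equal after the summation indices are
  renamed.\<close>

lemma sum3_antisym:
  fixes h :: "'i \<Rightarrow> 'i \<Rightarrow> 'i \<Rightarrow> complex"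
  assumes "\<And>a b c. h b a c = - h a b c" "\<And>a b c. h a c b = - h a b c"
  shows "(\<Sum>a\<in>I. \<Sum>b\<in>I. \<Sum>c\<in>I. h a b c * (u a * (v b * w c - v c * w b) - u b * (v a * w c - v c * w a) + u c * (v a * w b - v b * w a)))
    = 6 * (\<Sum>a\<in>I. \<Sum>b\<in>I. \<Sum>c\<in>I. h a b c * (u a * v b * w c))"
proof -
  let ?S = "\<lambda>f. \<Sum>a\<in>I. \<Sum>b\<in>I. \<Sum>c\<in>I. h a b c * f a b c"
  have swap1: "?S (\<lambda>a b c. f b a c) = - ?S f" for f
  proof -
    have "?S (\<lambda>a b c. f b a c) = (\<Sum>a\<in>I. \<Sum>b\<in>I. \<Sum>c\<in>I. h b a c * f a b c)" by (rule sum.swap)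
    then show ?thesis by (subst (asm) assms(1)) (simp add: sum_negf)
  qed
  have swap2: "?S (\<lambda>a b c. f a c b) = - ?S f" for f
  proof -
    have "?S (\<lambda>a b c. f a c b) = (\<Sum>a\<in>I. \<Sum>b\<in>I. \<Sum>c\<in>I. h a c b * f a b c)" by (rule sum.cong[OF refl], rule sum.swap)
    then show ?thesis by (subst (asm) assms(2)) (simp add: sum_negf)
  qed
  let ?f = "\<lambda>a b c. u a * v b * w c"
  have "?S (\<lambda>a b c. u a * (v b * w c - v c * w b) - u b * (v a * w c - v c * w a) + u c * (v a * w b - v b * w a))
    = ?S ?f - ?S (\<lambda>a b c. ?f a c b) - ?S (\<lambda>a b c. ?f b a c) + ?S (\<lambda>a b c. ?f b c a) + ?S (\<lambda>a b c. ?f c a b) - ?S (\<lambda>a b c. ?f c b a)"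
    by (simp add: algebra_simps sum_subtractf sum.distrib)
  moreover have "?S (\<lambda>a b c. ?f a c b) = - ?S ?f" by (rule swap2)
  moreover have "?S (\<lambda>a b c. ?f b a c) = - ?S ?f" by (rule swap1)
  moreover have "?S (\<lambda>a b c. ?f b c a) = ?S ?f" using swap1[of "\<lambda>a b c. ?f a c b"] swap2[of ?f] by simp
  moreover have "?S (\<lambda>a b c. ?f c a b) = ?S ?f" using swap2[of "\<lambda>a b c. ?f b a c"] swap1[of ?f] by simp
  moreover have "?S (\<lambda>a b c. ?f c b a) = - ?S ?f" using swap1[of "\<lambda>a b c. ?f c a b"] swap2[of "\<lambda>a b c. ?f b a c"] swap1[of ?f] by simp
  ultimately show ?thesis by simp
qed

lemma alt_form_swap01: "alt_form h \<Longrightarrow> h (b # a # vs) = - h (a # b # vs)"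
  using iprod_anticommute[of h a b] by (auto simp: iprod_def fun_eq_iff)

lemma alt_form_swap12: "alt_form h \<Longrightarrow> h (c # b # a # vs) = - h (c # a # b # vs)"
  using alt_form_swap01[OF alt_form_iprod, of h c b a vs] by (simp add: iprod_def)

context gcs_point
begin

lemma clin_projL: "clin f \<Longrightarrow> clin (\<lambda>x. f (projL J x))"
proof -
  assume f: "clin f"
  have "projL J (z + w) = projL J z + projL J w" "projL J (csc a z) = csc a (projL J z)" for z w a
    by (simp_all add: projL_def Jc_simps csc_simps mult.commute)
  then show ?thesis by (intro clinI) (simp_all only: clin_add[OF f] clin_csc[OF f])
qed

text \<open>The projection is idempotent, so it can be inserted a second time and the extra copy
  moved to the other slot.\<close>

lemma sum_GI_projL:
  assumes F: "\<And>y. clin (\<lambda>x. F x y)" "\<And>x. clin (F x)"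
  shows "(\<Sum>i\<in>GI. F (projL J (gw i)) (gd i)) = (\<Sum>i\<in>GI. F (projL J (gw i)) (projM (gd i)))"
proof -
  have "(\<Sum>i\<in>GI. F (projL J (projL J (gw i))) (gd i)) = (\<Sum>i\<in>GI. F (projL J (gw i)) (projM (gd i)))"
    by (rule sum_GI_adjoint[of "\<lambda>x y. F (projL J x) y"]) (rule clin_projL[OF F(1)], rule F(2), rule cinner_projL)
  then show ?thesis by (simp only: projL_id[OF projL_LL])
qed

text \<open>The part of the spin action of \<open>M\<close> that lowers the weight by 2: for
  \<open>M\<close> anticommuting with \<open>J\<close>, both factors lie in the conjugate of
  \<open>L\<close>.\<close>

definition low :: "('e gtan \<Rightarrow> 'e gtan) \<Rightarrow> 'e form \<Rightarrow> 'e form" where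
  "low M \<phi> = fsc (- \<i> / 2) (\<Sum>i\<in>GI. cliff (Jc M (projL J (gw i))) (cliff (projM (gd i)) \<phi>))"

text \<open>The torsion term of weight \<open>k - 3\<close>. The \<open>1/2\<close> comes from
  dividing by the difference 2 of the weights \<open>k\<close> and \<open>k - 2\<close>, the
  \<open>1/6\<close> from the formula for multiplication by a 3-form.\<close>

definition Tlow :: "('e \<Rightarrow> 'e gtan \<Rightarrow> 'e gtan) \<Rightarrow> 'e form \<Rightarrow> 'e form \<Rightarrow> 'e form" where
  "Tlow M h \<phi> = (\<Sum>b\<in>Basis. fsc (1/2) (cliff (projM (ee b)) (low (M b) \<phi>))) +
    (\<Sum>a\<in>Basis. \<Sum>b\<in>Basis. \<Sum>c\<in>Basis. fsc (h [a, b, c] / 6) (cliff (projM (ee a)) (cliff (projM (ee b)) (cliff (projM (ee c)) \<phi>))))"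

end

text \<open>The conditions on \<open>M\<close> are the linearizations of
  \<open>J (J w) = - w\<close> and of the antisymmetry of \<open>J\<close>, that is, what first
  derivatives of a family of structures satisfy.\<close>

locale gcs_variation = gcs_point +
  fixes M :: "'a \<Rightarrow> 'a gtan \<Rightarrow> 'a gtan" and h :: "'a form"
  assumes M_linear: "b \<in> Basis \<Longrightarrow> linear (M b)" and M_J: "b \<in> Basis \<Longrightarrow> M b (J w) = - J (M b w)"
    and M_antisym: "b \<in> Basis \<Longrightarrow> ginner (M b w) z = - ginner w (M b z)"
    and h_alt: "alt_form h" and h_homog: "homog 3 h"
begin

lemma gcs_variation_uminus: "gcs_variation (\<lambda>w. - J w) (\<lambda>b w. - M b w) h"
proof (intro gcs_variation.intro gcs_variation_axioms.intro gcs_point_uminus)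
  show "linear (\<lambda>w. - M b w)" if "b \<in> Basis" for b by (rule linear_compose_neg[OF M_linear[OF that]])
qed (simp_all add: h_alt h_homog M_J M_antisym ginner_simps linear_neg[OF M_linear] linear_neg[OF J_linear])

lemma Mc_simps:
  assumes "b \<in> Basis"
  shows "Jc (M b) (z + w) = Jc (M b) z + Jc (M b) w" "Jc (M b) (csc a z) = csc a (Jc (M b) z)"
  "Jc (M b) (Jc J z) = - Jc J (Jc (M b) z)" "cinner (Jc (M b) z) w = - cinner z (Jc (M b) w)"
  by (auto simp: Jc_def cscale_def prod_eq_iff M_J[OF assms] linear_add[OF M_linear[OF assms]] linear_cmul[OF M_linear[OF assms]]
      linear_diff[OF M_linear[OF assms]] cinner_def M_antisym[OF assms] complex_eq_iff)

lemma Mc_LL: "b \<in> Basis \<Longrightarrow> z \<in> LL J \<Longrightarrow> Jc (M b) z \<in> LL (\<lambda>w. - J w)"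
proof -
  assume b: "b \<in> Basis" and "z \<in> LL J"
  then have "Jc J z = csc \<i> z" by (simp add: LL_iff)
  then have "- Jc J (Jc (M b) z) = csc \<i> (Jc (M b) z)" using Mc_simps(3)[OF b, of z] Mc_simps(2)[OF b] by simp
  then have "Jc J (Jc (M b) z) = - csc \<i> (Jc (M b) z)" by (metis add.inverse_inverse)
  then show "Jc (M b) z \<in> LL (\<lambda>w. - J w)" by (simp add: LL_uminus_iff csc_simps)
qed

text \<open>\<open>M b\<close> exchanges \<open>L\<close> and its conjugate, so its spin action has
  a lowering and a raising part and no part of weight 0. The raising part is the lowering part for
  the opposite structure; the minus sign undoes the sign of \<open>M\<close>.\<close>

lemma Sop_M_eq:
  assumes b: "b \<in> Basis" and alt: "alt_form \<phi>"
  shows "Sop (M b) \<phi> = low (M b) \<phi> - gcs_point.low (\<lambda>w. - J w) (\<lambda>w. - M b w) \<phi>"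
proof -
  interpret neg: gcs_point "\<lambda>w. - J w" by (rule gcs_point_uminus)
  define F where "F vs x y = cliff (Jc (M b) x) (cliff y \<phi>) vs" for vs x y
  have F1: "clin (\<lambda>x. F vs x y)" for vs y
    by (rule clinI) (simp_all add: F_def Mc_simps[OF b] cliff_add cliff_csc alt alt_form_cliff)
  have F2: "clin (F vs x)" for vs x
    using clin_cliff(2)[OF alt] by (simp add: F_def[abs_def])
  have "(\<Sum>i\<in>GI. cliff (Jc (M b) (gw i)) (cliff (gd i) \<phi>) vs) =
     (\<Sum>i\<in>GI. F vs (projL J (gw i)) (gd i)) + (\<Sum>i\<in>GI. F vs (projM (gw i)) (gd i))" for vs
    by (subst sum.distrib[symmetric], rule sum.cong[OF refl])
       (simp only: clin_add[OF F1, symmetric] projL_projM, simp only: F_def)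
  then have "(\<Sum>i\<in>GI. cliff (Jc (M b) (gw i)) (cliff (gd i) \<phi>) vs) =
     (\<Sum>i\<in>GI. F vs (projL J (gw i)) (projM (gd i))) + (\<Sum>i\<in>GI. F vs (projM (gw i)) (projL J (gd i)))" for vs
    using sum_GI_projL[OF F1 F2, of vs] neg.sum_GI_projL[OF F1 F2, of vs] by simp
  then show ?thesis
    by (simp add: Sop_def low_def neg.low_def Jc_uminus_fun cliff_uminus alt alt_form_cliff fun_eq_iff sum_fun_apply F_def
       fun_Compl_def sum_negf algebra_simps)
qed

lemma low_EE:
  assumes "b \<in> Basis" "\<phi> \<in> EE J k"
  shows "low (M b) \<phi> \<in> EE J (k - 2)"
proof -
  have "cliff (Jc (M b) (projL J x)) (cliff (projM y) \<phi>) \<in> EE J (k - 1 - 1)" for x y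
    by (intro cliff_LM_EE Mc_LL projL_LL projM_LL assms)
  then show ?thesis unfolding low_def by (intro EE_simps EE_sum) simp
qed

lemma Tlow_EE:
  assumes "\<phi> \<in> EE J k"
  shows "Tlow M h \<phi> \<in> EE J (k - 3)"
proof -
  have "cliff (projM (ee b)) (low (M b) \<phi>) \<in> EE J (k - 2 - 1)" if "b \<in> Basis" for b
    by (intro cliff_LM_EE projM_LL low_EE assms that)
  moreover have "cliff (projM x) (cliff (projM y) (cliff (projM z) \<phi>)) \<in> EE J (k - 1 - 1 - 1)" for x y z
    by (intro cliff_LM_EE projM_LL assms)
  ultimately show ?thesis unfolding Tlow_def by (intro EE_simps EE_sum) simp_all
qed

text \<open>\<open>Tlow\<close> is already a sum of products of three vectors in the conjugate of
  \<open>L\<close>; it remains to compute the 3-form of these trivectors and to recognize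
  \<open>Tor\<close>.\<close>

lemma act3_Tlow:
  assumes alt: "alt_form \<phi>"
  shows "act3 (LL J) (Tor M h) \<phi> (Tlow M h \<phi>)"
proof -
  \<comment> \<open>\<open>- \<i> / 4\<close> is the product of the \<open>1/2\<close> in
    \<open>Tlow\<close> and the \<open>- \<i> / 2\<close> in \<open>low\<close>.\<close>
  let ?t1 = "\<lambda>b i. (csc (- \<i> / 4) (projM (ee b)), Jc (M b) (projL J (gw i)), projM (gd i))"
  let ?t2 = "\<lambda>a b c. (csc (h [a, b, c] / 6) (projM (ee a)), projM (ee b), projM (ee c))"
  have LM: "csc a x \<in> cconj ` LL J" if "x \<in> LL (\<lambda>w. - J w)" for a x
    unfolding cconj_LL using gcs_point.LL_simps(2)[OF gcs_point_uminus that] .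
  have 1: "act3 (LL J) (\<lambda>u v w. \<Sum>b\<in>Basis. \<Sum>i\<in>GI. trivector_form (?t1 b i) u v w) \<phi>
     (\<Sum>b\<in>Basis. \<Sum>i\<in>GI. cliff (csc (- \<i> / 4) (projM (ee b))) (cliff (Jc (M b) (projL J (gw i))) (cliff (projM (gd i)) \<phi>)))"
    by (intro act3_sum act3_single LM projM_LL) (simp_all add: cconj_LL projM_LL Mc_LL projL_LL)
  have 2: "act3 (LL J) (\<lambda>u v w. \<Sum>a\<in>Basis. \<Sum>b\<in>Basis. \<Sum>c\<in>Basis. trivector_form (?t2 a b c) u v w) \<phi>
     (\<Sum>a\<in>Basis. \<Sum>b\<in>Basis. \<Sum>c\<in>Basis. cliff (csc (h [a, b, c] / 6) (projM (ee a))) (cliff (projM (ee b)) (cliff (projM (ee c)) \<phi>)))"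
    by (intro act3_sum act3_single LM projM_LL) (simp_all add: cconj_LL projM_LL)
  show ?thesis
  proof (rule act3_cong[OF act3_add[OF 1 2]])
    show "Tlow M h \<phi> = (\<Sum>b\<in>Basis. \<Sum>i\<in>GI. cliff (csc (- \<i> / 4) (projM (ee b))) (cliff (Jc (M b) (projL J (gw i))) (cliff (projM (gd i)) \<phi>)))
      + (\<Sum>a\<in>Basis. \<Sum>b\<in>Basis. \<Sum>c\<in>Basis. cliff (csc (h [a, b, c] / 6) (projM (ee a))) (cliff (projM (ee b)) (cliff (projM (ee c)) \<phi>)))"
      by (simp add: Tlow_def low_def cliff_csc cliff_uminus alt alt_form_cliff cliff_linear cliff_sum fsc_simps)
  next
    fix u v w assume L: "u \<in> LL J" "v \<in> LL J" "w \<in> LL J"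
    have cL: "cinner (projM x) y = cinner x y" if "y \<in> LL J" for x y
      by (simp add: cinner_projM projL_id[OF that])
    \<comment> \<open>The sum over the frame contracts two pairings to one. The factor
      \<open>1/2\<close> comes from the expansion in the frame and the sign from the antisymmetry of
      \<open>M b\<close>; antisymmetrizing in \<open>T1\<close> doubles the result.\<close>
    have P: "(\<Sum>i\<in>GI. cinner (Jc (M b) (projL J (gw i))) v * cinner (gd i) w) = - (1/2) * cinner (Jc (M b) v) w"
      if b: "b \<in> Basis" and L: "v \<in> LL J" "w \<in> LL J" for b v w
    proof -
      have "cinner (Jc (M b) (projL J (gw i))) v = - cinner (gw i) (Jc (M b) v)" for i
        using Mc_simps(4)[OF b, of "projL J (gw i)" v] cinner_projL[of "gw i" "Jc (M b) v"] projM_id[OF Mc_LL[OF b L(1)]] by simp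
      then have "(\<Sum>i\<in>GI. cinner (Jc (M b) (projL J (gw i))) v * cinner (gd i) w)
         = - (1/2) * (\<Sum>i\<in>GI. 2 * cinner w (gd i) * cinner (gw i) (Jc (M b) v))"
        by (simp add: sum_distrib_left cinner_commute[of w] algebra_simps sum_negf)
      also have "(\<Sum>i\<in>GI. 2 * cinner w (gd i) * cinner (gw i) (Jc (M b) v)) = cinner w (Jc (M b) v)"
        using clin_expand(1)[OF clin_cinner(2), of w "Jc (M b) v"] by simp
      finally show ?thesis by (simp add: cinner_commute)
    qed
    have anti: "cinner (Jc (M b) x) y = - cinner (Jc (M b) y) x" if "b \<in> Basis" for b x y
      using Mc_simps(4)[OF that, of x y] by (simp add: cinner_commute)
    have T1: "(\<Sum>i\<in>GI. trivector_form (?t1 b i) u v w) = - \<i> * (cinner (ee b) u * cinner (Jc (M b) v) w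
      + cinner (ee b) v * cinner (Jc (M b) w) u + cinner (ee b) w * cinner (Jc (M b) u) v)" if b: "b \<in> Basis" for b
    proof -
      let ?P = "\<lambda>v w. \<Sum>i\<in>GI. cinner (Jc (M b) (projL J (gw i))) v * cinner (gd i) w"
      have "(\<Sum>i\<in>GI. trivector_form (?t1 b i) u v w) = \<i> * (cinner (ee b) u * (?P v w - ?P w v)
        + cinner (ee b) v * (?P w u - ?P u w) + cinner (ee b) w * (?P u v - ?P v u))"
        by (simp add: trivector_form_def cinner_simps cL L sum_distrib_left sum_subtractf[symmetric] sum.distrib[symmetric] algebra_simps)
      also have "\<dots> = - \<i> * (cinner (ee b) u * cinner (Jc (M b) v) w
      + cinner (ee b) v * cinner (Jc (M b) w) u + cinner (ee b) w * cinner (Jc (M b) u) v)"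
        by (simp add: P[OF b] L anti[OF b, of w v] anti[OF b, of u w] anti[OF b, of v u]) (simp add: algebra_simps)
      finally show ?thesis .
    qed
    have T2: "(\<Sum>a\<in>Basis. \<Sum>b\<in>Basis. \<Sum>c\<in>Basis. trivector_form (?t2 a b c) u v w)
      = - 4 * (\<Sum>a\<in>Basis. \<Sum>b\<in>Basis. \<Sum>c\<in>Basis. h [a, b, c] * (cinner (ee a) u * cinner (ee b) v * cinner (ee c) w))"
    proof -
      let ?u = "\<lambda>a. cinner (ee a) u" and ?v = "\<lambda>a. cinner (ee a) v" and ?w = "\<lambda>a. cinner (ee a) w"
      \<comment> \<open>\<open>2/3\<close> is the 4 of \<open>trivector_form\<close> times
        \<open>1/6\<close>. The six equal terms of the determinant bring it back to 4.\<close>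
      have "trivector_form (?t2 a b c) u v w = - (2/3) * (h [a, b, c] * (?u a * (?v b * ?w c - ?v c * ?w b)
        - ?u b * (?v a * ?w c - ?v c * ?w a) + ?u c * (?v a * ?w b - ?v b * ?w a)))" for a b c
        by (simp add: trivector_form_def cinner_simps cL L algebra_simps)
      then have "(\<Sum>a\<in>Basis. \<Sum>b\<in>Basis. \<Sum>c\<in>Basis. trivector_form (?t2 a b c) u v w)
       = - (2/3) * (\<Sum>a\<in>Basis. \<Sum>b\<in>Basis. \<Sum>c\<in>Basis. h [a, b, c] * (?u a * (?v b * ?w c - ?v c * ?w b)
        - ?u b * (?v a * ?w c - ?v c * ?w a) + ?u c * (?v a * ?w b - ?v b * ?w a)))"
        by (simp only: sum_distrib_left)
      also have "\<dots> = - (2/3) * (6 * (\<Sum>a\<in>Basis. \<Sum>b\<in>Basis. \<Sum>c\<in>Basis. h [a, b, c] * (?u a * ?v b * ?w c)))"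
        unfolding sum3_antisym[of "\<lambda>a b c. h [a, b, c]", OF alt_form_swap01[OF h_alt] alt_form_swap12[OF h_alt]] ..
      finally show ?thesis by simp
    qed
    show "Tor M h u v w = (\<Sum>b\<in>Basis. \<Sum>i\<in>GI. trivector_form (?t1 b i) u v w)
      + (\<Sum>a\<in>Basis. \<Sum>b\<in>Basis. \<Sum>c\<in>Basis. trivector_form (?t2 a b c) u v w)"
      unfolding T2 Tor_def sum_distrib_left[of "- \<i>"] by (simp only: T1 cong: sum.cong) simp
  qed
qed

text \<open>\<open>D b\<close> plays the role of the partial derivatives of a section of \<open>U\<^sup>k\<close> and \<open>M b\<close> that of the
  partial derivatives of \<open>J\<close>, so that the second hypothesis on \<open>D\<close> is the derivative of
  \<open>S \<phi> = k \<phi>\<close>.  It determines the components of \<open>D b\<close> outside of \<open>U\<^sup>k\<close>.\<close>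

lemma torsion:
  assumes phi: "\<phi> \<in> EE J k" and D: "\<And>b. b \<in> Basis \<Longrightarrow> alt_form (D b)"
    "\<And>b. b \<in> Basis \<Longrightarrow> Sop J (D b) + Sop (M b) \<phi> = fsc (of_int k) (D b)"
  shows "\<exists>g1\<in>EE J (k + 1). \<exists>g2\<in>EE J (k - 1). (\<Sum>b\<in>Basis. eps (dx b) (D b)) + wedge h \<phi>
    = g1 + g2 + Tlow M h \<phi> + gcs_point.Tlow (\<lambda>w. - J w) (\<lambda>b w. - M b w) h \<phi>"
proof -
  interpret neg: gcs_variation "\<lambda>w. - J w" "\<lambda>b w. - M b w" h by (rule gcs_variation_uminus)
  have alt: "alt_form \<phi>" using phi by (rule EE_alt)
  define l where "l b = low (M b) \<phi>" for b
  define u where "u b = neg.low (\<lambda>w. - M b w) \<phi>" for b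
  \<comment> \<open>The hypothesis says that \<open>k - Sop J\<close> maps \<open>D b\<close> to
    \<open>l b - u b\<close>. As it acts by 2 in weight \<open>k - 2\<close> and by
    \<open>-2\<close> in weight \<open>k + 2\<close>, subtracting half of \<open>l b\<close> and
    half of \<open>u b\<close> leaves a form of weight \<open>k\<close>.\<close>
  define \<psi> where "\<psi> b = D b - fsc (1/2) (l b) - fsc (1/2) (u b)" for b
  have l: "l b \<in> EE J (k - 2)" if "b \<in> Basis" for b
    using low_EE[OF that phi] by (simp add: l_def)
  have phi': "\<phi> \<in> EE (\<lambda>w. - J w) (- k)" using phi by (simp add: EE_uminus)
  have u: "u b \<in> EE J (k + 2)" if "b \<in> Basis" for b
    using neg.low_EE[OF that phi'] EE_uminus[of "k + 2"] by (simp add: u_def)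
  have \<psi>: "\<psi> b \<in> EE J k" if b: "b \<in> Basis" for b
  proof -
    have S: "Sop J (D b) = fsc (of_int k) (D b) - l b + u b"
      using D(2)[OF b] Sop_M_eq[OF b alt] by (simp add: l_def u_def algebra_simps)
    have Slu: "Sop J (l b) = fsc (of_int k - 2) (l b)" "Sop J (u b) = fsc (of_int k + 2) (u b)"
      using l[OF b] u[OF b] by (simp_all add: EE_def)
    have "Sop J (\<psi> b) = fsc (of_int k) (D b) - l b + u b - fsc (1/2) (fsc (of_int k - 2) (l b)) - fsc (1/2) (fsc (of_int k + 2) (u b))"
      by (simp only: \<psi>_def Sop_linear S Slu)
    also have "\<dots> = fsc (of_int k) (\<psi> b)"
      by (simp add: \<psi>_def fun_eq_iff algebra_simps add_divide_distrib diff_divide_distrib)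
    finally have "Sop J (\<psi> b) = fsc (of_int k) (\<psi> b)" .
    then show ?thesis using D(1)[OF b] EE_alt[OF l[OF b]] EE_alt[OF u[OF b]] by (simp add: EE_def \<psi>_def alt_form_simps)
  qed
  define m where "m b = projM (ee b)" for b :: 'a
  define p where "p b = projL J (ee b)" for b :: 'a
  have pL: "p b \<in> LL J" and mL: "m b \<in> LL (\<lambda>w. - J w)" for b by (simp_all add: p_def m_def projL_LL projM_LL)
  have mp: "cliff (ee b) \<theta> = cliff (p b) \<theta> + cliff (m b) \<theta>" if "alt_form \<theta>" for b \<theta>
    using projL_projM[of "ee b"] cliff_add[OF that, of "p b" "m b"] by (simp add: p_def m_def)
  let ?c3 = "\<lambda>x y z. \<Sum>a\<in>Basis. \<Sum>b\<in>Basis. \<Sum>c\<in>Basis. fsc (h [a, b, c] / 6) (cliff (x a) (cliff (y b) (cliff (z c) \<phi>)))"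
  \<comment> \<open>\<open>p b\<close> raises and \<open>m b\<close> lowers the weight by 1. The
    products of total weight 1 and \<open>-1\<close> are collected in \<open>g1\<close> and
    \<open>g2\<close>; those of weight 3 and \<open>-3\<close> make up the two torsion
    terms.\<close>
  define g1 where "g1 = (\<Sum>b\<in>Basis. cliff (p b) (\<psi> b) + fsc (1/2) (cliff (m b) (u b))) + (?c3 p p m + ?c3 p m p + ?c3 m p p)"
  define g2 where "g2 = (\<Sum>b\<in>Basis. cliff (m b) (\<psi> b) + fsc (1/2) (cliff (p b) (l b))) + (?c3 m m p + ?c3 m p m + ?c3 p m m)"
  have c3: "?c3 x y z \<in> EE J j" if "\<And>a b c. cliff (x a) (cliff (y b) (cliff (z c) \<phi>)) \<in> EE J j" for x y z j
    by (intro EE_sum EE_simps that)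
  have c3_1: "?c3 p p m \<in> EE J (k + 1)" "?c3 p m p \<in> EE J (k + 1)" "?c3 m p p \<in> EE J (k + 1)"
    by (rule c3, use cliff_LL_EE[OF pL cliff_LL_EE[OF pL cliff_LM_EE[OF mL phi]]]
       cliff_LL_EE[OF pL cliff_LM_EE[OF mL cliff_LL_EE[OF pL phi]]] cliff_LM_EE[OF mL cliff_LL_EE[OF pL cliff_LL_EE[OF pL phi]]] in \<open>simp add: add.commute\<close>)+
  have c3_2: "?c3 m m p \<in> EE J (k - 1)" "?c3 m p m \<in> EE J (k - 1)" "?c3 p m m \<in> EE J (k - 1)"
    by (rule c3, use cliff_LM_EE[OF mL cliff_LM_EE[OF mL cliff_LL_EE[OF pL phi]]]
       cliff_LM_EE[OF mL cliff_LL_EE[OF pL cliff_LM_EE[OF mL phi]]] cliff_LL_EE[OF pL cliff_LM_EE[OF mL cliff_LM_EE[OF mL phi]]] in simp)+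
  have g1: "g1 \<in> EE J (k + 1)"
  proof -
    have "cliff (p b) (\<psi> b) \<in> EE J (k + 1)" "cliff (m b) (u b) \<in> EE J (k + 1)" if "b \<in> Basis" for b
      using cliff_LL_EE[OF pL \<psi>[OF that]] cliff_LM_EE[OF mL u[OF that]] by (simp_all add: add.commute)
    then have "(\<Sum>b\<in>Basis. cliff (p b) (\<psi> b) + fsc (1/2) (cliff (m b) (u b))) \<in> EE J (k + 1)"
      by (intro EE_sum EE_simps(2,3))
    then show ?thesis unfolding g1_def by (intro EE_simps(2) c3_1)
  qed
  have g2: "g2 \<in> EE J (k - 1)"
  proof -
    have "cliff (m b) (\<psi> b) \<in> EE J (k - 1)" "cliff (p b) (l b) \<in> EE J (k - 1)" if "b \<in> Basis" for b
      using cliff_LM_EE[OF mL \<psi>[OF that]] cliff_LL_EE[OF pL l[OF that]] by simp_all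
    then have "(\<Sum>b\<in>Basis. cliff (m b) (\<psi> b) + fsc (1/2) (cliff (p b) (l b))) \<in> EE J (k - 1)"
      by (intro EE_sum EE_simps(2,3))
    then show ?thesis unfolding g2_def by (intro EE_simps(2) c3_2)
  qed
  have low: "Tlow M h \<phi> = (\<Sum>b\<in>Basis. fsc (1/2) (cliff (m b) (l b))) + ?c3 m m m"
    by (simp add: Tlow_def m_def l_def)
  have up: "neg.Tlow (\<lambda>b w. - M b w) h \<phi> = (\<Sum>b\<in>Basis. fsc (1/2) (cliff (p b) (u b))) + ?c3 p p p"
    by (simp add: neg.Tlow_def p_def u_def)
  have "eps (dx b) (D b) = cliff (p b) (\<psi> b) + fsc (1/2) (cliff (p b) (l b)) + fsc (1/2) (cliff (p b) (u b))
     + (cliff (m b) (\<psi> b) + fsc (1/2) (cliff (m b) (l b)) + fsc (1/2) (cliff (m b) (u b)))" if "b \<in> Basis" for b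
  proof -
    have "D b = \<psi> b + fsc (1/2) (l b) + fsc (1/2) (u b)" by (simp add: \<psi>_def)
    then show ?thesis using eps_eq_cliff[OF D(1)[OF that]] mp[OF D(1)[OF that]] by (simp only: cliff_linear)
  qed
  then have d: "(\<Sum>b\<in>Basis. eps (dx b) (D b)) = (\<Sum>b\<in>Basis. cliff (p b) (\<psi> b)) + (\<Sum>b\<in>Basis. fsc (1/2) (cliff (p b) (l b)))
     + (\<Sum>b\<in>Basis. fsc (1/2) (cliff (p b) (u b)))
     + ((\<Sum>b\<in>Basis. cliff (m b) (\<psi> b)) + (\<Sum>b\<in>Basis. fsc (1/2) (cliff (m b) (l b))) + (\<Sum>b\<in>Basis. fsc (1/2) (cliff (m b) (u b))))"
    by (simp only: sum.distrib cong: sum.cong)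
  have w: "wedge h \<phi> = ?c3 p p p + ?c3 p p m + ?c3 p m p + ?c3 p m m + ?c3 m p p + ?c3 m p m + ?c3 m m p + ?c3 m m m"
  proof -
    have "wedge h \<phi> = ?c3 ee ee ee"
      unfolding wedge_3_eps[OF h_alt h_homog] fsc_simps
      by (simp add: eps_eq_cliff alt alt_form_cliff)
    also have "\<dots> = ?c3 p p p + ?c3 p p m + ?c3 p m p + ?c3 p m m + ?c3 m p p + ?c3 m p m + ?c3 m m p + ?c3 m m m"
      unfolding sum.distrib[symmetric] fsc_simps(1)[symmetric]
      by (intro sum.cong refl) (simp add: mp alt alt_form_cliff cliff_linear fsc_simps ac_simps)
    finally show ?thesis .
  qed
  have "(\<Sum>b\<in>Basis. eps (dx b) (D b)) + wedge h \<phi> = g1 + g2 + Tlow M h \<phi> + neg.Tlow (\<lambda>b w. - M b w) h \<phi>"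
    unfolding d w low up g1_def g2_def sum.distrib by (simp only: ac_simps)
  then show ?thesis using g1 g2 by blast
qed

end

section \<open>Smooth functions\<close>

lemma frechet_derivative_cong:
  assumes "open S" "x \<in> S" "\<And>y. y \<in> S \<Longrightarrow> f y = g y"
  shows "frechet_derivative f (at x) = frechet_derivative g (at x)"
proof -
  have "(f has_derivative D) (at x) \<longleftrightarrow> (g has_derivative D) (at x)" for D
    using has_derivative_transform_within_open[OF _ assms(1,2)] assms(3) by metis
  then show ?thesis by (simp add: frechet_derivative_def)
qed

lemma Ck_cong:
  assumes "open S" "\<And>x. x \<in> S \<Longrightarrow> f x = g x" "Ck_on k S f"
  shows "Ck_on k S g"
  using assms(2,3)
proof (induction k arbitrary: f g)
  case 0
  then show ?case by (auto cong: continuous_on_cong)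
next
  case (Suc k)
  have "frechet_derivative f (at x) = frechet_derivative g (at x)" if "x \<in> S" for x
    using frechet_derivative_cong[OF assms(1) that] Suc.prems(1) by blast
  then have "Ck_on k S (\<lambda>x. frechet_derivative g (at x) v)" for v
    using Suc.IH[of "\<lambda>x. frechet_derivative f (at x) v" "\<lambda>x. frechet_derivative g (at x) v"] Suc.prems by simp
  moreover have "g differentiable (at x)" if "x \<in> S" for x
  proof -
    have "f differentiable (at x)" using Suc.prems that by simp
    then show ?thesis unfolding differentiable_def
      using has_derivative_transform_within_open[OF _ assms(1) that] Suc.prems(1) by metis
  qed
  ultimately show ?case by simp
qed

lemma Ck_SucI:
  assumes "open S" "\<And>x. x \<in> S \<Longrightarrow> (f has_derivative f' x) (at x)" "\<And>v. Ck_on k S (\<lambda>x. f' x v)"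
  shows "Ck_on (Suc k) S f"
proof -
  have "f' x = frechet_derivative f (at x)" if "x \<in> S" for x
    using frechet_derivative_at[OF assms(2)[OF that]] by simp
  then have "Ck_on k S (\<lambda>x. frechet_derivative f (at x) v)" for v
    by (intro Ck_cong[OF assms(1) _ assms(3)[of v]]) simp
  moreover have "f differentiable (at x)" if "x \<in> S" for x
    using assms(2)[OF that] by (auto simp: differentiable_def)
  ultimately show ?thesis by simp
qed

lemma Ck_SucD:
  "Ck_on (Suc k) S f \<Longrightarrow> x \<in> S \<Longrightarrow> (f has_derivative frechet_derivative f (at x)) (at x)"
  "Ck_on (Suc k) S f \<Longrightarrow> Ck_on k S (\<lambda>x. frechet_derivative f (at x) v)"
  by (auto simp: frechet_derivative_works[symmetric])

lemma Ck_Suc_imp: "Ck_on (Suc k) S f \<Longrightarrow> Ck_on k S f"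
proof (induction k arbitrary: f)
  case 0
  then show ?case
    by (auto intro!: continuous_at_imp_continuous_on differentiable_imp_continuous_within)
next
  case (Suc k)
  have "Ck_on k S (\<lambda>x. frechet_derivative f (at x) v)" for v
    by (rule Suc.IH[OF Ck_SucD(2)[OF Suc.prems]])
  moreover have "f differentiable (at x)" if "x \<in> S" for x using Suc.prems that by simp
  ultimately show ?case by simp
qed

lemma Ck_subset: "Ck_on k S f \<Longrightarrow> T \<subseteq> S \<Longrightarrow> Ck_on k T f"
  by (induction k arbitrary: f) (auto intro: continuous_on_subset)

lemma Ck_local:
  assumes "\<And>x. x \<in> S \<Longrightarrow> \<exists>U. open U \<and> x \<in> U \<and> Ck_on k U f"
  shows "Ck_on k S f"
  using assms
proof (induction k arbitrary: f)
  case 0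
  have "isCont f x" if "x \<in> S" for x
    using 0[OF that] by (auto simp: continuous_on_eq_continuous_at)
  then show ?case by (simp add: continuous_at_imp_continuous_on)
next
  case (Suc k)
  have "Ck_on k S (\<lambda>x. frechet_derivative f (at x) v)" for v
    by (rule Suc.IH) (use Suc.prems in fastforce)
  then show ?case using Suc.prems by fastforce
qed

lemma Ck_const: "Ck_on k S (\<lambda>x. c)"
  by (induction k arbitrary: c) auto

lemma Ck_bounded_linear:
  assumes "open S" "bounded_linear T" "Ck_on k S f"
  shows "Ck_on k S (\<lambda>x. T (f x))"
  using assms(3)
proof (induction k arbitrary: f)
  case 0
  then show ?case using bounded_linear.continuous_on[OF assms(2)] by auto
next
  case (Suc k)
  show ?case
    by (rule Ck_SucI[OF assms(1) bounded_linear.has_derivative[OF assms(2) Ck_SucD(1)[OF Suc.prems]] Suc.IH[OF Ck_SucD(2)[OF Suc.prems]] ])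
qed

lemma Ck_add:
  assumes "open S" "Ck_on k S f" "Ck_on k S g"
  shows "Ck_on k S (\<lambda>x. f x + g x)"
  using assms(2,3)
proof (induction k arbitrary: f g)
  case (Suc k)
  show ?case
    by (rule Ck_SucI[OF assms(1) has_derivative_add[OF Ck_SucD(1)[OF Suc.prems(1)] Ck_SucD(1)[OF Suc.prems(2)]]
          Suc.IH[OF Ck_SucD(2)[OF Suc.prems(1)] Ck_SucD(2)[OF Suc.prems(2)]] ])
qed (auto intro: continuous_intros)

lemma Ck_bounded_bilinear:
  assumes "open S" "bounded_bilinear B" "Ck_on k S f" "Ck_on k S g"
  shows "Ck_on k S (\<lambda>x. B (f x) (g x))"
  using assms(3,4)
proof (induction k arbitrary: f g)
  case 0
  then show ?case using bounded_bilinear.continuous_on[OF assms(2)] by auto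
next
  case (Suc k)
  show ?case
    by (rule Ck_SucI[OF assms(1) bounded_bilinear.FDERIV[OF assms(2) Ck_SucD(1)[OF Suc.prems(1)] Ck_SucD(1)[OF Suc.prems(2)]]
         Ck_add[OF assms(1) Suc.IH[OF Ck_Suc_imp[OF Suc.prems(1)] Ck_SucD(2)[OF Suc.prems(2)]]
           Suc.IH[OF Ck_SucD(2)[OF Suc.prems(1)] Ck_Suc_imp[OF Suc.prems(2)]]] ])
qed

lemma Ck_sum:
  assumes "open S" "\<And>i. i \<in> I \<Longrightarrow> Ck_on k S (f i)"
  shows "Ck_on k S (\<lambda>x. \<Sum>i\<in>I. f i x)"
  using assms(2) by (induction I rule: infinite_finite_induct) (auto intro: Ck_const Ck_add[OF assms(1)])

text \<open>\<open>Ck_on\<close> speaks of derivatives in a fixed direction, while the chain rule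
  produces a direction that moves with \<open>x\<close>. Expanding it in the basis of the
  intermediate space restores fixed directions.\<close>

lemma Ck_compose:
  fixes f :: "'a::real_normed_vector \<Rightarrow> 'b::euclidean_space"
  assumes "open S" "f ` S \<subseteq> T" "Ck_on k S f" "Ck_on k T g"
  shows "Ck_on k S (\<lambda>x. g (f x))"
  using assms(3,4)
proof (induction k arbitrary: g)
  case 0
  then show ?case using assms(2) continuous_on_compose2[of T g S f] by auto
next
  case (Suc k)
  have *: "frechet_derivative g (at (f x)) (frechet_derivative f (at x) v)
     = (\<Sum>b\<in>Basis. (frechet_derivative f (at x) v \<bullet> b) *\<^sub>R frechet_derivative g (at (f x)) b)" if "x \<in> S" for x v
  proof -
    have l: "linear (frechet_derivative g (at (f x)))"
      using Ck_SucD(1)[OF Suc.prems(2)] that assms(2) by (blast intro: has_derivative_linear)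
    show ?thesis
      by (subst euclidean_representation[symmetric], subst linear_sum[OF l]) (simp add: linear_cmul[OF l])
  qed
  show ?case
  proof (rule Ck_SucI[OF assms(1) _ _])
    show "((\<lambda>x. g (f x)) has_derivative (\<lambda>v. \<Sum>b\<in>Basis. (frechet_derivative f (at x) v \<bullet> b) *\<^sub>R frechet_derivative g (at (f x)) b)) (at x)"
      if "x \<in> S" for x
      using has_derivative_compose[OF Ck_SucD(1)[OF Suc.prems(1) that] Ck_SucD(1)[OF Suc.prems(2)]] that assms(2)
      by (simp add: *[OF that] image_subset_iff)
    show "Ck_on k S (\<lambda>x. \<Sum>b\<in>Basis. (frechet_derivative f (at x) v \<bullet> b) *\<^sub>R frechet_derivative g (at (f x)) b)" for v
      by (intro Ck_sum Ck_bounded_bilinear[OF assms(1) bounded_bilinear_scaleR]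
          Ck_bounded_linear[OF assms(1) bounded_linear_inner_left] Suc.IH Ck_SucD(2)[OF Suc.prems(1)]
          Ck_SucD(2)[OF Suc.prems(2)] Ck_Suc_imp[OF Suc.prems(1)] assms(1))
  qed
qed

lemma Ck_inverse:
  fixes f :: "'a::real_normed_vector \<Rightarrow> real"
  assumes "open S" "Ck_on k S f" "\<And>x. x \<in> S \<Longrightarrow> f x \<noteq> 0"
  shows "Ck_on k S (\<lambda>x. inverse (f x))"
  using assms(2)
proof (induction k)
  case 0
  then show ?case using assms(3) by (auto intro: continuous_intros)
next
  case (Suc k)
  have IH: "Ck_on k S (\<lambda>x. inverse (f x))" using Suc.IH[OF Ck_Suc_imp[OF Suc.prems]] .
  show ?case
  proof (rule Ck_SucI[OF assms(1) Deriv.has_derivative_inverse[OF assms(3) Ck_SucD(1)[OF Suc.prems]] _])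
    show "Ck_on k S (\<lambda>x. - (inverse (f x) * frechet_derivative f (at x) v * inverse (f x)))" for v
      using Ck_bounded_linear[OF assms(1) bounded_linear_minus[OF bounded_linear_ident]
        Ck_bounded_bilinear[OF assms(1) bounded_bilinear_mult
          Ck_bounded_bilinear[OF assms(1) bounded_bilinear_mult IH Ck_SucD(2)[OF Suc.prems]] IH]] .
  qed
qed

section \<open>Infinitely differentiable functions\<close>

lemma Cinf_const: "Cinf_on S (\<lambda>x. c)"
  by (simp add: Cinf_on_def Ck_const)

lemma Cinf_cong: "open S \<Longrightarrow> (\<And>x. x \<in> S \<Longrightarrow> f x = g x) \<Longrightarrow> Cinf_on S f \<Longrightarrow> Cinf_on S g"
  unfolding Cinf_on_def by (intro allI) (rule Ck_cong[of S f g]; simp)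

lemma Cinf_subset: "Cinf_on S f \<Longrightarrow> T \<subseteq> S \<Longrightarrow> Cinf_on T f"
  unfolding Cinf_on_def by (intro allI) (rule Ck_subset[of _ S]; simp)

lemma Cinf_bounded_linear: "open S \<Longrightarrow> bounded_linear L \<Longrightarrow> Cinf_on S f \<Longrightarrow> Cinf_on S (\<lambda>x. L (f x))"
  unfolding Cinf_on_def by (intro allI) (rule Ck_bounded_linear; simp)

lemma Cinf_add: "open S \<Longrightarrow> Cinf_on S f \<Longrightarrow> Cinf_on S g \<Longrightarrow> Cinf_on S (\<lambda>x. f x + g x)"
  unfolding Cinf_on_def by (intro allI) (rule Ck_add; simp)

lemma Cinf_bounded_bilinear:
  "open S \<Longrightarrow> bounded_bilinear B \<Longrightarrow> Cinf_on S f \<Longrightarrow> Cinf_on S g \<Longrightarrow> Cinf_on S (\<lambda>x. B (f x) (g x))"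
  unfolding Cinf_on_def by (intro allI) (rule Ck_bounded_bilinear; simp)

lemma Cinf_local: "(\<And>x. x \<in> S \<Longrightarrow> \<exists>U. open U \<and> x \<in> U \<and> Cinf_on U f) \<Longrightarrow> Cinf_on S f"
  unfolding Cinf_on_def by (intro allI Ck_local) fast

lemma Cinf_sum: "open S \<Longrightarrow> (\<And>i. i \<in> I \<Longrightarrow> Cinf_on S (f i)) \<Longrightarrow> Cinf_on S (\<lambda>x. \<Sum>i\<in>I. f i x)"
  unfolding Cinf_on_def by (intro allI) (rule Ck_sum; simp)

lemma Cinf_compose:
  fixes f :: "'a::real_normed_vector \<Rightarrow> 'b::euclidean_space"
  shows "open S \<Longrightarrow> f ` S \<subseteq> T \<Longrightarrow> Cinf_on S f \<Longrightarrow> Cinf_on T g \<Longrightarrow> Cinf_on S (\<lambda>x. g (f x))"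
  unfolding Cinf_on_def by (intro allI) (rule Ck_compose[of S f T]; simp)

lemma Cinf_inverse:
  fixes f :: "'a::real_normed_vector \<Rightarrow> real"
  shows "open S \<Longrightarrow> Cinf_on S f \<Longrightarrow> (\<And>x. x \<in> S \<Longrightarrow> f x \<noteq> 0) \<Longrightarrow> Cinf_on S (\<lambda>x. inverse (f x))"
  unfolding Cinf_on_def by (intro allI) (rule Ck_inverse; simp)

lemma Cinf_derivative: "Cinf_on S f \<Longrightarrow> Cinf_on S (\<lambda>x. frechet_derivative f (at x) v)"
  unfolding Cinf_on_def by (intro allI) (rule Ck_SucD(2), simp)

lemma Cinf_has_derivative: "Cinf_on S f \<Longrightarrow> x \<in> S \<Longrightarrow> (f has_derivative frechet_derivative f (at x)) (at x)"
  using Ck_SucD(1)[of 0 S f x] by (simp only: Cinf_on_def)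

lemma Cinf_continuous_on: "Cinf_on S f \<Longrightarrow> continuous_on S f"
  using Ck_on.simps(1)[of S f] by (simp only: Cinf_on_def)

lemma Cinf_ident: "open S \<Longrightarrow> Cinf_on S (\<lambda>x. x)"
proof -
  assume "open S"
  have "Ck_on k S (\<lambda>x. x)" for k
  proof (cases k)
    case (Suc k')
    show ?thesis unfolding Suc
      by (rule Ck_SucI[OF \<open>open S\<close> has_derivative_ident _]) (rule Ck_const)
  qed auto
  then show ?thesis by (simp add: Cinf_on_def)
qed

lemma Cinf_Pair:
  assumes "open S" "Cinf_on S f" "Cinf_on S g"
  shows "Cinf_on S (\<lambda>x. (f x, g x))"
proof -
  have "bounded_linear (\<lambda>x. (x, 0 :: 'c))" "bounded_linear (\<lambda>x. (0 :: 'b, x))"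
    by (intro bounded_linear_Pair bounded_linear_ident bounded_linear_zero)+
  then have "Cinf_on S (\<lambda>x. (f x, 0) + (0, g x))"
    using assms by (intro Cinf_add Cinf_bounded_linear[of S "\<lambda>x. (x, 0)"] Cinf_bounded_linear[of S "\<lambda>x. (0, x)"])
  then show ?thesis by simp
qed

lemma Cinf_mult:
  fixes f g :: "'a::real_normed_vector \<Rightarrow> 'b::real_normed_algebra"
  shows "open S \<Longrightarrow> Cinf_on S f \<Longrightarrow> Cinf_on S g \<Longrightarrow> Cinf_on S (\<lambda>x. f x * g x)"
  by (rule Cinf_bounded_bilinear[OF _ bounded_bilinear_mult])

lemma Cinf_scaleR:
  "open S \<Longrightarrow> Cinf_on S f \<Longrightarrow> Cinf_on S g \<Longrightarrow> Cinf_on S (\<lambda>x. f x *\<^sub>R g x)"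
  by (rule Cinf_bounded_bilinear[OF _ bounded_bilinear_scaleR])

lemma Cinf_of_real:
  fixes f :: "'a::real_normed_vector \<Rightarrow> real"
  shows "open S \<Longrightarrow> Cinf_on S f \<Longrightarrow> Cinf_on S (\<lambda>x. complex_of_real (f x))"
  by (rule Cinf_bounded_linear[OF _ bounded_linear_of_real])

lemma Cinf_uminus: "open S \<Longrightarrow> Cinf_on S f \<Longrightarrow> Cinf_on S (\<lambda>x. - f x)"
  by (rule Cinf_bounded_linear[OF _ bounded_linear_minus[OF bounded_linear_ident]])

lemma Cinf_diff: "open S \<Longrightarrow> Cinf_on S f \<Longrightarrow> Cinf_on S g \<Longrightarrow> Cinf_on S (\<lambda>x. f x - g x)"
  using Cinf_add[OF _ _ Cinf_uminus, of S f g] by simp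

subsection \<open>Symmetry of second derivatives\<close>

text \<open>Two applications of the mean value theorem. The second difference is symmetric in
  \<open>v\<close> and \<open>w\<close>, so both mixed derivatives take equal values at points close
  to \<open>x\<close>.\<close>

lemma second_difference_mvt:
  fixes f :: "'a::real_normed_vector \<Rightarrow> real"
  assumes f: "Ck_on 2 (ball x r) f" and h: "0 < h" "h * (norm v + norm w) < r"
  shows "\<exists>\<xi> \<eta>. 0 < \<xi> \<and> \<xi> < h \<and> 0 < \<eta> \<and> \<eta> < h \<and>
    f (x + h *\<^sub>R v + h *\<^sub>R w) - f (x + h *\<^sub>R v) - (f (x + h *\<^sub>R w) - f x)
      = h * h * frechet_derivative (\<lambda>y. frechet_derivative f (at y) v) (at (x + \<xi> *\<^sub>R v + \<eta> *\<^sub>R w)) w"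
proof -
  have f: "Ck_on (Suc (Suc 0)) (ball x r) f" using f by (simp add: numeral_2_eq_2)
  have in_ball: "x + s *\<^sub>R v + t *\<^sub>R w \<in> ball x r" if "0 \<le> s" "s \<le> h" "0 \<le> t" "t \<le> h" for s t
  proof -
    have "norm (s *\<^sub>R v + t *\<^sub>R w) \<le> s * norm v + t * norm w"
      using norm_triangle_ineq[of "s *\<^sub>R v" "t *\<^sub>R w"] that by simp
    also have "\<dots> \<le> h * norm v + h * norm w" using that by (intro add_mono mult_right_mono) auto
    also have "\<dots> < r" using h by (simp add: algebra_simps)
    finally have "norm (- (s *\<^sub>R v + t *\<^sub>R w)) < r" by (simp only: norm_minus_cancel)
    then show ?thesis by (simp add: dist_norm algebra_simps)
  qed
  let ?Df = "\<lambda>y. frechet_derivative f (at y)"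
  let ?g = "\<lambda>y. ?Df y v"
  have d1: "((\<lambda>s. f (x + s *\<^sub>R v + t *\<^sub>R w)) has_real_derivative ?Df (x + s *\<^sub>R v + t *\<^sub>R w) v) (at s)"
    if "0 \<le> s" "s \<le> h" "0 \<le> t" "t \<le> h" for s t
  proof -
    have lin: "linear (?Df (x + s *\<^sub>R v + t *\<^sub>R w))"
      using has_derivative_linear[OF Ck_SucD(1)[OF f in_ball[OF that]]] .
    have "((\<lambda>s. f (x + s *\<^sub>R v + t *\<^sub>R w)) has_derivative (\<lambda>u. ?Df (x + s *\<^sub>R v + t *\<^sub>R w) (u *\<^sub>R v))) (at s)"
      by (rule has_derivative_compose[where f="\<lambda>s. x + s *\<^sub>R v + t *\<^sub>R w" and g=f, OF _ Ck_SucD(1)[OF f in_ball[OF that]]]) (auto intro!: derivative_eq_intros)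
    moreover have "(\<lambda>u. ?Df (x + s *\<^sub>R v + t *\<^sub>R w) (u *\<^sub>R v)) = (*) (?Df (x + s *\<^sub>R v + t *\<^sub>R w) v)"
      by (simp add: fun_eq_iff linear_cmul[OF lin])
    ultimately show ?thesis by (simp only: has_field_derivative_def)
  qed
  have d1': "((\<lambda>s. f (x + s *\<^sub>R v + h *\<^sub>R w) - f (x + s *\<^sub>R v + 0 *\<^sub>R w)) has_real_derivative
     ?Df (x + s *\<^sub>R v + h *\<^sub>R w) v - ?Df (x + s *\<^sub>R v + 0 *\<^sub>R w) v) (at s)" if "0 \<le> s" "s \<le> h" for s
    using h(1) by (intro DERIV_diff d1 that order_refl) simp_all
  have "\<exists>z>0. z < h \<and> (f (x + h *\<^sub>R v + h *\<^sub>R w) - f (x + h *\<^sub>R v + 0 *\<^sub>R w)) - (f (x + 0 *\<^sub>R v + h *\<^sub>R w) - f (x + 0 *\<^sub>R v + 0 *\<^sub>R w))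
     = (h - 0) * (?Df (x + z *\<^sub>R v + h *\<^sub>R w) v - ?Df (x + z *\<^sub>R v + 0 *\<^sub>R w) v)"
    by (rule MVT2[OF h(1), of "\<lambda>s. f (x + s *\<^sub>R v + h *\<^sub>R w) - f (x + s *\<^sub>R v + 0 *\<^sub>R w)"]) (rule d1')
  then obtain \<xi> where \<xi>: "0 < \<xi>" "\<xi> < h" "f (x + h *\<^sub>R v + h *\<^sub>R w) - f (x + h *\<^sub>R v) - (f (x + h *\<^sub>R w) - f x)
     = h * (?g (x + \<xi> *\<^sub>R v + h *\<^sub>R w) - ?g (x + \<xi> *\<^sub>R v + 0 *\<^sub>R w))" by auto
  have f': "Ck_on (Suc 0) (ball x r) ?g" by (rule Ck_SucD(2)[OF f])
  have d2: "((\<lambda>t. ?g (x + \<xi> *\<^sub>R v + t *\<^sub>R w)) has_real_derivative frechet_derivative ?g (at (x + \<xi> *\<^sub>R v + t *\<^sub>R w)) w) (at t)"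
    if "0 \<le> t" "t \<le> h" for t
  proof -
    have i: "x + \<xi> *\<^sub>R v + t *\<^sub>R w \<in> ball x r" using in_ball \<xi> that by simp
    have lin: "linear (frechet_derivative ?g (at (x + \<xi> *\<^sub>R v + t *\<^sub>R w)))"
      using has_derivative_linear[OF Ck_SucD(1)[OF f' i]] .
    have "((\<lambda>t. ?g (x + \<xi> *\<^sub>R v + t *\<^sub>R w)) has_derivative (\<lambda>u. frechet_derivative ?g (at (x + \<xi> *\<^sub>R v + t *\<^sub>R w)) (u *\<^sub>R w))) (at t)"
      by (rule has_derivative_compose[where f="\<lambda>t. x + \<xi> *\<^sub>R v + t *\<^sub>R w" and g="?g", OF _ Ck_SucD(1)[OF f' i]]) (auto intro!: derivative_eq_intros)
    moreover have "(\<lambda>u. frechet_derivative ?g (at (x + \<xi> *\<^sub>R v + t *\<^sub>R w)) (u *\<^sub>R w))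
        = (*) (frechet_derivative ?g (at (x + \<xi> *\<^sub>R v + t *\<^sub>R w)) w)"
      by (simp add: fun_eq_iff linear_cmul[OF lin])
    ultimately show ?thesis by (simp only: has_field_derivative_def)
  qed
  have "\<exists>z>0. z < h \<and> ?g (x + \<xi> *\<^sub>R v + h *\<^sub>R w) - ?g (x + \<xi> *\<^sub>R v + 0 *\<^sub>R w)
     = (h - 0) * frechet_derivative ?g (at (x + \<xi> *\<^sub>R v + z *\<^sub>R w)) w"
    by (rule MVT2[OF h(1), of "\<lambda>t. ?g (x + \<xi> *\<^sub>R v + t *\<^sub>R w)"]) (rule d2)
  then obtain \<eta> where "0 < \<eta>" "\<eta> < h" "?g (x + \<xi> *\<^sub>R v + h *\<^sub>R w) - ?g (x + \<xi> *\<^sub>R v + 0 *\<^sub>R w)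
     = h * frechet_derivative ?g (at (x + \<xi> *\<^sub>R v + \<eta> *\<^sub>R w)) w" by auto
  then show ?thesis using \<xi> by (intro exI[of _ \<xi>] exI[of _ \<eta>]) (simp only: mult.assoc simp_thms)
qed

lemma second_derivative_symmetric_real:
  fixes f :: "'a::real_normed_vector \<Rightarrow> real"
  assumes "open S" "x \<in> S" and f: "Ck_on 2 S f"
  shows "frechet_derivative (\<lambda>y. frechet_derivative f (at y) v) (at x) w
    = frechet_derivative (\<lambda>y. frechet_derivative f (at y) w) (at x) v"
proof (rule ccontr)
  let ?F = "\<lambda>v w x. frechet_derivative (\<lambda>y. frechet_derivative f (at y) v) (at x) w"
  assume neq: "?F v w x \<noteq> ?F w v x"
  \<comment> \<open>Half of the gap: numbers closer than \<open>e\<close> to the two limits cannot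
    be equal.\<close>
  define e where "e = \<bar>?F v w x - ?F w v x\<bar> / 2"
  have e: "e > 0" using neq by (simp add: e_def)
  have cont: "continuous_on S (?F v w)" for v w
    using Ck_SucD(2)[OF Ck_SucD(2)[of "Suc 0"]] f by (simp add: numeral_2_eq_2)
  obtain r where r: "r > 0" "ball x r \<subseteq> S" using assms openE by blast
  have ev: "\<forall>\<^sub>F y in nhds x. \<bar>?F v w y - ?F v w x\<bar> < e" for v w
  proof -
    have "isCont (?F v w) x" using cont[of v w] assms(1,2) by (simp add: continuous_on_eq_continuous_at)
    then have "(?F v w \<longlongrightarrow> ?F v w x) (nhds x)" unfolding isCont_def by (rule tendsto_at_iff_tendsto_nhds[THEN iffD1])
    from tendstoD[OF this e] show ?thesis by (simp only: dist_real_def)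
  qed
  have "\<forall>\<^sub>F y in nhds x. \<bar>?F v w y - ?F v w x\<bar> < e \<and> \<bar>?F w v y - ?F w v x\<bar> < e"
    by (rule eventually_conj) (rule ev)+
  then obtain d where d: "d > 0" "\<And>y. dist y x < d \<Longrightarrow> \<bar>?F v w y - ?F v w x\<bar> < e \<and> \<bar>?F w v y - ?F w v x\<bar> < e"
    unfolding eventually_nhds_metric by blast
  \<comment> \<open>The \<open>+ 1\<close> keeps the denominator positive and the bound on the
    parallelogram strict.\<close>
  define h where "h = min r d / (2 * (norm v + norm w + 1))"
  have nn: "norm v + norm w + 1 > 0" by (simp add: add_nonneg_pos)
  have h: "h > 0" using r d nn by (simp add: h_def)
  have hm: "h * (norm v + norm w) < min r d"
  proof -
    have N: "0 \<le> N \<Longrightarrow> N < 2 * (N + 1)" for N :: real by simp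
    have "h * (norm v + norm w) < h * (2 * (norm v + norm w + 1))"
      by (rule mult_strict_left_mono[OF N h]) simp
    also have "\<dots> = min r d" using nn by (simp add: h_def)
    finally show ?thesis .
  qed
  have near: "dist (x + s *\<^sub>R a + t *\<^sub>R b) x < d" if "0 < s" "s < h" "0 < t" "t < h" "norm a + norm b = norm v + norm w" for s t a b
  proof -
    have "norm (s *\<^sub>R a + t *\<^sub>R b) \<le> s * norm a + t * norm b"
      using norm_triangle_ineq[of "s *\<^sub>R a" "t *\<^sub>R b"] that by simp
    also have "\<dots> \<le> h * norm a + h * norm b" using that by (intro add_mono mult_right_mono) auto
    also have "\<dots> < d" using hm that(5) by (simp flip: distrib_left)
    finally show ?thesis by (simp add: dist_norm algebra_simps)
  qed
  have fb: "Ck_on 2 (ball x r) f" using Ck_subset[OF f r(2)] .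
  obtain s t where st: "0 < s" "s < h" "0 < t" "t < h"
    "f (x + h *\<^sub>R v + h *\<^sub>R w) - f (x + h *\<^sub>R v) - (f (x + h *\<^sub>R w) - f x) = h * h * ?F v w (x + s *\<^sub>R v + t *\<^sub>R w)"
    using second_difference_mvt[OF fb h, of v w] hm by auto
  obtain s' t' where st': "0 < s'" "s' < h" "0 < t'" "t' < h"
    "f (x + h *\<^sub>R w + h *\<^sub>R v) - f (x + h *\<^sub>R w) - (f (x + h *\<^sub>R v) - f x) = h * h * ?F w v (x + s' *\<^sub>R w + t' *\<^sub>R v)"
    using second_difference_mvt[OF fb h, of w v] hm by (auto simp: add.commute)
  have "h * h * ?F v w (x + s *\<^sub>R v + t *\<^sub>R w) = h * h * ?F w v (x + s' *\<^sub>R w + t' *\<^sub>R v)"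
    using st(5) st'(5) by (simp add: algebra_simps)
  then have "?F v w (x + s *\<^sub>R v + t *\<^sub>R w) = ?F w v (x + s' *\<^sub>R w + t' *\<^sub>R v)" using h by simp
  moreover have "\<bar>?F v w (x + s *\<^sub>R v + t *\<^sub>R w) - ?F v w x\<bar> < e" using d(2) near st by blast
  moreover have "\<bar>?F w v (x + s' *\<^sub>R w + t' *\<^sub>R v) - ?F w v x\<bar> < e" using d(2) near[of s' t' w v] st' by (simp add: add.commute)
  moreover have "a = b \<Longrightarrow> \<bar>a - c\<bar> < \<bar>c - d\<bar> / 2 \<Longrightarrow> \<bar>b - d\<bar> < \<bar>c - d\<bar> / 2 \<Longrightarrow> False" for a b c d :: real
    using abs_triangle_ineq[of "c - a" "a - d"] abs_minus_commute[of c a] by simp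
  ultimately show False unfolding e_def by blast
qed

lemma second_derivative_symmetric:
  fixes f :: "'a::real_normed_vector \<Rightarrow> 'b::euclidean_space"
  assumes "open S" "x \<in> S" and f: "Cinf_on S f"
  shows "frechet_derivative (\<lambda>y. frechet_derivative f (at y) v) (at x) w
    = frechet_derivative (\<lambda>y. frechet_derivative f (at y) w) (at x) v"
proof (rule euclidean_eqI)
  fix b :: 'b assume "b \<in> Basis"
  have bl: "bounded_linear (\<lambda>z::'b. z \<bullet> b)" by (rule bounded_linear_inner_left)
  have 1: "frechet_derivative (\<lambda>y. g y \<bullet> b) (at y) u = frechet_derivative g (at y) u \<bullet> b"
    if "Cinf_on S g" "y \<in> S" for g :: "'a \<Rightarrow> 'b" and y u
    using frechet_derivative_at[OF bounded_linear.has_derivative[OF bl Cinf_has_derivative[OF that]]] by metis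
  have "frechet_derivative (\<lambda>y. frechet_derivative (\<lambda>y. f y \<bullet> b) (at y) v) (at x) w =
      frechet_derivative (\<lambda>y. frechet_derivative f (at y) v) (at x) w \<bullet> b" for v w
    using frechet_derivative_cong[OF assms(1,2), of "\<lambda>y. frechet_derivative (\<lambda>y. f y \<bullet> b) (at y) v" "\<lambda>y. frechet_derivative f (at y) v \<bullet> b"]
      1[OF f] 1[OF Cinf_derivative[OF f] assms(2)] by simp
  moreover have "Ck_on 2 S (\<lambda>y. f y \<bullet> b)"
    using Cinf_bounded_linear[OF assms(1) bl f] by (simp add: Cinf_on_def)
  ultimately show "frechet_derivative (\<lambda>y. frechet_derivative f (at y) v) (at x) w \<bullet> b
      = frechet_derivative (\<lambda>y. frechet_derivative f (at y) w) (at x) v \<bullet> b"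
    using second_derivative_symmetric_real[OF assms(1,2)] by metis
qed

subsection \<open>Bump functions\<close>

text \<open>A family closed under differentiation: the derivative of
  \<open>p (1/t) * exp (- 1 / t)\<close> belongs to the polynomial \<open>x * x * (p - p')\<close>.
  Smoothness at 0 thus follows by induction for all \<open>p\<close> at once.\<close>

definition flat :: "real poly \<Rightarrow> real \<Rightarrow> real" where
  "flat p t = (if t > 0 then poly p (1 / t) * exp (- 1 / t) else 0)"

lemma tendsto_poly_div_exp: "((\<lambda>x::real. poly p x * exp (- x)) \<longlongrightarrow> 0) at_top"
proof -
  have "((\<lambda>x::real. \<Sum>i\<le>degree p. coeff p i * (x ^ i / exp x)) \<longlongrightarrow> (\<Sum>i\<le>degree p. coeff p i * 0)) at_top"
    by (intro tendsto_sum tendsto_mult tendsto_const tendsto_power_div_exp_0)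
  then show ?thesis by (simp add: poly_altdef exp_minus field_simps sum_distrib_left)
qed

lemma flat_has_derivative:
  "(flat p has_real_derivative flat (pCons 0 (pCons 0 (p - pderiv p))) t) (at t)"
proof -
  consider "t > 0" | "t < 0" | "t = 0" by linarith
  then show ?thesis
  proof cases
    case 1
    have "((\<lambda>t. poly p (1 / t) * exp (- 1 / t)) has_real_derivative flat (pCons 0 (pCons 0 (p - pderiv p))) t) (at t)"
      unfolding flat_def using 1
      by (auto intro!: derivative_eq_intros DERIV_chain'[OF _ poly_DERIV] simp: field_simps power2_eq_square)
    then show ?thesis
      by (rule has_field_derivative_transform_within_open[where S="{0<..}"]) (use 1 in \<open>auto simp: flat_def\<close>)
  next
    case 2
    have "((\<lambda>t::real. 0::real) has_real_derivative flat (pCons 0 (pCons 0 (p - pderiv p))) t) (at t)"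
      unfolding flat_def using 2 by auto
    then show ?thesis
      by (rule has_field_derivative_transform_within_open[where S="{..<0}"]) (use 2 in \<open>auto simp: flat_def\<close>)
  next
    case 3
    have "((\<lambda>h. (flat p (0 + h) - flat p 0) / h) \<longlongrightarrow> 0) (at 0)"
    proof (rule filterlim_split_at)
      show "((\<lambda>h. (flat p (0 + h) - flat p 0) / h) \<longlongrightarrow> 0) (at_left 0)"
        by (rule tendsto_eventually) (auto simp: flat_def eventually_at_filter)
      \<comment> \<open>With \<open>x = 1 / h\<close>, the difference quotient on the right is
        \<open>x * p x * exp (- x)\<close>.\<close>
      have "((\<lambda>h. poly (pCons 0 p) (inverse h) * exp (- inverse h)) \<longlongrightarrow> 0) (at_right (0::real))"
        by (rule filterlim_compose[OF tendsto_poly_div_exp filterlim_inverse_at_top_right])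
      then show "((\<lambda>h. (flat p (0 + h) - flat p 0) / h) \<longlongrightarrow> 0) (at_right 0)"
        by (rule Lim_transform_eventually) (auto simp: flat_def eventually_at_filter field_simps)
    qed
    then show ?thesis using 3 by (simp add: DERIV_def flat_def)
  qed
qed

lemma Cinf_flat: "Cinf_on UNIV (flat p)"
proof -
  have "Ck_on k UNIV (flat p)" for k
  proof (induction k arbitrary: p)
    case 0
    then show ?case using DERIV_isCont[OF flat_has_derivative] by (simp add: continuous_at_imp_continuous_on)
  next
    case (Suc k)
    show ?case
    proof (rule Ck_SucI[OF open_UNIV])
      show "(flat p has_derivative (\<lambda>v. flat (pCons 0 (pCons 0 (p - pderiv p))) t * v)) (at t)" for t
        using flat_has_derivative[of p t] by (simp add: has_field_derivative_def)
      show "Ck_on k UNIV (\<lambda>t. flat (pCons 0 (pCons 0 (p - pderiv p))) t * v)" for v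
        by (rule Ck_bounded_linear[OF open_UNIV bounded_linear_mult_left Suc.IH])
    qed
  qed
  then show ?thesis by (simp add: Cinf_on_def)
qed

lemma bump_exists:
  fixes x0 :: "'a::euclidean_space"
  assumes "open U" "x0 \<in> U"
  shows "\<exists>f r. Cinf_on UNIV f \<and> f x0 = (1::real) \<and> cball x0 r \<subseteq> U \<and> (\<forall>x. x \<notin> cball x0 r \<longrightarrow> f x = 0)"
proof -
  obtain r where r: "r > 0" "cball x0 r \<subseteq> U" using assms open_contains_cball by blast
  define f where "f x = flat 1 (r\<^sup>2 - (x - x0) \<bullet> (x - x0)) / flat 1 (r\<^sup>2)" for x
  have sub: "Cinf_on UNIV (\<lambda>x::'a. x - x0)" by (intro Cinf_diff Cinf_ident Cinf_const open_UNIV)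
  have "Cinf_on UNIV (\<lambda>x. r\<^sup>2 - (x - x0) \<bullet> (x - x0))"
    by (intro Cinf_diff Cinf_const open_UNIV Cinf_bounded_bilinear[OF open_UNIV bounded_bilinear_inner] sub)
  then have "Cinf_on UNIV (\<lambda>x. flat 1 (r\<^sup>2 - (x - x0) \<bullet> (x - x0)))"
    by (rule Cinf_compose[OF open_UNIV subset_UNIV _ Cinf_flat])
  then have "Cinf_on UNIV f"
    unfolding f_def divide_inverse by (rule Cinf_bounded_linear[OF open_UNIV bounded_linear_mult_left])
  moreover have "f x = 0" if "x \<notin> cball x0 r" for x
  proof -
    have "r < norm (x - x0)" using that by (simp add: dist_norm norm_minus_commute)
    then have "r\<^sup>2 < (norm (x - x0))\<^sup>2" using r(1) by (intro power_strict_mono) auto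
    then show ?thesis by (simp add: f_def flat_def power2_norm_eq_inner)
  qed
  moreover have "f x0 = 1" using r(1) by (simp add: f_def flat_def)
  ultimately show ?thesis using r(2) by blast
qed

section \<open>Differential forms in coordinates\<close>

definition pull :: "('e \<Rightarrow> 'e) \<Rightarrow> 'e form \<Rightarrow> 'e form" where
  "pull A \<phi> = (\<lambda>vs. \<phi> (map A vs))"

lemma pull_Nil [simp]: "pull A \<phi> [] = \<phi> []"
  by (simp add: pull_def)

lemma pull_Cons: "pull A \<phi> (v # vs) = pull A (iprod (A v) \<phi>) vs"
  by (simp add: pull_def iprod_def)

lemma iprod_pull: "iprod v (pull A \<phi>) = pull A (iprod (A v) \<phi>)"
  by (simp add: pull_def iprod_def fun_eq_iff)

lemma pull_linear:
  "pull A (\<phi> + \<psi>) = pull A \<phi> + pull A \<psi>" "pull A (fsc a \<phi>) = fsc a (pull A \<phi>)" "pull A 0 = 0"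
  "pull A (\<phi> - \<psi>) = pull A \<phi> - pull A \<psi>"
  by (auto simp: pull_def fun_eq_iff)

lemma pull_sum: "pull A (sum f I) = (\<Sum>i\<in>I. pull A (f i))"
  by (rule additive_sum[of "pull A"]) (simp_all add: pull_linear)

lemma pull_pull: "pull A (pull B \<phi>) = pull (B \<circ> A) \<phi>"
  by (simp add: pull_def)

lemma pull_wedge: "pull A (wedge \<alpha> \<beta>) = wedge (pull A \<alpha>) (pull A \<beta>)"
  by (simp add: pull_def wedge_def fun_eq_iff nths_map)

lemma alt_form_pull:
  assumes "linear A" "alt_form \<phi>"
  shows "alt_form (pull A \<phi>)"
  unfolding alt_form_def pull_def
proof (intro conjI allI)
  fix us vs x ws
  show "linear (\<lambda>x. \<phi> (map A (us @ x # vs)))"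
    using linear_compose[OF assms(1) alt_form_linear[OF assms(2), of "map A us" "map A vs"]] by (simp add: o_def)
  show "\<phi> (map A (us @ x # vs @ x # ws)) = 0" using alt_form_zero[OF assms(2)] by simp
qed

lemma alt_form_expand: "alt_form \<phi> \<Longrightarrow> \<phi> (x # vs) = (\<Sum>b\<in>Basis. of_real (x \<bullet> b) * \<phi> (b # vs))"
proof -
  assume alt: "alt_form \<phi>"
  have "iprod x \<phi> = (\<Sum>b\<in>Basis. fsc (of_real (x \<bullet> b)) (iprod b \<phi>))"
    using iprod_sum[OF alt, of "\<lambda>b. (x \<bullet> b) *\<^sub>R b" Basis] by (simp add: euclidean_representation iprod_scaleR[OF alt])
  then have "iprod x \<phi> vs = (\<Sum>b\<in>Basis. fsc (of_real (x \<bullet> b)) (iprod b \<phi>)) vs" by (rule fun_cong)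
  then show ?thesis by (simp add: sum_fun_apply iprod_def)
qed

lemma eps_explicit:
  "eps \<xi> \<phi> vs = (\<Sum>i<length vs. (- 1) ^ i * of_real (\<xi> (vs ! i)) * \<phi> (take i vs @ drop (Suc i) vs))"
proof (induction vs arbitrary: \<phi>)
  case (Cons v vs)
  show ?case
    by (simp add: eps_Cons Cons.IH lessThan_Suc_eq_insert_0 sum.insert_if sum.reindex image_iff sum_negf iprod_def)
qed simp

text \<open>The exterior derivative at a point as a function of the directional derivatives
  \<open>D b\<close>; this separates its algebra from the differentiation.\<close>

definition dform :: "('e::euclidean_space \<Rightarrow> 'e form) \<Rightarrow> 'e form" where
  "dform D = (\<Sum>b\<in>Basis. eps (dx b) (D b))"

lemma dform_explicit:
  assumes "\<And>us. linear (\<lambda>b. D b us)"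
  shows "dform D vs = (\<Sum>i<length vs. (- 1) ^ i * D (vs ! i) (take i vs @ drop (Suc i) vs))"
proof -
  have e: "D v us = (\<Sum>b\<in>Basis. of_real (v \<bullet> b) * D b us)" for v us
    by (subst euclidean_representation[symmetric, of v], subst linear_sum[OF assms])
       (simp add: linear_cmul[OF assms] scaleR_conv_of_real)
  show ?thesis
    unfolding dform_def sum_fun_apply eps_explicit
    by (subst sum.swap) (simp add: e[of "vs ! _"] sum_distrib_left mult.assoc)
qed

section \<open>Smooth families of alternating forms\<close>

definition sform :: "'e::euclidean_space set \<Rightarrow> ('e \<Rightarrow> 'e form) \<Rightarrow> bool" where
  "sform S F \<longleftrightarrow> (\<forall>y\<in>S. alt_form (F y)) \<and> (\<forall>vs. Cinf_on S (\<lambda>y. F y vs))"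

lemma sform_alt: "sform S F \<Longrightarrow> y \<in> S \<Longrightarrow> alt_form (F y)"
  and sform_Cinf: "sform S F \<Longrightarrow> Cinf_on S (\<lambda>y. F y vs)"
  by (auto simp: sform_def)

lemma sform_cong: "open S \<Longrightarrow> (\<And>y. y \<in> S \<Longrightarrow> F y = G y) \<Longrightarrow> sform S F \<Longrightarrow> sform S G"
  unfolding sform_def by (metis (no_types, lifting) Cinf_cong)

lemma sform_add: "open S \<Longrightarrow> sform S F \<Longrightarrow> sform S G \<Longrightarrow> sform S (\<lambda>y. F y + G y)"
  by (simp add: sform_def alt_form_simps Cinf_add)

lemma sform_scale: "open S \<Longrightarrow> Cinf_on S f \<Longrightarrow> sform S F \<Longrightarrow> sform S (\<lambda>y. fsc (f y) (F y))"
  by (simp add: sform_def alt_form_simps Cinf_mult)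

lemma sform_fsc: "open S \<Longrightarrow> sform S F \<Longrightarrow> sform S (\<lambda>y. fsc a (F y))"
  by (simp add: sform_scale Cinf_const)

lemma sform_diff: "open S \<Longrightarrow> sform S F \<Longrightarrow> sform S G \<Longrightarrow> sform S (\<lambda>y. F y - G y)"
  by (simp add: sform_def alt_form_simps Cinf_diff)

lemma sform_sum: "open S \<Longrightarrow> (\<And>i. i \<in> I \<Longrightarrow> sform S (F i)) \<Longrightarrow> sform S (\<lambda>y. \<Sum>i\<in>I. F i y)"
  by (simp add: sform_def alt_form_sum Cinf_sum sum_fun_apply)

text \<open>Smoothness is asked only for fixed arguments, so the moving vector \<open>X y\<close> is
  expanded in the basis, where linearity of the form applies.\<close>

lemma sform_iprod:
  assumes S: "open S" and F: "sform S F" and X: "Cinf_on S X"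
  shows "sform S (\<lambda>y. iprod (X y) (F y))"
proof -
  have "Cinf_on S (\<lambda>y. iprod (X y) (F y) vs)" for vs
  proof (rule Cinf_cong[OF S])
    show "Cinf_on S (\<lambda>y. \<Sum>b\<in>Basis. of_real (X y \<bullet> b) * F y (b # vs))"
      by (intro Cinf_sum Cinf_mult Cinf_of_real Cinf_bounded_linear[OF S bounded_linear_inner_left] S X sform_Cinf[OF F])
    show "(\<Sum>b\<in>Basis. of_real (X y \<bullet> b) * F y (b # vs)) = iprod (X y) (F y) vs" if "y \<in> S" for y
      using alt_form_expand[OF sform_alt[OF F that], of "X y" vs] by (simp add: iprod_def)
  qed
  then show ?thesis using F by (simp add: sform_def alt_form_iprod)
qed

lemma sform_eps:
  assumes S: "open S" and F: "sform S F" and X: "Cinf_on S \<xi>"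
  shows "sform S (\<lambda>y. eps (\<xi> y) (F y))"
proof -
  have "Cinf_on S (\<lambda>y. eps (\<xi> y) (F y) vs)" for vs
    using F
  proof (induction vs arbitrary: F)
    case Nil
    then show ?case by (simp add: Cinf_const)
  next
    case (Cons v vs)
    show ?case unfolding eps_Cons
      by (intro Cinf_diff Cinf_mult Cinf_of_real Cinf_bounded_linear[OF S blinfun.bounded_linear_left] S X
          sform_Cinf[OF Cons.prems] Cons.IH sform_iprod Cons.prems Cinf_const)
  qed
  then show ?thesis using F by (simp add: sform_def alt_form_eps)
qed

lemma sform_cliff_real:
  assumes S: "open S" and F: "sform S F" and w: "Cinf_on S w"
  shows "sform S (\<lambda>y. cliff_real (w y) (F y))"
  unfolding cliff_real_eq
  by (intro sform_add sform_iprod sform_eps S F Cinf_bounded_linear[OF S bounded_linear_fst w]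
      Cinf_bounded_linear[OF S bounded_linear_snd w])

lemma sform_pull:
  assumes S: "open S" and F: "sform S F" and T: "\<And>v. Cinf_on S (\<lambda>y. T y v)" "\<And>y. y \<in> S \<Longrightarrow> linear (T y)"
  shows "sform S (\<lambda>y. pull (T y) (F y))"
proof -
  have "Cinf_on S (\<lambda>y. pull (T y) (F y) vs)" for vs
    using F
  proof (induction vs arbitrary: F)
    case Nil
    then show ?case by (simp add: sform_Cinf)
  next
    case (Cons v vs)
    show ?case unfolding pull_Cons by (intro Cons.IH sform_iprod S Cons.prems T)
  qed
  then show ?thesis using F T by (simp add: sform_def alt_form_pull)
qed

lemma sform_const: "alt_form \<phi> \<Longrightarrow> sform S (\<lambda>y. \<phi>)"
  by (simp add: sform_def Cinf_const)

text \<open>Differentiation value by value, since functions on lists of arbitrary length carry no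
  norm.\<close>

definition HD :: "('e::euclidean_space \<Rightarrow> 'e form) \<Rightarrow> 'e \<Rightarrow> ('e \<Rightarrow> 'e form) \<Rightarrow> bool" where
  "HD F x D \<longleftrightarrow> (\<forall>vs. ((\<lambda>y. F y vs) has_derivative (\<lambda>b. D b vs)) (at x))"

definition fd :: "('e::euclidean_space \<Rightarrow> 'e form) \<Rightarrow> 'e \<Rightarrow> 'e \<Rightarrow> 'e form" where
  "fd F x b vs = frechet_derivative (\<lambda>y. F y vs) (at x) b"

lemma HD_D: "HD F x D \<Longrightarrow> ((\<lambda>y. F y vs) has_derivative (\<lambda>b. D b vs)) (at x)"
  by (simp add: HD_def)

lemma HD_fd: "HD F x D \<Longrightarrow> fd F x = D"
  by (intro ext) (metis HD_def fd_def frechet_derivative_at)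

lemma sform_HD: "sform S F \<Longrightarrow> x \<in> S \<Longrightarrow> HD F x (fd F x)"
  unfolding HD_def fd_def by (simp add: Cinf_has_derivative[OF sform_Cinf])

lemma HD_linear: "HD F x D \<Longrightarrow> linear (\<lambda>b. D b us)"
  using HD_D has_derivative_linear by blast

lemma HD_cong:
  assumes "open S" "x \<in> S" "\<And>y. y \<in> S \<Longrightarrow> F y = G y" "HD F x D"
  shows "HD G x D"
  unfolding HD_def
  using has_derivative_transform_within_open[OF HD_D[OF assms(4)] assms(1,2)] assms(3) by metis

lemma HD_alt:
  assumes S: "open S" "x \<in> S" and F: "\<And>y. y \<in> S \<Longrightarrow> alt_form (F y)" and H: "HD F x D"
  shows "alt_form (D b)"
proof -
  \<comment> \<open>Multilinearity and vanishing on repeated vectors are linear equations that hold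
    near \<open>x\<close>; the derivative of a function that is zero near \<open>x\<close> is zero,
    so they pass to \<open>D b\<close>.\<close>
  have u: "D' b = 0" if "(f has_derivative D') (at x)" "\<And>y. y \<in> S \<Longrightarrow> f y = 0" for f :: "'a \<Rightarrow> complex" and D'
  proof -
    have "((\<lambda>y. 0) has_derivative D') (at x)"
      by (rule has_derivative_transform_within_open[OF that(1) S]) (rule that(2))
    then show ?thesis using has_derivative_unique[OF _ has_derivative_const] by metis
  qed
  have "D b (us @ (v + w) # vs) - (D b (us @ v # vs) + D b (us @ w # vs)) = 0" for us v w vs
    by (rule u[OF has_derivative_diff[OF HD_D[OF H] has_derivative_add[OF HD_D[OF H] HD_D[OF H]]]])
       (simp add: linear_add[OF alt_form_linear[OF F]])
  moreover have "D b (us @ (r *\<^sub>R v) # vs) - r *\<^sub>R D b (us @ v # vs) = 0" for us v r vs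
    by (rule u[OF has_derivative_diff[OF HD_D[OF H] has_derivative_scaleR_right[OF HD_D[OF H]]]])
       (simp add: linear_cmul[OF alt_form_linear[OF F]])
  moreover have "D b (us @ v # vs @ v # ws) = 0" for us v vs ws
    by (rule u[OF HD_D[OF H]]) (simp add: alt_form_zero[OF F])
  ultimately show ?thesis by (simp add: alt_form_def linear_iff)
qed

lemma HD_add: "HD F x D \<Longrightarrow> HD G x E \<Longrightarrow> HD (\<lambda>y. F y + G y) x (\<lambda>b. D b + E b)"
  unfolding HD_def by (simp add: has_derivative_add)

lemma HD_fsc: "HD F x D \<Longrightarrow> HD (\<lambda>y. fsc a (F y)) x (\<lambda>b. fsc a (D b))"
  unfolding HD_def by (simp add: has_derivative_mult_right)

lemma HD_sum: "(\<And>i. i \<in> I \<Longrightarrow> HD (F i) x (D i)) \<Longrightarrow> HD (\<lambda>y. \<Sum>i\<in>I. F i y) x (\<lambda>b. \<Sum>i\<in>I. D i b)"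
  unfolding HD_def by (simp add: has_derivative_sum sum_fun_apply)

lemma HD_compose: "HD F (\<tau> x) D \<Longrightarrow> (\<tau> has_derivative A) (at x) \<Longrightarrow> HD (\<lambda>y. F (\<tau> y)) x (\<lambda>b. D (A b))"
  unfolding HD_def using has_derivative_compose[of \<tau> A x UNIV] by blast

lemma HD_iprod:
  assumes S: "open S" "x \<in> S" and F: "\<And>y. y \<in> S \<Longrightarrow> alt_form (F y)" and H: "HD F x D"
    and X: "(X has_derivative X') (at x)"
  shows "HD (\<lambda>y. iprod (X y) (F y)) x (\<lambda>b. iprod (X' b) (F x) + iprod (X x) (D b))"
  unfolding HD_def
proof
  fix vs
  have "((\<lambda>y. \<Sum>c\<in>Basis. of_real (X y \<bullet> c) * F y (c # vs)) has_derivative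
     (\<lambda>b. \<Sum>c\<in>Basis. of_real (X x \<bullet> c) * D b (c # vs) + of_real (X' b \<bullet> c) * F x (c # vs))) (at x)"
    by (intro has_derivative_sum has_derivative_mult HD_D[OF H] bounded_linear.has_derivative[OF bounded_linear_of_real]
       bounded_linear.has_derivative[OF bounded_linear_inner_left] X)
  moreover have "(\<lambda>b. \<Sum>c\<in>Basis. of_real (X x \<bullet> c) * D b (c # vs) + of_real (X' b \<bullet> c) * F x (c # vs))
     = (\<lambda>b. (iprod (X' b) (F x) + iprod (X x) (D b)) vs)"
  proof
    fix b
    have "iprod (X' b) (F x) vs = (\<Sum>c\<in>Basis. of_real (X' b \<bullet> c) * F x (c # vs))"
      unfolding iprod_def by (rule alt_form_expand[OF F[OF S(2)]])
    moreover have "iprod (X x) (D b) vs = (\<Sum>c\<in>Basis. of_real (X x \<bullet> c) * D b (c # vs))"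
      unfolding iprod_def by (rule alt_form_expand[OF HD_alt[OF S F H]])
    ultimately show "(\<Sum>c\<in>Basis. of_real (X x \<bullet> c) * D b (c # vs) + of_real (X' b \<bullet> c) * F x (c # vs))
        = (iprod (X' b) (F x) + iprod (X x) (D b)) vs" by (simp add: sum.distrib)
  qed
  ultimately have "((\<lambda>y. \<Sum>c\<in>Basis. of_real (X y \<bullet> c) * F y (c # vs)) has_derivative
     (\<lambda>b. (iprod (X' b) (F x) + iprod (X x) (D b)) vs)) (at x)" by simp
  then show "((\<lambda>y. iprod (X y) (F y) vs) has_derivative (\<lambda>b. (iprod (X' b) (F x) + iprod (X x) (D b)) vs)) (at x)"
    by (rule has_derivative_transform_within_open[OF _ S]) (simp only: iprod_def alt_form_expand[OF F, symmetric])
qed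

lemma HD_eps:
  assumes S: "open S" "x \<in> S" and F: "\<And>y. y \<in> S \<Longrightarrow> alt_form (F y)" and H: "HD F x D"
    and X: "(\<xi> has_derivative \<xi>') (at x)"
  shows "HD (\<lambda>y. eps (\<xi> y) (F y)) x (\<lambda>b. eps (\<xi>' b) (F x) + eps (\<xi> x) (D b))"
proof -
  have "((\<lambda>y. eps (\<xi> y) (F y) vs) has_derivative (\<lambda>b. eps (\<xi>' b) (F x) vs + eps (\<xi> x) (D b) vs)) (at x)" for vs
    using F H
  proof (induction vs arbitrary: F D)
    case Nil
    then show ?case by simp
  next
    case (Cons v vs)
    have IH: "((\<lambda>y. eps (\<xi> y) (iprod v (F y)) vs) has_derivative
       (\<lambda>b. eps (\<xi>' b) (iprod v (F x)) vs + eps (\<xi> x) (iprod v (D b)) vs)) (at x)"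
    proof (rule Cons.IH)
      show "HD (\<lambda>y. iprod v (F y)) x (\<lambda>b. iprod v (D b))"
        using Cons.prems(2) by (simp add: HD_def iprod_def)
    qed (simp add: alt_form_iprod Cons.prems)
    have "((\<lambda>y. of_real (\<xi> y v) * F y vs - eps (\<xi> y) (iprod v (F y)) vs) has_derivative
      (\<lambda>b. (of_real (\<xi> x v) * D b vs + of_real (\<xi>' b v) * F x vs) - (eps (\<xi>' b) (iprod v (F x)) vs + eps (\<xi> x) (iprod v (D b)) vs))) (at x)"
      by (intro has_derivative_diff has_derivative_mult HD_D[OF Cons.prems(2)] IH
          bounded_linear.has_derivative[OF bounded_linear_of_real] bounded_linear.has_derivative[OF blinfun.bounded_linear_left] X)
    then show ?case by (simp add: eps_Cons algebra_simps)
  qed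
  then show ?thesis by (simp add: HD_def)
qed

lemma HD_cliff_real:
  assumes S: "open S" "x \<in> S" and F: "\<And>y. y \<in> S \<Longrightarrow> alt_form (F y)" and H: "HD F x D"
    and w: "(w has_derivative w') (at x)"
  shows "HD (\<lambda>y. cliff_real (w y) (F y)) x (\<lambda>b. cliff_real (w' b) (F x) + cliff_real (w x) (D b))"
proof -
  have "HD (\<lambda>y. iprod (fst (w y)) (F y) + eps (snd (w y)) (F y)) x
    (\<lambda>b. (iprod (fst (w' b)) (F x) + iprod (fst (w x)) (D b)) + (eps (snd (w' b)) (F x) + eps (snd (w x)) (D b)))"
    by (intro HD_add HD_iprod[OF S F H] HD_eps[OF S F H] has_derivative_fst has_derivative_snd w)
  then show ?thesis by (simp add: cliff_real_eq add_ac)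
qed

text \<open>\<open>pd A B\<close> is the derivative of \<open>pull T\<close> at \<open>T = A\<close> in the direction \<open>B\<close>.\<close>

primrec pd :: "('e \<Rightarrow> 'e) \<Rightarrow> ('e \<Rightarrow> 'e) \<Rightarrow> 'e list \<Rightarrow> 'e form \<Rightarrow> complex" where
  "pd A B [] \<phi> = 0"
| "pd A B (w # vs) \<phi> = pd A B vs (iprod (A w) \<phi>) + pull A (iprod (B w) \<phi>) vs"

lemma HD_pull:
  assumes S: "open S" "x \<in> S" and F: "\<And>y. y \<in> S \<Longrightarrow> alt_form (F y)" and H: "HD F x D"
    and T: "\<And>w. ((\<lambda>y. T y w) has_derivative (\<lambda>b. T' b w)) (at x)"
  shows "HD (\<lambda>y. pull (T y) (F y)) x (\<lambda>b. pull (T x) (D b) + (\<lambda>vs. pd (T x) (T' b) vs (F x)))"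
proof -
  have "((\<lambda>y. pull (T y) (F y) vs) has_derivative (\<lambda>b. pull (T x) (D b) vs + pd (T x) (T' b) vs (F x))) (at x)" for vs
    using F H
  proof (induction vs arbitrary: F D)
    case Nil
    then show ?case using HD_D[OF Nil(2), of "[]"] by simp
  next
    case (Cons w vs)
    have "((\<lambda>y. pull (T y) (iprod (T y w) (F y)) vs) has_derivative
        (\<lambda>b. pull (T x) (iprod (T' b w) (F x) + iprod (T x w) (D b)) vs + pd (T x) (T' b) vs (iprod (T x w) (F x)))) (at x)"
      by (rule Cons.IH[OF _ HD_iprod[OF S Cons.prems T, of w]]) (simp add: alt_form_iprod Cons.prems(1))
    then show ?case
      by (simp only: pull_Cons pull_linear pd.simps) (simp only: plus_fun_apply add_ac)
  qed
  then show ?thesis by (simp add: HD_def)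
qed

text \<open>\<open>pd A B\<close> replaces \<open>A\<close> by \<open>B\<close> in one argument at a
  time. Such a derivation is a sum of a contraction with \<open>B c\<close> followed by
  multiplication with the dual covector, as the recursion confirms.\<close>

lemma pd_eq:
  assumes alt: "alt_form \<phi>" and B: "linear B"
  shows "pd A B vs \<phi> = (\<Sum>c\<in>Basis. eps (dx c) (pull A (iprod (B c) \<phi>))) vs"
  using alt
proof (induction vs arbitrary: \<phi>)
  case Nil
  then show ?case by (simp add: sum_fun_apply)
next
  case (Cons w vs)
  have "iprod (B w) \<phi> = (\<Sum>c\<in>Basis. fsc (of_real (w \<bullet> c)) (iprod (B c) \<phi>))"
  proof -
    have "B w = (\<Sum>c\<in>Basis. (w \<bullet> c) *\<^sub>R B c)"
      by (subst euclidean_representation[symmetric, of w], subst linear_sum[OF B]) (simp add: linear_cmul[OF B])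
    then show ?thesis by (simp add: iprod_sum[OF Cons.prems] iprod_scaleR[OF Cons.prems])
  qed
  then have 1: "pull A (iprod (B w) \<phi>) vs = (\<Sum>c\<in>Basis. of_real (w \<bullet> c) * pull A (iprod (B c) \<phi>) vs)"
    by (simp only: pull_sum pull_linear sum_fun_apply fsc_apply)
  have 2: "iprod w (pull A (iprod (B c) \<phi>)) = - pull A (iprod (B c) (iprod (A w) \<phi>))" for c
    unfolding iprod_pull by (subst iprod_anticommute[OF Cons.prems]) (simp add: pull_def fun_eq_iff)
  show ?case
    using Cons.IH[OF alt_form_iprod[OF Cons.prems, of "A w"]]
    by (simp add: 1 sum_fun_apply eps_Cons 2 eps_linear sum.distrib)
qed

text \<open>The contribution of the second derivatives of a coordinate change to the exterior
  derivative of a pullback: a symmetric bilinear map is antisymmetrized.\<close>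

lemma dform_pd_zero:
  assumes alt: "alt_form \<phi>" and B: "\<And>v. linear (B v)" "\<And>v w. B v w = B w v"
  shows "dform (\<lambda>b vs. pd A (B b) vs \<phi>) = 0"
proof -
  have "dform (\<lambda>b vs. pd A (B b) vs \<phi>) vs = 0" for vs
    using alt
  proof (induction vs arbitrary: \<phi>)
    case Nil
    then show ?case by (simp add: dform_def sum_fun_apply)
  next
    case (Cons w vs)
    have Bw: "B w c = (\<Sum>b\<in>Basis. (w \<bullet> b) *\<^sub>R B b c)" for c
      using B by (subst euclidean_representation[symmetric, of w], subst B(2), subst linear_sum[OF B(1)])
        (simp add: linear_cmul[OF B(1)] B(2)[of c])
    have 1: "(\<Sum>b\<in>Basis. of_real (w \<bullet> b) * pd A (B b) vs \<phi>) = pd A (B w) vs \<phi>"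
    proof -
      have "pull A (iprod (B w c) \<phi>) = (\<Sum>b\<in>Basis. fsc (of_real (w \<bullet> b)) (pull A (iprod (B b c) \<phi>)))" for c
        by (simp add: Bw iprod_sum[OF Cons.prems] iprod_scaleR[OF Cons.prems] pull_sum pull_linear)
      then show ?thesis
        unfolding pd_eq[OF Cons.prems B(1)]
        by (simp only: eps_sum eps_linear) (simp only: sum_fun_apply fsc_apply sum_distrib_left, rule sum.swap)
    qed
    have 2: "iprod w (\<lambda>vs. pd A (B b) vs \<phi>) = (\<lambda>vs. pd A (B b) vs (iprod (A w) \<phi>)) + pull A (iprod (B w b) \<phi>)" for b
      by (auto simp: iprod_def fun_eq_iff B(2)[of b w])
    \<comment> \<open>The two occurrences of \<open>pd A (B w)\<close> have different origins: one
      is the value of \<open>dx b\<close> on \<open>w\<close>, the other the contraction of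
      \<open>pd A (B b)\<close> with \<open>w\<close>, where the symmetry of \<open>B\<close> is
      used.\<close>
    have "dform (\<lambda>b vs. pd A (B b) vs \<phi>) (w # vs) = pd A (B w) vs \<phi>
       - (dform (\<lambda>b vs. pd A (B b) vs (iprod (A w) \<phi>)) vs + pd A (B w) vs \<phi>)"
      unfolding pd_eq[OF Cons.prems B(1), of A w]
      by (simp add: dform_def sum_fun_apply eps_Cons 2 eps_linear sum_subtractf sum.distrib 1 pd_eq[OF Cons.prems B(1), of A w])
    then show ?case using Cons.IH[OF alt_form_iprod[OF Cons.prems]] by simp
  qed
  then show ?thesis by (simp add: fun_eq_iff)
qed

lemma pull_eps: "linear A \<Longrightarrow> pull A (eps \<xi> \<phi>) = eps (Blinfun (\<lambda>v. blinfun_apply \<xi> (A v))) (pull A \<phi>)"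
proof -
  assume A: "linear A"
  have "bounded_linear (\<lambda>v. blinfun_apply \<xi> (A v))"
    using A by (intro bounded_linear_compose[OF blinfun.bounded_linear_right]) (simp add: linear_conv_bounded_linear)
  then have b: "blinfun_apply (Blinfun (\<lambda>v. blinfun_apply \<xi> (A v))) = (\<lambda>v. blinfun_apply \<xi> (A v))"
    by (rule bounded_linear_Blinfun_apply)
  have "pull A (eps \<xi> \<phi>) vs = eps (Blinfun (\<lambda>v. blinfun_apply \<xi> (A v))) (pull A \<phi>) vs" for vs
  proof (induction vs arbitrary: \<phi>)
    case (Cons v vs)
    have "pull A (eps \<xi> \<phi>) (v # vs) = of_real (\<xi> (A v)) * pull A \<phi> vs - pull A (eps \<xi> (iprod (A v) \<phi>)) vs"
      by (simp add: pull_def eps_Cons)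
    then show ?case by (simp add: eps_Cons b iprod_pull Cons.IH)
  qed simp
  then show ?thesis by (simp add: fun_eq_iff)
qed

text \<open>Naturality of the exterior derivative. \<open>T\<close> is the Jacobian of
  \<open>\<tau>\<close>; the chain rule gives the transformed derivatives of \<open>F\<close>, and
  the derivative \<open>B\<close> of the Jacobian drops out by symmetry.\<close>

lemma dform_pull:
  assumes S: "open S" "\<tau> x \<in> S" and F: "\<And>y. y \<in> S \<Longrightarrow> alt_form (F y)" and H: "HD F (\<tau> x) D"
    and U: "open U" "x \<in> U" "\<tau> ` U \<subseteq> S"
    and \<tau>: "(\<tau> has_derivative T x) (at x)"
    and T: "\<And>w. ((\<lambda>y. T y w) has_derivative (\<lambda>b. B b w)) (at x)" and lin: "\<And>y. y \<in> U \<Longrightarrow> linear (T y)"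
    and B: "\<And>v w. B v w = B w v"
  shows "dform (fd (\<lambda>y. pull (T y) (F (\<tau> y))) x) = pull (T x) (dform D)"
proof -
  have A: "linear (T x)" using lin U by blast
  have B1: "linear (B v)" for v
  proof -
    have "B v = (\<lambda>b. B b v)" using B by auto
    then show ?thesis using has_derivative_linear[OF T[of v]] by simp
  qed
  have "HD (\<lambda>y. pull (T y) (F (\<tau> y))) x (\<lambda>b. pull (T x) (D (T x b)) + (\<lambda>vs. pd (T x) (B b) vs (F (\<tau> x))))"
    by (rule HD_pull[OF U(1,2) F HD_compose[OF H \<tau>] T]) (use U(3) in auto)
  then have "dform (fd (\<lambda>y. pull (T y) (F (\<tau> y))) x)
      = dform (\<lambda>b. pull (T x) (D (T x b))) + dform (\<lambda>b vs. pd (T x) (B b) vs (F (\<tau> x)))"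
    by (simp only: HD_fd dform_def eps_linear sum.distrib)
  also have "\<dots> = dform (\<lambda>b. pull (T x) (D (T x b)))"
    using dform_pd_zero[OF F[OF S(2)] B1 B] by simp
  also have "\<dots> = pull (T x) (dform D)"
  proof -
    have D: "D v = (\<Sum>c\<in>Basis. fsc (of_real (v \<bullet> c)) (D c))" for v
    proof
      fix us
      show "D v us = (\<Sum>c\<in>Basis. fsc (of_real (v \<bullet> c)) (D c)) us"
        by (subst euclidean_representation[symmetric, of v], subst linear_sum[OF HD_linear[OF H]])
          (simp add: linear_cmul[OF HD_linear[OF H]] scaleR_conv_of_real sum_fun_apply)
    qed
    have "Blinfun (\<lambda>v. blinfun_apply (dx c) (T x v)) = (\<Sum>b\<in>Basis. (T x b \<bullet> c) *\<^sub>R dx b)" for c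
    proof -
      have "bounded_linear (\<lambda>v. blinfun_apply (dx c) (T x v))"
        using A by (intro bounded_linear_compose[OF blinfun.bounded_linear_right]) (simp add: linear_conv_bounded_linear)
      then show ?thesis
        using covec_expand[of "Blinfun (\<lambda>v. blinfun_apply (dx c) (T x v))"] by (simp add: bounded_linear_Blinfun_apply)
    qed
    then have "pull (T x) (dform D) = (\<Sum>c\<in>Basis. \<Sum>b\<in>Basis. fsc (of_real (T x b \<bullet> c)) (eps (dx b) (pull (T x) (D c))))"
      by (simp add: dform_def pull_sum pull_eps[OF A] eps_sum_left eps_linear)
    also have "\<dots> = dform (\<lambda>b. pull (T x) (D (T x b)))"
      unfolding dform_def by (subst sum.swap, subst (2) D) (simp add: pull_sum pull_linear eps_sum eps_linear)
    finally show ?thesis by simp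
  qed
  finally show ?thesis .
qed

section \<open>Charts\<close>

lemma bounded_linear_blinfun_compose:
  assumes "linear (T :: 'e::euclidean_space \<Rightarrow> 'e)"
  shows "bounded_linear (\<lambda>v. blinfun_apply \<xi> (T v))"
  using assms by (intro bounded_linear_compose[OF blinfun.bounded_linear_right]) (simp add: linear_conv_bounded_linear)

lemma Blinfun_compose_apply [simp]:
  "linear (T :: 'e::euclidean_space \<Rightarrow> 'e) \<Longrightarrow> blinfun_apply (Blinfun (\<lambda>v. blinfun_apply \<xi> (T v))) = (\<lambda>v. blinfun_apply \<xi> (T v))"
  by (rule bounded_linear_Blinfun_apply[OF bounded_linear_blinfun_compose])

text \<open>The transformation of \<open>T \<oplus> T\<^sup>*\<close> that corresponds to \<open>pull T\<close> on forms, \<open>T'\<close> being the inverse of \<open>T\<close>.\<close>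

definition gpull :: "('e::euclidean_space \<Rightarrow> 'e) \<Rightarrow> ('e \<Rightarrow> 'e) \<Rightarrow> 'e gtan \<Rightarrow> 'e gtan" where
  "gpull T T' w = (T' (fst w), Blinfun (\<lambda>v. blinfun_apply (snd w) (T v)))"

lemma gtr_eq_gpull: "gtr c c' p = gpull (tr c' c p) (tr c c' p)"
  by (rule ext) (simp add: gtr_def gpull_def)

locale lin_iso =
  fixes T T' :: "'e::euclidean_space \<Rightarrow> 'e"
  assumes lin: "linear T" "linear T'" and inv: "T (T' v) = v" "T' (T v) = v"
begin

lemma lin_iso_sym: "lin_iso T' T"
  using lin inv by unfold_locales (simp_all add: linear_add linear_scale)

lemma gpull_inverse: "gpull T T' (gpull T' T w) = w"
  by (simp add: gpull_def prod_eq_iff inv lin blinfun_apply_inverse)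

lemma gpull_linear: "linear (gpull T T')"
  by (rule linearI; simp add: gpull_def linear_add lin linear_scale;
      rule blinfun_eqI; (subst blinfun.add_left | subst blinfun.scaleR_left);
      simp only: Blinfun_compose_apply[OF lin(1)]; simp add: blinfun.bilinear_simps)

lemma ginner_gpull: "ginner (gpull T T' w) (gpull T T' z) = ginner w z"
  by (simp add: gpull_def ginner_def lin inv)

lemma ginner_gpull_adjoint: "ginner (gpull T T' w) z = ginner w (gpull T' T z)"
  by (simp add: gpull_def ginner_def lin inv)

lemma pull_cliff_real: "pull T (cliff_real w \<phi>) = cliff_real (gpull T T' w) (pull T \<phi>)"
  by (simp add: cliff_real_eq gpull_def iprod_pull inv pull_linear pull_eps[OF lin(1)])

lemma pull_cliff: "pull T (cliff z \<phi>) = cliff (Jc (gpull T T') z) (pull T \<phi>)"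
  by (simp add: cliff_eq pull_linear pull_cliff_real Jc_def)

lemma Jc_linear: "linear G \<Longrightarrow> Jc G (z + w) = Jc G z + Jc G w" "linear G \<Longrightarrow> Jc G (csc a z) = csc a (Jc G z)"
  for G :: "'e gtan \<Rightarrow> 'e gtan"
  by (simp_all add: Jc_def cscale_def prod_eq_iff linear_add linear_scale linear_diff)

text \<open>Pulling back transforms the frame inside \<open>Sop\<close> as well. Since the
  transformation and its inverse are adjoint, the sum can be rewritten in the standard frame with a
  conjugated \<open>J\<close>.\<close>

lemma pull_Sop:
  assumes alt: "alt_form \<phi>" and J: "linear J"
  shows "pull T (Sop J \<phi>) = Sop (\<lambda>w. gpull T T' (J (gpull T' T w))) (pull T \<phi>)"
proof -
  define \<psi> where "\<psi> = pull T \<phi>"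
  have \<psi>: "alt_form \<psi>" using alt lin by (simp add: \<psi>_def alt_form_pull)
  let ?G = "Jc (gpull T T')" and ?G' = "Jc (gpull T' T)"
  have lin': "linear (gpull T' T)" using lin_iso.gpull_linear[OF lin_iso_sym] .
  define F where "F vs x y = cliff (?G (Jc J x)) (cliff y \<psi>) vs" for vs x y
  have "(\<Sum>i\<in>GI. F vs (?G' (gw i)) (gd i)) = (\<Sum>i\<in>GI. F vs (gw i) (?G (gd i)))" for vs
  proof (rule sum_GI_adjoint)
    show "clin (\<lambda>x. F vs x y)" for y
      by (rule clinI) (simp_all add: F_def Jc_linear gpull_linear J cliff_add cliff_csc alt_form_cliff \<psi>)
    show "clin (F vs x)" for x
      using clin_cliff(2)[OF \<psi>, of "?G (Jc J x)" vs] by (simp add: F_def[abs_def])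
    show "cinner (?G' x) y = cinner x (?G y)" for x y
      by (simp add: cinner_def Jc_def lin_iso.ginner_gpull_adjoint[OF lin_iso_sym])
  qed
  then have *: "(\<Sum>i\<in>GI. cliff (?G (Jc J (?G' (gw i)))) (cliff (gd i) \<psi>)) = (\<Sum>i\<in>GI. cliff (?G (Jc J (gw i))) (cliff (?G (gd i)) \<psi>))"
    by (simp add: fun_eq_iff sum_fun_apply F_def)
  have "pull T (Sop J \<phi>) = fsc (- \<i> / 2) (\<Sum>i\<in>GI. cliff (?G (Jc J (gw i))) (cliff (?G (gd i)) \<psi>))"
    by (simp only: Sop_def pull_linear pull_sum pull_cliff \<psi>_def)
  moreover have "Jc (\<lambda>w. gpull T T' (J (gpull T' T w))) z = ?G (Jc J (?G' z))" for z by (simp add: Jc_def)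
  ultimately show ?thesis by (simp only: *[symmetric] Sop_def \<psi>_def[symmetric])
qed

lemma pull_EE:
  assumes "\<phi> \<in> EE J k" "linear J"
  shows "pull T \<phi> \<in> EE (\<lambda>w. gpull T T' (J (gpull T' T w))) k"
  using assms pull_Sop[OF EE_alt[OF assms(1)] assms(2)] lin by (simp add: EE_def alt_form_pull pull_linear)

lemma gcs_point_gpull:
  assumes "gcs_point J"
  shows "gcs_point (\<lambda>w. gpull T T' (J (gpull T' T w)))"
proof -
  interpret gcs_point J by (rule assms)
  interpret sym: lin_iso T' T by (rule lin_iso_sym)
  show ?thesis
  proof (rule gcs_point.intro)
    show "linear (\<lambda>w. gpull T T' (J (gpull T' T w)))"
      using linear_compose[OF linear_compose[OF sym.gpull_linear J_linear] gpull_linear] by (simp add: o_def)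
  qed (simp_all add: gpull_inverse sym.gpull_inverse J_J J_orth ginner_gpull sym.ginner_gpull linear_neg[OF gpull_linear])
qed

end

locale smooth_manifold =
  fixes A :: "('m::{t2_space,second_countable_topology}, 'e::euclidean_space) chart set"
  assumes atlas: "smooth_atlas A"
begin

definition ov :: "('m, 'e) chart \<Rightarrow> ('m, 'e) chart \<Rightarrow> 'e set" where
  "ov c c' = snd c ` (fst c \<inter> fst c')"

definition trans :: "('m, 'e) chart \<Rightarrow> ('m, 'e) chart \<Rightarrow> 'e \<Rightarrow> 'e" where
  "trans c c' = snd c' \<circ> cinv c"

lemma chart_homeo: "c \<in> A \<Longrightarrow> homeomorphism (fst c) (cimage c) (snd c) (cinv c)"
  and open_chart: "c \<in> A \<Longrightarrow> open (fst c)" and open_cimage: "c \<in> A \<Longrightarrow> open (cimage c)"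
  using atlas by (auto simp: smooth_atlas_def is_chart_def)

lemma cinv_snd: "c \<in> A \<Longrightarrow> p \<in> fst c \<Longrightarrow> cinv c (snd c p) = p"
  and snd_cinv: "c \<in> A \<Longrightarrow> x \<in> cimage c \<Longrightarrow> snd c (cinv c x) = x"
  and cinv_in: "c \<in> A \<Longrightarrow> x \<in> cimage c \<Longrightarrow> cinv c x \<in> fst c"
  and snd_in: "p \<in> fst c \<Longrightarrow> snd c p \<in> cimage c"
  using chart_homeo[of c] by (auto simp: homeomorphism_def cimage_def)

lemma pchart: "pchart A p \<in> A" "p \<in> fst (pchart A p)"
proof -
  have "p \<in> (\<Union>c\<in>A. fst c)" using atlas by (simp add: smooth_atlas_def)
  then have "\<exists>c. c \<in> A \<and> p \<in> fst c" by blast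
  from someI_ex[OF this] show "pchart A p \<in> A" "p \<in> fst (pchart A p)" by (simp_all add: pchart_def)
qed

lemma ov_eq: "c \<in> A \<Longrightarrow> ov c c' = {x \<in> cimage c. cinv c x \<in> fst c'}"
  by (auto simp: ov_def cinv_snd snd_in cinv_in) (metis IntI cinv_in image_eqI snd_cinv)

lemma open_cinv_preimage: "c \<in> A \<Longrightarrow> open V \<Longrightarrow> open {x \<in> cimage c. cinv c x \<in> V}"
proof -
  assume "c \<in> A" "open V"
  then have "open (cimage c \<inter> cinv c -` V)"
    using chart_homeo[of c] open_cimage[of c] by (intro continuous_open_preimage) (auto simp: homeomorphism_def)
  then show ?thesis by (simp add: Int_def vimage_def)
qed

lemma open_ov: "c \<in> A \<Longrightarrow> c' \<in> A \<Longrightarrow> open (ov c c')"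
  by (simp add: ov_eq open_cinv_preimage open_chart)

lemma Cinf_trans: "c \<in> A \<Longrightarrow> c' \<in> A \<Longrightarrow> Cinf_on (ov c c') (trans c c')"
  using atlas unfolding smooth_atlas_def ov_def trans_def by blast

lemma trans_ov: "c \<in> A \<Longrightarrow> c' \<in> A \<Longrightarrow> x \<in> ov c c' \<Longrightarrow> trans c c' x \<in> ov c' c"
  by (auto simp: ov_def trans_def cinv_snd)

lemma trans_ov_image: "c \<in> A \<Longrightarrow> c' \<in> A \<Longrightarrow> trans c c' ` ov c c' \<subseteq> ov c' c"
  by (rule image_subsetI) (rule trans_ov)

lemma tr_eq: "c \<in> A \<Longrightarrow> p \<in> fst c \<Longrightarrow> tr c c' p = frechet_derivative (trans c c') (at (snd c p))"
  by (simp add: tr_def trans_def)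

lemma tr_cinv: "c \<in> A \<Longrightarrow> y \<in> cimage c \<Longrightarrow> tr c c' (cinv c y) = frechet_derivative (trans c c') (at y)"
  by (simp add: tr_def trans_def snd_cinv)

lemma trans_has_derivative:
  "c \<in> A \<Longrightarrow> c' \<in> A \<Longrightarrow> p \<in> fst c \<Longrightarrow> p \<in> fst c' \<Longrightarrow> (trans c c' has_derivative tr c c' p) (at (snd c p))"
  unfolding tr_eq by (rule Cinf_has_derivative[OF Cinf_trans]) (auto simp: ov_def)

lemma tr_linear: "c \<in> A \<Longrightarrow> c' \<in> A \<Longrightarrow> p \<in> fst c \<Longrightarrow> p \<in> fst c' \<Longrightarrow> linear (tr c c' p)"
  using trans_has_derivative has_derivative_linear by blast

lemma tr_self: "c \<in> A \<Longrightarrow> p \<in> fst c \<Longrightarrow> tr c c p = (\<lambda>v. v)"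
proof -
  assume c: "c \<in> A" "p \<in> fst c"
  have "(trans c c has_derivative (\<lambda>v. v)) (at (snd c p))"
    by (rule has_derivative_transform_within_open[OF has_derivative_ident open_cimage[OF c(1)] snd_in[OF c(2)]])
       (simp add: trans_def snd_cinv c)
  then show ?thesis using has_derivative_unique[OF trans_has_derivative[OF c(1,1,2,2)]] by metis
qed

lemma tr_tr:
  assumes c: "c \<in> A" "c' \<in> A" "c'' \<in> A" and p: "p \<in> fst c" "p \<in> fst c'" "p \<in> fst c''"
  shows "tr c' c'' p (tr c c' p v) = tr c c'' p v"
proof -
  have e: "trans c c' (snd c p) = snd c' p" using c p by (simp add: trans_def cinv_snd)
  have "((\<lambda>x. trans c' c'' (trans c c' x)) has_derivative (\<lambda>v. tr c' c'' p (tr c c' p v))) (at (snd c p))"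
    by (rule has_derivative_compose[OF trans_has_derivative]) (use c p e trans_has_derivative in auto)
  then have "(trans c c'' has_derivative (\<lambda>v. tr c' c'' p (tr c c' p v))) (at (snd c p))"
    by (rule has_derivative_transform_within_open[OF _ open_ov[OF c(1,2)]])
       (use c p in \<open>auto simp: ov_def trans_def cinv_snd\<close>)
  then show ?thesis using has_derivative_unique[OF trans_has_derivative[OF c(1,3) p(1,3)]] by metis
qed

lemma lin_iso_tr: "c \<in> A \<Longrightarrow> c' \<in> A \<Longrightarrow> p \<in> fst c \<Longrightarrow> p \<in> fst c' \<Longrightarrow> lin_iso (tr c c' p) (tr c' c p)"
  by unfold_locales (simp_all add: tr_linear tr_tr tr_self linear_add linear_scale)

lemma gtr_gtr:
  assumes "c \<in> A" "c' \<in> A" "c'' \<in> A" "p \<in> fst c" "p \<in> fst c'" "p \<in> fst c''"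
  shows "gtr c' c'' p (gtr c c' p w) = gtr c c'' p w"
  using assms by (simp add: gtr_eq_gpull gpull_def tr_tr tr_linear)

lemma gtr_self: "c \<in> A \<Longrightarrow> p \<in> fst c \<Longrightarrow> gtr c c p w = w"
  by (auto simp: gtr_eq_gpull gpull_def tr_self prod_eq_iff blinfun_apply_inverse)

lemma gtr_linear: "c \<in> A \<Longrightarrow> c' \<in> A \<Longrightarrow> p \<in> fst c \<Longrightarrow> p \<in> fst c' \<Longrightarrow> linear (gtr c c' p)"
  unfolding gtr_eq_gpull by (rule lin_iso.gpull_linear[OF lin_iso_tr])

subsection \<open>Forms and sections in a chart\<close>

lemma floc_eq: "floc A c \<phi> x = pull (tr c (pchart A (cinv c x)) (cinv c x)) (\<phi> (cinv c x))"
  by (simp add: floc_def pull_def Let_def)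

definition sloc :: "('m, 'e) chart \<Rightarrow> ('m \<Rightarrow> 'e gtan) \<Rightarrow> 'e \<Rightarrow> 'e gtan" where
  "sloc c s x = gtr (pchart A (cinv c x)) c (cinv c x) (s (cinv c x))"

lemma sloc_eq: "sloc c s x = (vloc A c (\<lambda>p. fst (s p)) x, cloc A c (\<lambda>p. snd (s p)) x)"
  by (simp add: sloc_def vloc_def cloc_def gtr_def Let_def)

lemma floc_pchart: "floc A (pchart A p) \<phi> (snd (pchart A p) p) = \<phi> p"
  by (simp add: floc_eq cinv_snd pchart tr_self pull_def)

lemma sloc_pchart: "sloc (pchart A p) s (snd (pchart A p) p) = s p"
  by (simp add: sloc_def cinv_snd pchart gtr_self)

lemma floc_trans:
  assumes c: "c \<in> A" "c' \<in> A" and x: "x \<in> ov c c'"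
  shows "floc A c \<phi> x = pull (tr c c' (cinv c x)) (floc A c' \<phi> (trans c c' x))"
proof -
  let ?q = "cinv c x"
  have q: "?q \<in> fst c" "?q \<in> fst c'" "x \<in> cimage c" using x c by (auto simp: ov_eq cinv_in)
  have "cinv c' (trans c c' x) = ?q" using q c by (simp add: trans_def cinv_snd)
  then show ?thesis
    using c q by (simp add: floc_eq pull_pull o_def tr_tr pchart)
qed

lemma floc_cliff_real:
  assumes c: "c \<in> A" and x: "x \<in> cimage c"
  shows "floc A c (\<lambda>p. cliff_real (s p) (\<phi> p)) x = cliff_real (sloc c s x) (floc A c \<phi> x)"
proof -
  interpret lin_iso "tr c (pchart A (cinv c x)) (cinv c x)" "tr (pchart A (cinv c x)) c (cinv c x)"
    by (rule lin_iso_tr) (use c x in \<open>auto simp: cinv_in pchart\<close>)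
  show ?thesis by (simp add: floc_eq sloc_def gtr_eq_gpull pull_cliff_real)
qed

lemma smooth_form_iff: "smooth_form A \<phi> \<longleftrightarrow> (\<forall>p. alt_form (\<phi> p)) \<and> (\<forall>c\<in>A. sform (cimage c) (floc A c \<phi>))"
proof -
  have "alt_form (floc A c \<phi> x)" if "\<forall>p. alt_form (\<phi> p)" "c \<in> A" "x \<in> cimage c" for c x
    unfolding floc_eq using that by (intro alt_form_pull tr_linear) (auto simp: cinv_in pchart)
  then show ?thesis by (auto simp: smooth_form_def sform_def)
qed

lemma smooth_formI:
  "(\<And>p. alt_form (\<phi> p)) \<Longrightarrow> (\<And>c. c \<in> A \<Longrightarrow> sform (cimage c) (floc A c \<phi>)) \<Longrightarrow> smooth_form A \<phi>"
  by (simp add: smooth_form_iff)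

lemma smooth_form_alt: "smooth_form A \<phi> \<Longrightarrow> alt_form (\<phi> p)"
  and smooth_form_sform: "smooth_form A \<phi> \<Longrightarrow> c \<in> A \<Longrightarrow> sform (cimage c) (floc A c \<phi>)"
  by (simp_all add: smooth_form_iff)

lemma smooth_gsection_iff: "smooth_gsection A s \<longleftrightarrow> (\<forall>c\<in>A. Cinf_on (cimage c) (sloc c s))"
proof -
  have "Cinf_on (cimage c) (sloc c s) \<longleftrightarrow> Cinf_on (cimage c) (vloc A c (\<lambda>p. fst (s p))) \<and> Cinf_on (cimage c) (cloc A c (\<lambda>p. snd (s p)))"
    if "c \<in> A" for c
  proof
    assume *: "Cinf_on (cimage c) (sloc c s)"
    show "Cinf_on (cimage c) (vloc A c (\<lambda>p. fst (s p))) \<and> Cinf_on (cimage c) (cloc A c (\<lambda>p. snd (s p)))"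
      using Cinf_bounded_linear[OF open_cimage[OF that] bounded_linear_fst *]
        Cinf_bounded_linear[OF open_cimage[OF that] bounded_linear_snd *] by (simp add: sloc_eq)
  next
    assume "Cinf_on (cimage c) (vloc A c (\<lambda>p. fst (s p))) \<and> Cinf_on (cimage c) (cloc A c (\<lambda>p. snd (s p)))"
    then have "Cinf_on (cimage c) (\<lambda>x. (vloc A c (\<lambda>p. fst (s p)) x, cloc A c (\<lambda>p. snd (s p)) x))"
      using Cinf_Pair[OF open_cimage[OF that]] by blast
    then show "Cinf_on (cimage c) (sloc c s)" by (rule back_subst[where P="Cinf_on (cimage c)"]) (auto simp: sloc_eq fun_eq_iff)
  qed
  then show ?thesis by (simp add: smooth_gsection_def)
qed

lemma floc_simps:
  "floc A c (\<lambda>p. \<phi> p + \<psi> p) = (\<lambda>x. floc A c \<phi> x + floc A c \<psi> x)"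
  "floc A c (\<lambda>p. \<phi> p - \<psi> p) = (\<lambda>x. floc A c \<phi> x - floc A c \<psi> x)"
  "floc A c (\<lambda>p. fsc a (\<phi> p)) = (\<lambda>x. fsc a (floc A c \<phi> x))"
  by (simp_all add: floc_eq fun_eq_iff pull_linear)

lemma smooth_form_simps:
  "smooth_form A \<phi> \<Longrightarrow> smooth_form A \<psi> \<Longrightarrow> smooth_form A (\<lambda>p. \<phi> p + \<psi> p)"
  "smooth_form A \<phi> \<Longrightarrow> smooth_form A \<psi> \<Longrightarrow> smooth_form A (\<lambda>p. \<phi> p - \<psi> p)"
  "smooth_form A \<phi> \<Longrightarrow> smooth_form A (\<lambda>p. fsc a (\<phi> p))"
  by (simp_all add: smooth_form_iff floc_simps alt_form_simps sform_add sform_diff sform_fsc open_cimage)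

lemma smooth_form_cliff_real:
  assumes "smooth_gsection A s" "smooth_form A \<phi>"
  shows "smooth_form A (\<lambda>p. cliff_real (s p) (\<phi> p))"
proof (rule smooth_formI)
  show "alt_form (cliff_real (s p) (\<phi> p))" for p by (intro alt_form_cliff_real smooth_form_alt assms)
  fix c assume c: "c \<in> A"
  show "sform (cimage c) (floc A c (\<lambda>p. cliff_real (s p) (\<phi> p)))"
    by (rule sform_cong[OF open_cimage[OF c] floc_cliff_real[OF c, symmetric]])
       (use assms c in \<open>auto simp: smooth_gsection_iff intro!: sform_cliff_real open_cimage smooth_form_sform\<close>)
qed

subsection \<open>The twisted differential in a chart\<close>

text \<open>The twisted differential computed throughout one chart \<open>c\<close>, whereas
  \<open>twisted_d\<close> changes its chart with the point.\<close>

definition TD :: "('m \<Rightarrow> 'e form) \<Rightarrow> ('m, 'e) chart \<Rightarrow> ('m \<Rightarrow> 'e form) \<Rightarrow> 'e \<Rightarrow> 'e form" where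
  "TD H c \<phi> x = dform (fd (floc A c \<phi>) x) + wedge (floc A c H x) (floc A c \<phi> x)"

lemma twisted_d_pchart:
  assumes "smooth_form A \<phi>"
  shows "twisted_d A H \<phi> p = TD H (pchart A p) \<phi> (snd (pchart A p) p)"
proof -
  let ?c = "pchart A p"
  have "HD (floc A ?c \<phi>) (snd ?c p) (fd (floc A ?c \<phi>) (snd ?c p))"
    by (rule sform_HD[OF smooth_form_sform[OF assms pchart(1)] snd_in[OF pchart(2)]])
  from dform_explicit[where D="fd (floc A ?c \<phi>) (snd ?c p)", OF HD_linear[OF this]]
  have "ext_d A \<phi> p vs = dform (fd (floc A ?c \<phi>) (snd ?c p)) vs" for vs
    by (simp add: ext_d_def fd_def Let_def)
  then show ?thesis by (auto simp: twisted_d_def TD_def floc_pchart fun_eq_iff)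
qed

text \<open>Chart independence of the twisted differential, without which it would not even be clear
  that it produces smooth forms. The symmetry of second derivatives of the transition map is what
  \<open>dform_pull\<close> asks for.\<close>

lemma TD_trans:
  assumes phi: "smooth_form A \<phi>" and c: "c \<in> A" "c' \<in> A" and x: "x \<in> ov c c'"
  shows "TD H c \<phi> x = pull (tr c c' (cinv c x)) (TD H c' \<phi> (trans c c' x))"
proof -
  let ?T = "\<lambda>y. frechet_derivative (trans c c') (at y)"
  have sub: "ov c c' \<subseteq> cimage c" "ov c' c \<subseteq> cimage c'" by (auto simp: ov_def cimage_def)
  have T: "tr c c' (cinv c y) = ?T y" if "y \<in> ov c c'" for y
    using tr_cinv[OF c(1)] that sub by blast
  have fl: "floc A c \<phi> y = pull (?T y) (floc A c' \<phi> (trans c c' y))" if "y \<in> ov c c'" for \<phi> y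
    using floc_trans[OF c that] T[OF that] by simp
  have HD': "HD (floc A c' \<phi>) (trans c c' x) (fd (floc A c' \<phi>) (trans c c' x))"
    using sform_HD[OF smooth_form_sform[OF phi c(2)]] trans_ov[OF c x] sub by blast
  have HDc: "HD (floc A c \<phi>) x (fd (floc A c \<phi>) x)"
    using sform_HD[OF smooth_form_sform[OF phi c(1)]] x sub by blast
  have d: "dform (fd (\<lambda>y. pull (?T y) (floc A c' \<phi> (trans c c' y))) x) = pull (?T x) (dform (fd (floc A c' \<phi>) (trans c c' x)))"
  proof (rule dform_pull[where B="\<lambda>b w. frechet_derivative (\<lambda>y. ?T y w) (at x) b" and U="ov c c'" and S="ov c' c"])
    show "open (ov c c')" "open (ov c' c)" using open_ov c by auto
    show "trans c c' x \<in> ov c' c" "trans c c' ` ov c c' \<subseteq> ov c' c" by (rule trans_ov[OF c x], rule trans_ov_image[OF c])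
    show "(trans c c' has_derivative ?T x) (at x)" by (rule Cinf_has_derivative[OF Cinf_trans[OF c] x])
    show "((\<lambda>y. ?T y w) has_derivative (\<lambda>b. frechet_derivative (\<lambda>y. ?T y w) (at x) b)) (at x)" for w
      by (rule Cinf_has_derivative[OF Cinf_derivative[OF Cinf_trans[OF c]] x])
    show "linear (?T y)" if "y \<in> ov c c'" for y
      by (rule has_derivative_linear[OF Cinf_has_derivative[OF Cinf_trans[OF c] that]])
    show "frechet_derivative (\<lambda>y. ?T y w) (at x) v = frechet_derivative (\<lambda>y. ?T y v) (at x) w" for v w
      by (rule second_derivative_symmetric[OF open_ov[OF c] x Cinf_trans[OF c]])
    show "alt_form (floc A c' \<phi> y)" if "y \<in> ov c' c" for y
      using sform_alt[OF smooth_form_sform[OF phi c(2)]] that sub by blast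
  qed (use x HD' in auto)
  have "fd (floc A c \<phi>) x = fd (\<lambda>y. pull (?T y) (floc A c' \<phi> (trans c c' y))) x"
    using HD_fd[OF HD_cong[OF open_ov[OF c] x fl HDc]] by simp
  then show ?thesis unfolding TD_def by (simp add: d fl[OF x] pull_linear pull_wedge T[OF x])
qed

lemma floc_twisted_d:
  assumes phi: "smooth_form A \<phi>" and c: "c \<in> A" and x: "x \<in> cimage c"
  shows "floc A c (twisted_d A H \<phi>) x = TD H c \<phi> x"
proof -
  let ?q = "cinv c x"
  have "x \<in> ov c (pchart A ?q)" using c x pchart(2) by (simp add: ov_eq)
  from TD_trans[OF phi c pchart(1) this] show ?thesis
    by (simp add: floc_eq twisted_d_pchart[OF phi] trans_def)
qed

lemma sform_fd: "open S \<Longrightarrow> sform S F \<Longrightarrow> sform S (\<lambda>x. fd F x b)"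
proof -
  assume "open S" "sform S F"
  then have "alt_form (fd F y b)" if "y \<in> S" for y
    using HD_alt[OF \<open>open S\<close> that sform_alt[OF \<open>sform S F\<close>] sform_HD[OF \<open>sform S F\<close> that]] by blast
  moreover have "Cinf_on S (\<lambda>y. fd F y b vs)" for vs
    unfolding fd_def by (rule Cinf_derivative[OF sform_Cinf[OF \<open>sform S F\<close>]])
  ultimately show ?thesis by (simp add: sform_def)
qed

lemma sform_dform: "open S \<Longrightarrow> sform S F \<Longrightarrow> sform S (\<lambda>x. dform (fd F x))"
  unfolding dform_def by (intro sform_sum sform_eps sform_fd Cinf_const)

lemma floc_homog: "homog k (H (cinv c x)) \<Longrightarrow> homog k (floc A c H x)"
  by (simp add: floc_eq homog_def pull_def)

lemma sform_wedge3:
  assumes S: "open S" and h: "sform S h" "\<And>y. y \<in> S \<Longrightarrow> homog 3 (h y)" and F: "sform S F"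
  shows "sform S (\<lambda>y. wedge (h y) (F y))"
proof (rule sform_cong[OF S wedge_3_eps[OF sform_alt[OF h(1)] h(2), symmetric]])
  show "sform S (\<lambda>y. fsc (1/6) (\<Sum>a\<in>Basis. \<Sum>b\<in>Basis. \<Sum>c\<in>Basis. fsc (h y [a, b, c]) (eps (dx a) (eps (dx b) (eps (dx c) (F y))))))"
    by (intro sform_fsc sform_sum sform_scale sform_eps S F Cinf_const sform_Cinf[OF h(1)])
qed

lemma sform_TD:
  assumes "smooth_form A \<phi>" "smooth_form A H" "\<And>p. homog 3 (H p)" "c \<in> A"
  shows "sform (cimage c) (TD H c \<phi>)"
  unfolding TD_def[abs_def] using assms open_cimage[OF assms(4)]
  by (intro sform_add sform_dform sform_wedge3 smooth_form_sform floc_homog)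

lemma smooth_form_twisted_d:
  assumes "smooth_form A \<phi>" "smooth_form A H" "\<And>p. homog 3 (H p)"
  shows "smooth_form A (twisted_d A H \<phi>)"
proof (rule smooth_formI)
  show "alt_form (twisted_d A H \<phi> p)" for p
    unfolding twisted_d_pchart[OF assms(1)]
    by (rule sform_alt[OF sform_TD[OF assms pchart(1)] snd_in[OF pchart(2)]])
  show "sform (cimage c) (floc A c (twisted_d A H \<phi>))" if "c \<in> A" for c
    by (rule sform_cong[OF open_cimage[OF that] floc_twisted_d[OF assms(1) that, symmetric] sform_TD[OF assms that]])
qed

subsection \<open>Extensions by bump functions\<close>

text \<open>A function that is smooth on the part of a chart \<open>c'\<close> inside \<open>c\<close> and vanishes outside of a
  compact subset of \<open>c\<close> is smooth, since compact subsets of a Hausdorff space are closed.\<close>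

lemma Cinf_extension:
  assumes c: "c \<in> A" "c' \<in> A" and K: "cball x0 r \<subseteq> cimage c"
    and F: "Cinf_on (ov c' c) F" "\<And>x. x \<in> cimage c' \<Longrightarrow> (x \<in> ov c' c \<Longrightarrow> trans c' c x \<notin> cball x0 r) \<Longrightarrow> F x = 0"
  shows "Cinf_on (cimage c') F"
proof (rule Cinf_local)
  define Q where "Q = cinv c ` cball x0 r"
  have "continuous_on (cball x0 r) (cinv c)"
    using chart_homeo[OF c(1)] K by (auto simp: homeomorphism_def intro: continuous_on_subset)
  then have "closed Q" unfolding Q_def by (intro compact_imp_closed compact_continuous_image compact_cball)
  then have V: "open {x \<in> cimage c'. cinv c' x \<in> - Q}" by (intro open_cinv_preimage c) (simp add: open_Compl)
  have F0: "F x = 0" if x: "x \<in> {x \<in> cimage c'. cinv c' x \<in> - Q}" for x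
  proof (rule F(2))
    show "trans c' c x \<notin> cball x0 r" if "x \<in> ov c' c"
    proof
      assume "trans c' c x \<in> cball x0 r"
      moreover have "cinv c (trans c' c x) = cinv c' x" using that c by (simp add: trans_def cinv_snd ov_eq)
      ultimately have "cinv c' x \<in> Q" unfolding Q_def by (metis image_eqI)
      then show False using x by simp
    qed
  qed (use x in simp)
  fix x assume x: "x \<in> cimage c'"
  show "\<exists>U. open U \<and> x \<in> U \<and> Cinf_on U F"
  proof (cases "cinv c' x \<in> Q")
    case True
    then obtain y where "cinv c' x = cinv c y" "y \<in> cball x0 r" by (auto simp: Q_def)
    then have "cinv c' x \<in> fst c" using K cinv_in[OF c(1), of y] by auto
    then have "x \<in> ov c' c" using x c by (simp add: ov_eq)
    then show ?thesis using open_ov c F(1) by blast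
  next
    case False
    moreover have "Cinf_on {x \<in> cimage c'. cinv c' x \<in> - Q} F"
      by (rule Cinf_cong[OF V _ Cinf_const[of _ 0]]) (simp add: F0)
    ultimately show ?thesis using V x by blast
  qed
qed

text \<open>The extension is a bump function times a constant form on the whole chart, not only at
  \<open>x0\<close>. Component functions can therefore be tested against it and the bump function
  divided out near \<open>x0\<close>.\<close>

lemma form_extension:
  assumes c: "c \<in> A" and x0: "x0 \<in> cimage c" and alt: "alt_form \<phi>\<^sub>0"
  shows "\<exists>\<phi> f. smooth_form A \<phi> \<and> Cinf_on UNIV f \<and> f x0 = (1::real) \<and> (\<forall>x\<in>cimage c. floc A c \<phi> x = fsc (of_real (f x)) \<phi>\<^sub>0)"
proof -
  obtain f r where f: "Cinf_on UNIV f" "f x0 = (1::real)" "cball x0 r \<subseteq> cimage c" "\<And>x. x \<notin> cball x0 r \<Longrightarrow> f x = 0"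
    using bump_exists[OF open_cimage[OF c] x0] by blast
  define \<phi> where "\<phi> q = (if q \<in> fst c then fsc (of_real (f (snd c q))) (pull (tr (pchart A q) c q) \<phi>\<^sub>0) else 0)" for q
  have alt_phi: "alt_form (\<phi> q)" for q
    using alt c by (auto simp: \<phi>_def pchart intro!: alt_form_simps alt_form_pull tr_linear)
  have fl: "floc A c' \<phi> x = fsc (of_real (f (trans c' c x))) (pull (tr c' c (cinv c' x)) \<phi>\<^sub>0)"
    if "c' \<in> A" "x \<in> ov c' c" for c' x
  proof -
    have q: "cinv c' x \<in> fst c" "cinv c' x \<in> fst c'" using that by (auto simp: ov_eq cinv_in)
    then show ?thesis using that c
      by (simp add: floc_eq \<phi>_def pull_linear pull_pull o_def tr_tr pchart trans_def)
  qed
  have "Cinf_on (cimage c') (\<lambda>x. floc A c' \<phi> x vs)" if c': "c' \<in> A" for c' vs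
  proof (rule Cinf_extension[OF c c' f(3)])
    have o: "open (ov c' c)" by (rule open_ov[OF c' c])
    have "sform (ov c' c) (\<lambda>x. fsc (of_real (f (trans c' c x))) (pull (frechet_derivative (trans c' c) (at x)) \<phi>\<^sub>0))"
      using has_derivative_linear[OF Cinf_has_derivative[OF Cinf_trans[OF c' c]]]
      by (intro sform_scale sform_pull sform_const alt Cinf_of_real Cinf_compose[OF o subset_UNIV _ f(1)] o Cinf_trans c c' Cinf_derivative)
    from sform_Cinf[OF this, of vs] show "Cinf_on (ov c' c) (\<lambda>x. floc A c' \<phi> x vs)"
    proof (rule Cinf_cong[OF o, rotated])
      fix x assume x: "x \<in> ov c' c"
      then have "x \<in> cimage c'" using c' by (simp add: ov_eq)
      then show "fsc (of_real (f (trans c' c x))) (pull (frechet_derivative (trans c' c) (at x)) \<phi>\<^sub>0) vs = floc A c' \<phi> x vs"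
        by (simp add: fl[OF c' x] tr_cinv[OF c'])
    qed
    fix x assume x: "x \<in> cimage c'" and "x \<in> ov c' c \<Longrightarrow> trans c' c x \<notin> cball x0 r"
    then show "floc A c' \<phi> x vs = 0"
      using fl[OF c'] f(4) c' by (cases "x \<in> ov c' c") (auto simp: ov_eq floc_eq \<phi>_def pull_def)
  qed
  then have "smooth_form A \<phi>" using alt_phi by (simp add: smooth_form_def)
  moreover have "floc A c \<phi> x = fsc (of_real (f x)) \<phi>\<^sub>0" if "x \<in> cimage c" for x
  proof -
    have "x \<in> ov c c" "trans c c x = x" using that c by (auto simp: ov_eq trans_def snd_cinv cinv_in)
    then show ?thesis using fl[OF c] that c by (simp add: tr_self cinv_in pull_def)
  qed
  ultimately show ?thesis using f by blast
qed

lemma form_extension_at: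
  assumes "alt_form \<phi>\<^sub>0"
  shows "\<exists>\<phi>. smooth_form A \<phi> \<and> \<phi> p = \<phi>\<^sub>0"
proof -
  obtain \<phi> f where "smooth_form A \<phi>" "f (snd (pchart A p) p) = (1::real)"
    "\<forall>x\<in>cimage (pchart A p). floc A (pchart A p) \<phi> x = fsc (of_real (f x)) \<phi>\<^sub>0"
    using form_extension[OF pchart(1) snd_in[OF pchart(2)] assms] by blast
  then show ?thesis using floc_pchart[of p \<phi>] snd_in[OF pchart(2), of p] by (auto simp: fsc_simps)
qed

lemma Cinf_gtr:
  assumes c: "c \<in> A" "c' \<in> A"
  shows "Cinf_on (ov c' c) (\<lambda>x. gtr c c' (cinv c' x) w)"
proof -
  have o: "open (ov c' c)" by (rule open_ov[OF c(2,1)])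
  have 1: "Cinf_on (ov c' c) (\<lambda>x. frechet_derivative (trans c c') (at (trans c' c x)) (fst w))"
    by (rule Cinf_compose[OF o _ Cinf_trans[OF c(2,1)] Cinf_derivative[OF Cinf_trans[OF c]]]) (rule trans_ov_image[OF c(2,1)])
  have 2: "Cinf_on (ov c' c) (\<lambda>x. \<Sum>b\<in>Basis. blinfun_apply (snd w) (frechet_derivative (trans c' c) (at x) b) *\<^sub>R dx b)"
    by (intro Cinf_sum o Cinf_scaleR Cinf_const Cinf_bounded_linear[OF o blinfun.bounded_linear_right] Cinf_derivative Cinf_trans c)
  show ?thesis
  proof (rule Cinf_cong[OF o _ Cinf_Pair[OF o 1 2]])
    fix x assume x: "x \<in> ov c' c"
    then have q: "cinv c' x \<in> fst c" "cinv c' x \<in> fst c'" "x \<in> cimage c'" using c by (auto simp: ov_eq cinv_in)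
    have "tr c c' (cinv c' x) = frechet_derivative (trans c c') (at (trans c' c x))"
      using q c by (simp add: tr_eq trans_def)
    moreover have "Blinfun (\<lambda>v. blinfun_apply (snd w) (tr c' c (cinv c' x) v))
        = (\<Sum>b\<in>Basis. blinfun_apply (snd w) (frechet_derivative (trans c' c) (at x) b) *\<^sub>R dx b)"
    proof -
      have l: "linear (tr c' c (cinv c' x))" using q c by (simp add: tr_linear)
      show ?thesis by (subst covec_expand, simp only: Blinfun_compose_apply[OF l]) (use q c in \<open>simp add: tr_cinv\<close>)
    qed
    ultimately show "(frechet_derivative (trans c c') (at (trans c' c x)) (fst w),
        \<Sum>b\<in>Basis. blinfun_apply (snd w) (frechet_derivative (trans c' c) (at x) b) *\<^sub>R dx b) = gtr c c' (cinv c' x) w"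
      by (simp add: gtr_def)
  qed
qed

lemma gsection_extension:
  "\<exists>s. smooth_gsection A s \<and> s p = w"
proof -
  let ?c = "pchart A p" and ?x0 = "snd (pchart A p) p"
  have c: "?c \<in> A" by (rule pchart)
  obtain f r where f: "Cinf_on UNIV f" "f ?x0 = (1::real)" "cball ?x0 r \<subseteq> cimage ?c" "\<And>x. x \<notin> cball ?x0 r \<Longrightarrow> f x = 0"
    using bump_exists[OF open_cimage[OF c] snd_in[OF pchart(2)]] by blast
  define s where "s q = (if q \<in> fst ?c then f (snd ?c q) *\<^sub>R gtr ?c (pchart A q) q w else 0)" for q
  have sl: "sloc c' s x = f (trans c' ?c x) *\<^sub>R gtr ?c c' (cinv c' x) w" if "c' \<in> A" "x \<in> ov c' ?c" for c' x
  proof -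
    have q: "cinv c' x \<in> fst ?c" "cinv c' x \<in> fst c'" using that by (auto simp: ov_eq cinv_in)
    then show ?thesis using that c
      by (simp add: sloc_def s_def linear_scale[OF gtr_linear] gtr_gtr pchart trans_def)
  qed
  have "Cinf_on (cimage c') (sloc c' s)" if c': "c' \<in> A" for c'
  proof (rule Cinf_extension[OF c c' f(3)])
    have o: "open (ov c' ?c)" by (rule open_ov[OF c' c])
    show "Cinf_on (ov c' ?c) (sloc c' s)"
      by (rule Cinf_cong[OF o sl[OF c', symmetric]])
        (auto intro!: Cinf_scaleR o Cinf_gtr c c' Cinf_compose[OF o subset_UNIV _ f(1)] Cinf_trans)
    fix x assume x: "x \<in> cimage c'" and "x \<in> ov c' ?c \<Longrightarrow> trans c' ?c x \<notin> cball ?x0 r"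
    then show "sloc c' s x = 0"
      using sl[OF c'] f(4) c' linear_0[OF gtr_linear[OF pchart(1) c' pchart(2)]]
      by (cases "x \<in> ov c' ?c") (auto simp: ov_eq sloc_def s_def cinv_in)
  qed
  then have "smooth_gsection A s" by (simp add: smooth_gsection_iff)
  moreover have "s p = w" using f(2) by (simp add: s_def pchart gtr_self)
  ultimately show ?thesis by blast
qed

end

section \<open>The derived bracket\<close>

lemma cliff_real_swap:
  "alt_form \<phi> \<Longrightarrow> cliff_real w (cliff_real z \<phi>) = fsc (of_real (2 * ginner w z)) \<phi> - cliff_real z (cliff_real w \<phi>)"
  using cliff_real_anticommute[of \<phi> w z] by (simp add: algebra_simps)

lemma eps_eq_cliff_real: "alt_form \<phi> \<Longrightarrow> eps \<xi> \<phi> = cliff_real (0, \<xi>) \<phi>"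
  by (simp add: cliff_real_eq iprod_zero)

lemma linear_Blinfun_apply: "linear (f :: 'e::euclidean_space \<Rightarrow> real) \<Longrightarrow> blinfun_apply (Blinfun f) = f"
  by (simp add: bounded_linear_Blinfun_apply linear_conv_bounded_linear)

lemma homog1_covec:
  assumes "alt_form \<alpha>" "homog 1 \<alpha>" "\<And>vs. \<alpha> vs \<in> \<real>"
  shows "\<alpha> = covec_form (form_covec \<alpha>)"
proof
  fix vs
  have "linear (\<lambda>v. Re (\<alpha> [v]))"
    using linear_compose[OF alt_form_linear0[OF assms(1), of "[]"] bounded_linear.linear[OF bounded_linear_Re]] by (simp add: o_def)
  then have "blinfun_apply (form_covec \<alpha>) v = Re (\<alpha> [v])" for v
    by (simp add: form_covec_def linear_Blinfun_apply)
  moreover have "of_real (Re (\<alpha> us)) = \<alpha> us" for us using assms(3)[of us] by (simp add: Reals_def complex_eq_iff image_iff)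
  ultimately show "\<alpha> vs = covec_form (form_covec \<alpha>) vs"
    using assms(2) by (auto simp: covec_form_def homog_def split: list.splits)
qed

text \<open>The twisted Courant bracket at a point from the values and the first derivatives of two
  sections. The sum is the 1-form with components \<open>2 * ginner (s' b) t\<close>, which makes
  the bracket fail to be antisymmetric.\<close>

definition bracket :: "('e::euclidean_space \<Rightarrow> 'e gtan) \<Rightarrow> ('e \<Rightarrow> 'e gtan) \<Rightarrow> 'e form \<Rightarrow> 'e gtan \<Rightarrow> 'e gtan \<Rightarrow> 'e gtan" where
  "bracket s' t' h s t = t' (fst s) - s' (fst t) + (\<Sum>b\<in>Basis. (2 * ginner (s' b) t) *\<^sub>R (0, dx b))
     + (0, form_covec (iprod (fst s) (iprod (fst t) h)))"

text \<open>The contribution of \<open>H\<close> to the derived bracket: each graded commutator with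
  a section contracts the 3-form once, since the exterior multiplications cancel.\<close>

lemma wedge_derived_bracket:
  assumes alt: "alt_form \<phi>" and h: "alt_form h" "homog 3 h" "\<And>vs. h vs \<in> \<real>"
  shows "wedge h (cliff_real s (cliff_real t \<phi>)) + cliff_real s (wedge h (cliff_real t \<phi>))
      - cliff_real t (wedge h (cliff_real s \<phi>)) - cliff_real t (cliff_real s (wedge h \<phi>))
    = cliff_real (0, form_covec (iprod (fst s) (iprod (fst t) h))) \<phi>"
proof -
  have ph: "par h = - h" using homog_par[OF h(2)] by (simp add: fun_eq_iff)
  have h2: "homog 2 (iprod v h)" for v using h(2) by (simp add: homog_def iprod_def)
  have ph2: "par (iprod v h) = iprod v h" for v using homog_par[OF h2] by (simp add: fsc_simps)
  have 1: "wedge h (cliff_real s \<psi>) + cliff_real s (wedge h \<psi>) = wedge (iprod (fst s) h) \<psi>" for s \<psi>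
    by (simp add: cliff_real_eq iprod_wedge eps_wedge ph wedge_linear)
  have 2: "wedge (iprod v h) (cliff_real t \<psi>) - cliff_real t (wedge (iprod v h) \<psi>) = wedge (iprod v (iprod (fst t) h)) \<psi>" for v t \<psi>
    by (simp add: cliff_real_eq iprod_wedge eps_wedge ph2 wedge_linear iprod_anticommute[OF h(1), of v "fst t"])
  have "wedge h (cliff_real s (cliff_real t \<phi>)) + cliff_real s (wedge h (cliff_real t \<phi>))
      - cliff_real t (wedge h (cliff_real s \<phi>)) - cliff_real t (cliff_real s (wedge h \<phi>))
    = (wedge h (cliff_real s (cliff_real t \<phi>)) + cliff_real s (wedge h (cliff_real t \<phi>)))
      - cliff_real t (wedge h (cliff_real s \<phi>) + cliff_real s (wedge h \<phi>))"
    by (simp add: cliff_real_linear)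
  also have "\<dots> = wedge (iprod (fst s) (iprod (fst t) h)) \<phi>" by (simp only: 1 2)
  also have "\<dots> = eps (form_covec (iprod (fst s) (iprod (fst t) h))) \<phi>"
    unfolding eps_def using h
    by (subst homog1_covec) (auto simp: alt_form_iprod homog_def iprod_def)
  finally show ?thesis by (simp add: eps_eq_cliff_real alt)
qed

text \<open>The Courant bracket as a derived bracket: take the anticommutator of \<open>d_H\<close>
  with \<open>s\<close> and then the commutator with \<open>t\<close>. \<open>D\<close> stands for
  the derivative of \<open>\<phi>\<close>, and the Leibniz rule is already inserted on the
  right.\<close>

lemma derived_bracket:
  assumes alt: "alt_form \<phi>" "\<And>b. alt_form (D b)" and lin: "linear s'" "linear t'"
    and h: "alt_form h" "homog 3 h" "\<And>vs. h vs \<in> \<real>"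
  shows "cliff_real (bracket s' t' h s t) \<phi> =
     (dform (\<lambda>b. cliff_real (s' b) (cliff_real t \<phi>) + cliff_real s (cliff_real (t' b) \<phi> + cliff_real t (D b)))
        + wedge h (cliff_real s (cliff_real t \<phi>)))
     + cliff_real s (dform (\<lambda>b. cliff_real (t' b) \<phi> + cliff_real t (D b)) + wedge h (cliff_real t \<phi>))
     - cliff_real t (dform (\<lambda>b. cliff_real (s' b) \<phi> + cliff_real s (D b)) + wedge h (cliff_real s \<phi>))
     - cliff_real t (cliff_real s (dform D + wedge h \<phi>))"
proof -
  let ?e = "\<lambda>b. (0, dx b) :: 'a gtan"
  let ?c = "cliff_real"
  have a: "alt_form (?c w \<phi>)" "alt_form (?c w (D b))" "alt_form (?c z (?c w \<phi>))" "alt_form (?c z (?c w (D b)))" for w z b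
    by (intro alt_form_cliff_real alt)+
  \<comment> \<open>In each direction the derivatives of \<open>\<phi>\<close> cancel, and only
    scalars from anticommutators remain as coefficients.\<close>
  have per_b: "?c (?e b) (?c (s' b) (?c t \<phi>) + ?c s (?c (t' b) \<phi> + ?c t (D b)))
     + ?c s (?c (?e b) (?c (t' b) \<phi> + ?c t (D b)))
     - ?c t (?c (?e b) (?c (s' b) \<phi> + ?c s (D b)))
     - ?c t (?c s (?c (?e b) (D b)))
    = fsc (of_real (2 * ginner (?e b) s)) (?c (t' b) \<phi>) - fsc (of_real (2 * ginner (?e b) t)) (?c (s' b) \<phi>)
      + fsc (of_real (2 * ginner (s' b) t)) (?c (?e b) \<phi>)" for b
  proof -
    have 1: "?c (?e b) (?c s X) = fsc (of_real (2 * ginner (?e b) s)) X - ?c s (?c (?e b) X)" if "alt_form X" for X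
      by (rule cliff_real_swap[OF that])
    have 2: "?c (?e b) (?c (s' b) (?c t \<phi>)) = fsc (of_real (2 * ginner (s' b) t)) (?c (?e b) \<phi>)
        - (fsc (of_real (2 * ginner (?e b) t)) (?c (s' b) \<phi>) - ?c t (?c (?e b) (?c (s' b) \<phi>)))"
      unfolding cliff_real_swap[OF alt(1), of "s' b" t] cliff_real_linear cliff_real_swap[OF a(1), of "?e b" t] ..
    show ?thesis
      unfolding cliff_real_linear 1[OF a(1)] 1[OF a(2)] 1[OF alt(2)] 2
      by (simp add: algebra_simps)
  qed
  have df: "dform X = (\<Sum>b\<in>Basis. ?c (?e b) (X b))" if "\<And>b. alt_form (X b)" for X
    unfolding dform_def by (simp add: eps_eq_cliff_real that)
  have "dform (\<lambda>b. ?c (s' b) (?c t \<phi>) + ?c s (?c (t' b) \<phi> + ?c t (D b)))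
     + ?c s (dform (\<lambda>b. ?c (t' b) \<phi> + ?c t (D b)))
     - ?c t (dform (\<lambda>b. ?c (s' b) \<phi> + ?c s (D b))) - ?c t (?c s (dform D))
    = (\<Sum>b\<in>Basis. ?c (?e b) (?c (s' b) (?c t \<phi>) + ?c s (?c (t' b) \<phi> + ?c t (D b)))
     + ?c s (?c (?e b) (?c (t' b) \<phi> + ?c t (D b)))
     - ?c t (?c (?e b) (?c (s' b) \<phi> + ?c s (D b)))
     - ?c t (?c s (?c (?e b) (D b))))"
    by (simp add: df alt_form_simps alt_form_cliff_real alt cliff_real_sum sum.distrib sum_subtractf)
  also have "\<dots> = ?c (t' (fst s) - s' (fst t) + (\<Sum>b\<in>Basis. (2 * ginner (s' b) t) *\<^sub>R (0, dx b))) \<phi>"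
  proof -
    have sum_left: "?c (sum f I) \<phi> = (\<Sum>i\<in>I. ?c (f i) \<phi>)" for f :: "'a \<Rightarrow> 'a gtan" and I
      by (rule additive_sum[of "\<lambda>w. ?c w \<phi>"]) (use cliff_real_scaleR[OF alt(1), of 0 0] in \<open>simp_all add: cliff_real_add alt fsc_simps\<close>)
    have lin_e: "?c (f v) \<phi> = (\<Sum>b\<in>Basis. fsc (of_real (v \<bullet> b)) (?c (f b) \<phi>))" if "linear f" for f and v :: 'a
      by (subst euclidean_representation[symmetric, of v], subst linear_sum[OF that])
        (simp add: sum_left linear_cmul[OF that] cliff_real_scaleR alt)
    have g: "2 * ginner (?e b) s = fst s \<bullet> b" for b s by (simp add: ginner_def)
    have sc: "?c (0, r *\<^sub>R dx b) \<phi> = fsc (of_real r) (?c (0, dx b) \<phi>)" for r b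
      using cliff_real_scaleR[OF alt(1), of r "(0, dx b)"] by simp
    show ?thesis
      unfolding per_b g
      by (simp add: sc cliff_real_add cliff_real_diff alt lin_e[OF lin(1), of "fst t"] lin_e[OF lin(2), of "fst s"] sum_left cliff_real_scaleR sum.distrib sum_subtractf)
  qed
  finally have "?c (t' (fst s) - s' (fst t) + (\<Sum>b\<in>Basis. (2 * ginner (s' b) t) *\<^sub>R (0, dx b))) \<phi> =
      dform (\<lambda>b. ?c (s' b) (?c t \<phi>) + ?c s (?c (t' b) \<phi> + ?c t (D b)))
     + ?c s (dform (\<lambda>b. ?c (t' b) \<phi> + ?c t (D b)))
     - ?c t (dform (\<lambda>b. ?c (s' b) \<phi> + ?c s (D b))) - ?c t (?c s (dform D))" ..
  then show ?thesis
    unfolding bracket_def cliff_real_add[OF alt(1), of _ "(0, form_covec _)"] wedge_derived_bracket[OF alt(1) h, symmetric] cliff_real_linear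
    by (simp add: algebra_simps)
qed

section \<open>Families of endomorphisms depending on a point\<close>

lemma bounded_linear_ginner: "bounded_linear (\<lambda>v. ginner v w)"
  unfolding ginner_def
  by (intro bounded_linear_compose[OF bounded_linear_divide] bounded_linear_add
      bounded_linear_compose[OF blinfun.bounded_linear_left bounded_linear_snd]
      bounded_linear_compose[OF blinfun.bounded_linear_right bounded_linear_fst])

lemma Cinf_ginner:
  assumes S: "open S" and "Cinf_on S f" "Cinf_on S g"
  shows "Cinf_on S (\<lambda>x. ginner (f x) (g x))"
  unfolding ginner_def
  by (intro Cinf_bounded_linear[OF S bounded_linear_divide] Cinf_add S
      Cinf_bounded_bilinear[OF S bounded_bilinear_blinfun_apply]
      Cinf_bounded_linear[OF S bounded_linear_fst] Cinf_bounded_linear[OF S bounded_linear_snd] assms)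

lemma linear_gtan_expand:
  assumes "linear G"
  shows "G w = (\<Sum>b\<in>Basis. (2 * ginner w (0, dx b)) *\<^sub>R G (b, 0) + (2 * ginner w (b, 0)) *\<^sub>R G (0, dx b))"
  by (subst gtan_expand, subst linear_sum[OF assms]) (simp only: linear_add[OF assms] linear_cmul[OF assms])

lemma Cinf_linear_family:
  fixes G :: "'e::euclidean_space \<Rightarrow> 'e gtan \<Rightarrow> 'e gtan"
  assumes S: "open S" and G: "\<And>x. x \<in> S \<Longrightarrow> linear (G x)" "\<And>w. Cinf_on S (\<lambda>x. G x w)" and v: "Cinf_on S v"
  shows "Cinf_on S (\<lambda>x. G x (v x))"
proof (rule Cinf_cong[OF S linear_gtan_expand[OF G(1), symmetric]])
  show "Cinf_on S (\<lambda>x. \<Sum>b\<in>Basis. (2 * ginner (v x) (0, dx b)) *\<^sub>R G x (b, 0) + (2 * ginner (v x) (b, 0)) *\<^sub>R G x (0, dx b))"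
    by (intro Cinf_sum S Cinf_add Cinf_scaleR G(2) Cinf_mult Cinf_const Cinf_ginner v)
qed

text \<open>Expanding \<open>v\<close> in the constant frame reduces this product rule to the one
  for scalar multiples, so that only the values of \<open>G\<close> on fixed vectors have to be
  differentiated.\<close>

lemma linear_family_has_derivative:
  fixes G :: "'e::euclidean_space \<Rightarrow> 'e gtan \<Rightarrow> 'e gtan"
  assumes S: "open S" "x \<in> S" and G: "\<And>x. x \<in> S \<Longrightarrow> linear (G x)" "\<And>w. ((\<lambda>x. G x w) has_derivative (\<lambda>b. M b w)) (at x)"
    and M: "\<And>b. linear (M b)" and v: "(v has_derivative v') (at x)"
  shows "((\<lambda>x. G x (v x)) has_derivative (\<lambda>b. M b (v x) + G x (v' b))) (at x)"
proof -
  let ?f = "\<lambda>x. \<Sum>b\<in>Basis. (2 * ginner (v x) (0, dx b)) *\<^sub>R G x (b, 0) + (2 * ginner (v x) (b, 0)) *\<^sub>R G x (0, dx b)"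
  have d: "((\<lambda>x. 2 * ginner (v x) w) has_derivative (\<lambda>b. 2 * ginner (v' b) w)) (at x)" for w
    by (intro has_derivative_mult_right bounded_linear.has_derivative[OF bounded_linear_ginner] v)
  have "(?f has_derivative (\<lambda>c. \<Sum>b\<in>Basis. ((2 * ginner (v x) (0, dx b)) *\<^sub>R M c (b, 0) + (2 * ginner (v' c) (0, dx b)) *\<^sub>R G x (b, 0))
     + ((2 * ginner (v x) (b, 0)) *\<^sub>R M c (0, dx b) + (2 * ginner (v' c) (b, 0)) *\<^sub>R G x (0, dx b)))) (at x)"
    by (intro has_derivative_sum has_derivative_add has_derivative_scaleR d G(2))
  moreover have "(\<lambda>c. \<Sum>b\<in>Basis. ((2 * ginner (v x) (0, dx b)) *\<^sub>R M c (b, 0) + (2 * ginner (v' c) (0, dx b)) *\<^sub>R G x (b, 0))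
     + ((2 * ginner (v x) (b, 0)) *\<^sub>R M c (0, dx b) + (2 * ginner (v' c) (b, 0)) *\<^sub>R G x (0, dx b)))
     = (\<lambda>b. M b (v x) + G x (v' b))"
  proof
    fix c
    show "(\<Sum>b\<in>Basis. ((2 * ginner (v x) (0, dx b)) *\<^sub>R M c (b, 0) + (2 * ginner (v' c) (0, dx b)) *\<^sub>R G x (b, 0))
     + ((2 * ginner (v x) (b, 0)) *\<^sub>R M c (0, dx b) + (2 * ginner (v' c) (b, 0)) *\<^sub>R G x (0, dx b))) = M c (v x) + G x (v' c)"
      unfolding linear_gtan_expand[OF M, of c "v x"] linear_gtan_expand[OF G(1)[OF S(2)], of "v' c"]
      by (simp add: sum.distrib algebra_simps)
  qed
  ultimately have "(?f has_derivative (\<lambda>b. M b (v x) + G x (v' b))) (at x)" by simp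
  then show ?thesis
    by (rule has_derivative_transform_within_open[OF _ S]) (rule linear_gtan_expand[OF G(1), symmetric])
qed

text \<open>The standard frame is real, so the spin action of a real \<open>J\<close> needs only
  real Clifford products, for which smoothness and the Leibniz rule are available.\<close>

lemma Sop_real:
  assumes "alt_form \<phi>" "linear J"
  shows "Sop J \<phi> = fsc (- \<i> / 2) (\<Sum>i\<in>GI. cliff_real (J (fst (gw i))) (cliff_real (fst (gd i)) \<phi>))"
proof -
  have "cliff (z, 0) \<psi> = cliff_real z \<psi>" if "alt_form \<psi>" for z and \<psi> :: "'a form"
    using cliff_real_scaleR[OF that, of 0 0] by (simp add: cliff_eq fsc_simps)
  moreover have "gw i = (fst (gw i), 0)" "gd i = (fst (gd i), 0)" for i :: "'a \<times> bool" by (simp_all add: gw_def gd_def)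
  then have "Jc J (gw i) = (J (fst (gw i)), 0)" "gd i = (fst (gd i), 0)" for i :: "'a \<times> bool"
    using linear_0[OF assms(2)] by (metis Jc_def snd_conv)+
  ultimately show ?thesis unfolding Sop_def using assms(1) by (metis (no_types, lifting) alt_form_cliff_real)
qed

section \<open>Generalized almost complex structures on a manifold\<close>

locale smooth_gcs = smooth_manifold A
  for A :: "('m::{t2_space,second_countable_topology}, 'e::euclidean_space) chart set" +
  fixes n :: nat and H :: "'m \<Rightarrow> 'e form" and J :: "'m \<Rightarrow> 'e gtan \<Rightarrow> 'e gtan"
  assumes dim: "DIM('e) = 2 * n" and H_smooth: "smooth_form A H" and H_real: "real_form_of_degree 3 H"
    and J_gac: "gen_almost_complex A J"
begin

lemma H_homog: "homog 3 (H p)" and H_Reals: "H p vs \<in> \<real>"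
  using H_real by (auto simp: real_form_of_degree_def homog_def)

lemma H_alt: "alt_form (H p)"
  by (rule smooth_form_alt[OF H_smooth])

lemma J_gcs: "gcs_point (J p)"
  using J_gac by (auto simp: gen_almost_complex_def gcs_point_def simp del: split_paired_All)

lemmas J_linear = gcs_point.J_linear[OF J_gcs]

definition Jloc :: "('m, 'e) chart \<Rightarrow> 'e \<Rightarrow> 'e gtan \<Rightarrow> 'e gtan" where
  "Jloc c x w = gtr (pchart A (cinv c x)) c (cinv c x) (J (cinv c x) (gtr c (pchart A (cinv c x)) (cinv c x) w))"

lemma Cinf_Jloc: "c \<in> A \<Longrightarrow> Cinf_on (cimage c) (\<lambda>x. Jloc c x w)"
  using J_gac unfolding gen_almost_complex_def Let_def Jloc_def by blast

lemma Jloc_eq: "Jloc c x = (\<lambda>w. gpull (tr c (pchart A (cinv c x)) (cinv c x)) (tr (pchart A (cinv c x)) c (cinv c x))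
    (J (cinv c x) (gpull (tr (pchart A (cinv c x)) c (cinv c x)) (tr c (pchart A (cinv c x)) (cinv c x)) w)))"
  by (rule ext) (simp add: Jloc_def gtr_eq_gpull)

lemma lin_iso_cinv: "c \<in> A \<Longrightarrow> x \<in> cimage c \<Longrightarrow> lin_iso (tr c (pchart A (cinv c x)) (cinv c x)) (tr (pchart A (cinv c x)) c (cinv c x))"
  by (rule lin_iso_tr) (auto simp: cinv_in pchart)

lemma Jloc_gcs: "c \<in> A \<Longrightarrow> x \<in> cimage c \<Longrightarrow> gcs_point (Jloc c x)"
  unfolding Jloc_eq by (rule lin_iso.gcs_point_gpull[OF lin_iso_cinv J_gcs])

lemmas Jloc_linear = gcs_point.J_linear[OF Jloc_gcs]

lemma Jloc_pchart: "Jloc (pchart A p) (snd (pchart A p) p) = J p"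
  by (rule ext) (simp add: Jloc_def cinv_snd pchart gtr_self)

lemma sloc_J: "c \<in> A \<Longrightarrow> x \<in> cimage c \<Longrightarrow> sloc c (\<lambda>q. J q (s q)) x = Jloc c x (sloc c s x)"
  by (simp add: sloc_def Jloc_def gtr_gtr gtr_self cinv_in pchart)

lemma floc_Sop:
  "c \<in> A \<Longrightarrow> x \<in> cimage c \<Longrightarrow> (\<And>p. alt_form (\<phi> p)) \<Longrightarrow> floc A c (\<lambda>p. Sop (J p) (\<phi> p)) x = Sop (Jloc c x) (floc A c \<phi> x)"
  unfolding floc_eq Jloc_eq by (rule lin_iso.pull_Sop[OF lin_iso_cinv _ J_linear])

lemma floc_EE: "c \<in> A \<Longrightarrow> x \<in> cimage c \<Longrightarrow> (\<And>p. \<phi> p \<in> EE (J p) k) \<Longrightarrow> floc A c \<phi> x \<in> EE (Jloc c x) k"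
  unfolding floc_eq Jloc_eq by (rule lin_iso.pull_EE[OF lin_iso_cinv _ J_linear])

lemma smooth_form_Sop:
  assumes "smooth_form A \<phi>"
  shows "smooth_form A (\<lambda>p. Sop (J p) (\<phi> p))"
proof (rule smooth_formI)
  show "alt_form (Sop (J p) (\<phi> p))" for p by (intro alt_form_Sop smooth_form_alt assms)
  fix c assume c: "c \<in> A"
  note F = smooth_form_sform[OF assms c]
  show "sform (cimage c) (floc A c (\<lambda>p. Sop (J p) (\<phi> p)))"
  proof (rule sform_cong[OF open_cimage[OF c]])
    show "sform (cimage c) (\<lambda>x. fsc (- \<i> / 2) (\<Sum>i\<in>GI. cliff_real (Jloc c x (fst (gw i))) (cliff_real (fst (gd i)) (floc A c \<phi> x))))"
      by (intro sform_fsc sform_sum sform_cliff_real open_cimage c F Cinf_Jloc Cinf_const)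
    show "fsc (- \<i> / 2) (\<Sum>i\<in>GI. cliff_real (Jloc c x (fst (gw i))) (cliff_real (fst (gd i)) (floc A c \<phi> x)))
        = floc A c (\<lambda>p. Sop (J p) (\<phi> p)) x" if x: "x \<in> cimage c" for x
      using floc_Sop[OF c x] smooth_form_alt[OF assms] Sop_real[OF sform_alt[OF F x] Jloc_linear[OF c x]] by simp
  qed
qed

lemma smooth_form_zero: "smooth_form A (\<lambda>p. 0)"
  by (rule smooth_formI) (simp_all add: alt_form_simps floc_eq[abs_def] pull_linear sform_const)

lemma smooth_form_gproj:
  assumes "smooth_form A \<phi>"
  shows "smooth_form A (\<lambda>p. gproj n (J p) k (\<phi> p))"
proof -
  define P where "P js \<longleftrightarrow> smooth_form A (\<lambda>p. foldr (gstep (J p) k) js (\<phi> p))" for js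
  have "P js" for js
  proof (induction js)
    case Nil
    then show ?case using assms by (simp add: P_def)
  next
    case (Cons j js)
    then have s: "smooth_form A (\<lambda>p. foldr (gstep (J p) k) js (\<phi> p))" by (simp add: P_def)
    show ?case unfolding P_def foldr_Cons o_apply gstep_def
      by (intro smooth_form_simps smooth_form_Sop s[unfolded gstep_def])
  qed
  then show ?thesis by (cases "\<bar>k\<bar> \<le> int n") (simp_all add: gproj_def P_def smooth_form_zero)
qed

lemma smooth_gsection_J:
  assumes "smooth_gsection A s"
  shows "smooth_gsection A (\<lambda>q. J q (s q))"
  unfolding smooth_gsection_iff
proof
  fix c assume c: "c \<in> A"
  have s: "Cinf_on (cimage c) (sloc c s)" using assms c by (simp add: smooth_gsection_iff del: split_paired_All)
  show "Cinf_on (cimage c) (sloc c (\<lambda>q. J q (s q)))"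
    by (rule Cinf_cong[OF open_cimage[OF c] sloc_J[OF c, symmetric]
        Cinf_linear_family[OF open_cimage[OF c] Jloc_linear[OF c] Cinf_Jloc[OF c] s]])
qed

lemma sections_U_iff: "\<phi> \<in> sections_U A n J k \<longleftrightarrow> smooth_form A \<phi> \<and> (\<forall>p. \<phi> p \<in> EE (J p) k)"
  by (simp add: sections_U_def Ubun_eq[where J=J, OF J_gcs dim])

lemmas smooth_form_dH = smooth_form_twisted_d[OF _ H_smooth H_homog]

lemma del_eq: "smooth_form A \<phi> \<Longrightarrow> del A H n J k \<phi> = (\<lambda>p. gproj n (J p) (k + 1) (twisted_d A H \<phi> p))"
  and delbar_eq: "smooth_form A \<phi> \<Longrightarrow> delbar A H n J k \<phi> = (\<lambda>p. gproj n (J p) (k - 1) (twisted_d A H \<phi> p))"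
  using smooth_form_alt[OF smooth_form_dH]
  by (auto simp: del_def delbar_def fun_eq_iff proj_U_eq[where J=J, OF J_gcs dim])

lemma gproj_sections_U:
  assumes "smooth_form A \<phi>"
  shows "(\<lambda>p. gproj n (J p) k (\<phi> p)) \<in> sections_U A n J k"
  using smooth_form_gproj[OF assms] gcs_point.gproj_in_EE[OF J_gcs dim smooth_form_alt[OF assms]]
  by (simp add: sections_U_iff)

subsection \<open>Derivatives at a point\<close>

abbreviation ch :: "'m \<Rightarrow> ('m, 'e) chart" where "ch \<equiv> pchart A"

abbreviation co :: "'m \<Rightarrow> 'e" where "co p \<equiv> snd (ch p) p"

lemma co_in: "co p \<in> cimage (ch p)"
  by (rule snd_in[OF pchart(2)])

text \<open>Derivatives at \<open>p\<close> of the components in the chart chosen at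
  \<open>p\<close>. There the values of the components are the given values, so no transition maps
  enter the formulas.\<close>

definition ds :: "'m \<Rightarrow> ('m \<Rightarrow> 'e gtan) \<Rightarrow> 'e \<Rightarrow> 'e gtan" where
  "ds p s = frechet_derivative (sloc (ch p) s) (at (co p))"

definition df :: "'m \<Rightarrow> ('m \<Rightarrow> 'e form) \<Rightarrow> 'e \<Rightarrow> 'e form" where
  "df p \<phi> = fd (floc A (ch p) \<phi>) (co p)"

definition dJ :: "'m \<Rightarrow> 'e \<Rightarrow> 'e gtan \<Rightarrow> 'e gtan" where
  "dJ p b w = frechet_derivative (\<lambda>y. Jloc (ch p) y w) (at (co p)) b"

lemma ds_has_derivative: "smooth_gsection A s \<Longrightarrow> (sloc (ch p) s has_derivative ds p s) (at (co p))"
  unfolding ds_def by (rule Cinf_has_derivative[OF _ co_in]) (use pchart(1) in \<open>simp add: smooth_gsection_iff\<close>)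

lemma ds_linear: "smooth_gsection A s \<Longrightarrow> linear (ds p s)"
  using ds_has_derivative has_derivative_linear by blast

lemma df_HD: "smooth_form A \<phi> \<Longrightarrow> HD (floc A (ch p) \<phi>) (co p) (df p \<phi>)"
  unfolding df_def by (rule sform_HD[OF smooth_form_sform[OF _ pchart(1)] co_in])

lemma df_alt: "smooth_form A \<phi> \<Longrightarrow> alt_form (df p \<phi> b)"
  by (rule HD_alt[OF open_cimage[OF pchart(1)] co_in sform_alt[OF smooth_form_sform[OF _ pchart(1)]] df_HD])

lemma dJ_has_derivative: "((\<lambda>y. Jloc (ch p) y w) has_derivative (\<lambda>b. dJ p b w)) (at (co p))"
  unfolding dJ_def by (rule Cinf_has_derivative[OF Cinf_Jloc[OF pchart(1)] co_in])

lemma twisted_d_eq: "smooth_form A \<phi> \<Longrightarrow> twisted_d A H \<phi> p = dform (df p \<phi>) + wedge (H p) (\<phi> p)"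
  by (simp add: twisted_d_pchart TD_def df_def floc_pchart)

lemma df_cliff_real:
  assumes "smooth_gsection A s" "smooth_form A \<phi>"
  shows "df p (\<lambda>q. cliff_real (s q) (\<phi> q)) = (\<lambda>b. cliff_real (ds p s b) (\<phi> p) + cliff_real (s p) (df p \<phi> b))"
proof -
  note S = open_cimage[OF pchart(1)] co_in
  have alt: "alt_form (floc A (ch p) \<phi> y)" if "y \<in> cimage (ch p)" for y
    by (rule sform_alt[OF smooth_form_sform[OF assms(2) pchart(1)] that])
  have "HD (\<lambda>y. cliff_real (sloc (ch p) s y) (floc A (ch p) \<phi> y)) (co p) (\<lambda>b. cliff_real (ds p s b) (\<phi> p) + cliff_real (s p) (df p \<phi> b))"
    using HD_cliff_real[OF S alt df_HD[OF assms(2)] ds_has_derivative[OF assms(1)]] by (simp add: floc_pchart sloc_pchart)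
  then have "HD (floc A (ch p) (\<lambda>q. cliff_real (s q) (\<phi> q))) (co p) (\<lambda>b. cliff_real (ds p s b) (\<phi> p) + cliff_real (s p) (df p \<phi> b))"
    by (rule HD_cong[OF S, rotated]) (simp add: floc_cliff_real pchart)
  then show ?thesis unfolding df_def by (rule HD_fd)
qed

lemma dJ_linear: "linear (dJ p b)"
proof (rule linearI)
  note S = open_cimage[OF pchart(1)] co_in
  fix w z r
  have "((\<lambda>y. Jloc (ch p) y w + Jloc (ch p) y z) has_derivative (\<lambda>b. dJ p b w + dJ p b z)) (at (co p))"
    by (intro has_derivative_add dJ_has_derivative)
  then have "((\<lambda>y. Jloc (ch p) y (w + z)) has_derivative (\<lambda>b. dJ p b w + dJ p b z)) (at (co p))"
    by (rule has_derivative_transform_within_open[OF _ S]) (simp add: linear_add[OF Jloc_linear[OF pchart(1)]])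
  from has_derivative_unique[OF this dJ_has_derivative] show "dJ p b (w + z) = dJ p b w + dJ p b z" by metis
  have "((\<lambda>y. r *\<^sub>R Jloc (ch p) y w) has_derivative (\<lambda>b. r *\<^sub>R dJ p b w)) (at (co p))"
    by (intro has_derivative_scaleR_right dJ_has_derivative)
  then have "((\<lambda>y. Jloc (ch p) y (r *\<^sub>R w)) has_derivative (\<lambda>b. r *\<^sub>R dJ p b w)) (at (co p))"
    by (rule has_derivative_transform_within_open[OF _ S]) (simp add: linear_cmul[OF Jloc_linear[OF pchart(1)]])
  from has_derivative_unique[OF this dJ_has_derivative] show "dJ p b (r *\<^sub>R w) = r *\<^sub>R dJ p b w" by metis
qed

lemma Jloc_has_derivative:
  assumes "(v has_derivative v') (at (co p))"
  shows "((\<lambda>y. Jloc (ch p) y (v y)) has_derivative (\<lambda>b. dJ p b (v (co p)) + J p (v' b))) (at (co p))"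
  using linear_family_has_derivative[OF open_cimage[OF pchart(1)] co_in Jloc_linear[OF pchart(1)] dJ_has_derivative dJ_linear assms]
  by (simp add: Jloc_pchart)

text \<open>Obtained by differentiating two functions that are constant near the point,
  \<open>J (J w)\<close> and \<open>ginner (J w) z + ginner (J z) w\<close>.\<close>

lemma gcs_variation_dJ: "gcs_variation (J p) (dJ p) (H p)"
proof (intro gcs_variation.intro gcs_variation_axioms.intro J_gcs dJ_linear H_alt H_homog)
  note S = open_cimage[OF pchart(1)] co_in
  fix b :: 'e and w z
  have "((\<lambda>y. - w) has_derivative (\<lambda>b. dJ p b (J p w) + J p (dJ p b w))) (at (co p))"
    by (rule has_derivative_transform_within_open[OF Jloc_has_derivative[OF dJ_has_derivative, of p w, unfolded Jloc_pchart] S])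
      (simp add: gcs_point.J_J[OF Jloc_gcs[OF pchart(1)]])
  from has_derivative_unique[OF this has_derivative_const] have "dJ p b (J p w) + J p (dJ p b w) = 0" by metis
  then show "dJ p b (J p w) = - J p (dJ p b w)" by (simp add: eq_neg_iff_add_eq_0)
  have "((\<lambda>y. ginner (Jloc (ch p) y w) z + ginner (Jloc (ch p) y z) w) has_derivative (\<lambda>b. ginner (dJ p b w) z + ginner (dJ p b z) w)) (at (co p))"
    by (intro has_derivative_add bounded_linear.has_derivative[OF bounded_linear_ginner] dJ_has_derivative)
  then have "((\<lambda>y. 0) has_derivative (\<lambda>b. ginner (dJ p b w) z + ginner (dJ p b z) w)) (at (co p))"
    by (rule has_derivative_transform_within_open[OF _ S])
      (simp add: gcs_point.ginner_J[OF Jloc_gcs[OF pchart(1)]] ginner_commute[of z])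
  from has_derivative_unique[OF this has_derivative_const] have "ginner (dJ p b w) z + ginner (dJ p b z) w = 0" by metis
  then show "ginner (dJ p b w) z = - ginner w (dJ p b z)" by (simp add: eq_neg_iff_add_eq_0 ginner_commute[of w])
qed

lemma df_Sop:
  assumes "smooth_form A \<phi>" "\<And>q. \<phi> q \<in> EE (J q) k"
  shows "Sop (J p) (df p \<phi> b) + Sop (dJ p b) (\<phi> p) = fsc (of_int k) (df p \<phi> b)"
proof -
  note S = open_cimage[OF pchart(1)] co_in
  let ?F = "floc A (ch p) \<phi>"
  have alt: "alt_form (?F y)" if "y \<in> cimage (ch p)" for y
    by (rule sform_alt[OF smooth_form_sform[OF assms(1) pchart(1)] that])
  have "HD (\<lambda>y. cliff_real w (?F y)) (co p) (\<lambda>b. cliff_real 0 (?F (co p)) + cliff_real w (df p \<phi> b))" for w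
    by (rule HD_cliff_real[OF S alt df_HD[OF assms(1)] has_derivative_const])
  moreover have "cliff_real 0 (?F (co p)) = 0" using cliff_real_scaleR[OF alt[OF co_in], of 0 0] by (simp add: fsc_simps)
  ultimately have 1: "HD (\<lambda>y. cliff_real w (?F y)) (co p) (\<lambda>b. cliff_real w (df p \<phi> b))" for w by simp
  have "HD (\<lambda>y. fsc (- \<i> / 2) (\<Sum>i\<in>GI. cliff_real (Jloc (ch p) y (fst (gw i))) (cliff_real (fst (gd i)) (?F y)))) (co p)
    (\<lambda>b. fsc (- \<i> / 2) (\<Sum>i\<in>GI. cliff_real (dJ p b (fst (gw i))) (cliff_real (fst (gd i)) (?F (co p)))
       + cliff_real (Jloc (ch p) (co p) (fst (gw i))) (cliff_real (fst (gd i)) (df p \<phi> b))))"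
    by (intro HD_fsc HD_sum HD_cliff_real[OF S _ 1 dJ_has_derivative] alt_form_cliff_real alt)
  \<comment> \<open>The eigenvalue equation holds on the whole chart, so the function just
    differentiated may be replaced by \<open>k\<close> times the form.\<close>
  then have "HD (\<lambda>y. fsc (of_int k) (?F y)) (co p)
    (\<lambda>b. fsc (- \<i> / 2) (\<Sum>i\<in>GI. cliff_real (dJ p b (fst (gw i))) (cliff_real (fst (gd i)) (?F (co p)))
       + cliff_real (Jloc (ch p) (co p) (fst (gw i))) (cliff_real (fst (gd i)) (df p \<phi> b))))"
  proof (rule HD_cong[OF S, rotated])
    fix y assume y: "y \<in> cimage (ch p)"
    have "?F y \<in> EE (Jloc (ch p) y) k" by (rule floc_EE[OF pchart(1) y assms(2)])
    then show "fsc (- \<i> / 2) (\<Sum>i\<in>GI. cliff_real (Jloc (ch p) y (fst (gw i))) (cliff_real (fst (gd i)) (?F y))) = fsc (of_int k) (?F y)"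
      using Sop_real[OF alt[OF y] Jloc_linear[OF pchart(1) y]] by (simp add: EE_def)
  qed
  from HD_fd[OF this] HD_fd[OF HD_fsc[OF df_HD[OF assms(1)]]]
  have "fsc (- \<i> / 2) (\<Sum>i\<in>GI. cliff_real (dJ p b (fst (gw i))) (cliff_real (fst (gd i)) (?F (co p)))
       + cliff_real (Jloc (ch p) (co p) (fst (gw i))) (cliff_real (fst (gd i)) (df p \<phi> b))) = fsc (of_int k) (df p \<phi> b)"
    by metis
  then show ?thesis
    unfolding Sop_real[OF df_alt[OF assms(1)] J_linear] Sop_real[OF smooth_form_alt[OF assms(1)] dJ_linear]
    by (simp add: floc_pchart Jloc_pchart sum.distrib fsc_simps add.commute)
qed

lemma twisted_d_decomposition:
  assumes "\<phi> \<in> sections_U A n J k"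
  shows "\<exists>g1\<in>EE (J p) (k + 1). \<exists>g2\<in>EE (J p) (k - 1). twisted_d A H \<phi> p
    = g1 + g2 + gcs_point.Tlow (J p) (dJ p) (H p) (\<phi> p) + gcs_point.Tlow (\<lambda>w. - J p w) (\<lambda>b w. - dJ p b w) (H p) (\<phi> p)"
proof -
  have s: "smooth_form A \<phi>" "\<And>q. \<phi> q \<in> EE (J q) k" using assms by (auto simp: sections_U_iff)
  show ?thesis
    unfolding twisted_d_eq[OF s(1)] dform_def
    by (rule gcs_variation.torsion[OF gcs_variation_dJ s(2) df_alt[OF s(1)] df_Sop[OF s]])
qed

end

section \<open>The Courant bracket in coordinates\<close>

lemma sum_scaleR_linear: "linear f \<Longrightarrow> (\<Sum>b\<in>Basis. (v \<bullet> b) *\<^sub>R f b) = f v"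
  for f :: "'e::euclidean_space \<Rightarrow> 'b::real_vector"
  by (subst (2) euclidean_representation[symmetric, of v], subst linear_sum) (simp_all add: linear_cmul)

lemma alt_form_expand3:
  assumes "alt_form h"
  shows "h [x, y, z] = (\<Sum>a\<in>Basis. \<Sum>b\<in>Basis. \<Sum>c\<in>Basis. of_real ((x \<bullet> a) * (y \<bullet> b) * (z \<bullet> c)) * h [a, b, c])"
proof -
  have 1: "h [a, y, z] = (\<Sum>b\<in>Basis. of_real (y \<bullet> b) * h [a, b, z])" for a y z
    using alt_form_expand[OF alt_form_iprod[OF assms, of a], of y "[z]"] by (simp add: iprod_def)
  have 2: "h [a, b, z] = (\<Sum>c\<in>Basis. of_real (z \<bullet> c) * h [a, b, c])" for a b z
    using alt_form_expand[OF alt_form_iprod[OF alt_form_iprod[OF assms, of a], of b], of z "[]"] by (simp add: iprod_def)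
  have "h [x, y, z] = (\<Sum>a\<in>Basis. of_real (x \<bullet> a) * h [a, y, z])"
    using alt_form_expand[OF assms] .
  also have "\<dots> = (\<Sum>a\<in>Basis. of_real (x \<bullet> a) * (\<Sum>b\<in>Basis. of_real (y \<bullet> b) * (\<Sum>c\<in>Basis. of_real (z \<bullet> c) * h [a, b, c])))"
    by (subst 1, subst 2) (rule refl)
  finally show ?thesis by (simp add: sum_distrib_left mult.assoc)
qed

lemma ginner_sum: "ginner (sum f I) w = (\<Sum>i\<in>I. ginner (f i) w)"
  by (rule additive_sum[of "\<lambda>v. ginner v w"]) (simp_all add: ginner_simps)

text \<open>This brings the bracket into the shape of \<open>Tor\<close>: components of vectors are
  rewritten as pairings with covectors, which double them.\<close>

lemma ginner_bracket:
  assumes lin: "linear s'" "linear t'" and h: "alt_form h"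
  shows "ginner (bracket s' t' h s t) u =
    (\<Sum>b\<in>Basis. 2 * ginner (0, dx b) s * ginner (t' b) u - 2 * ginner (0, dx b) t * ginner (s' b) u + 2 * ginner (s' b) t * ginner (0, dx b) u)
    - 4 * (\<Sum>a\<in>Basis. \<Sum>b\<in>Basis. \<Sum>c\<in>Basis. Re (h [a, b, c]) * (ginner (0, dx a) s * ginner (0, dx b) t * ginner (0, dx c) u))"
proof -
  have e: "2 * ginner (0, dx b) s = fst s \<bullet> b" for b s by (simp add: ginner_def)
  have 1: "ginner (t' (fst s)) u = (\<Sum>b\<in>Basis. 2 * ginner (0, dx b) s * ginner (t' b) u)" if "linear t'" for t' s
    unfolding e sum_scaleR_linear[OF that, symmetric, of "fst s"] by (simp add: ginner_sum ginner_simps)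
  have "linear (\<lambda>v. Re (iprod (fst s) (iprod (fst t) h) [v]))"
    using linear_compose[OF alt_form_linear0[OF alt_form_iprod[OF alt_form_iprod[OF h, of "fst t"], of "fst s"], of "[]"] bounded_linear.linear[OF bounded_linear_Re]]
    by (simp add: o_def)
  then have "ginner (0, form_covec (iprod (fst s) (iprod (fst t) h))) u = Re (iprod (fst s) (iprod (fst t) h) [fst u]) / 2"
    by (simp add: form_covec_def linear_Blinfun_apply ginner_def)
  also have "iprod (fst s) (iprod (fst t) h) [fst u] = - h [fst s, fst t, fst u]"
    using alt_form_swap01[OF h, of "fst t" "fst s" "[fst u]"] by (simp add: iprod_def)
  also have "Re (- h [fst s, fst t, fst u]) / 2 = - 4 * (\<Sum>a\<in>Basis. \<Sum>b\<in>Basis. \<Sum>c\<in>Basis. Re (h [a, b, c]) * (ginner (0, dx a) s * ginner (0, dx b) t * ginner (0, dx c) u))"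
    by (subst alt_form_expand3[OF h]) (simp add: e[symmetric] sum_distrib_left sum_divide_distrib sum_negf[symmetric] algebra_simps)
  finally have 2: "ginner (0, form_covec (iprod (fst s) (iprod (fst t) h))) u =
    - 4 * (\<Sum>a\<in>Basis. \<Sum>b\<in>Basis. \<Sum>c\<in>Basis. Re (h [a, b, c]) * (ginner (0, dx a) s * ginner (0, dx b) t * ginner (0, dx c) u))" .
  have 3: "ginner (\<Sum>b\<in>Basis. (2 * ginner (s' b) t) *\<^sub>R (0, dx b)) u = (\<Sum>b\<in>Basis. 2 * ginner (s' b) t * ginner (0, dx b) u)"
    unfolding ginner_sum ginner_simps ..
  show ?thesis
    unfolding bracket_def ginner_simps 1[OF lin(1)] 1[OF lin(2)] 2 3 by (simp add: sum.distrib sum_subtractf)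
qed

context smooth_gcs
begin

lemma frechet_vloc: "smooth_gsection A s \<Longrightarrow> frechet_derivative (vloc A (ch p) (\<lambda>q. fst (s q))) (at (co p)) b = fst (ds p s b)"
  and frechet_cloc: "smooth_gsection A s \<Longrightarrow> frechet_derivative (cloc A (ch p) (\<lambda>q. snd (s q))) (at (co p)) b = snd (ds p s b)"
  and cloc_has_derivative: "smooth_gsection A s \<Longrightarrow> (cloc A (ch p) (\<lambda>q. snd (s q)) has_derivative (\<lambda>b. snd (ds p s b))) (at (co p))"
proof -
  assume s: "smooth_gsection A s"
  have 1: "((\<lambda>x. fst (sloc (ch p) s x)) has_derivative (\<lambda>b. fst (ds p s b))) (at (co p))"
    by (rule has_derivative_fst[OF ds_has_derivative[OF s]])
  have 2: "((\<lambda>x. snd (sloc (ch p) s x)) has_derivative (\<lambda>b. snd (ds p s b))) (at (co p))"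
    by (rule has_derivative_snd[OF ds_has_derivative[OF s]])
  have e: "(\<lambda>x. fst (sloc (ch p) s x)) = vloc A (ch p) (\<lambda>q. fst (s q))" "(\<lambda>x. snd (sloc (ch p) s x)) = cloc A (ch p) (\<lambda>q. snd (s q))"
    by (simp_all add: sloc_eq)
  show "frechet_derivative (vloc A (ch p) (\<lambda>q. fst (s q))) (at (co p)) b = fst (ds p s b)"
    using frechet_derivative_at[OF 1] unfolding e by metis
  show "(cloc A (ch p) (\<lambda>q. snd (s q)) has_derivative (\<lambda>b. snd (ds p s b))) (at (co p))" using 2 unfolding e .
  then show "frechet_derivative (cloc A (ch p) (\<lambda>q. snd (s q))) (at (co p)) b = snd (ds p s b)"
    using frechet_derivative_at by metis
qed

lemma ext_d_covec:
  assumes s: "smooth_gsection A s"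
  shows "ext_d A (\<lambda>q. covec_form (snd (s q))) p [v, w] = of_real (snd (ds p s v) w - snd (ds p s w) v)"
proof -
  let ?c = "ch p"
  have "((\<lambda>x. complex_of_real (blinfun_apply (cloc A ?c (\<lambda>q. snd (s q)) x) u)) has_derivative (\<lambda>b. of_real (blinfun_apply (snd (ds p s b)) u))) (at (co p))" for u
    by (intro bounded_linear.has_derivative[OF bounded_linear_of_real] bounded_linear.has_derivative[OF blinfun.bounded_linear_left] cloc_has_derivative s)
  then have "((\<lambda>x. floc A ?c (\<lambda>q. covec_form (snd (s q))) x [u]) has_derivative (\<lambda>b. of_real (blinfun_apply (snd (ds p s b)) u))) (at (co p))" for u
  proof (rule has_derivative_transform_within_open[OF _ open_cimage[OF pchart(1)] co_in])
    fix x assume x: "x \<in> cimage ?c"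
    have l: "linear (tr ?c (ch (cinv ?c x)) (cinv ?c x))"
      using x by (intro tr_linear) (auto simp: pchart cinv_in)
    show "complex_of_real (blinfun_apply (cloc A ?c (\<lambda>q. snd (s q)) x) u) = floc A ?c (\<lambda>q. covec_form (snd (s q))) x [u]"
      by (simp add: cloc_def floc_def Let_def covec_form_def Blinfun_compose_apply[OF l])
  qed
  then have *: "frechet_derivative (\<lambda>x. floc A ?c (\<lambda>q. covec_form (snd (s q))) x [u]) (at (co p)) b = of_real (blinfun_apply (snd (ds p s b)) u)" for u b
    using frechet_derivative_at by metis
  show ?thesis by (simp add: ext_d_def Let_def * lessThan_Suc numeral_2_eq_2)
qed

text \<open>In the covector part, the terms of the Lie derivative and of the contraction of
  \<open>d\<xi>\<close> that differentiate in the direction of the argument add up to twice the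
  inner product of the derivative of \<open>s\<close> with \<open>t\<close>.\<close>

lemma courant_eq:
  assumes s: "smooth_gsection A s" and t: "smooth_gsection A t"
  shows "courant A H s t p = bracket (ds p s) (ds p t) (H p) (s p) (t p)"
proof -
  let ?s = "ds p s" and ?t = "ds p t"
  have "fst (courant A H s t p) = fst (bracket ?s ?t (H p) (s p) (t p))"
    by (simp add: courant_def bracket_def lie_bracket_def Let_def frechet_vloc s t fst_sum)
  moreover have "snd (courant A H s t p) = snd (bracket ?s ?t (H p) (s p) (t p))"
  proof (rule blinfun_eqI)
    fix v
    have lin_s: "linear (\<lambda>v. fst (?s v))" "linear (\<lambda>v. snd (?s v))"
      using ds_linear[OF s, of p] by (auto simp: linear_iff)
    have 1: "blinfun_apply (lie_deriv A (\<lambda>q. fst (s q)) (\<lambda>q. snd (t q)) p) v = snd (?t (fst (s p))) v + snd (t p) (fst (?s v))"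
    proof -
      have "linear (\<lambda>v. blinfun_apply (snd (?t (fst (s p)))) v + blinfun_apply (snd (t p)) (fst (?s v)))"
        by (rule linearI) (simp_all add: blinfun.bilinear_simps linear_add[OF lin_s(1)] linear_cmul[OF lin_s(1)] algebra_simps)
      then show ?thesis by (simp add: lie_deriv_def Let_def frechet_cloc frechet_vloc s t linear_Blinfun_apply)
    qed
    have 2: "blinfun_apply (form_covec (iprod (fst (t p)) (ext_d A (\<lambda>q. covec_form (snd (s q))) p))) v
        = snd (?s (fst (t p))) v - snd (?s v) (fst (t p))"
    proof -
      have "linear (\<lambda>v. blinfun_apply (snd (?s (fst (t p)))) v - blinfun_apply (snd (?s v)) (fst (t p)))"
        by (rule linearI) (simp_all add: blinfun.bilinear_simps linear_add[OF lin_s(2)] linear_cmul[OF lin_s(2)] algebra_simps)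
      then show ?thesis by (simp add: form_covec_def iprod_def ext_d_covec[OF s] linear_Blinfun_apply)
    qed
    have 3: "(\<Sum>b\<in>Basis. (2 * ginner (?s b) (t p)) * (v \<bullet> b)) = snd (?s v) (fst (t p)) + snd (t p) (fst (?s v))"
    proof -
      have "(\<Sum>b\<in>Basis. (2 * ginner (?s b) (t p)) * (v \<bullet> b)) = 2 * ginner (\<Sum>b\<in>Basis. (v \<bullet> b) *\<^sub>R ?s b) (t p)"
        by (simp add: ginner_sum ginner_simps sum_distrib_left algebra_simps)
      then show ?thesis unfolding sum_scaleR_linear[OF ds_linear[OF s]] by (simp add: ginner_def)
    qed
    show "snd (courant A H s t p) v = snd (bracket ?s ?t (H p) (s p) (t p)) v"
      by (simp add: courant_def bracket_def Let_def snd_sum blinfun.bilinear_simps blinfun.sum_left 1 2 3)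
  qed
  ultimately show ?thesis by (simp add: prod_eq_iff)
qed

text \<open>Transfers properties of the twisted differential to the bracket: the right-hand side is
  built from operations that preserve smooth forms.\<close>

lemma cliff_courant:
  assumes s: "smooth_gsection A s" and t: "smooth_gsection A t" and phi: "smooth_form A \<phi>"
  shows "cliff_real (courant A H s t p) (\<phi> p) =
     twisted_d A H (\<lambda>q. cliff_real (s q) (cliff_real (t q) (\<phi> q))) p
     + cliff_real (s p) (twisted_d A H (\<lambda>q. cliff_real (t q) (\<phi> q)) p)
     - cliff_real (t p) (twisted_d A H (\<lambda>q. cliff_real (s q) (\<phi> q)) p)
     - cliff_real (t p) (cliff_real (s p) (twisted_d A H \<phi> p))"
  by (simp only: courant_eq[OF s t] twisted_d_eq[OF phi] twisted_d_eq[OF smooth_form_cliff_real[OF s phi]] twisted_d_eq[OF smooth_form_cliff_real[OF t phi]]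
      twisted_d_eq[OF smooth_form_cliff_real[OF s smooth_form_cliff_real[OF t phi]]]
      df_cliff_real[OF s phi] df_cliff_real[OF t phi] df_cliff_real[OF s smooth_form_cliff_real[OF t phi]])
    (rule derived_bracket[OF smooth_form_alt[OF phi] df_alt[OF phi] ds_linear[OF s] ds_linear[OF t] H_alt H_homog H_Reals])

section \<open>Smoothness of sections tested on forms\<close>

lemma Cinf_of_bump:
  fixes g :: "'e \<Rightarrow> real"
  assumes S: "open S" and *: "\<And>x0. x0 \<in> S \<Longrightarrow> \<exists>f. Cinf_on UNIV f \<and> f x0 = (1::real) \<and> Cinf_on S (\<lambda>x. f x * g x)"
  shows "Cinf_on S g"
proof (rule Cinf_local)
  fix x0 assume x0: "x0 \<in> S"
  obtain f where f: "Cinf_on UNIV f" "f x0 = 1" "Cinf_on S (\<lambda>x. f x * g x)" using *[OF x0] by blast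
  \<comment> \<open>On this neighbourhood of \<open>x0\<close> the bump function has no zeros and
    can be divided out.\<close>
  define U where "U = S \<inter> f -` (- {0})"
  have "open U" unfolding U_def
    by (rule continuous_open_preimage[OF _ S]) (auto intro: continuous_on_subset[OF Cinf_continuous_on[OF f(1)]])
  moreover have "x0 \<in> U" using x0 f(2) by (simp add: U_def)
  moreover have "Cinf_on U g"
  proof (rule Cinf_cong[OF \<open>open U\<close>])
    show "Cinf_on U (\<lambda>x. inverse (f x) * (f x * g x))"
      by (intro Cinf_mult Cinf_inverse \<open>open U\<close> Cinf_subset[OF f(1)] Cinf_subset[OF f(3)]) (auto simp: U_def)
  qed (simp add: U_def)
  ultimately show "\<exists>U. open U \<and> x0 \<in> U \<and> Cinf_on U g" by blast
qed

text \<open>Acting on the constant function 1 exhibits the covector components of a section, acting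
  on \<open>dx b\<close> its vector components. These constant forms live in one chart, so they are
  multiplied by bump functions to become global.\<close>

lemma smooth_gsectionI:
  assumes "\<And>\<phi>. smooth_form A \<phi> \<Longrightarrow> smooth_form A (\<lambda>p. cliff_real (u p) (\<phi> p))"
  shows "smooth_gsection A u"
proof -
  have "Cinf_on (cimage c) (sloc c u)" if c: "c \<in> A" for c
  proof -
    note S = open_cimage[OF c]
    have key: "Cinf_on (cimage c) g"
      if alt: "alt_form \<phi>\<^sub>0" and g: "\<And>x a. x \<in> cimage c \<Longrightarrow> cliff_real (sloc c u x) (fsc a \<phi>\<^sub>0) vs = a * of_real (g x)" for \<phi>\<^sub>0 vs g
    proof (rule Cinf_of_bump[OF S])
      fix x0 assume x0: "x0 \<in> cimage c"
      obtain \<phi> f where f: "smooth_form A \<phi>" "Cinf_on UNIV f" "f x0 = (1::real)" "\<forall>x\<in>cimage c. floc A c \<phi> x = fsc (of_real (f x)) \<phi>\<^sub>0"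
        using form_extension[OF c x0 alt] by blast
      have "Cinf_on (cimage c) (\<lambda>x. Re (floc A c (\<lambda>p. cliff_real (u p) (\<phi> p)) x vs))"
        by (rule Cinf_bounded_linear[OF S bounded_linear_Re sform_Cinf[OF smooth_form_sform[OF assms[OF f(1)] c]]])
      then have "Cinf_on (cimage c) (\<lambda>x. f x * g x)"
        by (rule Cinf_cong[OF S, rotated]) (simp add: floc_cliff_real[OF c] f(4) g)
      then show "\<exists>f. Cinf_on UNIV f \<and> f x0 = (1::real) \<and> Cinf_on (cimage c) (\<lambda>x. f x * g x)" using f by blast
    qed
    define one :: "'e form" where "one vs = (if vs = [] then 1 else 0)" for vs
    have alt_one: "alt_form one" unfolding alt_form_def by (simp add: one_def linear_zero)
    have alt_dx: "alt_form (covec_form (dx b))" for b :: 'e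
    proof -
      have "covec_form (dx b) = eps (dx b) one"
      proof (rule form_eqI)
        have i0: "iprod v one = 0" for v by (simp add: fun_eq_iff iprod_def one_def)
        show "iprod v (covec_form (dx b)) = iprod v (eps (dx b) one)" for v
          unfolding iprod_eps i0 eps_linear iprod_covec_form by (simp add: fun_eq_iff one_def)
      qed (simp add: covec_form_def)
      then show ?thesis using alt_form_eps[OF alt_one] by simp
    qed
    have 1: "Cinf_on (cimage c) (\<lambda>x. fst (sloc c u x) \<bullet> b)" for b
      by (rule key[OF alt_dx[of b], where vs="[]"]) (simp add: cliff_real_eq iprod_def covec_form_def)
    have 2: "Cinf_on (cimage c) (\<lambda>x. snd (sloc c u x) v)" for v
      by (rule key[OF alt_one, where vs="[v]"]) (simp add: cliff_real_eq iprod_def one_def eps_Cons)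
    have "Cinf_on (cimage c) (\<lambda>x. \<Sum>b\<in>Basis. (fst (sloc c u x) \<bullet> b) *\<^sub>R (b, 0) + (snd (sloc c u x) b) *\<^sub>R (0, dx b))"
      by (intro Cinf_sum Cinf_add Cinf_scaleR S 1 2 Cinf_const)
    then show ?thesis
    proof (rule Cinf_cong[OF S, rotated])
      show "(\<Sum>b\<in>Basis. (fst (sloc c u x) \<bullet> b) *\<^sub>R (b, 0) + (snd (sloc c u x) b) *\<^sub>R (0, dx b)) = sloc c u x" for x
        by (subst gtan_expand) (simp add: ginner_def)
    qed
  qed
  then show ?thesis by (simp add: smooth_gsection_iff del: split_paired_All)
qed

lemma smooth_gsection_courant:
  assumes s: "smooth_gsection A s" and t: "smooth_gsection A t"
  shows "smooth_gsection A (courant A H s t)"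
proof (rule smooth_gsectionI)
  fix \<phi> assume phi: "smooth_form A \<phi>"
  show "smooth_form A (\<lambda>p. cliff_real (courant A H s t p) (\<phi> p))"
    unfolding cliff_courant[OF s t phi]
    by (intro smooth_form_simps smooth_form_cliff_real smooth_form_dH s t phi)
qed

lemma smooth_gsection_simps:
  assumes "smooth_gsection A s" "smooth_gsection A t"
  shows "smooth_gsection A (\<lambda>p. s p + t p)" "smooth_gsection A (\<lambda>p. s p - t p)" "smooth_gsection A (\<lambda>p. - s p)"
  by (rule smooth_gsectionI,
      simp only: cliff_real_add cliff_real_diff cliff_real_uminus smooth_form_alt,
      use assms in \<open>auto intro!: smooth_form_simps smooth_form_cliff_real smooth_form_zero smooth_form_simps(2)[OF smooth_form_zero, simplified]\<close>)+

lemma smooth_csection_ccourant: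
  assumes "smooth_csection A e" "smooth_csection A f"
  shows "smooth_csection A (ccourant A H e f)"
  using assms unfolding smooth_csection_def ccourant_def Let_def fst_conv snd_conv
  by (intro conjI smooth_gsection_simps smooth_gsection_courant) simp_all

section \<open>Sections of \<open>L\<close> and the tensor \<open>T_L\<close>\<close>

lemma sections_L_iff: "e \<in> sections_L A J \<longleftrightarrow> smooth_csection A e \<and> (\<forall>p. e p \<in> LL (J p))"
  by (simp add: sections_L_def Lbun_eq)

text \<open>An element of \<open>L\<close> is \<open>s - \<i> J s\<close> for its real part
  \<open>s\<close>, which is arbitrary. Hence real sections extending a given vector yield sections
  of \<open>L\<close>.\<close>

lemma LL_snd: "z \<in> LL (J p) \<longleftrightarrow> snd z = - J p (fst z)"
proof -
  interpret gcs_point "J p" by (rule J_gcs)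
  have "z \<in> LL (J p) \<longleftrightarrow> J p (fst z) = - snd z \<and> J p (snd z) = fst z"
    by (auto simp: LL_def Jc_def cscale_def prod_eq_iff)
  also have "\<dots> \<longleftrightarrow> snd z = - J p (fst z)"
    by (auto simp: linear_neg[OF J_linear] J_J)
  finally show ?thesis .
qed

lemma sections_L_extension:
  assumes "z \<in> LL (J p)"
  shows "\<exists>e\<in>sections_L A J. e p = z"
proof -
  obtain s where s: "smooth_gsection A s" "s p = fst z" using gsection_extension by blast
  let ?e = "\<lambda>q. (s q, - J q (s q))"
  have "?e \<in> sections_L A J"
    unfolding sections_L_iff smooth_csection_def
    using s smooth_gsection_simps(3)[OF smooth_gsection_J[OF s(1)] s(1)] by (simp add: LL_snd)
  moreover have "?e p = z" by (rule prod_eqI) (simp_all only: fst_conv snd_conv s(2) assms[unfolded LL_snd])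
  ultimately show ?thesis by (rule bexI[where x="?e", rotated])
qed

definition de :: "'m \<Rightarrow> ('m \<Rightarrow> 'e cgtan) \<Rightarrow> 'e \<Rightarrow> 'e cgtan" where
  "de p e b = (ds p (\<lambda>q. fst (e q)) b, ds p (\<lambda>q. snd (e q)) b)"

text \<open>The complexification of \<open>ginner_bracket\<close>, assembled from the eight real
  inner products of four real brackets.\<close>

lemma cinner_ccourant:
  assumes e: "smooth_csection A e" and f: "smooth_csection A f"
  shows "cinner (ccourant A H e f p) z =
    (\<Sum>b\<in>Basis. 2 * cinner (ee b) (e p) * cinner (de p f b) z - 2 * cinner (ee b) (f p) * cinner (de p e b) z
       + 2 * cinner (de p e b) (f p) * cinner (ee b) z)
    - 4 * (\<Sum>a\<in>Basis. \<Sum>b\<in>Basis. \<Sum>c\<in>Basis. H p [a, b, c] * (cinner (ee a) (e p) * cinner (ee b) (f p) * cinner (ee c) z))"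
proof -
  obtain e1 e2 f1 f2 where ef: "e1 = (\<lambda>q. fst (e q))" "e2 = (\<lambda>q. snd (e q))" "f1 = (\<lambda>q. fst (f q))" "f2 = (\<lambda>q. snd (f q))" by blast
  obtain z1 z2 where z: "z = (z1, z2)" by (cases z)
  have sm: "smooth_gsection A e1" "smooth_gsection A e2" "smooth_gsection A f1" "smooth_gsection A f2"
    using e f by (simp_all add: smooth_csection_def ef)
  have Hr: "H p vs = of_real (Re (H p vs))" for vs using H_Reals[of p vs] by (simp add: complex_eq_iff complex_is_Real_iff)
  let ?g = "ginner"
  let ?E = "\<lambda>b. (0, dx b) :: 'e gtan"
  define S where "S s t s' t' u = (\<Sum>b\<in>Basis. 2 * ?g (?E b) s * ?g (t' b) u - 2 * ?g (?E b) t * ?g (s' b) u + 2 * ?g (s' b) t * ?g (?E b) u)"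
    for s t :: "'e gtan" and s' t' :: "'e \<Rightarrow> 'e gtan" and u
  define T where "T s t u = (\<Sum>a\<in>Basis. \<Sum>b\<in>Basis. \<Sum>c\<in>Basis. Re (H p [a, b, c]) * (?g (?E a) s * ?g (?E b) t * ?g (?E c) u))"
    for s t u :: "'e gtan"
  have R: "?g (courant A H s t p) u = S (s p) (t p) (ds p s) (ds p t) u - 4 * T (s p) (t p) u"
    if "smooth_gsection A s" "smooth_gsection A t" for s t u
    unfolding courant_eq[OF that] ginner_bracket[OF ds_linear[OF that(1)] ds_linear[OF that(2)] H_alt] S_def T_def ..
  have S: "(\<Sum>b\<in>Basis. 2 * cinner (ee b) (e p) * cinner (de p f b) z - 2 * cinner (ee b) (f p) * cinner (de p e b) z
       + 2 * cinner (de p e b) (f p) * cinner (ee b) z)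
    = Complex (S (e1 p) (f1 p) (ds p e1) (ds p f1) z1 - S (e2 p) (f2 p) (ds p e2) (ds p f2) z1
         - S (e1 p) (f2 p) (ds p e1) (ds p f2) z2 - S (e2 p) (f1 p) (ds p e2) (ds p f1) z2)
       (S (e1 p) (f1 p) (ds p e1) (ds p f1) z2 - S (e2 p) (f2 p) (ds p e2) (ds p f2) z2
         + S (e1 p) (f2 p) (ds p e1) (ds p f2) z1 + S (e2 p) (f1 p) (ds p e2) (ds p f1) z1)"
    unfolding complex_eq_iff Re_sum Im_sum S_def complex.sel sum_subtractf[symmetric] sum.distrib[symmetric]
    by (intro conjI sum.cong refl) (simp_all add: cinner_def ee_def de_def ef z ginner_simps flip: zero_prod_def, simp_all add: algebra_simps)
  have T: "(\<Sum>a\<in>Basis. \<Sum>b\<in>Basis. \<Sum>c\<in>Basis. H p [a, b, c] * (cinner (ee a) (e p) * cinner (ee b) (f p) * cinner (ee c) z))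
    = Complex (T (e1 p) (f1 p) z1 - T (e2 p) (f2 p) z1 - T (e1 p) (f2 p) z2 - T (e2 p) (f1 p) z2)
       (T (e1 p) (f1 p) z2 - T (e2 p) (f2 p) z2 + T (e1 p) (f2 p) z1 + T (e2 p) (f1 p) z1)"
    unfolding complex_eq_iff Re_sum Im_sum T_def complex.sel sum_subtractf[symmetric] sum.distrib[symmetric]
    by (subst (1 2) Hr, intro conjI sum.cong refl)
       (simp_all add: cinner_def ee_def ef z ginner_simps flip: zero_prod_def, simp_all add: algebra_simps)
  have "cinner (ccourant A H e f p) z = Complex
     (?g (courant A H e1 f1 p) z1 - ?g (courant A H e2 f2 p) z1 - ?g (courant A H e1 f2 p) z2 - ?g (courant A H e2 f1 p) z2)
     (?g (courant A H e1 f1 p) z2 - ?g (courant A H e2 f2 p) z2 + ?g (courant A H e1 f2 p) z1 + ?g (courant A H e2 f1 p) z1)"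
    by (simp add: ccourant_def Let_def ef[symmetric] cinner_def z ginner_simps)
  also have "\<dots> = (\<Sum>b\<in>Basis. 2 * cinner (ee b) (e p) * cinner (de p f b) z - 2 * cinner (ee b) (f p) * cinner (de p e b) z
       + 2 * cinner (de p e b) (f p) * cinner (ee b) z)
    - 4 * (\<Sum>a\<in>Basis. \<Sum>b\<in>Basis. \<Sum>c\<in>Basis. H p [a, b, c] * (cinner (ee a) (e p) * cinner (ee b) (f p) * cinner (ee c) z))"
    unfolding S T by (simp add: R sm complex_eq_iff)
  finally show ?thesis .
qed

text \<open>Differentiating \<open>J e = \<i> e\<close> shows that \<open>J\<close> maps the
  derivative of \<open>e\<close> to \<open>\<i>\<close> times itself minus the derivative of
  \<open>J\<close> applied to \<open>e\<close>. Paired with \<open>z\<close> in \<open>L\<close>,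
  antisymmetry of \<open>J\<close> gives \<open>- \<i>\<close> instead, so the pairing is determined
  by the derivative of \<open>J\<close>.\<close>

lemma cinner_de:
  assumes e: "e \<in> sections_L A J" and z: "z \<in> LL (J p)" and b: "b \<in> Basis"
  shows "cinner (de p e b) z = - \<i> / 2 * cinner (Jc (dJ p b) (e p)) z"
proof -
  interpret gcs_variation "J p" "dJ p" "H p" by (rule gcs_variation_dJ)
  note S = open_cimage[OF pchart(1)] co_in
  let ?s = "\<lambda>q. fst (e q)"
  have s: "smooth_gsection A ?s" "smooth_gsection A (\<lambda>q. snd (e q))" and L: "\<And>q. snd (e q) = - J q (fst (e q))"
    using e by (auto simp: sections_L_iff smooth_csection_def LL_snd)
  have "((\<lambda>y. - Jloc (ch p) y (sloc (ch p) ?s y)) has_derivative (\<lambda>b. - (dJ p b (?s p) + J p (ds p ?s b)))) (at (co p))"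
    using has_derivative_minus[OF Jloc_has_derivative[OF ds_has_derivative[OF s(1)]]] by (simp add: sloc_pchart)
  then have "(sloc (ch p) (\<lambda>q. snd (e q)) has_derivative (\<lambda>b. - (dJ p b (?s p) + J p (ds p ?s b)))) (at (co p))"
  proof (rule has_derivative_transform_within_open[OF _ S])
    fix y assume y: "y \<in> cimage (ch p)"
    have "linear (gtr (ch (cinv (ch p) y)) (ch p) (cinv (ch p) y))"
      using y by (intro gtr_linear) (auto simp: pchart cinv_in)
    then show "- Jloc (ch p) y (sloc (ch p) ?s y) = sloc (ch p) (\<lambda>q. snd (e q)) y"
      using sloc_J[OF pchart(1) y, of ?s] by (simp add: sloc_def L linear_neg)
  qed
  from fun_cong[OF has_derivative_unique[OF this ds_has_derivative[OF s(2)]], of b]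
  have d: "ds p (\<lambda>q. snd (e q)) b = - (dJ p b (?s p) + J p (ds p ?s b))" by (rule sym)
  have "Jc (J p) (de p e b) = csc \<i> (de p e b) - Jc (dJ p b) (e p)"
    unfolding de_def d Jc_def cscale_def using b
    by (simp add: L linear_neg[OF J_linear] linear_neg[OF M_linear] linear_diff[OF J_linear] J_J M_J prod_eq_iff)
  then have "cinner (Jc (J p) (de p e b)) z = \<i> * cinner (de p e b) z - cinner (Jc (dJ p b) (e p)) z"
    by (simp add: cinner_simps)
  moreover have "cinner (Jc (J p) (de p e b)) z = - \<i> * cinner (de p e b) z"
    using z by (simp add: cinner_Jc LL_iff cinner_simps)
  ultimately have "\<i> * cinner (de p e b) z + \<i> * cinner (de p e b) z = cinner (Jc (dJ p b) (e p)) z"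
    by (simp add: algebra_simps)
  then have "cinner (Jc (dJ p b) (e p)) z = 2 * \<i> * cinner (de p e b) z" by (simp add: mult.assoc)
  then show ?thesis by (simp add: algebra_simps)
qed

text \<open>In the inner product of a bracket with an element of \<open>L\<close>, each derivative
  of a section is paired with an element of \<open>L\<close>. By \<open>cinner_de\<close> the
  derivatives disappear, and the expression is tensorial.\<close>

lemma cinner_ccourant_L:
  assumes e: "e \<in> sections_L A J" and f: "f \<in> sections_L A J" and z: "z \<in> LL (J p)"
  shows "cinner (ccourant A H e f p) z = Tor (dJ p) (H p) (e p) (f p) z"
proof -
  interpret gcs_variation "J p" "dJ p" "H p" by (rule gcs_variation_dJ)
  have fL: "f p \<in> LL (J p)" using f by (simp add: sections_L_iff)
  have "2 * cinner (ee b) (e p) * cinner (de p f b) z - 2 * cinner (ee b) (f p) * cinner (de p e b) z + 2 * cinner (de p e b) (f p) * cinner (ee b) z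
    = - \<i> * (cinner (ee b) (e p) * cinner (Jc (dJ p b) (f p)) z
      + cinner (ee b) (f p) * cinner (Jc (dJ p b) z) (e p) + cinner (ee b) z * cinner (Jc (dJ p b) (e p)) (f p))" if b: "b \<in> Basis" for b
    using Mc_simps(4)[OF b, of z "e p"]
    by (simp add: cinner_de[OF e z b] cinner_de[OF f z b] cinner_de[OF e fL b] cinner_commute[of z] algebra_simps)
  then show ?thesis
    using e f by (simp add: cinner_ccourant sections_L_iff Tor_def sum_distrib_left cong: sum.cong)
qed

text \<open>The value is the same for all extensions by \<open>cinner_ccourant_L\<close>, and
  extensions exist; both are needed for the definite description.\<close>

lemma TL_eq:
  assumes "u \<in> LL (J p)" "v \<in> LL (J p)" "w \<in> LL (J p)"
  shows "TL A H J p u v w = Tor (dJ p) (H p) u v w"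
  unfolding TL_def
proof (rule the_equality)
  show "\<forall>e1\<in>sections_L A J. \<forall>e2\<in>sections_L A J. \<forall>e3\<in>sections_L A J.
     e1 p = u \<and> e2 p = v \<and> e3 p = w \<longrightarrow> cinner (ccourant A H e1 e2 p) (e3 p) = Tor (dJ p) (H p) u v w"
    using cinner_ccourant_L[OF _ _ assms(3)] by blast
next
  fix r assume r: "\<forall>e1\<in>sections_L A J. \<forall>e2\<in>sections_L A J. \<forall>e3\<in>sections_L A J.
     e1 p = u \<and> e2 p = v \<and> e3 p = w \<longrightarrow> cinner (ccourant A H e1 e2 p) (e3 p) = r"
  obtain e1 e2 e3 where "e1 \<in> sections_L A J" "e1 p = u" "e2 \<in> sections_L A J" "e2 p = v" "e3 \<in> sections_L A J" "e3 p = w"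
    using sections_L_extension assms by meson
  then show "r = Tor (dJ p) (H p) u v w" using r cinner_ccourant_L[OF _ _ assms(3)] by blast
qed

text \<open>The cyclic sum is alternating because each derivative of \<open>J\<close> is
  antisymmetric for the inner product, the other sum because \<open>H\<close> is.\<close>

lemma Tor_alternating:
  "Tor (dJ p) (H p) v u w = - Tor (dJ p) (H p) u v w" "Tor (dJ p) (H p) u w v = - Tor (dJ p) (H p) u v w"
proof -
  interpret gcs_variation "J p" "dJ p" "H p" by (rule gcs_variation_dJ)
  let ?M = "\<lambda>b. Jc (dJ p b)"
  let ?h = "\<lambda>u v w. \<Sum>a\<in>Basis. \<Sum>b\<in>Basis. \<Sum>c\<in>Basis. H p [a, b, c] * (cinner (ee a) u * cinner (ee b) v * cinner (ee c) w)"
  have M: "cinner (?M b x) y = - cinner (?M b y) x" if "b \<in> Basis" for b x y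
    using Mc_simps(4)[OF that, of x y] by (simp add: cinner_commute)
  have "?h v u w = (\<Sum>a\<in>Basis. \<Sum>b\<in>Basis. \<Sum>c\<in>Basis. H p [b, a, c] * (cinner (ee b) v * cinner (ee a) u * cinner (ee c) w))"
    by (rule sum.swap)
  also have "\<dots> = - ?h u v w"
    unfolding sum_negf[symmetric]
  proof (intro sum.cong refl)
    show "H p [b, a, c] * (cinner (ee b) v * cinner (ee a) u * cinner (ee c) w)
      = - (H p [a, b, c] * (cinner (ee a) u * cinner (ee b) v * cinner (ee c) w))" for a b c
      unfolding alt_form_swap01[OF h_alt, of b a] by simp
  qed
  finally have h1: "?h v u w = - ?h u v w" .
  have "?h u w v = (\<Sum>a\<in>Basis. \<Sum>b\<in>Basis. \<Sum>c\<in>Basis. H p [a, c, b] * (cinner (ee a) u * cinner (ee c) w * cinner (ee b) v))"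
    by (intro sum.cong refl sum.swap)
  also have "\<dots> = - ?h u v w"
    unfolding sum_negf[symmetric]
  proof (intro sum.cong refl)
    show "H p [a, c, b] * (cinner (ee a) u * cinner (ee c) w * cinner (ee b) v)
      = - (H p [a, b, c] * (cinner (ee a) u * cinner (ee b) v * cinner (ee c) w))" for a b c
      unfolding alt_form_swap12[OF h_alt, of a c b] by simp
  qed
  finally have h2: "?h u w v = - ?h u v w" .
  let ?m = "\<lambda>u v w. \<Sum>b\<in>Basis. cinner (ee b) u * cinner (?M b v) w + cinner (ee b) v * cinner (?M b w) u
      + cinner (ee b) w * cinner (?M b u) v"
  have m1: "?m v u w = - ?m u v w"
    unfolding sum_negf[symmetric]
  proof (rule sum.cong[OF refl])
    fix b :: 'e assume b: "b \<in> Basis"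
    show "cinner (ee b) v * cinner (?M b u) w + cinner (ee b) u * cinner (?M b w) v + cinner (ee b) w * cinner (?M b v) u
      = - (cinner (ee b) u * cinner (?M b v) w + cinner (ee b) v * cinner (?M b w) u + cinner (ee b) w * cinner (?M b u) v)"
      using M[OF b, of u w] M[OF b, of w v] M[OF b, of v u] by simp
  qed
  have m2: "?m u w v = - ?m u v w"
    unfolding sum_negf[symmetric]
  proof (rule sum.cong[OF refl])
    fix b :: 'e assume b: "b \<in> Basis"
    show "cinner (ee b) u * cinner (?M b w) v + cinner (ee b) w * cinner (?M b v) u + cinner (ee b) v * cinner (?M b u) w
      = - (cinner (ee b) u * cinner (?M b v) w + cinner (ee b) v * cinner (?M b w) u + cinner (ee b) w * cinner (?M b u) v)"
      using M[OF b, of u w] M[OF b, of w v] M[OF b, of v u] by simp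
  qed
  show "Tor (dJ p) (H p) v u w = - Tor (dJ p) (H p) u v w"
    unfolding Tor_def m1 h1 by simp
  show "Tor (dJ p) (H p) u w v = - Tor (dJ p) (H p) u v w"
    unfolding Tor_def m2 h2 by simp
qed

lemma Tor_linear:
  "Tor (dJ p) (H p) (u + u') v w = Tor (dJ p) (H p) u v w + Tor (dJ p) (H p) u' v w"
  "Tor (dJ p) (H p) (csc a u) v w = a * Tor (dJ p) (H p) u v w"
proof -
  interpret gcs_variation "J p" "dJ p" "H p" by (rule gcs_variation_dJ)
  have e: "Tor (dJ p) (H p) u v w = (\<Sum>b\<in>Basis. - \<i> * (cinner (ee b) u * cinner (Jc (dJ p b) v) w
      + cinner (ee b) v * cinner (Jc (dJ p b) w) u + cinner (ee b) w * cinner (Jc (dJ p b) u) v))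
      + (\<Sum>a\<in>Basis. \<Sum>b\<in>Basis. \<Sum>c\<in>Basis. - 4 * (H p [a, b, c] * (cinner (ee a) u * cinner (ee b) v * cinner (ee c) w)))" for u
    by (simp add: Tor_def sum_distrib_left sum_negf)
  have "Tor (dJ p) (H p) (u + u') v w - Tor (dJ p) (H p) u v w = Tor (dJ p) (H p) u' v w"
    unfolding e add_diff_add sum_subtractf[symmetric]
    by (intro arg_cong2[where f="(+)"] sum.cong refl) (simp_all add: cinner_simps Mc_simps(1) algebra_simps)
  then show "Tor (dJ p) (H p) (u + u') v w = Tor (dJ p) (H p) u v w + Tor (dJ p) (H p) u' v w" by (simp add: algebra_simps)
  show "Tor (dJ p) (H p) (csc a u) v w = a * Tor (dJ p) (H p) u v w"
    unfolding e distrib_left sum_distrib_left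
    by (intro arg_cong2[where f="(+)"] sum.cong refl) (simp_all add: cinner_simps Mc_simps(2) algebra_simps)
qed

lemma smooth_fun_cinner:
  assumes "smooth_csection A e" "smooth_csection A f"
  shows "smooth_fun A (\<lambda>p. cinner (e p) (f p))"
  unfolding smooth_fun_def
proof
  fix c assume c: "c \<in> A"
  have g: "Cinf_on (cimage c) (\<lambda>x. complex_of_real (ginner (s (cinv c x)) (t (cinv c x))))"
    if "smooth_gsection A s" "smooth_gsection A t" for s t
  proof (rule Cinf_cong[OF open_cimage[OF c]])
    show "Cinf_on (cimage c) (\<lambda>x. complex_of_real (ginner (sloc c s x) (sloc c t x)))"
      by (intro Cinf_of_real Cinf_ginner open_cimage c) (use that c in \<open>simp_all add: smooth_gsection_iff del: split_paired_All\<close>)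
    show "complex_of_real (ginner (sloc c s x) (sloc c t x)) = complex_of_real (ginner (s (cinv c x)) (t (cinv c x)))"
      if "x \<in> cimage c" for x
      unfolding sloc_def gtr_eq_gpull lin_iso.ginner_gpull[OF lin_iso_cinv[OF c that]] ..
  qed
  have "cinner z w = of_real (ginner (fst z) (fst w)) - of_real (ginner (snd z) (snd w))
      + \<i> * (of_real (ginner (fst z) (snd w)) + of_real (ginner (snd z) (fst w)))" for z w :: "'e cgtan"
    by (simp add: cinner_def complex_eq_iff)
  then show "Cinf_on (cimage c) (\<lambda>x. cinner (e (cinv c x)) (f (cinv c x)))"
    using assms unfolding smooth_csection_def
    by (simp only:) (intro Cinf_add Cinf_diff Cinf_mult Cinf_const open_cimage c g; simp)
qed

lemma TL_sections: "TL A H J \<in> sections_wedge3_dualL A J"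
  unfolding sections_wedge3_dualL_def mem_Collect_eq
proof (intro conjI allI ballI)
  fix p
  interpret gcs_point "J p" by (rule J_gcs)
  show "alt3_on (Lbun J p) (TL A H J p)"
    unfolding alt3_on_def Lbun_eq
    by (intro conjI ballI allI, simp_all only: TL_eq LL_simps Tor_linear, (rule Tor_alternating)+)
next
  fix e1 e2 e3 assume e: "e1 \<in> sections_L A J" "e2 \<in> sections_L A J" "e3 \<in> sections_L A J"
  then have "TL A H J p (e1 p) (e2 p) (e3 p) = cinner (ccourant A H e1 e2 p) (e3 p)" for p
    by (simp add: TL_eq cinner_ccourant_L sections_L_iff)
  then show "smooth_fun A (\<lambda>p. TL A H J p (e1 p) (e2 p) (e3 p))"
    using e smooth_fun_cinner[OF smooth_csection_ccourant] by (simp add: sections_L_iff)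
qed

lemma TL_act_eq: "alt_form (\<phi> p) \<Longrightarrow> TL_act A H J \<phi> p = gcs_point.Tlow (J p) (dJ p) (H p) (\<phi> p)"
proof -
  assume alt: "alt_form (\<phi> p)"
  show ?thesis
    unfolding TL_act_def Lbun_eq
    by (rule gcs_point.cliff3_eqI[OF J_gcs alt], rule act3_cong[OF gcs_variation.act3_Tlow[OF gcs_variation_dJ alt]])
       (simp_all add: TL_eq)
qed

text \<open>The conjugate of \<open>T_L\<close> is the torsion of the opposite structure, so the
  computation for \<open>L\<close> is reused with \<open>J\<close> replaced by its negative.\<close>

lemma TLbar_act_eq:
  "alt_form (\<phi> p) \<Longrightarrow> TLbar_act A H J \<phi> p = gcs_point.Tlow (\<lambda>w. - J p w) (\<lambda>b w. - dJ p b w) (H p) (\<phi> p)"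
proof -
  assume alt: "alt_form (\<phi> p)"
  interpret gcs_variation "J p" "dJ p" "H p" by (rule gcs_variation_dJ)
  have "conj_tri (TL A H J p) u v w = Tor (\<lambda>b w. - dJ p b w) (H p) u v w"
    if "u \<in> LL (\<lambda>w. - J p w)" "v \<in> LL (\<lambda>w. - J p w)" "w \<in> LL (\<lambda>w. - J p w)" for u v w
  proof -
    have "cconj u \<in> LL (J p)" if "u \<in> LL (\<lambda>w. - J p w)" for u
      using that unfolding cconj_LL[symmetric] by auto
    then have "conj_tri (TL A H J p) u v w = conj_tri (Tor (dJ p) (H p)) u v w"
      using that by (simp add: conj_tri_def TL_eq)
    then show ?thesis by (simp add: conj_tri_Tor dJ_linear H_Reals)
  qed
  then show ?thesis
    unfolding TLbar_act_def Lbun_eq cconj_LL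
    by (intro gcs_point.cliff3_eqI[OF gcs_point_uminus alt] act3_cong[OF gcs_variation.act3_Tlow[OF gcs_variation_uminus alt]]) simp_all
qed

text \<open>The four terms have the distinct weights \<open>k + 1\<close>, \<open>k - 1\<close>,
  \<open>k - 3\<close> and \<open>k + 3\<close>, so each of them is recovered by a projection. The
  second equation is what converts a condition on \<open>d_H\<close> into one on
  \<open>T_L\<close>.\<close>

lemma gproj_twisted_d:
  assumes "\<phi> \<in> sections_U A n J k"
  shows "twisted_d A H \<phi> p = gproj n (J p) (k + 1) (twisted_d A H \<phi> p) + gproj n (J p) (k - 1) (twisted_d A H \<phi> p)
     + TL_act A H J \<phi> p + TLbar_act A H J \<phi> p"
    "gproj n (J p) (k - 3) (twisted_d A H \<phi> p) = TL_act A H J \<phi> p"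
proof -
  interpret gcs_variation "J p" "dJ p" "H p" by (rule gcs_variation_dJ)
  interpret neg: gcs_variation "\<lambda>w. - J p w" "\<lambda>b w. - dJ p b w" "H p" by (rule gcs_variation_uminus)
  have phi: "\<phi> p \<in> EE (J p) k" using assms by (simp add: sections_U_iff)
  have alt: "alt_form (\<phi> p)" by (rule EE_alt[OF phi])
  obtain g1 g2 where g: "g1 \<in> EE (J p) (k + 1)" "g2 \<in> EE (J p) (k - 1)"
    "twisted_d A H \<phi> p = g1 + g2 + TL_act A H J \<phi> p + TLbar_act A H J \<phi> p"
    using twisted_d_decomposition[OF assms, of p] unfolding TL_act_eq[of \<phi> p, OF alt, symmetric] TLbar_act_eq[of \<phi> p, OF alt, symmetric] by blast
  have t: "TL_act A H J \<phi> p \<in> EE (J p) (k - 3)" using Tlow_EE[OF phi] by (simp add: TL_act_eq alt)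
  have "\<phi> p \<in> EE (\<lambda>w. - J p w) (- k)" using phi by (simp add: EE_uminus)
  from neg.Tlow_EE[OF this] have t': "TLbar_act A H J \<phi> p \<in> EE (J p) (k + 3)"
    using EE_uminus[of "k + 3"] by (simp add: TLbar_act_eq alt)
  have "gproj n (J p) l (twisted_d A H \<phi> p) = (if k + 1 = l then g1 else 0) + (if k - 1 = l then g2 else 0)
      + (if k - 3 = l then TL_act A H J \<phi> p else 0) + (if k + 3 = l then TLbar_act A H J \<phi> p else 0)" for l
    unfolding g(3) gproj_add gproj_EE'[OF dim g(1)] gproj_EE'[OF dim g(2)] gproj_EE'[OF dim t] gproj_EE'[OF dim t'] ..
  then show "twisted_d A H \<phi> p = gproj n (J p) (k + 1) (twisted_d A H \<phi> p) + gproj n (J p) (k - 1) (twisted_d A H \<phi> p)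
     + TL_act A H J \<phi> p + TLbar_act A H J \<phi> p"
    "gproj n (J p) (k - 3) (twisted_d A H \<phi> p) = TL_act A H J \<phi> p"
    using g(3) by simp_all
qed

section \<open>Criteria for integrability\<close>

lemma integrable_iff_Tor: "integrable_gcs A H J \<longleftrightarrow> (\<forall>p. \<forall>u\<in>LL (J p). \<forall>v\<in>LL (J p). \<forall>w\<in>LL (J p). Tor (dJ p) (H p) u v w = 0)"
proof
  assume i: "integrable_gcs A H J"
  show "\<forall>p. \<forall>u\<in>LL (J p). \<forall>v\<in>LL (J p). \<forall>w\<in>LL (J p). Tor (dJ p) (H p) u v w = 0"
  proof (intro allI ballI)
    fix p u v w assume L: "u \<in> LL (J p)" "v \<in> LL (J p)" "w \<in> LL (J p)"
    obtain e where e: "e \<in> sections_L A J" "e p = u" using sections_L_extension[OF L(1)] by blast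
    obtain f where f: "f \<in> sections_L A J" "f p = v" using sections_L_extension[OF L(2)] by blast
    have "ccourant A H e f \<in> sections_L A J" using i e f by (simp add: integrable_gcs_def)
    then have "cinner (ccourant A H e f p) w = 0"
      using gcs_point.LL_isotropic[OF J_gcs _ L(3)] by (simp add: sections_L_iff)
    then show "Tor (dJ p) (H p) u v w = 0" using cinner_ccourant_L[OF e(1) f(1) L(3)] e f by simp
  qed
next
  assume T: "\<forall>p. \<forall>u\<in>LL (J p). \<forall>v\<in>LL (J p). \<forall>w\<in>LL (J p). Tor (dJ p) (H p) u v w = 0"
  show "integrable_gcs A H J"
    unfolding integrable_gcs_def
  proof (intro ballI)
    fix e f assume e: "e \<in> sections_L A J" and f: "f \<in> sections_L A J"
    have "ccourant A H e f p \<in> LL (J p)" for p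
      by (rule gcs_point.LL_maximal[OF J_gcs]) (use cinner_ccourant_L[OF e f] T e f in \<open>simp add: sections_L_iff\<close>)
    then show "ccourant A H e f \<in> sections_L A J"
      using e f smooth_csection_ccourant by (simp add: sections_L_iff)
  qed
qed

lemma integrable_TL_act:
  assumes "integrable_gcs A H J" "alt_form (\<phi> p)"
  shows "TL_act A H J \<phi> p = 0" "TLbar_act A H J \<phi> p = 0"
proof -
  interpret gcs_point "J p" by (rule J_gcs)
  have T: "TL A H J p u v w = 0" if "u \<in> LL (J p)" "v \<in> LL (J p)" "w \<in> LL (J p)" for u v w
    using assms(1) that unfolding integrable_iff_Tor by (simp add: TL_eq)
  show "TL_act A H J \<phi> p = 0"
    unfolding TL_act_def Lbun_eq by (rule cliff3_eqI[OF assms(2) act3_zero]) (rule T)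
  have "cconj u \<in> LL (J p)" if "u \<in> LL (\<lambda>w. - J p w)" for u
    using that unfolding cconj_LL[symmetric] by auto
  then have "conj_tri (TL A H J p) u v w = 0" if "u \<in> LL (\<lambda>w. - J p w)" "v \<in> LL (\<lambda>w. - J p w)" "w \<in> LL (\<lambda>w. - J p w)" for u v w
    using that T by (simp add: conj_tri_def)
  then show "TLbar_act A H J \<phi> p = 0"
    unfolding TLbar_act_def Lbun_eq cconj_LL by (intro gcs_point.cliff3_eqI[OF gcs_point_uminus assms(2) act3_zero])
qed

lemma integrableI:
  assumes "\<And>\<phi>. \<phi> \<in> sections_U A n J (int n) \<Longrightarrow> twisted_d A H \<phi> \<in> sections_U A n J (int n - 1)"
  shows "integrable_gcs A H J"
  unfolding integrable_iff_Tor
proof (intro allI ballI)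
  fix p u v w assume L: "u \<in> LL (J p)" "v \<in> LL (J p)" "w \<in> LL (J p)"
  interpret gcs_variation "J p" "dJ p" "H p" by (rule gcs_variation_dJ)
  obtain \<phi>\<^sub>0 where k: "\<phi>\<^sub>0 \<in> KK (J p)" "\<phi>\<^sub>0 \<noteq> 0" using KK_nonzero[OF dim] by blast
  have kE: "\<phi>\<^sub>0 \<in> EE (J p) (int n)" using k(1) KK_eq_EE[OF dim] by simp
  obtain \<phi> where phi: "smooth_form A \<phi>" "\<phi> p = \<phi>\<^sub>0" using form_extension_at[OF EE_alt[OF kE]] by blast
  \<comment> \<open>An arbitrary smooth extension of the pure spinor need not stay in the canonical
    bundle. Its projection is smooth, does stay there, and is unchanged at \<open>p\<close>.\<close>
  define \<psi> where "\<psi> q = gproj n (J q) (int n) (\<phi> q)" for q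
  have \<psi>: "\<psi> \<in> sections_U A n J (int n)" unfolding \<psi>_def by (rule gproj_sections_U[OF phi(1)])
  have \<psi>p: "\<psi> p = \<phi>\<^sub>0" using gproj_EE'[OF dim kE, of "int n"] by (simp add: \<psi>_def phi)
  have "twisted_d A H \<psi> p \<in> EE (J p) (int n - 1)" using assms[OF \<psi>] by (simp add: sections_U_iff)
  \<comment> \<open>A form of weight \<open>n - 1\<close> has no component of weight
    \<open>n - 3\<close>, and that component is the action of \<open>T_L\<close>.\<close>
  from gproj_EE'[OF dim this, of "int n - 3"] have "TL_act A H J \<psi> p = 0"
    using gproj_twisted_d(2)[OF \<psi>, of p] by simp
  then have "Tlow (dJ p) (H p) \<phi>\<^sub>0 = 0" using TL_act_eq[of \<psi> p] EE_alt[OF kE] \<psi>p by simp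
  then have "act3 (LL (J p)) (Tor (dJ p) (H p)) \<phi>\<^sub>0 0" using act3_Tlow[OF EE_alt[OF kE]] by simp
  from act3_faithful[OF k this L] show "Tor (dJ p) (H p) u v w = 0" .
qed

lemma del_delbar_sections:
  assumes "\<phi> \<in> sections_U A n J k"
  shows "del A H n J k \<phi> \<in> sections_U A n J (k + 1)" "delbar A H n J k \<phi> \<in> sections_U A n J (k - 1)"
proof -
  have s: "smooth_form A \<phi>" using assms by (simp add: sections_U_iff)
  show "del A H n J k \<phi> \<in> sections_U A n J (k + 1)" "delbar A H n J k \<phi> \<in> sections_U A n J (k - 1)"
    unfolding del_eq[OF s] delbar_eq[OF s] by (rule gproj_sections_U[OF smooth_form_dH[OF s]])+
qed

lemma twisted_d_formula:
  assumes "\<phi> \<in> sections_U A n J k"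
  shows "twisted_d A H \<phi> = (\<lambda>p vs. del A H n J k \<phi> p vs + delbar A H n J k \<phi> p vs
                                       + TL_act A H J \<phi> p vs + TLbar_act A H J \<phi> p vs)"
proof (intro ext)
  fix p vs
  have s: "smooth_form A \<phi>" using assms by (simp add: sections_U_iff)
  show "twisted_d A H \<phi> p vs = del A H n J k \<phi> p vs + delbar A H n J k \<phi> p vs + TL_act A H J \<phi> p vs + TLbar_act A H J \<phi> p vs"
    using fun_cong[OF gproj_twisted_d(1)[OF assms, of p], of vs] by (simp only: del_eq[OF s] delbar_eq[OF s] plus_fun_apply)
qed

lemma integrable_twisted_d:
  assumes "integrable_gcs A H J" "\<phi> \<in> sections_U A n J k"
  shows "twisted_d A H \<phi> = (\<lambda>p vs. del A H n J k \<phi> p vs + delbar A H n J k \<phi> p vs)"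
proof -
  have "alt_form (\<phi> p)" for p using assms(2) by (simp add: sections_U_iff smooth_form_alt)
  then show ?thesis
    using twisted_d_formula[OF assms(2)] by (simp add: integrable_TL_act[OF assms(1)])
qed

lemma twisted_d_top:
  assumes "\<phi> \<in> sections_U A n J (int n)"
    and "twisted_d A H \<phi> = (\<lambda>p vs. del A H n J (int n) \<phi> p vs + delbar A H n J (int n) \<phi> p vs)"
  shows "twisted_d A H \<phi> \<in> sections_U A n J (int n - 1)"
proof -
  have s: "smooth_form A \<phi>" using assms(1) by (simp add: sections_U_iff)
  \<comment> \<open>There is no weight \<open>n + 1\<close>, and the projection onto it is zero by
    convention.\<close>
  have "del A H n J (int n) \<phi> p vs = 0" for p vs
    by (simp add: del_eq[OF s] gproj_def)
  then have "twisted_d A H \<phi> = delbar A H n J (int n) \<phi>" using assms(2) by simp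
  then show ?thesis using del_delbar_sections(2)[OF assms(1)] by simp
qed

end

theorem theorem3p15:
  fixes A :: "('m::{t2_space,second_countable_topology}, 'e::euclidean_space) chart set"
    and n :: nat
    and H :: "'m \<Rightarrow> 'e form"
    and J :: "'m \<Rightarrow> 'e gtan \<Rightarrow> 'e gtan"
  assumes "smooth_atlas A"
    and "DIM('e) = 2 * n"
    and "smooth_form A H" and "real_form_of_degree 3 H" and "ext_d A H = (\<lambda>p vs. 0)"
    and "gen_almost_complex A J"
  shows "(\<forall>k. \<forall>\<phi>\<in>sections_U A n J k.
            del A H n J k \<phi> \<in> sections_U A n J (k + 1) \<and>
            delbar A H n J k \<phi> \<in> sections_U A n J (k - 1))
       \<and> TL A H J \<in> sections_wedge3_dualL A J
       \<and> (\<forall>e1\<in>sections_L A J. \<forall>e2\<in>sections_L A J. \<forall>e3\<in>sections_L A J. \<forall>p.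
            TL A H J p (e1 p) (e2 p) (e3 p) = cinner (ccourant A H e1 e2 p) (e3 p))
       \<and> (\<forall>k. \<forall>\<phi>\<in>sections_U A n J k.
            twisted_d A H \<phi> = (\<lambda>p vs. del A H n J k \<phi> p vs + delbar A H n J k \<phi> p vs
                                       + TL_act A H J \<phi> p vs + TLbar_act A H J \<phi> p vs))
       \<and> (integrable_gcs A H J \<longleftrightarrow>
            (\<forall>k. \<forall>\<phi>\<in>sections_U A n J k.
               twisted_d A H \<phi> = (\<lambda>p vs. del A H n J k \<phi> p vs + delbar A H n J k \<phi> p vs)))
       \<and> (integrable_gcs A H J \<longleftrightarrow>
            twisted_d A H ` sections_U A n J (int n) \<subseteq> sections_U A n J (int n - 1))"
proof -
  interpret smooth_gcs A n H J
    using assms by unfold_locales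
  have TL: "TL A H J p (e1 p) (e2 p) (e3 p) = cinner (ccourant A H e1 e2 p) (e3 p)"
    if "e1 \<in> sections_L A J" "e2 \<in> sections_L A J" "e3 \<in> sections_L A J" for e1 e2 e3 p
    using that by (simp add: TL_eq cinner_ccourant_L sections_L_iff)
  \<comment> \<open>The three conditions are linked in a cycle: integrability gives the formula
    without torsion terms, its case \<open>k = n\<close> gives the inclusion, and the inclusion
    gives integrability.\<close>
  have 1: "integrable_gcs A H J" if "twisted_d A H ` sections_U A n J (int n) \<subseteq> sections_U A n J (int n - 1)"
    using that by (intro integrableI) blast
  have 2: "twisted_d A H ` sections_U A n J (int n) \<subseteq> sections_U A n J (int n - 1)"
    if "\<forall>k. \<forall>\<phi>\<in>sections_U A n J k. twisted_d A H \<phi> = (\<lambda>p vs. del A H n J k \<phi> p vs + delbar A H n J k \<phi> p vs)"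
    using that twisted_d_top by blast
  have 3: "\<forall>k. \<forall>\<phi>\<in>sections_U A n J k. twisted_d A H \<phi> = (\<lambda>p vs. del A H n J k \<phi> p vs + delbar A H n J k \<phi> p vs)"
    if "integrable_gcs A H J"
    by (intro allI ballI integrable_twisted_d[OF that])
  show ?thesis
    by (intro conjI allI ballI iffI del_delbar_sections TL_sections TL twisted_d_formula)
      (assumption | erule (1) integrable_twisted_d | erule 1 | erule 1[OF 2] | erule 2[OF 3])+
qed

end
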